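(* Let $\Omega\Subset\Omega'$ be bounded open subsets of $\mathbb{R}^n$, and assume that $\mathbb{R}^n\setminus\Omega$ satisfies the measure density condition. Suppose that $g\in C(\Omega')\cap L^{p-1}_{sp}(\mathbb{R}^n)$. Then there is a weak solution $u$ in $\Omega$ which is continuous in $\Omega'$ and has boundary values $g$ on $\mathbb{R}^n\setminus\Omega$ (that is, $u=g$ on $\mathbb{R}^n\setminus\Omega$). Such a solution is unique.
   Context: Standing assumptions: $n\ge1$ is an integer, $s\in(0,1)$, $p\in(1,\infty)$, $\Lambda\ge1$, and $K:\mathbb{R}^n\times\mathbb{R}^n\to[0,\infty)$ is a measurable symmetric kernel ($K(x,y)=K(y,x)$) with $\Lambda^{-1}\le K(x,y)|x-y|^{n+sp}\le\Lambda$ for a.e. $x,y\in\mathbb{R}^n$. $D\Subset\Omega$ means that $\overline D$ is a compact subset of $\Omega$; $u_-:=\max\{-u,0\}$. A set $E\subset\mathbb{R}^n$ satisfies the measure density condition if there exist $r_0>0$ and $\delta_E\in(0,1)$ such that $\inf_{0<r<r_0}\frac{|E\cap B_r(x_0)|}{|B_r(x_0)|}\ge\delta_E$ for every $x_0\in\partial E$. $W^{s,p}(U)$ consists of $v\in L^p(U)$ with $\int_U\int_U\frac{|v(x)-v(y)|^p}{|x-y|^{n+sp}}\,dx\,dy<\infty$; $v\in W^{s,p}_{\rm loc}(\Omega)$ means $v\in W^{s,p}(D)$ for every open $D\Subset\Omega$. The tail space is $L^{p-1}_{sp}(\mathbb{R}^n):=\{f\in L^{p-1}_{\rm loc}(\mathbb{R}^n):\int_{\mathbb{R}^n}|f(x)|^{p-1}(1+|x|)^{-n-sp}\,dx<\infty\}$.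 A weak supersolution in $\Omega$ is a measurable function $u$ on $\mathbb{R}^n$ with $u\in W^{s,p}_{\rm loc}(\Omega)$, $u_-\in L^{p-1}_{sp}(\mathbb{R}^n)$, and $$\int_{\mathbb{R}^n}\int_{\mathbb{R}^n}|u(x)-u(y)|^{p-2}(u(x)-u(y))(\eta(x)-\eta(y))K(x,y)\,dx\,dy\ge0$$ for every nonnegative $\eta\in C_0^\infty(\Omega)$. $u$ is a weak subsolution if $-u$ is a weak supersolution, and a weak solution if it is both. *)

theory Defs
  imports "HOL-Analysis.Analysis"
begin

definition compactly_contained :: "'a::topological_space set \<Rightarrow> 'a set \<Rightarrow> bool"
  where "compactly_contained D \<Omega> \<longleftrightarrow> compact (closure D) \<and> closure D \<subseteq> \<Omega>"

definition measure_density_condition :: "'a::euclidean_space set \<Rightarrow> bool"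
  where "measure_density_condition E \<longleftrightarrow>
    (\<exists>r0>0. \<exists>\<delta>\<in>{0<..<1}. \<forall>x0\<in>frontier E.
      (INF r\<in>{0<..<r0}. measure lebesgue (E \<inter> ball x0 r) / measure lebesgue (ball x0 r)) \<ge> \<delta>)"

(* The a.e. condition is with respect to 2n-dimensional Lebesgue measure, so that
   the diagonal, where the lower bound fails, is negligible. *)
definition elliptic_kernel ::
    "real \<Rightarrow> real \<Rightarrow> real \<Rightarrow> ('a::euclidean_space \<Rightarrow> 'a \<Rightarrow> real) \<Rightarrow> bool"
  where "elliptic_kernel s p \<Lambda> K \<longleftrightarrow>
    (\<lambda>(x, y). K x y) \<in> borel_measurable lebesgue \<and>
    (\<forall>x y. 0 \<le> K x y) \<and>
    (\<forall>x y. K x y = K y x) \<and>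
    (AE (x, y) in lebesgue.
      inverse \<Lambda> \<le> K x y * norm (x - y) powr (real DIM('a) + s * p) \<and>
      K x y * norm (x - y) powr (real DIM('a) + s * p) \<le> \<Lambda>)"

(* Elements are functions on the whole space; only their restriction to U matters. *)
definition frac_sobolev :: "real \<Rightarrow> real \<Rightarrow> 'a::euclidean_space set \<Rightarrow> ('a \<Rightarrow> real) set"
  where "frac_sobolev s p U =
    {v. v \<in> borel_measurable (lebesgue_on U) \<and>
        set_integrable lebesgue U (\<lambda>x. \<bar>v x\<bar> powr p) \<and>
        set_integrable lebesgue (U \<times> U)
          (\<lambda>(x, y). \<bar>v x - v y\<bar> powr p / norm (x - y) powr (real DIM('a) + s * p))}"

definition frac_sobolev_loc :: "real \<Rightarrow> real \<Rightarrow> 'a::euclidean_space set \<Rightarrow> ('a \<Rightarrow> real) set"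
  where "frac_sobolev_loc s p \<Omega> =
    {v. \<forall>D. open D \<and> compactly_contained D \<Omega> \<longrightarrow> v \<in> frac_sobolev s p D}"

definition tail_space :: "real \<Rightarrow> real \<Rightarrow> ('a::euclidean_space \<Rightarrow> real) set"
  where "tail_space s p =
    {f. f \<in> borel_measurable lebesgue \<and>
        (\<forall>C. compact C \<longrightarrow> set_integrable lebesgue C (\<lambda>x. \<bar>f x\<bar> powr (p - 1))) \<and>
        integrable lebesgue
          (\<lambda>x. \<bar>f x\<bar> powr (p - 1) * (1 + norm x) powr (- real DIM('a) - s * p))}"

primrec Ck :: "nat \<Rightarrow> ('a::euclidean_space \<Rightarrow> real) \<Rightarrow> bool"
  where
    "Ck 0 f \<longleftrightarrow> continuous_on UNIV f"
  | "Ck (Suc k) f \<longleftrightarrow>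
      (\<forall>x. f differentiable (at x)) \<and>
      (\<forall>i\<in>Basis. Ck k (\<lambda>x. frechet_derivative f (at x) i))"

definition test_functions :: "'a::euclidean_space set \<Rightarrow> ('a \<Rightarrow> real) set"
  where "test_functions \<Omega> =
    {\<eta>. (\<forall>k. Ck k \<eta>) \<and> compactly_contained {x. \<eta> x \<noteq> 0} \<Omega>}"

definition energy_integrand ::
    "('a::euclidean_space \<Rightarrow> 'a \<Rightarrow> real) \<Rightarrow> real \<Rightarrow> ('a \<Rightarrow> real) \<Rightarrow> ('a \<Rightarrow> real) \<Rightarrow> 'a \<times> 'a \<Rightarrow> real"
  where "energy_integrand K p u \<eta> =
    (\<lambda>(x, y). \<bar>u x - u y\<bar> powr (p - 2) * (u x - u y) * (\<eta> x - \<eta> y) * K x y)"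

(* By the first three conditions and the bounds on K, the positive part has finite
   integral, so the double integral always exists in [-\<infinity>, \<infinity>); that it is
   nonnegative then includes integrability.  The latter has to be required explicitly
   because the Bochner integral of a non-integrable function is 0. *)
definition weak_supersolution ::
    "('a::euclidean_space \<Rightarrow> 'a \<Rightarrow> real) \<Rightarrow> real \<Rightarrow> real \<Rightarrow> 'a set \<Rightarrow> ('a \<Rightarrow> real) \<Rightarrow> bool"
  where "weak_supersolution K s p \<Omega> u \<longleftrightarrow>
    u \<in> borel_measurable lebesgue \<and>
    u \<in> frac_sobolev_loc s p \<Omega> \<and>
    (\<lambda>x. max (- u x) 0) \<in> tail_space s p \<and>
    (\<forall>\<eta>\<in>test_functions \<Omega>. (\<forall>x. 0 \<le> \<eta> x) \<longrightarrow>
      integrable lebesgue (energy_integrand K p u \<eta>) \<and>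
      0 \<le> (LINT z|lebesgue. energy_integrand K p u \<eta> z))"

definition weak_subsolution ::
    "('a::euclidean_space \<Rightarrow> 'a \<Rightarrow> real) \<Rightarrow> real \<Rightarrow> real \<Rightarrow> 'a set \<Rightarrow> ('a \<Rightarrow> real) \<Rightarrow> bool"
  where "weak_subsolution K s p \<Omega> u \<longleftrightarrow> weak_supersolution K s p \<Omega> (\<lambda>x. - u x)"

definition weak_solution ::
    "('a::euclidean_space \<Rightarrow> 'a \<Rightarrow> real) \<Rightarrow> real \<Rightarrow> real \<Rightarrow> 'a set \<Rightarrow> ('a \<Rightarrow> real) \<Rightarrow> bool"
  where "weak_solution K s p \<Omega> u \<longleftrightarrow>
    weak_supersolution K s p \<Omega> u \<and> weak_subsolution K s p \<Omega> u"

end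

theory Submission
  imports Defs
begin

text \<open>
  After replacing \<open>K\<close> and \<open>g\<close> by Borel representatives, boundary data of finite energy are handled
  by minimising, among functions bounded by a large constant \<open>M\<close>, the difference between the energy of \<open>v\<close> and
  that of the datum: uniform convexity makes minimising sequences converge almost everywhere, and since
  \<open>M\<close> is a supersolution the constraint is inactive.  Testing with \<open>(\<psi> - v)\<^sub>+\<close> for a barrier \<open>\<psi>\<close> gives a
  Caccioppoli inequality, whose nonlocal term shows that a nonnegative solution that is at least \<open>h\<close>
  on a set of positive density is small only on a small set; De Giorgi iteration turns this into a pointwise
  lower bound.  Applied to \<open>u\<close> minus its limit inferior, and to its negative, it yields continuity inside
  \<open>\<Omega>\<close> and, by the measure density condition, up to the boundary.  A continuous \<open>g\<close> is approximated
  uniformly by polynomials near the closure of \<open>\<Omega>\<close>, and the comparison principle makes the solutions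
  converge uniformly.  For uniqueness, \<open>(u - v - \<epsilon>)\<^sub>+\<close> has compact support in \<open>\<Omega>\<close> and, after
  mollification, is an admissible test function for both solutions.
\<close>

section \<open>The power nonlinearity\<close>

text \<open>A merely continuous datum may have infinite energy near \<Omega>, and far away only
  \<open>\<bar>g\<bar> powr (p - 1)\<close> is integrable against a decaying weight, so neither the
  energy nor its first variation makes sense globally. Integrals are therefore taken against the
  measure \<open>\<mu>\<close> with density \<open>K\<close> and split by a compact neighbourhood
  \<open>N\<close> of the closure of \<Omega>: pairs inside \<open>N\<close> are controlled by
  energy, pairs joining \<Omega> to the complement of \<open>N\<close> by sup bounds on
  \<open>N\<close> and by tails. Hence \<open>finite_energy\<close> includes boundedness, and every
  construction must deliver a pointwise bound along with the energy. The set
  \<open>N - \<Omega>\<close> has positive measure and takes the place of a Poincare inequality: all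
  competitors agree there, and every point of \<Omega> interacts with it at bounded distance.
  Regularity is purely qualitative: improving a bound by a fixed fraction at one small radius
  already contradicts the definition of a limit inferior, and small radii make any finite tail
  negligible. In the final approximation comparison controls the values, and a barrier lying above
  the solution gives a local energy bound.\<close>

definition Jp :: "real => real => real" where
  "Jp p t = \<bar>t\<bar> powr (p - 2) * t"

lemma Jp_nonneg_eq: "0 <= t ==> Jp p t = t powr (p - 1)"
  by (cases "t = 0") (auto simp: Jp_def powr_mult_base[symmetric] powr_diff field_simps power2_eq_square)

lemma Jp_minus [simp]: "Jp p (- t) = - Jp p t" by (simp add: Jp_def)

lemma Jp_0 [simp]: "Jp p 0 = 0" by (simp add: Jp_def)

lemma Jp_minus_commute: "Jp p (a - b) = - Jp p (b - a)" using Jp_minus[of p "b - a"] by simp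

lemma Jp_nonpos_eq: "t <= 0 ==> Jp p t = - ((- t) powr (p - 1))" using Jp_nonneg_eq[of "- t" p] by simp

lemma abs_Jp: "\<bar>Jp p t\<bar> = \<bar>t\<bar> powr (p - 1)" by (cases "0 <= t") (auto simp: Jp_nonneg_eq Jp_nonpos_eq)

lemma Jp_mult_self: "Jp p t * t = \<bar>t\<bar> powr p"
proof (cases "t = 0")
  case False have "Jp p t * t = \<bar>t\<bar> powr (p - 2) * (\<bar>t\<bar> powr 2)" using False by (simp add: Jp_def power2_eq_square)
  also have "... = \<bar>t\<bar> powr p" by (simp only: powr_add[symmetric]) simp
  finally show ?thesis .
qed simp

text \<open>Both powers have the positive exponent \<open>p - 1\<close>, so continuity at 0 becomes
  visible even for \<open>p < 2\<close>, where the factor \<open>\<bar>t\<bar> powr (p - 2)\<close>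
  is singular.\<close>

lemma Jp_eq_max: "1 < p ==> Jp p t = max t 0 powr (p - 1) - max (- t) 0 powr (p - 1)"
  by (cases "0 <= t") (auto simp: Jp_nonneg_eq Jp_nonpos_eq max_def)

lemma continuous_on_Jp: assumes "1 < p" shows "continuous_on A (Jp p)"
proof -
  have "continuous_on A (\<lambda>t. max t 0 powr (p - 1) - max (- t) 0 powr (p - 1))" using assms by (intro continuous_intros continuous_on_powr') auto
  then show ?thesis using Jp_eq_max[OF assms] by (simp cong: continuous_on_cong)
qed

lemma isCont_Jp: "1 < p ==> isCont (Jp p) x" using continuous_on_Jp[of p UNIV] by (simp add: continuous_on_eq_continuous_at)

lemma borel_measurable_Jp [measurable]: "Jp p \<in> borel_measurable borel" unfolding Jp_def[abs_def] by measurable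

lemma Jp_nonneg: "0 <= t ==> 0 <= Jp p t" by (simp add: Jp_nonneg_eq)

lemma Jp_nonpos: "t <= 0 ==> Jp p t <= 0" by (simp add: Jp_nonpos_eq)

lemma Jp_less: assumes "1 < p" "a < b" shows "Jp p a < Jp p b"
proof -
  consider "0 <= a" | "a < 0" "0 <= b" | "b < 0" by linarith
  then show ?thesis
  proof cases
    case 1 then show ?thesis using assms by (simp add: Jp_nonneg_eq powr_less_mono2)
  next
    case 2 have "Jp p a < 0" using 2 by (simp add: Jp_nonpos_eq)
    with Jp_nonneg[of b p] 2 show ?thesis by linarith
  next
    case 3 then show ?thesis using assms by (simp add: Jp_nonpos_eq powr_less_mono2)
  qed
qed

lemma Jp_le: "1 < p ==> a <= b ==> Jp p a <= Jp p b" using Jp_less[of p a b] by (cases "a = b") auto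

text \<open>The crude factor \<open>2 powr q\<close> comes from \<open>a + b <= 2 * max a b\<close>;
  it works for every exponent \<open>q >= 0\<close>, so \<open>p - 1\<close> below and above 1 need
  no separate treatment.\<close>

lemma powr_add_le:
  fixes a b q :: real
  assumes "0 <= a" "0 <= b" "0 <= q"
  shows "(a + b) powr q <= 2 powr q * (a powr q + b powr q)"
proof -
  have "(a + b) powr q <= (2 * max a b) powr q" using assms by (intro powr_mono2) auto
  also have "... = 2 powr q * max a b powr q" using assms by (simp add: powr_mult)
  also have "... <= 2 powr q * (a powr q + b powr q)" by (intro mult_left_mono) (auto simp: max_def)
  finally show ?thesis .
qed

text \<open>Young's inequality with a free weight and without conjugate exponents: according to
  which of \<open>\<bar>b\<bar>\<close> and \<open>t * \<bar>a\<bar>\<close> is larger, one of the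
  two terms dominates alone. The weight later makes the contribution of a merely bounded energy
  arbitrarily small.\<close>

lemma Jp_mult_le_Young:
  assumes p: "1 < p" and t: "0 < t"
  shows "\<bar>Jp p a * b\<bar> <= t * \<bar>a\<bar> powr p + t powr (1 - p) * \<bar>b\<bar> powr p"
proof (cases "\<bar>b\<bar> <= t * \<bar>a\<bar>")
  case True have "\<bar>Jp p a * b\<bar> = \<bar>Jp p a\<bar> * \<bar>b\<bar>" by (simp add: abs_mult)
  also have "... <= \<bar>Jp p a\<bar> * (t * \<bar>a\<bar>)" using True by (intro mult_left_mono) auto
  also have "... = t * \<bar>Jp p a * a\<bar>" by (simp add: abs_mult)
  also have "... = t * \<bar>a\<bar> powr p" by (simp add: Jp_mult_self)
  finally show ?thesis by (smt (verit) mult_nonneg_nonneg powr_ge_zero)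
next
  case False then have *: "\<bar>a\<bar> <= \<bar>b\<bar> / t" using t by (simp add: field_simps)
  have "\<bar>Jp p a * b\<bar> = \<bar>a\<bar> powr (p - 1) * \<bar>b\<bar>" by (simp add: abs_mult abs_Jp)
  also have "... <= (\<bar>b\<bar> / t) powr (p - 1) * \<bar>b\<bar>" using * p by (intro mult_right_mono powr_mono2) auto
  also have "... = t powr (1 - p) * (\<bar>Jp p b * b\<bar>)"
    using t by (simp add: powr_divide abs_Jp abs_mult powr_minus_divide[of t "p - 1", simplified])
  also have "... = t powr (1 - p) * \<bar>b\<bar> powr p" by (simp add: Jp_mult_self)
  finally show ?thesis using t by (smt (verit) mult_nonneg_nonneg powr_ge_zero)
qed

text \<open>In the application \<open>b\<close> is the jump of the barrier and \<open>a\<close> that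
  of the truncation, so that \<open>b - a\<close> is the jump of the solution when both points lie
  below the barrier. If \<open>\<bar>a\<bar> >= 2 * \<bar>b\<bar>\<close>, then \<open>b - a\<close>
  has the sign of \<open>- a\<close> and size at least \<open>\<bar>a\<bar> / 2\<close>, which
  produces the negative term; otherwise \<open>\<bar>b - a\<bar> <= 3 * \<bar>b\<bar>\<close> and
  everything is of the size of \<open>\<bar>b\<bar> powr p\<close>.\<close>

lemma Jp_barrier_le:
  assumes p: "1 < p"
  shows "Jp p (b - a) * a <= (3 powr p + 1) * \<bar>b\<bar> powr p - 2 powr (- p) * \<bar>a\<bar> powr p"
proof (cases "2 * \<bar>b\<bar> <= \<bar>a\<bar>")
  case True have *: "Jp p (b - a) * a <= Jp p (- (a / 2)) * a"
  proof (cases "0 <= a")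
    case True
    with \<open>2 * \<bar>b\<bar> <= \<bar>a\<bar>\<close> show ?thesis by (intro mult_right_mono Jp_le p) auto
  next
    case False
    with \<open>2 * \<bar>b\<bar> <= \<bar>a\<bar>\<close> show ?thesis by (intro mult_right_mono_neg Jp_le p) auto
  qed
  have "Jp p (- (a / 2)) * a = - 2 * (Jp p (a/2) * (a/2))" by (simp add: Jp_minus)
  also have "... = - 2 * \<bar>a/2\<bar> powr p" by (simp only: Jp_mult_self)
  also have "... = - 2 * (2 powr (- p) * \<bar>a\<bar> powr p)" by (simp add: powr_divide powr_minus field_simps)
  also have "... <= - (2 powr (- p) * \<bar>a\<bar> powr p)" by simp
  finally show ?thesis using * by (smt (verit) mult_nonneg_nonneg powr_ge_zero)
next
  case False then have a: "\<bar>a\<bar> <= 2 * \<bar>b\<bar>" by simp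
  have "Jp p (b - a) * a <= \<bar>Jp p (b - a)\<bar> * \<bar>a\<bar>" by (metis abs_ge_self abs_mult)
  also have "... = \<bar>b - a\<bar> powr (p - 1) * \<bar>a\<bar>" by (simp add: abs_Jp)
  also have "... <= (3 * \<bar>b\<bar>) powr (p - 1) * (3 * \<bar>b\<bar>)" using a p by (intro mult_mono powr_mono2) auto
  also have "... = \<bar>Jp p (3 * b) * (3 * b)\<bar>" by (simp add: abs_Jp abs_mult)
  also have "... = 3 powr p * \<bar>b\<bar> powr p" by (simp add: Jp_mult_self abs_mult powr_mult)
  finally have 1: "Jp p (b - a) * a <= 3 powr p * \<bar>b\<bar> powr p" .
  have "2 powr (- p) * \<bar>a\<bar> powr p <= 2 powr (- p) * (2 * \<bar>b\<bar>) powr p" using a p by (intro mult_left_mono powr_mono2) auto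
  also have "... = \<bar>b\<bar> powr p" by (simp add: powr_mult powr_minus field_simps)
  finally show ?thesis using 1 by (simp add: algebra_simps)
qed

section \<open>Derivative and uniform convexity of the power function\<close>

lemma DERIV_abs_powr:
  assumes p: "1 < p"
  shows "((\<lambda>t. \<bar>t\<bar> powr p) has_real_derivative p * Jp p x) (at x)"
proof -
  consider "0 < x" | "x < 0" | "x = 0" by linarith
  then show ?thesis
  proof cases
    case 1 have "((\<lambda>t. t powr p) has_real_derivative p * x powr (p - 1)) (at x)" using 1 by (rule has_real_derivative_powr)
    then have "((\<lambda>t. \<bar>t\<bar> powr p) has_real_derivative p * x powr (p - 1)) (at x)"
      by (rule has_field_derivative_transform_within_open[of _ _ _ "{0<..}"]) (use 1 in auto)
    then show ?thesis using 1 by (simp add: Jp_nonneg_eq)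
  next
    case 2
    have "((\<lambda>t. (- t) powr p) has_real_derivative - (p * (- x) powr (p - 1))) (at x)" using 2 by (auto intro!: derivative_eq_intros)
    then have "((\<lambda>t. \<bar>t\<bar> powr p) has_real_derivative - (p * (- x) powr (p - 1))) (at x)"
      by (rule has_field_derivative_transform_within_open[of _ _ _ "{..<0}"]) (use 2 in auto)
    then show ?thesis using 2 by (simp add: Jp_nonpos_eq)
  next
    case 3 have "((\<lambda>h. Jp p h) \<longlongrightarrow> Jp p 0) (at 0)" using isCont_Jp[OF p, of 0] by (simp add: isCont_def)
    then have "((\<lambda>h. (\<bar>h\<bar> powr p - \<bar>0\<bar> powr p) / (h - 0)) \<longlongrightarrow> 0) (at 0)" by (rule filterlim_cong[THEN iffD1, rotated -1])
        (auto simp: Jp_mult_self[symmetric] eventually_at intro!: exI[of _ 1])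
    then show ?thesis using 3 by (simp add: has_field_derivative_iff)
  qed
qed

lemma abs_powr_MVT:
  fixes a b p :: real
  assumes p: "1 < p" and "a < b"
  obtains z where "a < z" "z < b" "\<bar>b\<bar> powr p - \<bar>a\<bar> powr p = (b - a) * (p * Jp p z)"
proof -
  have "\<exists>z. a < z \<and> z < b \<and> \<bar>b\<bar> powr p - \<bar>a\<bar> powr p = (b - a) * (p * Jp p z)" using \<open>a < b\<close> by (rule MVT2) (rule DERIV_abs_powr[OF p])
  then show ?thesis using that by blast
qed

lemma abs_powr_subgradient:
  fixes a b p :: real
  assumes p: "1 < p"
  shows "p * Jp p a * (b - a) <= \<bar>b\<bar> powr p - \<bar>a\<bar> powr p"
proof -
  consider "a < b" | "b < a" | "a = b" by linarith
  then show ?thesis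
  proof cases
    case 1
    then obtain z where z: "a < z" "\<bar>b\<bar> powr p - \<bar>a\<bar> powr p = (b - a) * (p * Jp p z)" using abs_powr_MVT[OF p] by metis
    have "(b - a) * (p * Jp p a) <= (b - a) * (p * Jp p z)" using 1 z p Jp_le[OF p, of a z] by (intro mult_left_mono) auto
    then show ?thesis using z by (simp add: algebra_simps)
  next
    case 2
    then obtain z where z: "z < a" "\<bar>a\<bar> powr p - \<bar>b\<bar> powr p = (a - b) * (p * Jp p z)" using abs_powr_MVT[OF p] by metis
    have "(a - b) * (p * Jp p z) <= (a - b) * (p * Jp p a)" using 2 z p Jp_le[OF p, of z a] by (intro mult_left_mono) auto
    then show ?thesis using z by (simp add: algebra_simps)
  qed auto
qed

text \<open>The tangent inequalities at \<open>b\<close> and at \<open>a\<close> bound the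
  difference from above and from below.\<close>

lemma abs_powr_diff_bound:
  fixes a b p :: real
  assumes p: "1 < p"
  shows "\<bar>\<bar>b\<bar> powr p - \<bar>a\<bar> powr p\<bar> <= p * (\<bar>a\<bar> powr (p - 1) + \<bar>b\<bar> powr (p - 1)) * \<bar>b - a\<bar>"
proof -
  have "\<bar>b\<bar> powr p - \<bar>a\<bar> powr p <= p * Jp p b * (b - a)" using abs_powr_subgradient[OF p, of b a] by (simp add: algebra_simps)
  also have "... <= p * \<bar>b\<bar> powr (p - 1) * \<bar>b - a\<bar>" using abs_ge_self[of "p * Jp p b * (b - a)"] p by (simp add: abs_mult abs_Jp)
  finally have 1: "\<bar>b\<bar> powr p - \<bar>a\<bar> powr p <= p * \<bar>b\<bar> powr (p - 1) * \<bar>b - a\<bar>" .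
  have "\<bar>a\<bar> powr p - \<bar>b\<bar> powr p <= - (p * Jp p a * (b - a))" using abs_powr_subgradient[OF p, of a b] by linarith
  also have "... <= p * \<bar>a\<bar> powr (p - 1) * \<bar>b - a\<bar>" using abs_ge_minus_self[of "p * Jp p a * (b - a)"] p by (simp add: abs_mult abs_Jp)
  finally have 2: "\<bar>a\<bar> powr p - \<bar>b\<bar> powr p <= p * \<bar>a\<bar> powr (p - 1) * \<bar>b - a\<bar>" .
  have "0 <= p * \<bar>a\<bar> powr (p - 1) * \<bar>b - a\<bar>" "0 <= p * \<bar>b\<bar> powr (p - 1) * \<bar>b - a\<bar>" using p by auto
  with 1 2 show ?thesis by (simp add: distrib_left distrib_right abs_le_iff)
qed

definition convexity_defect :: "real => real => real => real" where
  "convexity_defect p a b = (\<bar>a\<bar> powr p + \<bar>b\<bar> powr p) / 2 - \<bar>(a + b) / 2\<bar> powr p"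

lemma convexity_defect_pos:
  assumes p: "1 < p" and "a \<noteq> b"
  shows "0 < convexity_defect p a b"
proof -
  have *: "0 < convexity_defect p a b" if "a < b" for a b
  proof -
    let ?m = "(a + b) / 2"
    obtain z where z: "?m < z" "\<bar>b\<bar> powr p - \<bar>?m\<bar> powr p = (b - ?m) * (p * Jp p z)" using abs_powr_MVT[OF p, of ?m b] \<open>a < b\<close> by auto
    obtain w where w: "w < ?m" "\<bar>?m\<bar> powr p - \<bar>a\<bar> powr p = (?m - a) * (p * Jp p w)" using abs_powr_MVT[OF p, of a ?m] \<open>a < b\<close> by auto
    have "Jp p w < Jp p z" using z w by (intro Jp_less p) auto
    then have "0 < (b - a) / 2 * p * (Jp p z - Jp p w)" using p \<open>a < b\<close> by simp
    also have "... = (b - ?m) * (p * Jp p z) - (?m - a) * (p * Jp p w)" by (simp add: field_simps)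
    also have "... = 2 * convexity_defect p a b" unfolding z(2)[symmetric] w(2)[symmetric] convexity_defect_def by simp
    finally show ?thesis by simp
  qed
  have "convexity_defect p a b = convexity_defect p b a" by (simp add: convexity_defect_def add.commute)
  then show ?thesis using *[of a b] *[of b a] \<open>a \<noteq> b\<close> by (cases "a < b") auto
qed

lemma convexity_defect_nonneg: "1 < p ==> 0 <= convexity_defect p a b"
  using convexity_defect_pos[of p a b] by (cases "a = b") (auto simp: convexity_defect_def)

text \<open>Strict convexity becomes uniform on bounded sets by compactness, which treats all
  \<open>p > 1\<close> alike and is one reason for working with bounded competitors.\<close>

lemma convexity_defect_lower_bound:
  assumes p: "1 < p" and t: "0 < t"
  obtains d where "0 < d"
    "!!a b. \<bar>a\<bar> <= M ==> \<bar>b\<bar> <= M ==> t <= \<bar>a - b\<bar> ==> d <= convexity_defect p a b"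
proof -
  define C where "C = {z :: real \<times> real. \<bar>fst z\<bar> <= M \<and> \<bar>snd z\<bar> <= M \<and> t <= \<bar>fst z - snd z\<bar>}"
  show ?thesis
  proof (cases "C = {}")
    case True then show ?thesis using that[of 1] unfolding C_def by fastforce
  next
    case False have "C = cbox (-M,-M) (M,M) \<inter> {z. t <= \<bar>fst z - snd z\<bar>}" by (auto simp: C_def cbox_Pair_eq)
    moreover have "closed {z :: real \<times> real. t <= \<bar>fst z - snd z\<bar>}" by (intro closed_Collect_le continuous_intros)
    ultimately have "compact C" using compact_Int_closed[OF compact_cbox] by metis
    moreover have "continuous_on C (\<lambda>z. convexity_defect p (fst z) (snd z))" unfolding convexity_defect_def using p
      by (intro continuous_intros continuous_on_powr') auto
    ultimately have "\<exists>z\<in>C. \<forall>y\<in>C.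
        convexity_defect p (fst z) (snd z) <= convexity_defect p (fst y) (snd y)" using False by (intro continuous_attains_inf)
    then obtain z where z: "z \<in> C" "!!y. y \<in> C ==>
        convexity_defect p (fst z) (snd z) <= convexity_defect p (fst y) (snd y)" by blast
    have "fst z \<noteq> snd z" using z(1) t by (auto simp: C_def)
    then have "0 < convexity_defect p (fst z) (snd z)" by (rule convexity_defect_pos[OF p])
    moreover have "convexity_defect p (fst z) (snd z) <= convexity_defect p a b"
      if "\<bar>a\<bar> <= M" "\<bar>b\<bar> <= M" "t <= \<bar>a - b\<bar>" for a b using z(2)[of "(a, b)"] that by (simp add: C_def)
    ultimately show ?thesis by (rule that)
  qed
qed

section \<open>The singular kernel\<close>

lemma ball_in_sets_borel [measurable]: "ball x r \<in> sets borel" by simp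

lemma powr_minus_scale:
  fixes c t E :: real
  assumes "0 < c" "0 <= t"
  shows "t powr (- E) = c powr E * (c * t) powr (- E)"
proof -
  have "c powr E * c powr (- E) = 1" using assms by (simp add: powr_minus)
  then show ?thesis using assms by (simp only: powr_mult mult.assoc[symmetric] mult_1)
qed

section \<open>Integrals of the singular kernel over dyadic shells\<close>

lemma dyadic_exists:
  fixes t :: real
  assumes "1 <= t"
  obtains j :: nat where "2 ^ j <= t" "t < 2 ^ Suc j"
proof -
  have ex: "\<exists>j::nat. t < 2 ^ Suc j" using real_arch_pow[of 2 t] by (metis one_less_numeral_iff power_Suc semiring_norm(76)
      mult_2 less_add_same_cancel2 order_less_trans zero_less_numeral zero_less_power)
  define j where "j = (LEAST j::nat. t < 2 ^ Suc j)"
  have 1: "t < 2 ^ Suc j" unfolding j_def using ex by (rule LeastI_ex)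
  have 2: "2 ^ j <= t"
  proof (cases j)
    case (Suc i) have "\<not> t < 2 ^ Suc i" using not_less_Least[of i "\<lambda>j. t < 2 ^ Suc j"] Suc by (simp add: j_def)
    then show ?thesis using Suc by simp
  qed (use assms in simp)
  show ?thesis using 2 1 by (rule that)
qed

text \<open>At each point a single term of a series of multiples of ball indicators dominates the
  integrand, so the integral is bounded by the sum of the series, without polar coordinates.\<close>

lemma nn_integral_dyadic_le:
  fixes f :: "'a::euclidean_space => ennreal" and c R :: "nat => real"
  assumes f: "!!y. f y = 0 \<or> (\<exists>j. y \<in> ball x (R j) \<and> f y <= ennreal (c j))"
    and c: "!!j. 0 <= c j" and R: "!!j. 0 <= R j"
    and S: "(\<lambda>j. c j * (unit_ball_vol (real DIM('a)) * R j ^ DIM('a))) sums S"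
  shows "(\<integral>\<^sup>+y. f y \<partial>lborel) <= ennreal S"
proof -
  have "(\<integral>\<^sup>+y. f y \<partial>lborel) <= (\<integral>\<^sup>+y. (\<Sum>j. ennreal (c j) * indicator (ball x (R j)) y) \<partial>lborel)"
  proof (rule nn_integral_mono)
    fix y
    consider "f y = 0" | j where "y \<in> ball x (R j)" "f y <= ennreal (c j)" using f by blast
    then show "f y <= (\<Sum>j. ennreal (c j) * indicator (ball x (R j)) y)"
    proof cases
      case 2 then have "f y <= sum (\<lambda>j. ennreal (c j) * indicator (ball x (R j)) y) {j}" by simp
      also have "... <= (\<Sum>j. ennreal (c j) * indicator (ball x (R j)) y)" by (rule sum_le_suminf) auto
      finally show ?thesis .
    qed simp
  qed
  also have "... = (\<Sum>j. \<integral>\<^sup>+y. ennreal (c j) * indicator (ball x (R j)) y \<partial>lborel)" by (rule nn_integral_suminf) measurable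
  also have "... = (\<Sum>j. ennreal (c j * (unit_ball_vol (real DIM('a)) * R j ^ DIM('a))))"
    using c R by (simp add: nn_integral_cmult_indicator emeasure_ball ennreal_mult)
  also have "... = ennreal S" using c R S by (intro suminf_ennreal_eq) auto
  finally show ?thesis .
qed

text \<open>Since \<open>0 powr a = 0\<close>, the value on the diagonal is 0. A kernel lying
  between two multiples of this function at every pair therefore vanishes on the diagonal, and lower
  bounds need \<open>x \<noteq> y\<close>.\<close>

definition riesz :: "real => 'a::euclidean_space => 'a => real" where
  "riesz q x y = norm (x - y) powr (- (real DIM('a) + q))"

definition tail_weight :: "real => 'a::euclidean_space => real" where
  "tail_weight q y = (1 + norm y) powr (- (real DIM('a) + q))"

lemma riesz_nonneg [simp]: "0 <= riesz q x y" by (simp add: riesz_def)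

lemma riesz_commute: "riesz q x y = riesz q y x" by (simp add: riesz_def norm_minus_commute)

lemma riesz_pos [simp]: "x \<noteq> y ==> 0 < riesz q x y" by (simp add: riesz_def)

lemma tail_weight_pos [simp]: "0 < tail_weight q y" using norm_ge_zero[of y] by (simp add: tail_weight_def add_nonneg_eq_0_iff)

lemma tail_weight_nonneg [simp]: "0 <= tail_weight q y" by (simp add: tail_weight_def)

lemma borel_measurable_riesz [measurable (raw)]:
  "f \<in> borel_measurable M ==> g \<in> borel_measurable M ==> (\<lambda>z. riesz q (f z) (g z)) \<in> borel_measurable M" unfolding riesz_def by measurable

lemma borel_measurable_riesz_snd [measurable]: "riesz q x \<in> borel_measurable borel" unfolding riesz_def[abs_def] by measurable

lemma borel_measurable_tail_weight [measurable]: "tail_weight q \<in> borel_measurable borel" unfolding tail_weight_def[abs_def] by measurable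

lemma riesz_antimono: "0 < norm (x - y) ==> norm (x - y) <= d ==> 0 < q ==>
    d powr (- (real DIM('a) + q)) <= riesz q x (y::'a::euclidean_space)" unfolding riesz_def by (rule powr_mono2') auto

lemma riesz_le: "0 < d ==> d <= norm (x - y) ==> 0 < q ==>
    riesz q x (y::'a::euclidean_space) <= d powr (- (real DIM('a) + q))" unfolding riesz_def by (rule powr_mono2') auto

lemma geometric_sums: "0 < q ==> (\<lambda>j. (2 powr (- q)) ^ j) sums (1 / (1 - 2 powr (- q :: real)))"
  by (rule geometric_sums) (simp add: powr_less_one)

lemma nn_integral_riesz_far:
  assumes q: "0 < q"
  obtains C where "0 < C" "!!(x::'a::euclidean_space) r. 0 < r ==>
    (\<integral>\<^sup>+y. ennreal (riesz q x y) * indicator (- ball x r) y \<partial>lborel) <= ennreal (C * r powr (- q))"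
proof
  let ?n = "DIM('a)" and ?w = "unit_ball_vol (real DIM('a))"
  let ?C = "?w * 2 ^ ?n * (1 / (1 - 2 powr (- q)))"
  have lt: "2 powr (- q) < (1::real)" using q by (simp add: powr_less_one)
  show "0 < ?C" using lt by simp
  fix x :: 'a and r :: real assume r: "0 < r"
  \<comment> \<open>On the shell between the radii \<open>2 ^ j * r\<close> and
    \<open>2 ^ Suc j * r\<close> the kernel is largest at the inner radius, while the measure is
    bounded by that of the outer ball; the products form a geometric series of ratio
    \<open>2 powr (- q)\<close>.\<close>
  let ?c = "\<lambda>j. (2 ^ j * r) powr (- (real ?n + q))" and ?R = "\<lambda>j. 2 ^ Suc j * r"
  have "?c j * (?w * ?R j ^ ?n) = ?w * 2 ^ ?n * r powr (- q) * (2 powr (- q)) ^ j" for j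
  proof -
    have "?R j ^ ?n = 2 ^ ?n * (2 ^ j * r) powr (real ?n)" using r by (simp add: powr_realpow power_mult_distrib)
    then have "?c j * (?w * ?R j ^ ?n) = ?w * 2 ^ ?n * ((2 ^ j * r) powr (- (real ?n + q)) * (2 ^ j * r) powr (real ?n))" by simp
    also have "(2 ^ j * r) powr (- (real ?n + q)) * (2 ^ j * r) powr (real ?n) = (2 ^ j * r) powr (- q)" by (simp add: powr_add[symmetric])
    also have "... = (2 powr (- q)) ^ j * r powr (- q)" using r by (simp add: powr_mult powr_realpow[symmetric] powr_powr mult.commute)
    finally show ?thesis by (simp add: mult_ac)
  qed
  moreover have "(\<lambda>j. ?w * 2 ^ ?n * r powr (- q) * (2 powr (- q)) ^ j) sums
      (?w * 2 ^ ?n * r powr (- q) * (1 / (1 - 2 powr (- q))))" by (intro sums_mult geometric_sums q)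
  ultimately have S: "(\<lambda>j. ?c j * (?w * ?R j ^ ?n)) sums (?C * r powr (- q))" by (simp only: mult_ac)
  show "(\<integral>\<^sup>+y. ennreal (riesz q x y) * indicator (- ball x r) y \<partial>lborel) <= ennreal (?C * r powr (- q))"
  proof (rule nn_integral_dyadic_le[OF _ _ _ S])
    fix y
    show "ennreal (riesz q x y) * indicator (- ball x r) y = 0 \<or>
       (\<exists>j. y \<in> ball x (2 ^ Suc j * r) \<and>
         ennreal (riesz q x y) * indicator (- ball x r) y <= ennreal ((2 ^ j * r) powr (- (real ?n + q))))"
    proof (cases "y \<in> ball x r")
      case False then have "1 <= norm (x - y) / r" using r by (simp add: dist_norm)
      then obtain j where j: "2 ^ j <= norm (x - y) / r" "norm (x - y) / r < 2 ^ Suc j" by (rule dyadic_exists)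
      then have "y \<in> ball x (2 ^ Suc j * r)" "2 ^ j * r <= norm (x - y)" using r by (auto simp: dist_norm field_simps)
      moreover from this have "riesz q x y <= (2 ^ j * r) powr (- (real ?n + q))" using r q by (intro riesz_le) auto
      ultimately show ?thesis using False by (intro disjI2 exI[of _ j]) (auto intro!: ennreal_leI)
    qed simp
  qed (use r in auto)
qed

text \<open>The factor \<open>norm (x - y) powr p\<close>, which comes from a Lipschitz bound, beats
  the singularity: the remaining exponent \<open>p - q\<close> of the radius is positive, so the
  shells shrinking to \<open>x\<close> again give a geometric series.\<close>

lemma nn_integral_riesz_near:
  assumes q: "q < p"
  obtains C where "0 < C" "!!(x::'a::euclidean_space) r. 0 < r ==>
    (\<integral>\<^sup>+y. ennreal (norm (x - y) powr p * riesz q x y) * indicator (ball x r) y \<partial>lborel)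
      <= ennreal (C * r powr (p - q))"
proof
  let ?n = "DIM('a)" and ?w = "unit_ball_vol (real DIM('a))"
  define e where "e = p - (real ?n + q)"
  \<comment> \<open>The sign of \<open>e\<close> is unknown. A point of the shell has distance
    comparable to \<open>r / 2 ^ j\<close> up to the factor 2, so
    \<open>2 powr \<bar>e\<bar>\<close> covers both signs.\<close>
  let ?C = "?w * 2 powr \<bar>e\<bar> * (1 / (1 - 2 powr (- (p - q))))"
  have lt: "2 powr (- (p - q)) < (1::real)" using q by (subst powr_less_one) auto
  show "0 < ?C" using lt by simp
  fix x :: 'a and r :: real assume r: "0 < r"
  let ?R = "\<lambda>j. r / 2 ^ j" and ?c = "\<lambda>j. 2 powr \<bar>e\<bar> * (r / 2 ^ j) powr e"
  have "?c j * (?w * ?R j ^ ?n) = ?w * 2 powr \<bar>e\<bar> * r powr (p - q) * (2 powr (- (p - q))) ^ j" for j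
  proof -
    have "?R j ^ ?n = (r / 2 ^ j) powr (real ?n)" using r by (simp add: powr_realpow)
    then have "?c j * (?w * ?R j ^ ?n) = ?w * 2 powr \<bar>e\<bar> * ((r / 2 ^ j) powr e * (r / 2 ^ j) powr (real ?n))" by simp
    also have "(r / 2 ^ j) powr e * (r / 2 ^ j) powr (real ?n) = (r / 2 ^ j) powr (p - q)" by (simp add: powr_add[symmetric] e_def)
    also have "... = (2 powr (- (p - q))) ^ j * r powr (p - q)"
      using r by (simp add: powr_divide powr_realpow[symmetric] powr_powr field_simps powr_minus_divide powr_diff)
    finally show ?thesis by (simp add: mult_ac)
  qed
  moreover have "(\<lambda>j. ?w * 2 powr \<bar>e\<bar> * r powr (p - q) * (2 powr (- (p - q))) ^ j) sums
      (?w * 2 powr \<bar>e\<bar> * r powr (p - q) * (1 / (1 - 2 powr (- (p - q)))))" using q by (intro sums_mult geometric_sums) auto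
  ultimately have S: "(\<lambda>j. ?c j * (?w * ?R j ^ ?n)) sums (?C * r powr (p - q))" by (simp only: mult_ac)
  show "(\<integral>\<^sup>+y. ennreal (norm (x - y) powr p * riesz q x y) * indicator (ball x r) y \<partial>lborel)
      <= ennreal (?C * r powr (p - q))"
  proof (rule nn_integral_dyadic_le[OF _ _ _ S])
    fix y
    let ?d = "norm (x - y)"
    show "ennreal (?d powr p * riesz q x y) * indicator (ball x r) y = 0 \<or>
       (\<exists>j. y \<in> ball x (r / 2 ^ j) \<and>
         ennreal (?d powr p * riesz q x y) * indicator (ball x r) y <= ennreal (2 powr \<bar>e\<bar> * (r / 2 ^ j) powr e))"
    proof (cases "y \<in> ball x r \<and> y \<noteq> x")
      case True then have d: "0 < ?d" "?d < r" by (auto simp: dist_norm)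
      then have "1 <= r / ?d" by simp
      then obtain j0 where j0: "2 ^ j0 <= r / ?d" "r / ?d < 2 ^ Suc j0" by (rule dyadic_exists)
      \<comment> \<open>The dyadic index may give a distance exactly equal to
        \<open>r / 2 ^ j0\<close>, which the open ball misses; the index is then lowered by one,
        which is possible because the distance is less than \<open>r\<close>.\<close>
      obtain j where j: "?d < r / 2 ^ j" "r / 2 ^ j <= 2 * ?d"
      proof (cases "?d < r / 2 ^ j0")
        case True then show ?thesis using that[of j0] j0 d by (simp add: field_simps)
      next
        case False then have eq: "?d = r / 2 ^ j0" using j0 d by (simp add: field_simps)
        then have "j0 \<noteq> 0" using d by (intro notI) simp
        then obtain i where "j0 = Suc i" by (cases j0) auto
        then show ?thesis using that[of i] eq d by (simp add: field_simps)
      qed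
      have "?d powr p * riesz q x y = ?d powr e" unfolding riesz_def e_def powr_add[symmetric] by (simp add: algebra_simps)
      also have "... <= 2 powr \<bar>e\<bar> * (r / 2 ^ j) powr e"
      proof (cases "0 <= e")
        case True then have "?d powr e <= 1 * (r / 2 ^ j) powr e" using j by (simp add: powr_mono2)
        also have "... <= 2 powr \<bar>e\<bar> * (r / 2 ^ j) powr e" by (intro mult_right_mono) (auto simp: ge_one_powr_ge_zero)
        finally show ?thesis .
      next
        case False have "?d powr e <= (r / 2 ^ j / 2) powr e" using False j d r by (intro powr_mono2') auto
        also have "... = 2 powr \<bar>e\<bar> * (r / 2 ^ j) powr e" using False r by (simp add: powr_divide powr_mult powr_minus_divide)
        finally show ?thesis .
      qed
      finally show ?thesis using j True by (intro disjI2 exI[of _ j]) (auto simp: dist_norm indicator_def intro!: ennreal_leI)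
    qed auto
  qed (use r in auto)
qed

lemma tail_weight_finite:
  assumes "0 < q"
  shows "(\<integral>\<^sup>+y. ennreal (tail_weight q (y::'a::euclidean_space)) \<partial>lborel) < \<infinity>"
proof -
  obtain C where "0 < C" and C: "!!(x::'a) r. 0 < r ==>
    (\<integral>\<^sup>+y. ennreal (riesz q x y) * indicator (- ball x r) y \<partial>lborel) <= ennreal (C * r powr (- q))"
    using nn_integral_riesz_far[OF assms] by blast
  have "(\<integral>\<^sup>+y. ennreal (tail_weight q (y::'a)) \<partial>lborel) <=
    (\<integral>\<^sup>+y. indicator (ball 0 1) y + ennreal (riesz q 0 y) * indicator (- ball 0 1) (y::'a) \<partial>lborel)"
  proof (rule nn_integral_mono)
    fix y :: 'a
    show "ennreal (tail_weight q y) <= indicator (ball 0 1) y + ennreal (riesz q 0 y) * indicator (- ball 0 1) y"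
    proof (cases "y \<in> ball 0 1")
      case True
      have "tail_weight q y <= 1" unfolding tail_weight_def using powr_mono2'[of "- (real DIM('a) + q)" 1 "1 + norm y"] assms by simp
      then show ?thesis using True by simp
    next
      case False
      then have "tail_weight q y <= riesz q 0 y" unfolding tail_weight_def riesz_def using assms by (intro powr_mono2') auto
      then show ?thesis using False by (simp add: ennreal_leI)
    qed
  qed
  also have "... = emeasure lborel (ball 0 1 :: 'a set) +
      (\<integral>\<^sup>+y. ennreal (riesz q 0 y) * indicator (- ball 0 1) (y::'a) \<partial>lborel)" by (subst nn_integral_add) auto
  also have "... < \<infinity>" using C[of 1 0] by (auto simp: emeasure_ball less_top[symmetric] top_unique)
  finally show ?thesis .
qed

lemma nn_integral_mult_indicator_le:
  assumes [measurable]: "A \<in> sets M" and "!!x. x \<in> A ==> f x <= c"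
  shows "(\<integral>\<^sup>+x. f x * indicator A x \<partial>M) <= c * emeasure M A"
proof -
  have "(\<integral>\<^sup>+x. f x * indicator A x \<partial>M) <= (\<integral>\<^sup>+x. c * indicator A x \<partial>M)" using assms(2) by (intro nn_integral_mono) (auto simp: indicator_def)
  then show ?thesis by (simp add: nn_integral_cmult_indicator)
qed

lemma nn_integral_weight_le:
  assumes [measurable]: "f \<in> borel_measurable M" "l \<in> borel_measurable M" and le: "!!y. k y <= c * l y" and c: "0 <= c"
  shows "(\<integral>\<^sup>+y. ennreal (k y) * f y \<partial>M) <= ennreal c * (\<integral>\<^sup>+y. ennreal (l y) * f y \<partial>M)"
proof -
  have "ennreal (k y) * f y <= ennreal c * (ennreal (l y) * f y)" for y
    using mult_right_mono[OF ennreal_leI[OF le[of y]], of "f y"] c by (simp add: ennreal_mult' mult.assoc)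
  then have "(\<integral>\<^sup>+y. ennreal (k y) * f y \<partial>M) <= (\<integral>\<^sup>+y. ennreal c * (ennreal (l y) * f y) \<partial>M)" by (rule nn_integral_mono)
  also have "... = ennreal c * (\<integral>\<^sup>+y. ennreal (l y) * f y \<partial>M)" by (rule nn_integral_cmult) measurable
  finally show ?thesis .
qed

lemma null_sets_fst:
  assumes "AE x in (lborel :: 'a::euclidean_space measure). P x"
  shows "AE z in (lborel \<Otimes>\<^sub>M (lborel :: 'a measure)). P (fst z)" 
    and "AE z in ((lborel :: 'a measure) \<Otimes>\<^sub>M lborel). P (snd z)"
proof -
  obtain N where N: "{x. \<not> P x} \<subseteq> N" "N \<in> null_sets lborel" using assms by (auto elim!: AE_E simp: null_sets_def)
  have [measurable]: "N \<in> sets borel" and N0: "emeasure lborel N = 0" using N(2) by (auto simp: null_sets_def)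
  have n: "N \<times> UNIV \<in> null_sets (lborel \<Otimes>\<^sub>M (lborel :: 'a measure))"
    "UNIV \<times> N \<in> null_sets ((lborel :: 'a measure) \<Otimes>\<^sub>M lborel)" using N0 by (auto simp: null_sets_def lborel.emeasure_pair_measure_Times)
  show "AE z in (lborel \<Otimes>\<^sub>M (lborel :: 'a measure)). P (fst z)" by (rule AE_I'[OF n(1)]) (use N(1) in auto)
  show "AE z in ((lborel :: 'a measure) \<Otimes>\<^sub>M lborel). P (snd z)" by (rule AE_I'[OF n(2)]) (use N(1) in auto)
qed

section \<open>Kernels pinched between multiples of the Riesz kernel\<close>

locale nonlocal_kernel =
  fixes s p \<Lambda> :: real and K :: "'a::euclidean_space => 'a => real"
  assumes s_pos: "0 < s" and s_less: "s < 1" and p_gt: "1 < p" and \<Lambda>_ge: "1 <= \<Lambda>"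
    and K_measurable [measurable]: "(\<lambda>z. K (fst z) (snd z)) \<in> borel_measurable (borel \<Otimes>\<^sub>M borel)"
    and K_commute: "K x y = K y x"
    and K_lower: "inverse \<Lambda> * riesz (s * p) x y <= K x y"
    and K_upper: "K x y <= \<Lambda> * riesz (s * p) x y"
begin

abbreviation "q \<equiv> s * p"

lemma K_measurable_snd [measurable]: "K x \<in> borel_measurable borel" using measurable_Pair2[OF K_measurable, of x] by simp

lemma q_pos: "0 < q" using s_pos p_gt by simp
lemma q_less: "q < p" using s_less p_gt by simp
lemma \<Lambda>_pos: "0 < \<Lambda>" using \<Lambda>_ge by simp
lemma p_pos: "0 < p" using p_gt by simp

lemma K_nonneg [simp]: "0 <= K x y" using K_lower[of x y] \<Lambda>_pos by (smt (verit) inverse_positive_iff_positive mult_nonneg_nonneg riesz_nonneg)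

lemma K_pos: "x \<noteq> y ==> 0 < K x y" using K_lower[of x y] \<Lambda>_pos riesz_pos[of x y q] by (smt (verit) inverse_positive_iff_positive mult_pos_pos)

text \<open>Absorbing the kernel into the measure turns the weak formulation into a plain integral
  of \<open>form\<close>, to which monotone and dominated convergence and Fatou's lemma apply
  directly.\<close>

definition \<mu> :: "('a \<times> 'a) measure" where
  "\<mu> = density (lborel \<Otimes>\<^sub>M lborel) (\<lambda>z. ennreal (K (fst z) (snd z)))"

lemma sets_\<mu> [measurable_cong, simp]: "sets \<mu> = sets (borel \<Otimes>\<^sub>M borel)" unfolding \<mu>_def by (simp cong: sets_pair_measure_cong)

lemma space_\<mu> [simp]: "space \<mu> = UNIV" by (simp add: \<mu>_def space_pair_measure)

lemma nn_integral_\<mu>: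
  assumes [measurable]: "f \<in> borel_measurable (borel \<Otimes>\<^sub>M borel)"
  shows "(\<integral>\<^sup>+z. f z \<partial>\<mu>) = (\<integral>\<^sup>+x. \<integral>\<^sup>+y. ennreal (K x y) * f (x, y) \<partial>lborel \<partial>lborel)"
proof -
  have "(\<integral>\<^sup>+z. f z \<partial>\<mu>) = (\<integral>\<^sup>+z. ennreal (K (fst z) (snd z)) * f z \<partial>(lborel \<Otimes>\<^sub>M lborel))" unfolding \<mu>_def by (rule nn_integral_density) measurable
  also have "... = (\<integral>\<^sup>+x. \<integral>\<^sup>+y. ennreal (K x y) * f (x, y) \<partial>lborel \<partial>lborel)" by (subst lborel.nn_integral_fst[symmetric]) auto
  finally show ?thesis .
qed

lemma nn_integral_\<mu>_swap:
  assumes [measurable]: "f \<in> borel_measurable (borel \<Otimes>\<^sub>M borel)"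
  shows "(\<integral>\<^sup>+z. f (snd z, fst z) \<partial>\<mu>) = (\<integral>\<^sup>+z. f z \<partial>\<mu>)"
proof -
  have "(\<integral>\<^sup>+z. f (snd z, fst z) \<partial>\<mu>) = (\<integral>\<^sup>+x. \<integral>\<^sup>+y. ennreal (K y x) * f (y, x) \<partial>lborel \<partial>lborel)" by (subst nn_integral_\<mu>) (auto simp: K_commute)
  also have "... = (\<integral>\<^sup>+x. \<integral>\<^sup>+y. ennreal (K x y) * f (x, y) \<partial>lborel \<partial>lborel)"
    using lborel_pair.Fubini[of "\<lambda>z. ennreal (K (fst z) (snd z)) * f z"] by simp
  finally show ?thesis by (simp add: nn_integral_\<mu>)
qed

lemma nn_integral_\<mu>_Times:
  assumes [measurable]: "f \<in> borel_measurable (borel \<Otimes>\<^sub>M borel)" "A \<in> sets borel" "B \<in> sets borel"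
  shows "(\<integral>\<^sup>+z. f z * indicator (A \<times> B) z \<partial>\<mu>) =
    (\<integral>\<^sup>+x. (\<integral>\<^sup>+y. ennreal (K x y) * f (x, y) * indicator B y \<partial>lborel) * indicator A x \<partial>lborel)"
  by (subst nn_integral_\<mu>) (auto intro!: nn_integral_cong simp: indicator_def)

lemma AE_\<mu>I:
  assumes "AE z in (lborel \<Otimes>\<^sub>M lborel). Q z"
  shows "AE z in \<mu>. Q z" unfolding \<mu>_def using assms by (subst AE_density) auto

lemma AE_\<mu>_fst: "AE x in lborel. P x ==> AE z in \<mu>. P (fst z)"
  and AE_\<mu>_snd: "AE x in lborel. P x ==> AE z in \<mu>. P (snd z)" by (auto intro: AE_\<mu>I null_sets_fst)

text \<open>Off the diagonal the density is positive, so a property holding almost everywhere for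
  \<open>\<mu>\<close> holds there almost everywhere for Lebesgue measure, and Fubini's theorem
  passes to sections.\<close>

lemma AE_\<mu>D:
  assumes "AE z in \<mu>. Q z"
  shows "AE x in lborel. AE y in lborel. x \<noteq> y --> Q (x, y)"
proof -
  have "AE z in (lborel \<Otimes>\<^sub>M lborel). 0 < ennreal (K (fst z) (snd z)) --> Q z" using assms unfolding \<mu>_def by (subst (asm) AE_density) auto
  then have "AE x in lborel. AE y in lborel. 0 < ennreal (K x y) --> Q (x, y)" by (drule_tac lborel_pair.AE_pair) simp
  then show ?thesis by (auto elim!: eventually_mono simp: K_pos)
qed

lemma nn_integral_K_le:
  "f \<in> borel_measurable borel ==>
    (\<integral>\<^sup>+y. ennreal (K x y) * f y \<partial>lborel) <= ennreal \<Lambda> * (\<integral>\<^sup>+y. ennreal (riesz q x y) * f y \<partial>lborel)"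
  using K_upper \<Lambda>_pos by (intro nn_integral_weight_le) auto

lemma nn_integral_K_far:
  obtains C where "0 < C" "!!x r. 0 < r ==>
    (\<integral>\<^sup>+y. ennreal (K x y) * indicator (- ball x r) y \<partial>lborel) <= ennreal (C * r powr (- q))"
proof -
  obtain C where C: "0 < C" "!!(x::'a) r. 0 < r ==>
    (\<integral>\<^sup>+y. ennreal (riesz q x y) * indicator (- ball x r) y \<partial>lborel) <= ennreal (C * r powr (- q))"
    using nn_integral_riesz_far[OF q_pos] by blast
  have "(\<integral>\<^sup>+y. ennreal (K x y) * indicator (- ball x r) y \<partial>lborel) <= ennreal (\<Lambda> * C * r powr (- q))" if "0 < r" for x r
    using order_trans[OF nn_integral_K_le mult_left_mono[OF C(2)[OF that, of x]]] \<Lambda>_pos C(1) by (simp add: ennreal_mult mult.assoc)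
  then show ?thesis using that[of "\<Lambda> * C"] C(1) \<Lambda>_pos by simp
qed

lemma nn_integral_K_near:
  obtains C where "0 < C" "!!x r. 0 < r ==>
    (\<integral>\<^sup>+y. ennreal (norm (x - y) powr p * K x y) * indicator (ball x r) y \<partial>lborel) <= ennreal (C * r powr (p - q))"
proof -
  obtain C where C: "0 < C" "!!(x::'a) r. 0 < r ==>
    (\<integral>\<^sup>+y. ennreal (norm (x - y) powr p * riesz q x y) * indicator (ball x r) y \<partial>lborel) <= ennreal (C * r powr (p - q))"
    using nn_integral_riesz_near[OF q_less] by blast
  have "(\<integral>\<^sup>+y. ennreal (norm (x - y) powr p * K x y) * indicator (ball x r) y \<partial>lborel) <= ennreal (\<Lambda> * C * r powr (p - q))"
    if r: "0 < r" for x r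
  proof -
    let ?f = "\<lambda>y. ennreal (norm (x - y) powr p) * indicator (ball x r) y"
    have e: "ennreal (norm (x - y) powr p * k) * indicator (ball x r) y = ennreal k * ?f y" if "0 <= k" for y k
      using that by (simp add: ennreal_mult mult_ac)
    show ?thesis using order_trans[OF nn_integral_K_le[of ?f x] mult_left_mono[OF C(2)[OF r, of x, unfolded e[OF riesz_nonneg]]]] \<Lambda>_pos C(1)
      by (simp add: ennreal_mult mult_ac)
  qed
  then show ?thesis using that[of "\<Lambda> * C"] C(1) \<Lambda>_pos by simp
qed

text \<open>The Lipschitz bound is used inside the ball of radius \<open>\<rho>\<close>, the
  oscillation bound \<open>k\<close> outside it. The radius stays free, so that it can be matched to
  the scale at which a cutoff varies.\<close>

lemma nn_integral_Lipschitz_energy: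
  obtains C where "0 < C" "!!\<psi> L k \<rho> x. \<psi> \<in> borel_measurable borel ==> 0 <= L ==> 0 <= k ==> 0 < \<rho> ==>
    (!!y. \<bar>\<psi> x - \<psi> y\<bar> <= L * norm (x - y)) ==> (!!y. \<bar>\<psi> x - \<psi> y\<bar> <= k) ==>
    (\<integral>\<^sup>+y. ennreal (K x y) * ennreal (\<bar>\<psi> x - \<psi> y\<bar> powr p) \<partial>lborel)
      <= ennreal (C * (L powr p * \<rho> powr (p - q) + k powr p * \<rho> powr (- q)))"
proof -
  obtain C1 where C1: "0 < C1" "!!x r. 0 < r ==>
    (\<integral>\<^sup>+y. ennreal (K x y) * indicator (- ball x r) y \<partial>lborel) <= ennreal (C1 * r powr (- q))" using nn_integral_K_far by blast
  obtain C2 where C2: "0 < C2" "!!x r. 0 < r ==>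
    (\<integral>\<^sup>+y. ennreal (norm (x - y) powr p * K x y) * indicator (ball x r) y \<partial>lborel)
      <= ennreal (C2 * r powr (p - q))" using nn_integral_K_near by blast
  show ?thesis
  proof (rule that[of "C1 + C2"])
    show "0 < C1 + C2" using C1 C2 by simp
    fix \<psi> :: "'a => real" and L k \<rho> :: real and x
    assume [measurable]: "\<psi> \<in> borel_measurable borel" and L: "0 <= L" and k: "0 <= k" and \<rho>: "0 < \<rho>"
      and 1: "!!y. \<bar>\<psi> x - \<psi> y\<bar> <= L * norm (x - y)" and 2: "!!y. \<bar>\<psi> x - \<psi> y\<bar> <= k"
    have "(\<integral>\<^sup>+y. ennreal (K x y) * ennreal (\<bar>\<psi> x - \<psi> y\<bar> powr p) \<partial>lborel) <=
      (\<integral>\<^sup>+y. ennreal (k powr p) * (ennreal (K x y) * indicator (- ball x \<rho>) y) +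
         ennreal (L powr p) * (ennreal (norm (x - y) powr p * K x y) * indicator (ball x \<rho>) y) \<partial>lborel)"
    proof (rule nn_integral_mono)
      fix y
      have 3: "\<bar>\<psi> x - \<psi> y\<bar> powr p <= L powr p * norm (x - y) powr p" using powr_mono2[OF _ _ 1, of p] p_gt L by (simp add: powr_mult)
      have 4: "\<bar>\<psi> x - \<psi> y\<bar> powr p <= k powr p" using powr_mono2[OF _ _ 2, of p] p_gt by simp
      have 5: "K x y * \<bar>\<psi> x - \<psi> y\<bar> powr p <= L powr p * (norm (x - y) powr p * K x y)"
        using mult_left_mono[OF 3, of "K x y"] by (simp add: mult_ac)
      have 6: "K x y * \<bar>\<psi> x - \<psi> y\<bar> powr p <= k powr p * K x y" using mult_left_mono[OF 4, of "K x y"] by (simp add: mult_ac)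
      show "ennreal (K x y) * ennreal (\<bar>\<psi> x - \<psi> y\<bar> powr p) <=
         ennreal (k powr p) * (ennreal (K x y) * indicator (- ball x \<rho>) y) +
         ennreal (L powr p) * (ennreal (norm (x - y) powr p * K x y) * indicator (ball x \<rho>) y)"
        using 5 6 by (cases "y \<in> ball x \<rho>") (auto simp: ennreal_mult[symmetric] intro!: ennreal_leI)
    qed
    also have "... = ennreal (k powr p) * (\<integral>\<^sup>+y. ennreal (K x y) * indicator (- ball x \<rho>) y \<partial>lborel) +
       ennreal (L powr p) * (\<integral>\<^sup>+y. ennreal (norm (x - y) powr p * K x y) * indicator (ball x \<rho>) y \<partial>lborel)"
    proof -
      have m: "(\<lambda>y. ennreal (K x y) * indicator (- ball x \<rho>) y) \<in> borel_measurable lborel"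
        "(\<lambda>y. ennreal (norm (x - y) powr p * K x y) * indicator (ball x \<rho>) y) \<in> borel_measurable lborel" by measurable
      show ?thesis unfolding nn_integral_cmult[OF m(1), symmetric] nn_integral_cmult[OF m(2), symmetric]
        by (intro nn_integral_add borel_measurable_times_ennreal m borel_measurable_const)
    qed
    also have "... <= ennreal (k powr p) * ennreal (C1 * \<rho> powr (- q)) + ennreal (L powr p) * ennreal (C2 * \<rho> powr (p - q))"
      by (intro add_mono mult_left_mono C1 C2 \<rho>) auto
    also have "... = ennreal (k powr p * (C1 * \<rho> powr (- q)) + L powr p * (C2 * \<rho> powr (p - q)))"
      using C1 C2 by (simp add: ennreal_mult[symmetric] ennreal_plus[symmetric] del: ennreal_plus)
    also have "... <= ennreal ((C1 + C2) * (L powr p * \<rho> powr (p - q) + k powr p * \<rho> powr (- q)))"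
      using C1 C2 by (intro ennreal_leI) (simp add: algebra_simps)
    finally show "(\<integral>\<^sup>+y. ennreal (K x y) * ennreal (\<bar>\<psi> x - \<psi> y\<bar> powr p) \<partial>lborel)
      <= ennreal ((C1 + C2) * (L powr p * \<rho> powr (p - q) + k powr p * \<rho> powr (- q)))" .
  qed
qed

text \<open>A point \<open>x\<close> of the bounded set \<open>W\<close> keeps the distance
  \<open>d\<close> from every \<open>y\<close> outside \<open>D\<close>, and then
  \<open>1 + norm y\<close> is at most a constant times \<open>norm (x - y)\<close>.\<close>

lemma K_le_tail_weight:
  assumes "bounded W" and d: "0 < d" and W: "!!x. x \<in> W ==> ball x d \<subseteq> D"
  obtains C where "0 < C" "!!x y. x \<in> W ==> y \<notin> D ==> K x y <= C * tail_weight q y"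
proof -
  obtain R where R: "!!x. x \<in> W ==> norm x <= R" "0 < R" using \<open>bounded W\<close> by (auto simp: bounded_pos)
  \<comment> \<open>With \<open>R\<close> bounding \<open>W\<close>, \<open>1 + norm y\<close> is at
    most \<open>(1 + R) + norm (x - y)\<close>, and \<open>1 + R\<close> is at most
    \<open>(1 + R) / d * norm (x - y)\<close>.\<close>
  define c where "c = (1 + R) / d + 1"
  have c: "1 <= c" using R d by (simp add: c_def)
  show ?thesis
  proof (rule that[of "\<Lambda> * c powr (real DIM('a) + q)"])
    show "0 < \<Lambda> * c powr (real DIM('a) + q)" using \<Lambda>_pos c by simp
    fix x y assume x: "x \<in> W" and y: "y \<notin> D"
    have dist: "d <= norm (x - y)" using W[OF x] y by (force simp: dist_norm)
    have "1 + norm y <= 1 + R + norm (x - y)" using norm_triangle_ineq2[of y x] R(1)[OF x] by (simp add: norm_minus_commute)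
    also have "1 + R = (1 + R) / d * d" using d by simp
    also have "... <= (1 + R) / d * norm (x - y)" using R d dist by (intro mult_left_mono) auto
    finally have "1 + norm y <= c * norm (x - y)" by (simp add: c_def algebra_simps)
    then have "(c * norm (x - y)) powr (- (real DIM('a) + q)) <= tail_weight q y" unfolding tail_weight_def using q_pos
      by (intro powr_mono2') (auto intro: add_pos_nonneg)
    then have "riesz q x y <= c powr (real DIM('a) + q) * tail_weight q y" using c unfolding riesz_def
      by (subst powr_minus_scale[of c]) (auto intro!: mult_left_mono)
    then have "\<Lambda> * riesz q x y <= \<Lambda> * (c powr (real DIM('a) + q) * tail_weight q y)" using \<Lambda>_pos by (intro mult_left_mono) auto
    with K_upper[of x y] show "K x y <= \<Lambda> * c powr (real DIM('a) + q) * tail_weight q y" by (simp add: mult_ac)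
  qed
qed

text \<open>The reverse comparison rests on \<open>norm (x - y) <= (1 + R) * (1 + norm y)\<close>
  and holds at all distances, except on the diagonal, where the kernel is 0.\<close>

lemma tail_weight_le_K:
  assumes "bounded W"
  obtains C where "0 < C" "!!x y. x \<in> W ==> x \<noteq> y ==> tail_weight q y <= C * K x y"
proof -
  obtain R where R: "!!x. x \<in> W ==> norm x <= R" "0 < R" using \<open>bounded W\<close> by (auto simp: bounded_pos)
  define c where "c = 1 + R"
  have c: "1 <= c" using R by (simp add: c_def)
  show ?thesis
  proof (rule that[of "\<Lambda> * c powr (real DIM('a) + q)"])
    show "0 < \<Lambda> * c powr (real DIM('a) + q)" using \<Lambda>_pos c by simp
    fix x y assume x: "x \<in> W" and y: "x \<noteq> y"
    have "norm (x - y) <= R + norm y" using norm_triangle_ineq4[of x y] R(1)[OF x] by simp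
    also have "... <= c * (1 + norm y)" using R by (simp add: c_def algebra_simps)
    finally have "(c * (1 + norm y)) powr (- (real DIM('a) + q)) <= riesz q x y"
      unfolding riesz_def using q_pos y by (intro powr_mono2') (auto simp: add_pos_nonneg)
    then have "tail_weight q y <= c powr (real DIM('a) + q) * riesz q x y" using c unfolding tail_weight_def
      by (subst powr_minus_scale[of c]) (auto intro!: mult_left_mono)
    also have "... <= c powr (real DIM('a) + q) * (\<Lambda> * K x y)" using K_lower[of x y] \<Lambda>_pos by (intro mult_left_mono) (auto simp: field_simps)
    finally show "tail_weight q y <= \<Lambda> * c powr (real DIM('a) + q) * K x y" by (simp add: mult_ac)
  qed
qed

lemma nn_integral_far_le:
  assumes "bounded W" and d: "0 < d" and W: "!!x. x \<in> W ==> ball x d \<subseteq> D"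
    and [measurable]: "W \<in> sets borel" "D \<in> sets borel"
  obtains C where "0 < C" "!!f. f \<in> borel_measurable borel ==>
    (\<integral>\<^sup>+z. f (snd z) * indicator (W \<times> (- D)) z \<partial>\<mu>) <= ennreal C * (\<integral>\<^sup>+y. f y * ennreal (tail_weight q y) \<partial>lborel)"
proof -
  obtain C where C: "0 < C" "!!x y. x \<in> W ==> y \<notin> D ==> K x y <= C * tail_weight q y" using K_le_tail_weight[OF assms(1-3)] by blast
  have fin: "emeasure lborel W < \<infinity>" using \<open>bounded W\<close> by (rule emeasure_bounded_finite)
  then obtain w where w: "emeasure lborel W = ennreal w" "0 <= w" by (cases "emeasure lborel W" rule: ennreal_cases) auto
  show ?thesis
  \<comment> \<open>The summand 1 keeps the constant positive when \<open>W\<close> is a null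
    set.\<close>
  proof (rule that[of "C * w + 1"])
    show "0 < C * w + 1" using C w by (simp add: add_nonneg_pos)
    fix f :: "'a => ennreal" assume [measurable]: "f \<in> borel_measurable borel"
    let ?I = "\<integral>\<^sup>+y. f y * ennreal (tail_weight q y) \<partial>lborel"
    have "(\<integral>\<^sup>+z. f (snd z) * indicator (W \<times> (- D)) z \<partial>\<mu>) =
      (\<integral>\<^sup>+x. (\<integral>\<^sup>+y. ennreal (K x y) * f y * indicator (- D) y \<partial>lborel) * indicator W x \<partial>lborel)" by (subst nn_integral_\<mu>_Times) auto
    also have "... <= (ennreal C * ?I) * emeasure lborel W"
    proof (rule nn_integral_mult_indicator_le)
      fix x assume x: "x \<in> W"
      have "(\<integral>\<^sup>+y. ennreal (K x y) * f y * indicator (- D) y \<partial>lborel) <=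
        (\<integral>\<^sup>+y. ennreal C * (f y * ennreal (tail_weight q y)) \<partial>lborel)"
      proof (rule nn_integral_mono)
        fix y
        have "ennreal (K x y) * indicator (- D) y <= ennreal C * ennreal (tail_weight q y)"
          using C x by (auto simp: indicator_def ennreal_mult[symmetric] intro!: ennreal_leI)
        then have "f y * (ennreal (K x y) * indicator (- D) y) <= f y * (ennreal C * ennreal (tail_weight q y))" by (rule mult_left_mono) simp
        then show "ennreal (K x y) * f y * indicator (- D) y <= ennreal C * (f y * ennreal (tail_weight q y))" by (simp add: mult_ac)
      qed
      also have "... = ennreal C * ?I" by (rule nn_integral_cmult) measurable
      finally show "(\<integral>\<^sup>+y. ennreal (K x y) * f y * indicator (- D) y \<partial>lborel) <= ennreal C * ?I" .
    qed simp
    also have "... = ennreal (C * w) * ?I" using C w by (simp add: ennreal_mult mult_ac)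
    also have "... <= ennreal (C * w + 1) * ?I" by (intro mult_right_mono ennreal_leI) auto
    finally show "(\<integral>\<^sup>+z. f (snd z) * indicator (W \<times> (- D)) z \<partial>\<mu>) <= ennreal (C * w + 1) * ?I" .
  qed
qed

end

section \<open>Functions of finite energy\<close>

text \<open>This is how an inequality tested with a solution is read off: neither \<open>P\<close>
  nor \<open>Q\<close> is known to be integrable, so the positive part of \<open>f\<close> is added
  to \<open>P\<close> and the negative part to \<open>Q\<close>. The integral of the negative part
  is at most that of the positive part, which is finite and cancels.\<close>

lemma nn_integral_le_of_integral_nonneg:
  fixes f P Q :: "'b => real"
  assumes f: "integrable M f" "0 <= (LINT z|M. f z)"
    and [measurable]: "P \<in> borel_measurable M" "Q \<in> borel_measurable M"
    and P: "!!z. 0 <= P z" and Q: "!!z. 0 <= Q z" and le: "AE z in M. f z + P z <= Q z"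
  shows "(\<integral>\<^sup>+z. ennreal (P z) \<partial>M) <= (\<integral>\<^sup>+z. ennreal (Q z) \<partial>M)"
proof -
  have [measurable]: "f \<in> borel_measurable M" using f by auto
  let ?a = "\<integral>\<^sup>+z. ennreal (f z) \<partial>M" and ?b = "\<integral>\<^sup>+z. ennreal (- f z) \<partial>M"
  have fin: "?a < \<infinity>" "?b < \<infinity>" using f(1) by (auto simp: real_integrable_def less_top)
  have "enn2real ?b <= enn2real ?a" using f real_lebesgue_integral_def[OF f(1)] by simp
  then have ba: "?b <= ?a" using fin by (metis ennreal_enn2real ennreal_leI infinity_ennreal_def)
  have "(\<integral>\<^sup>+z. ennreal (P z) \<partial>M) + ?a = (\<integral>\<^sup>+z. ennreal (P z) + ennreal (f z) \<partial>M)" by (rule nn_integral_add[symmetric]) auto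
  also have "... <= (\<integral>\<^sup>+z. ennreal (Q z) + ennreal (- f z) \<partial>M)" using le
  proof (intro nn_integral_mono_AE, eventually_elim)
    case (elim z) show ?case
    proof (cases "0 <= f z")
      case True then have "ennreal (P z) + ennreal (f z) = ennreal (f z + P z)" using P by (simp add: add.commute)
      then show ?thesis using elim True by (auto simp: ennreal_neg intro!: ennreal_leI)
    next
      case False then have "ennreal (Q z) + ennreal (- f z) = ennreal (Q z - f z)" using Q[of z] by (simp flip: ennreal_plus)
      moreover have "ennreal (P z) <= ennreal (Q z - f z)" using elim by (intro ennreal_leI) simp
      ultimately show ?thesis using False by (auto simp: ennreal_neg)
    qed
  qed
  also have "... = (\<integral>\<^sup>+z. ennreal (Q z) \<partial>M) + ?b" by (rule nn_integral_add) auto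
  also have "... <= (\<integral>\<^sup>+z. ennreal (Q z) \<partial>M) + ?a" by (intro add_left_mono ba)
  finally show ?thesis using fin by (metis add.commute ennreal_add_left_cancel_le infinity_ennreal_def less_irrefl)
qed

abbreviation jump :: "('a => real) => 'a \<times> 'a => real" where
  "jump v z \<equiv> v (fst z) - v (snd z)"

context nonlocal_kernel
begin

definition energy_on :: "'a set => ('a => real) => ennreal" where
  "energy_on D v = (\<integral>\<^sup>+z. ennreal (\<bar>jump v z\<bar> powr p) * indicator (D \<times> D) z \<partial>\<mu>)"

definition finite_energy :: "'a set => ('a => real) => bool" where
  "finite_energy D v \<longleftrightarrow> v \<in> borel_measurable borel \<and> (\<exists>M. \<forall>x\<in>D. \<bar>v x\<bar> <= M) \<and> energy_on D v < \<infinity>"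

definition finite_tail :: "('a => real) => bool" where
  "finite_tail v \<longleftrightarrow> v \<in> borel_measurable borel \<and>
    (\<integral>\<^sup>+y. ennreal (\<bar>v y\<bar> powr (p - 1)) * ennreal (tail_weight q y) \<partial>lborel) < \<infinity>"

definition form :: "('a => real) => ('a => real) => 'a \<times> 'a => real" where
  "form v \<eta> z = Jp p (jump v z) * (jump \<eta> z)"

lemma finite_energy_measurable [measurable_dest]: "finite_energy D v ==> v \<in> borel_measurable borel" by (simp add: finite_energy_def)

lemma finite_tail_measurable [measurable_dest]: "finite_tail v ==> v \<in> borel_measurable borel" by (simp add: finite_tail_def)

lemma form_measurable [measurable (raw)]:
  assumes [measurable]: "v \<in> borel_measurable borel" "\<eta> \<in> borel_measurable borel"
  shows "form v \<eta> \<in> borel_measurable (borel \<Otimes>\<^sub>M borel)" unfolding form_def[abs_def] by measurable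

lemma form_swap: "form v \<eta> (y, x) = form v \<eta> (x, y)" using Jp_minus_commute[of p "v y" "v x"] by (simp add: form_def algebra_simps)

lemma form_uminus: "form (\<lambda>x. - v x) \<eta> z = - form v \<eta> z" using Jp_minus[of p "jump v z"] by (simp add: form_def)

lemma form_uminus_right: "form v (\<lambda>x. - \<eta> x) z = - form v \<eta> z" by (simp add: form_def algebra_simps)

lemma form_shift: "form (\<lambda>x. c + v x) \<eta> z = form v \<eta> z" by (simp add: form_def)

section \<open>Operations preserving bounded functions of finite energy\<close>

lemma energy_on_cong_AE:
  assumes [measurable]: "v \<in> borel_measurable borel" "w \<in> borel_measurable borel" "D \<in> sets borel"
    and eq: "AE x in lborel. x \<in> D --> v x = w x"
  shows "energy_on D v = energy_on D w" unfolding energy_on_def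
proof (rule nn_integral_cong_AE)
  show "AE z in \<mu>. ennreal (\<bar>jump v z\<bar> powr p) * indicator (D \<times> D) z =
      ennreal (\<bar>jump w z\<bar> powr p) * indicator (D \<times> D) z" using AE_\<mu>_fst[OF eq] AE_\<mu>_snd[OF eq] by eventually_elim (auto simp: indicator_def)
qed

lemma energy_on_mono:
  "D' \<subseteq> D ==> energy_on D' v <= energy_on D v" unfolding energy_on_def by (intro nn_integral_mono) (auto simp: indicator_def)

lemma finite_energy_mono: "finite_energy D v ==> D' \<subseteq> D ==> finite_energy D' v"
  unfolding finite_energy_def using energy_on_mono[of D' D v] by (auto intro: order_le_less_trans)

lemma energy_on_dominate:
  assumes [measurable]: "f \<in> borel_measurable borel" "g \<in> borel_measurable borel" "D \<in> sets borel"
    and C: "0 <= C" and le: "!!x y. x \<in> D ==> y \<in> D ==> \<bar>h x - h y\<bar> <= C * (\<bar>f x - f y\<bar> + \<bar>g x - g y\<bar>)"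
  shows "energy_on D h <= ennreal ((2 * C) powr p) * (energy_on D f + energy_on D g)"
proof -
  have "energy_on D h <= (\<integral>\<^sup>+z. ennreal ((2 * C) powr p) * (ennreal (\<bar>jump f z\<bar> powr p) * indicator (D \<times> D) z
      + ennreal (\<bar>jump g z\<bar> powr p) * indicator (D \<times> D) z) \<partial>\<mu>)" unfolding energy_on_def
  proof (rule nn_integral_mono)
    fix z :: "'a \<times> 'a"
    obtain x y where z: "z = (x, y)" by (cases z)
    show "ennreal (\<bar>jump h z\<bar> powr p) * indicator (D \<times> D) z <=
      ennreal ((2 * C) powr p) * (ennreal (\<bar>jump f z\<bar> powr p) * indicator (D \<times> D) z
      + ennreal (\<bar>jump g z\<bar> powr p) * indicator (D \<times> D) z)"
    proof (cases "x \<in> D \<and> y \<in> D")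
      case True
      have "\<bar>h x - h y\<bar> powr p <= (C * (\<bar>f x - f y\<bar> + \<bar>g x - g y\<bar>)) powr p" using True le p_pos by (intro powr_mono2) auto
      also have "... = C powr p * (\<bar>f x - f y\<bar> + \<bar>g x - g y\<bar>) powr p" using C by (simp add: powr_mult)
      also have "... <= C powr p * (2 powr p * (\<bar>f x - f y\<bar> powr p + \<bar>g x - g y\<bar> powr p))" using p_pos by (intro mult_left_mono powr_add_le) auto
      also have "... = (2 * C) powr p * (\<bar>f x - f y\<bar> powr p + \<bar>g x - g y\<bar> powr p)" using C by (simp add: powr_mult)
      finally have "ennreal (\<bar>h x - h y\<bar> powr p) <= ennreal ((2 * C) powr p * (\<bar>f x - f y\<bar> powr p + \<bar>g x - g y\<bar> powr p))" by (rule ennreal_leI)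
      then show ?thesis using True z by (simp add: ennreal_mult)
    qed (auto simp: z)
  qed
  also have "... = ennreal ((2 * C) powr p) * (energy_on D f + energy_on D g)"
    unfolding energy_on_def by (subst nn_integral_cmult, measurable) (subst nn_integral_add, auto)
  finally show ?thesis .
qed

text \<open>One estimate for increments yields all the closure properties below, for sums, multiples
  and positive parts. Boundedness follows from it as well, by comparison with the value at one point
  of \<open>D\<close>.\<close>

lemma finite_energy_dominate:
  assumes f: "finite_energy D f" and g: "finite_energy D g"
    and [measurable]: "h \<in> borel_measurable borel" "D \<in> sets borel"
    and C: "0 <= C" and le: "!!x y. x \<in> D ==> y \<in> D ==> \<bar>h x - h y\<bar> <= C * (\<bar>f x - f y\<bar> + \<bar>g x - g y\<bar>)"
  shows "finite_energy D h"
proof -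
  have "energy_on D h <= ennreal ((2 * C) powr p) * (energy_on D f + energy_on D g)"
    using f g C le by (intro energy_on_dominate) (auto simp: finite_energy_def)
  also have "... < \<infinity>" using f g by (auto simp: finite_energy_def ennreal_mult_less_top)
  finally have 1: "energy_on D h < \<infinity>" .
  obtain Mf Mg where M: "!!x. x \<in> D ==> \<bar>f x\<bar> <= Mf" "!!x. x \<in> D ==> \<bar>g x\<bar> <= Mg" using f g unfolding finite_energy_def by metis
  have "\<exists>M. \<forall>x\<in>D. \<bar>h x\<bar> <= M"
  proof (cases "D = {}")
    case False
    then obtain x0 where x0: "x0 \<in> D" by auto
    have "\<bar>h x\<bar> <= \<bar>h x0\<bar> + C * (2 * Mf + 2 * Mg)" if x: "x \<in> D" for x
    proof -
      have "\<bar>f x - f x0\<bar> + \<bar>g x - g x0\<bar> <= 2 * Mf + 2 * Mg" using M(1)[OF x] M(1)[OF x0] M(2)[OF x] M(2)[OF x0] by linarith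
      then have "C * (\<bar>f x - f x0\<bar> + \<bar>g x - g x0\<bar>) <= C * (2 * Mf + 2 * Mg)" using C by (rule mult_left_mono)
      with le[OF x x0] show ?thesis by linarith
    qed
    then show ?thesis by blast
  qed simp
  then show ?thesis using 1 by (simp add: finite_energy_def)
qed

lemma finite_energy_const [simp]: "finite_energy D (\<lambda>x. c)" by (auto simp: finite_energy_def energy_on_def p_pos)

lemma finite_energy_add:
  assumes "finite_energy D f" "finite_energy D g" and [measurable]: "D \<in> sets borel"
  shows "finite_energy D (\<lambda>x. f x + g x)" by (rule finite_energy_dominate[OF assms(1,2), of _ 1]) (use assms in \<open>auto simp: finite_energy_def\<close>)

lemma finite_energy_diff:
  assumes "finite_energy D f" "finite_energy D g" and [measurable]: "D \<in> sets borel"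
  shows "finite_energy D (\<lambda>x. f x - g x)" by (rule finite_energy_dominate[OF assms(1,2), of _ 1]) (use assms in \<open>auto simp: finite_energy_def\<close>)

lemma finite_energy_cmult:
  assumes "finite_energy D f" and [measurable]: "D \<in> sets borel"
  shows "finite_energy D (\<lambda>x. c * f x)" by (rule finite_energy_dominate[OF assms(1) assms(1), of _ "\<bar>c\<bar>"])
    (use assms in \<open>auto simp: finite_energy_def abs_mult right_diff_distrib[symmetric]\<close>)

lemma finite_energy_uminus:
  assumes "finite_energy D f" and [measurable]: "D \<in> sets borel"
  shows "finite_energy D (\<lambda>x. - f x)" using finite_energy_cmult[OF assms, of "- 1"] by simp

lemma finite_energy_pos_part:
  assumes "finite_energy D f" and [measurable]: "D \<in> sets borel"
  shows "finite_energy D (\<lambda>x. max (f x) 0)"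
  by (rule finite_energy_dominate[OF assms(1) assms(1), of _ 1]) (use assms in \<open>auto simp: finite_energy_def max_def\<close>)

lemma finite_energy_Lipschitz:
  assumes [measurable]: "f \<in> borel_measurable borel" "D \<in> sets borel" and "bounded D" and L: "0 <= L"
    and le: "!!x y. x \<in> D ==> y \<in> D ==> \<bar>f x - f y\<bar> <= L * norm (x - y)"
  shows "finite_energy D f"
proof (cases "D = {}")
  case True then show ?thesis by (simp add: finite_energy_def energy_on_def)
next
  case False
  then obtain x0 where x0: "x0 \<in> D" by auto
  obtain R where R: "0 < R" "!!x. x \<in> D ==> norm x <= R" using \<open>bounded D\<close> by (auto simp: bounded_pos)
  \<comment> \<open>The distance is at most \<open>2 * R\<close>; the larger factor 3 puts
    \<open>y\<close> into the open ball around \<open>x\<close>.\<close>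
  have dist: "norm (x - y) < 3 * R" if "x \<in> D" "y \<in> D" for x y
    using norm_triangle_ineq4[of x y] R(1) R(2)[OF that(1)] R(2)[OF that(2)] by linarith
  have bd: "\<bar>f x\<bar> <= \<bar>f x0\<bar> + L * (3 * R)" if "x \<in> D" for x
  proof -
    have "L * norm (x - x0) <= L * (3 * R)" using dist[OF that x0] L by (intro mult_left_mono) auto
    then show ?thesis using le[OF that x0] by linarith
  qed
  obtain C where C: "0 < C" "!!x r. 0 < r ==>
    (\<integral>\<^sup>+y. ennreal (norm (x - y) powr p * K x y) * indicator (ball x r) y \<partial>lborel)
      <= ennreal (C * r powr (p - q))" using nn_integral_K_near by blast
  have "energy_on D f = (\<integral>\<^sup>+x. (\<integral>\<^sup>+y. ennreal (K x y) * ennreal (\<bar>f x - f y\<bar> powr p) * indicator D y \<partial>lborel) * indicator D x \<partial>lborel)"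
    unfolding energy_on_def by (subst nn_integral_\<mu>_Times) auto
  also have "... <= (ennreal (L powr p) * ennreal (C * (3 * R) powr (p - q))) * emeasure lborel D"
  proof (rule nn_integral_mult_indicator_le)
    fix x assume x: "x \<in> D"
    have "(\<integral>\<^sup>+y. ennreal (K x y) * ennreal (\<bar>f x - f y\<bar> powr p) * indicator D y \<partial>lborel) <=
      (\<integral>\<^sup>+y. ennreal (L powr p) * (ennreal (norm (x - y) powr p * K x y) * indicator (ball x (3 * R)) y) \<partial>lborel)"
    proof (rule nn_integral_mono)
      fix y
      show "ennreal (K x y) * ennreal (\<bar>f x - f y\<bar> powr p) * indicator D y <=
         ennreal (L powr p) * (ennreal (norm (x - y) powr p * K x y) * indicator (ball x (3 * R)) y)"
      proof (cases "y \<in> D")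
        case True have "\<bar>f x - f y\<bar> powr p <= (L * norm (x - y)) powr p" using le[OF x True] p_pos by (intro powr_mono2) auto
        then have "\<bar>f x - f y\<bar> powr p <= L powr p * norm (x - y) powr p" using L by (simp add: powr_mult)
        then have "K x y * \<bar>f x - f y\<bar> powr p <= K x y * (L powr p * norm (x - y) powr p)" by (rule mult_left_mono) simp
        then show ?thesis using True dist[OF x True] by (simp add: ennreal_mult[symmetric] dist_norm mult_ac ennreal_leI)
      qed simp
    qed
    also have "... = ennreal (L powr p) * (\<integral>\<^sup>+y. ennreal (norm (x - y) powr p * K x y) * indicator (ball x (3 * R)) y \<partial>lborel)"
      by (rule nn_integral_cmult) measurable
    also have "... <= ennreal (L powr p) * ennreal (C * (3 * R) powr (p - q))" using R by (intro mult_left_mono C) auto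
    finally show "(\<integral>\<^sup>+y. ennreal (K x y) * ennreal (\<bar>f x - f y\<bar> powr p) * indicator D y \<partial>lborel)
      <= ennreal (L powr p) * ennreal (C * (3 * R) powr (p - q))" .
  qed simp
  also have "... < \<infinity>" using emeasure_bounded_finite[OF \<open>bounded D\<close>] by (auto simp: ennreal_mult_less_top)
  finally show ?thesis using bd by (auto simp: finite_energy_def)
qed

section \<open>Functions with finite tail and their far interactions\<close>

lemma finite_tail_dominate:
  assumes v: "finite_tail v" and [measurable]: "w \<in> borel_measurable borel"
    and le: "AE y in lborel. \<bar>w y\<bar> <= c + \<bar>v y\<bar>"
  shows "finite_tail w"
proof -
  have [measurable]: "v \<in> borel_measurable borel" using v by (simp add: finite_tail_def)
  have p0: "0 <= p - 1" using p_gt by simp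
  let ?A = "2 powr (p - 1) * \<bar>c\<bar> powr (p - 1)" and ?B = "2 powr (p - 1)"
  have "(\<integral>\<^sup>+y. ennreal (\<bar>w y\<bar> powr (p - 1)) * ennreal (tail_weight q y) \<partial>lborel) <=
    (\<integral>\<^sup>+y. ennreal ?A * ennreal (tail_weight q y) + ennreal ?B * (ennreal (\<bar>v y\<bar> powr (p - 1)) * ennreal (tail_weight q y)) \<partial>lborel)" using le
  proof (intro nn_integral_mono_AE, eventually_elim)
    case (elim y) have "\<bar>w y\<bar> powr (p - 1) <= (\<bar>c\<bar> + \<bar>v y\<bar>) powr (p - 1)" using elim p_gt by (intro powr_mono2) auto
    also have "... <= ?B * (\<bar>c\<bar> powr (p - 1) + \<bar>v y\<bar> powr (p - 1))" by (rule powr_add_le) (use p0 in auto)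
    finally have "\<bar>w y\<bar> powr (p - 1) * tail_weight q y <= ?B * (\<bar>c\<bar> powr (p - 1) + \<bar>v y\<bar> powr (p - 1)) * tail_weight q y"
      by (rule mult_right_mono) simp
    then show ?case by (simp add: ennreal_mult[symmetric] ennreal_plus[symmetric] algebra_simps ennreal_leI del: ennreal_plus)
  qed
  also have "... = ennreal ?A * (\<integral>\<^sup>+y. ennreal (tail_weight q (y::'a)) \<partial>lborel) +
      ennreal ?B * (\<integral>\<^sup>+y. ennreal (\<bar>v y\<bar> powr (p - 1)) * ennreal (tail_weight q y) \<partial>lborel)"
    by (subst nn_integral_add, measurable) (subst nn_integral_cmult, measurable, subst nn_integral_cmult, measurable)
  also have "... < \<infinity>" using v tail_weight_finite[OF q_pos, where 'a='a] by (auto simp: finite_tail_def ennreal_mult_less_top)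
  finally show ?thesis by (simp add: finite_tail_def)
qed

lemma finite_tail_const [simp]: "finite_tail (\<lambda>x. c)"
proof -
  have "finite_tail (\<lambda>x. 0)" using p_gt by (simp add: finite_tail_def)
  then show ?thesis by (rule finite_tail_dominate[of _ _ "\<bar>c\<bar>"]) auto
qed

text \<open>Every estimate for a pair with one point in \<open>W\<close> and the other outside
  \<open>D\<close> has the shape \<open>a + b * \<bar>v y\<bar> powr (p - 1)\<close>, where
  \<open>y\<close> is the far point. The second statement is the mirror image under exchanging the
  two variables.\<close>

lemma integrable_far:
  assumes "bounded W" and d: "0 < d" and W: "!!x. x \<in> W ==> ball x d \<subseteq> D"
    and [measurable]: "W \<in> sets borel" "D \<in> sets borel"
    and v: "finite_tail v"
  shows "integrable \<mu> (\<lambda>z. indicator (W \<times> (- D)) z * (a + b * \<bar>v (snd z)\<bar> powr (p - 1)))"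
    and "integrable \<mu> (\<lambda>z. indicator ((- D) \<times> W) z * (a + b * \<bar>v (fst z)\<bar> powr (p - 1)))"
proof -
  have [measurable]: "v \<in> borel_measurable borel" using v by (simp add: finite_tail_def)
  let ?f = "\<lambda>y. a + b * \<bar>v y\<bar> powr (p - 1)"
  obtain C where C: "0 < C" "!!f. f \<in> borel_measurable borel ==>
    (\<integral>\<^sup>+z. f (snd z) * indicator (W \<times> (- D)) z \<partial>\<mu>) <= ennreal C * (\<integral>\<^sup>+y. f y * ennreal (tail_weight q y) \<partial>lborel)"
    using nn_integral_far_le[OF assms(1-5)] by blast
  have fin: "(\<integral>\<^sup>+z. ennreal (norm (indicator (W \<times> (- D)) z * ?f (snd z))) \<partial>\<mu>) < \<infinity>"
  proof -
    have "(\<integral>\<^sup>+z. ennreal (norm (indicator (W \<times> (- D)) z * ?f (snd z))) \<partial>\<mu>) =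
      (\<integral>\<^sup>+z. ennreal \<bar>?f (snd z)\<bar> * indicator (W \<times> (- D)) z \<partial>\<mu>)" by (intro nn_integral_cong) (auto simp: indicator_def)
    also have "... <= ennreal C * (\<integral>\<^sup>+y. ennreal \<bar>?f y\<bar> * ennreal (tail_weight q y) \<partial>lborel)" by (rule C(2)[of "\<lambda>y. ennreal \<bar>?f y\<bar>"]) measurable
    also have "(\<integral>\<^sup>+y. ennreal \<bar>?f y\<bar> * ennreal (tail_weight q y) \<partial>lborel) <=
      (\<integral>\<^sup>+y. ennreal \<bar>a\<bar> * ennreal (tail_weight q y) + ennreal \<bar>b\<bar> * (ennreal (\<bar>v y\<bar> powr (p - 1)) * ennreal (tail_weight q y)) \<partial>lborel)"
    proof (rule nn_integral_mono)
      fix y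
      have "\<bar>?f y\<bar> <= \<bar>a\<bar> + \<bar>b\<bar> * \<bar>v y\<bar> powr (p - 1)" using abs_triangle_ineq[of a "b * \<bar>v y\<bar> powr (p - 1)"] by (simp add: abs_mult)
      then have "\<bar>?f y\<bar> * tail_weight q y <= (\<bar>a\<bar> + \<bar>b\<bar> * \<bar>v y\<bar> powr (p - 1)) * tail_weight q y" by (rule mult_right_mono) simp
      then show "ennreal \<bar>?f y\<bar> * ennreal (tail_weight q y) <=
        ennreal \<bar>a\<bar> * ennreal (tail_weight q y) + ennreal \<bar>b\<bar> * (ennreal (\<bar>v y\<bar> powr (p - 1)) * ennreal (tail_weight q y))"
        by (simp add: ennreal_mult[symmetric] ennreal_plus[symmetric] algebra_simps ennreal_leI del: ennreal_plus)
    qed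
    also have "... = ennreal \<bar>a\<bar> * (\<integral>\<^sup>+y. ennreal (tail_weight q (y::'a)) \<partial>lborel) +
        ennreal \<bar>b\<bar> * (\<integral>\<^sup>+y. ennreal (\<bar>v y\<bar> powr (p - 1)) * ennreal (tail_weight q y) \<partial>lborel)"
      by (subst nn_integral_add, measurable) (subst nn_integral_cmult, measurable, subst nn_integral_cmult, measurable)
    also have "ennreal C * ... < \<infinity>" using v tail_weight_finite[OF q_pos, where 'a='a] by (auto simp: finite_tail_def ennreal_mult_less_top)
    finally show ?thesis by (simp add: mult_left_mono)
  qed
  then show 1: "integrable \<mu> (\<lambda>z. indicator (W \<times> (- D)) z * ?f (snd z))" by (intro integrableI_bounded) auto
  have "(\<integral>\<^sup>+z. ennreal (norm (indicator ((- D) \<times> W) z * ?f (fst z))) \<partial>\<mu>) =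
    (\<integral>\<^sup>+z. (\<lambda>z. ennreal (norm (indicator (W \<times> (- D)) z * ?f (snd z)))) (snd z, fst z) \<partial>\<mu>)" by (intro nn_integral_cong) (auto simp: indicator_def)
  also have "... = (\<integral>\<^sup>+z. ennreal (norm (indicator (W \<times> (- D)) z * ?f (snd z))) \<partial>\<mu>)" by (rule nn_integral_\<mu>_swap) measurable
  finally show "integrable \<mu> (\<lambda>z. indicator ((- D) \<times> W) z * ?f (fst z))" using fin by (intro integrableI_bounded) auto
qed

lemma integrable_energy:
  assumes "finite_energy D v" and [measurable]: "D \<in> sets borel"
  shows "integrable \<mu> (\<lambda>z. indicator (D \<times> D) z * \<bar>jump v z\<bar> powr p)"
proof (rule integrableI_bounded)
  have [measurable]: "v \<in> borel_measurable borel" using assms by (simp add: finite_energy_def)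
  show "(\<lambda>z. indicator (D \<times> D) z * \<bar>jump v z\<bar> powr p) \<in> borel_measurable \<mu>" by measurable
  have "(\<integral>\<^sup>+z. ennreal (norm (indicator (D \<times> D) z * \<bar>jump v z\<bar> powr p)) \<partial>\<mu>) = energy_on D v"
    unfolding energy_on_def by (intro nn_integral_cong) (auto simp: indicator_def)
  then show "(\<integral>\<^sup>+z. ennreal (norm (indicator (D \<times> D) z * \<bar>jump v z\<bar> powr p)) \<partial>\<mu>) < \<infinity>" using assms by (simp add: finite_energy_def)
qed

text \<open>The majorant of \<open>\<bar>form v \<eta>\<bar>\<close> on pairs joining
  \<open>W\<close> to the complement of \<open>D\<close>: \<open>M\<close> bounds the test function,
  \<open>Mv\<close> bounds \<open>v\<close> in \<open>D\<close>, and \<open>G\<close> dominates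
  \<open>v\<close> outside. As \<open>G\<close> need not be \<open>v\<close>, one majorant serves a
  whole sequence of functions.\<close>

definition form_far :: "'a set => 'a set => real => real => ('a => real) => 'a \<times> 'a => real" where
  "form_far W D M Mv G z =
    indicator (W \<times> (- D)) z * (M * 2 powr (p - 1) * Mv powr (p - 1) + M * 2 powr (p - 1) * \<bar>G (snd z)\<bar> powr (p - 1)) +
    indicator ((- D) \<times> W) z * (M * 2 powr (p - 1) * Mv powr (p - 1) + M * 2 powr (p - 1) * \<bar>G (fst z)\<bar> powr (p - 1))"

lemma integrable_form_far:
  assumes "bounded W" "0 < d" "!!x. x \<in> W ==> ball x d \<subseteq> D" "W \<in> sets borel" "D \<in> sets borel" "finite_tail G"
  shows "integrable \<mu> (form_far W D M Mv G)"
  unfolding form_far_def[abs_def] using integrable_far[OF assms] by (intro Bochner_Integration.integrable_add) auto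

text \<open>Young's inequality is used on \<open>D \<times> D\<close>. If one point lies outside
  \<open>D\<close>, then the test function vanishes there, and only
  \<open>\<bar>v x - v y\<bar> powr (p - 1) * \<bar>\<eta> x\<bar>\<close> remains; if both points
  lie outside \<open>W\<close>, the form is 0.\<close>

lemma abs_form_le:
  assumes WD: "W \<subseteq> D" and t: "0 < t"
    and \<eta>: "!!x. x \<notin> W ==> \<eta> x = 0" "!!x. x \<in> W ==> \<bar>\<eta> x\<bar> <= M"
    and v: "!!x. x \<in> D ==> \<bar>v x\<bar> <= Mv" "!!x. x \<notin> D ==> \<bar>v x\<bar> <= \<bar>G x\<bar>"
  shows "\<bar>form v \<eta> z\<bar> <= t * (indicator (D \<times> D) z * \<bar>jump v z\<bar> powr p) +
    t powr (1 - p) * (indicator (D \<times> D) z * \<bar>jump \<eta> z\<bar> powr p) + form_far W D M Mv G z"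
proof -
  have far: "\<bar>form v \<eta> (x, y)\<bar> <= M * 2 powr (p - 1) * Mv powr (p - 1) + M * 2 powr (p - 1) * \<bar>G y\<bar> powr (p - 1)"
    if x: "x \<in> W" and y: "y \<notin> D" for x y
  proof -
    have "\<eta> y = 0" using y WD \<eta> by auto
    then have "\<bar>form v \<eta> (x, y)\<bar> = \<bar>v x - v y\<bar> powr (p - 1) * \<bar>\<eta> x\<bar>" by (simp add: form_def abs_mult abs_Jp)
    also have "... <= (Mv + \<bar>G y\<bar>) powr (p - 1) * M" using v(1)[of x] v(2)[OF y] x WD \<eta>(2)[OF x] p_gt by (intro mult_mono powr_mono2) auto
    also have "... <= (2 powr (p - 1) * (Mv powr (p - 1) + \<bar>G y\<bar> powr (p - 1))) * M"
      using v(1)[of x] x WD \<eta>(2)[OF x] p_gt by (intro mult_right_mono powr_add_le) auto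
    finally show ?thesis by (simp add: algebra_simps)
  qed
  obtain x y where z: "z = (x, y)" by (cases z)
  consider "x \<in> D" "y \<in> D" | "x \<in> W" "y \<notin> D" | "x \<notin> D" "y \<in> W" | "x \<notin> W" "y \<notin> W"  using WD by blast
  then show ?thesis
  proof cases
    case 1
    then show ?thesis using Jp_mult_le_Young[OF p_gt t, of "v x - v y" "\<eta> x - \<eta> y"] by (simp add: z form_def form_far_def indicator_def)
  next
    case 2 then show ?thesis using far[OF 2] WD by (auto simp: z form_far_def indicator_def)
  next
    case 3 then show ?thesis using far[OF 3(2,1)] WD by (auto simp: z form_far_def indicator_def form_swap[of _ _ y x])
  next
    case 4 then have "form v \<eta> z = 0" using \<eta> by (simp add: z form_def)
    moreover have "form_far W D M Mv G z = 0" using 4 by (simp add: z form_far_def)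
    ultimately show ?thesis using t by (simp add: indicator_def)
  qed
qed

lemma integrable_form:
  assumes "bounded W" "0 < d" and WD: "!!x. x \<in> W ==> ball x d \<subseteq> D"
    and [measurable]: "W \<in> sets borel" "D \<in> sets borel"
    and v: "finite_energy D v" "finite_tail v" and \<eta>: "finite_energy D \<eta>" "!!x. x \<notin> W ==> \<eta> x = 0"
  shows "integrable \<mu> (form v \<eta>)"
proof -
  have WD': "W \<subseteq> D" using WD \<open>0 < d\<close> by force
  have [measurable]: "v \<in> borel_measurable borel" "\<eta> \<in> borel_measurable borel" using v \<eta> by (auto simp: finite_energy_def)
  obtain M Mv where M: "!!x. x \<in> D ==> \<bar>\<eta> x\<bar> <= M" "!!x. x \<in> D ==> \<bar>v x\<bar> <= Mv" using v \<eta> unfolding finite_energy_def by metis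
  have "integrable \<mu> (\<lambda>z. 1 * (indicator (D \<times> D) z * \<bar>jump v z\<bar> powr p) +
    1 powr (1 - p) * (indicator (D \<times> D) z * \<bar>jump \<eta> z\<bar> powr p) + form_far W D M Mv v z)"
    using integrable_energy[OF v(1)] integrable_energy[OF \<eta>(1)] integrable_form_far[OF assms(1-5) v(2)]
    by (intro Bochner_Integration.integrable_add integrable_mult_right) auto
  then show ?thesis
  proof (rule Bochner_Integration.integrable_bound)
    show "form v \<eta> \<in> borel_measurable \<mu>" by measurable
    show "AE z in \<mu>. norm (form v \<eta> z) <= norm (1 * (indicator (D \<times> D) z * \<bar>jump v z\<bar> powr p) +
      1 powr (1 - p) * (indicator (D \<times> D) z * \<bar>jump \<eta> z\<bar> powr p) + form_far W D M Mv v z)"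
    proof (rule AE_I2)
      fix z
      have "\<bar>form v \<eta> z\<bar> <= 1 * (indicator (D \<times> D) z * \<bar>jump v z\<bar> powr p) +
      1 powr (1 - p) * (indicator (D \<times> D) z * \<bar>jump \<eta> z\<bar> powr p) + form_far W D M Mv v z" by (rule abs_form_le) (use WD' M \<eta> in auto)
      then show "norm (form v \<eta> z) <= norm (1 * (indicator (D \<times> D) z * \<bar>jump v z\<bar> powr p) +
      1 powr (1 - p) * (indicator (D \<times> D) z * \<bar>jump \<eta> z\<bar> powr p) + form_far W D M Mv v z)" unfolding real_norm_def by linarith
    qed
  qed
qed

text \<open>Since \<open>\<eta>\<close> vanishes outside \<open>W\<close>, passing from
  \<open>D\<close> to the whole space adds only pairs joining \<open>W\<close> to the complement of
  \<open>D\<close>, on which the jump is bounded and the kernel has finite mass.\<close>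

lemma integrable_energy_extend:
  assumes W: "bounded W" "0 < d" "!!x. x \<in> W ==> ball x d \<subseteq> D" and Wm [measurable]: "W \<in> sets borel" "D \<in> sets borel"
    and fe: "finite_energy D \<eta>" and 0: "!!x. x \<notin> W ==> \<eta> x = 0"
  shows "integrable \<mu> (\<lambda>z. \<bar>jump \<eta> z\<bar> powr p)"
proof -
  have WD: "W \<subseteq> D" using W by force
  have [measurable]: "\<eta> \<in> borel_measurable borel" using fe by (simp add: finite_energy_def)
  obtain M where M: "!!x. x \<in> D ==> \<bar>\<eta> x\<bar> <= M" using fe by (auto simp: finite_energy_def)
  \<comment> \<open>The zero coefficients present this as an instance of
    \<open>integrable_far\<close> for the function 0.\<close>
  let ?far = "\<lambda>z. indicator (W \<times> (- D)) z * (M powr p + 0 * \<bar>0\<bar> powr (p - 1)) + indicator ((- D) \<times> W) z * (M powr p + 0 * \<bar>0\<bar> powr (p - 1))"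
  have "integrable \<mu> (\<lambda>z. indicator (D \<times> D) z * \<bar>jump \<eta> z\<bar> powr p + ?far z)"
    using integrable_far[OF W Wm finite_tail_const, of 0] by (intro Bochner_Integration.integrable_add integrable_energy[OF fe]) auto
  then show ?thesis
  proof (rule Bochner_Integration.integrable_bound)
    show "AE z in \<mu>. norm (\<bar>jump \<eta> z\<bar> powr p) <= norm (indicator (D \<times> D) z * \<bar>jump \<eta> z\<bar> powr p + ?far z)"
    proof (rule AE_I2)
      fix z :: "'a \<times> 'a" obtain x y where z: "z = (x, y)" by (cases z)
      have M': "\<bar>\<eta> u\<bar> powr p <= M powr p" if "u \<in> W" for u using M[of u] that WD p_pos by (intro powr_mono2) auto
      consider "x \<in> D" "y \<in> D" | "x \<in> W" "y \<notin> D" | "x \<notin> D" "y \<in> W" | "x \<notin> W" "y \<notin> W" using WD by blast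
      then show "norm (\<bar>jump \<eta> z\<bar> powr p) <= norm (indicator (D \<times> D) z * \<bar>jump \<eta> z\<bar> powr p + ?far z)"
      proof cases
        case 1 then show ?thesis by (simp add: z indicator_def)
      next
        case 2 then have "\<eta> y = 0" using WD by (intro 0) auto
        then show ?thesis using M'[OF 2(1)] 2 WD by (auto simp: z indicator_def)
      next
        case 3 then have "\<eta> x = 0" using WD by (intro 0) auto
        then show ?thesis using M'[OF 3(2)] 3 WD by (auto simp: z indicator_def)
      next
        case 4 then show ?thesis using 0 by (simp add: z)
      qed
    qed
  qed measurable
qed

end

section \<open>Caccioppoli inequality with a barrier\<close>

locale dirichlet_domain = nonlocal_kernel s p \<Lambda> K
  for s p \<Lambda> :: real and K :: "'a::euclidean_space => 'a => real" +
  fixes \<Omega> N :: "'a set" and d0 :: real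
  assumes open_\<Omega>: "open \<Omega>" and compact_N: "compact N" and d0_pos: "0 < d0"
    and ball_\<Omega>: "x \<in> \<Omega> ==> ball x d0 \<subseteq> N"
    and emeasure_N_minus_\<Omega>: "emeasure lborel (N - \<Omega>) \<noteq> 0"
begin

lemma \<Omega>_subset_N: "\<Omega> \<subseteq> N" using ball_\<Omega> d0_pos by force

lemma bounded_N: "bounded N" using compact_N by (rule compact_imp_bounded)

lemma bounded_\<Omega>: "bounded \<Omega>" using bounded_N \<Omega>_subset_N by (rule bounded_subset)

lemma sets_\<Omega> [measurable, simp]: "\<Omega> \<in> sets borel" using open_\<Omega> by simp

lemma sets_N [measurable, simp]: "N \<in> sets borel" using compact_N by (simp add: borel_compact)

text \<open>A larger class than smooth functions of compact support: truncations of solutions belong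
  to it, and its members may reach the boundary of \<Omega> and be discontinuous. It is the natural
  class for the minimiser.\<close>

definition test :: "('a => real) => bool" where
  "test \<eta> \<longleftrightarrow> finite_energy N \<eta> \<and> (\<forall>x. x \<notin> \<Omega> --> \<eta> x = 0)"

definition solution :: "('a => real) => bool" where
  "solution v \<longleftrightarrow> finite_energy N v \<and> finite_tail v \<and> (\<forall>\<eta>. test \<eta> --> (LINT z|\<mu>. form v \<eta> z) = 0)"

lemma solution_measurable [measurable_dest]: "solution v ==> v \<in> borel_measurable borel" by (simp add: solution_def finite_energy_def)

lemma integrable_form_test:
  assumes "finite_energy N v" "finite_tail v" "test \<eta>"
  shows "integrable \<mu> (form v \<eta>)" using assms by (intro integrable_form[OF bounded_\<Omega> d0_pos ball_\<Omega>]) (auto simp: test_def)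

lemma finite_tail_affine:
  assumes "finite_tail v" "\<bar>a\<bar> <= 1"
  shows "finite_tail (\<lambda>x. c + a * v x)"
proof (rule finite_tail_dominate[OF assms(1), of _ "\<bar>c\<bar>"])
  show "(\<lambda>x. c + a * v x) \<in> borel_measurable borel" using assms by (auto simp: finite_tail_def)
  have "\<bar>a * v y\<bar> <= \<bar>v y\<bar>" for y using mult_right_mono[OF assms(2), of "\<bar>v y\<bar>"] by (simp add: abs_mult)
  then show "AE y in lborel. \<bar>c + a * v y\<bar> <= \<bar>c\<bar> + \<bar>v y\<bar>" by (intro AE_I2 order_trans[OF abs_triangle_ineq] add_left_mono)
qed

lemma solution_shift: "solution v ==> solution (\<lambda>x. c + v x)" using finite_energy_add[of N "\<lambda>x. c" v] finite_tail_affine[of v 1 c]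
  by (auto simp: solution_def form_shift[abs_def])

lemma solution_uminus: "solution v ==> solution (\<lambda>x. - v x)" using finite_energy_uminus[of N v] finite_tail_affine[of v "- 1" 0]
  by (auto simp: solution_def form_uminus)

lemma solution_minus: "solution v ==> solution (\<lambda>x. c - v x)" using solution_shift[OF solution_uminus, of v c] by simp

text \<open>The restriction to \<Omega> makes the truncation vanish where the solution is
  prescribed; the ordering of \<open>\<psi>\<close> and \<open>v\<close> off \<Omega>, part of
  \<open>barrier\<close>, makes this harmless up to null sets.\<close>

definition barrier_gap :: "('a => real) => 'a set => ('a => real) => 'a => real" where
  "barrier_gap v W \<psi> x = indicator (W \<inter> \<Omega>) x * max (\<psi> x - v x) 0"

definition below_barrier :: "('a => real) => 'a set => ('a => real) => 'a set" where
  "below_barrier v W \<psi> = {x \<in> W \<inter> \<Omega>. v x < \<psi> x}"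

text \<open>\<open>S\<close> is the region where \<open>v\<close> is nonnegative, and
  \<open>W\<close> carries the Lipschitz function \<open>\<psi>\<close> of height \<open>k\<close>
  and lies at distance \<open>\<rho>\<close> from the outside of \<open>S\<close>; \<open>T\<close>
  bounds the effect of the negative part of \<open>v\<close> outside \<open>S\<close>. Allowing
  \<open>W\<close> to leave \<Omega>, with \<open>\<psi>\<close> below \<open>v\<close> there, makes
  one inequality serve interior and boundary points.\<close>

definition barrier :: "('a => real) => 'a set => 'a set => ('a => real) => real => real => real => real => bool" where
  "barrier v S W \<psi> k L \<rho> T \<longleftrightarrow> solution v \<and> S \<in> sets borel \<and> W \<in> sets borel \<and> S \<subseteq> N \<and>
    0 < \<rho> \<and> (\<forall>x\<in>W. ball x \<rho> \<subseteq> S) \<and> (AE x in lborel. x \<in> S --> 0 <= v x) \<and>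
    0 <= L \<and> (\<forall>x y. \<bar>\<psi> x - \<psi> y\<bar> <= L * norm (x - y)) \<and> (\<forall>x. 0 <= \<psi> x \<and> \<psi> x <= k) \<and>
    (\<forall>x. x \<notin> W --> \<psi> x = 0) \<and> (AE x in lborel. x \<in> W - \<Omega> --> \<psi> x <= v x) \<and> 0 <= T \<and>
    (\<forall>x\<in>W. (\<integral>\<^sup>+y. ennreal (K x y) * ennreal (max (- v y) 0 powr (p - 1)) * indicator (- S) y \<partial>lborel) <= ennreal T)"

text \<open>A bound for the energy per unit volume: the variation of the barrier up to distance
  \<open>\<rho>\<close>, its height beyond that distance, and the interaction with the negative
  tail.\<close>

definition barrier_bound :: "real => real => real => real => real" where
  "barrier_bound L k \<rho> T = L powr p * \<rho> powr (p - q) + k powr p * \<rho> powr (- q) + k * T"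

definition barrier_rhs :: "('a => real) => 'a set => 'a set => ('a => real) => real => 'a \<times> 'a => real" where
  "barrier_rhs v S W \<psi> k z =
    (3 powr p + 1) * \<bar>jump \<psi> z\<bar> powr p * indicator (below_barrier v W \<psi> \<times> S) z +
    k * 2 powr (p - 1) * (k powr (p - 1) + max (- v (snd z)) 0 powr (p - 1)) *
      indicator (below_barrier v W \<psi> \<times> (- S)) z"

lemma Lipschitz_borel_measurable:
  fixes \<psi> :: "'a => real"
  assumes "!!x y. \<bar>\<psi> x - \<psi> y\<bar> <= L * norm (x - y)"
  shows "\<psi> \<in> borel_measurable borel"
proof (rule borel_measurable_continuous_onI)
  have "L' \<ge> 0 ==> L <= L' ==> L'-lipschitz_on UNIV \<psi>" for L' using assms by (intro lipschitz_onI)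
      (auto simp: dist_real_def dist_norm intro!: order_trans[OF assms] mult_right_mono)
  from this[of "max L 0"] have "(max L 0)-lipschitz_on UNIV \<psi>" by simp
  then show "continuous_on UNIV \<psi>" by (rule lipschitz_on_continuous_on)
qed

lemma barrier_measurable:
  assumes "barrier v S W \<psi> k L \<rho> T"
  shows "v \<in> borel_measurable borel" "\<psi> \<in> borel_measurable borel" "S \<in> sets borel" "W \<in> sets borel"
    "below_barrier v W \<psi> \<in> sets borel" "barrier_gap v W \<psi> \<in> borel_measurable borel"
proof -
  show [measurable]: "v \<in> borel_measurable borel" "S \<in> sets borel" "W \<in> sets borel"
    using assms by (auto simp: barrier_def solution_def finite_energy_def)
  show [measurable]: "\<psi> \<in> borel_measurable borel" using assms by (intro Lipschitz_borel_measurable[of _ L]) (auto simp: barrier_def)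
  have "{x \<in> space borel. x \<in> W \<inter> \<Omega> \<and> v x < \<psi> x} \<in> sets borel" by measurable
  then show "below_barrier v W \<psi> \<in> sets borel" by (simp add: below_barrier_def)
  show "barrier_gap v W \<psi> \<in> borel_measurable borel" unfolding barrier_gap_def[abs_def] by measurable
qed

lemma barrier_subset:
  assumes "barrier v S W \<psi> k L \<rho> T"
  shows "W \<subseteq> S" "S \<subseteq> N" "bounded W" "bounded S"
proof -
  have "x \<in> ball x \<rho>" for x using assms by (simp add: barrier_def)
  then show 1: "W \<subseteq> S" using assms unfolding barrier_def by blast
  show 2: "S \<subseteq> N" using assms by (simp add: barrier_def)
  show 3: "bounded S" using bounded_N 2 by (rule bounded_subset)
  show "bounded W" using 3 1 by (rule bounded_subset)
qed

lemma barrierD: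
  assumes "barrier v S W \<psi> k L \<rho> T"
  shows "solution v" "finite_energy N v" "finite_tail v" "0 < \<rho>" "0 <= L" "0 <= T" "0 <= k"
    "\<bar>\<psi> x - \<psi> y\<bar> <= L * norm (x - y)" "0 <= \<psi> x" "\<psi> x <= k" "x \<notin> W ==> \<psi> x = 0"
    "x \<in> W ==> ball x \<rho> \<subseteq> S"
    "AE x in lborel. x \<in> S --> 0 <= v x" "AE x in lborel. x \<in> W - \<Omega> --> \<psi> x <= v x"
proof -
  show s: "solution v" using assms by (simp add: barrier_def)
  show "finite_energy N v" "finite_tail v" using s by (simp_all add: solution_def)
  have "0 <= \<psi> x \<and> \<psi> x <= k" using assms by (simp add: barrier_def)
  then show "0 <= k" "0 <= \<psi> x" "\<psi> x <= k" by linarith+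
  show "0 < \<rho>" "0 <= L" "0 <= T" "\<bar>\<psi> x - \<psi> y\<bar> <= L * norm (x - y)" "x \<notin> W ==> \<psi> x = 0"
    "x \<in> W ==> ball x \<rho> \<subseteq> S"
    "AE x in lborel. x \<in> S --> 0 <= v x" "AE x in lborel. x \<in> W - \<Omega> --> \<psi> x <= v x" using assms by (simp_all add: barrier_def)
qed

text \<open>On \<open>S\<close> the gap agrees almost everywhere with the positive part of
  \<open>\<psi> - v\<close>, which has finite energy because \<open>\<psi>\<close> is Lipschitz. The
  remaining pairs join \<open>W\<close> to the outside of \<open>S\<close>; they stay at distance at
  least \<open>\<rho>\<close>, and the gap is bounded.\<close>

lemma barrier_test:
  assumes b: "barrier v S W \<psi> k L \<rho> T"
  shows "test (barrier_gap v W \<psi>)"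
proof -
  note [measurable] = barrier_measurable[OF b]
  let ?\<eta> = "barrier_gap v W \<psi>" and ?h = "\<lambda>x. max (\<psi> x - v x) 0"
  have fv: "finite_energy S v" by (rule finite_energy_mono[OF barrierD(2)[OF b] barrier_subset(2)[OF b]])
  have f\<psi>: "finite_energy S \<psi>" using barrier_subset[OF b] barrierD(5,8)[OF b] by (intro finite_energy_Lipschitz[of _ _ L]) auto
  have fh: "finite_energy S ?h" by (intro finite_energy_pos_part finite_energy_diff fv f\<psi>) auto
  obtain Mv where Mv: "!!x. x \<in> N ==> \<bar>v x\<bar> <= Mv" using barrierD(2)[OF b] by (auto simp: finite_energy_def)
  have k: "0 <= k" by (rule barrierD(7)[OF b])
  have bd: "\<bar>?\<eta> x\<bar> <= k + \<bar>Mv\<bar>" for x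
  proof (cases "x \<in> W \<inter> \<Omega>")
    case True then have "\<bar>v x\<bar> <= Mv" using Mv \<Omega>_subset_N by auto
    moreover have "\<psi> x <= k" by (rule barrierD(10)[OF b])
    ultimately show ?thesis using True k by (auto simp: barrier_gap_def)
  qed (use k in \<open>auto simp: barrier_gap_def\<close>)
  \<comment> \<open>In \<open>S - W\<close> the barrier is 0 and \<open>v\<close> is nonnegative; in
    \<open>W - \<Omega>\<close> the barrier lies below \<open>v\<close>. Both hold almost
    everywhere, and in both places the positive part vanishes.\<close>
  have eq: "AE x in lborel. x \<in> S --> ?\<eta> x = ?h x"
  proof -
    have 0: "x \<notin> W ==> \<psi> x = 0" for x by (rule barrierD(11)[OF b])
    from barrierD(13,14)[OF b] show ?thesis
    proof eventually_elim
      case (elim x) then show ?case using 0[of x] by (cases "x \<in> W") (auto simp: barrier_gap_def indicator_def max_def)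
    qed
  qed
  have eS: "energy_on S ?\<eta> < \<infinity>" using energy_on_cong_AE[OF _ _ _ eq] fh by (auto simp: finite_energy_def)
  let ?M = "(k + \<bar>Mv\<bar>) powr p"
  have WS: "!!x. x \<in> W ==> ball x \<rho> \<subseteq> S" and \<rho>: "0 < \<rho>" using barrierD(4,12)[OF b] by auto
  have i1: "integrable \<mu> (\<lambda>z. indicator (W \<times> (- S)) z * (?M + 0 * \<bar>0\<bar> powr (p - 1)))"
    and i2: "integrable \<mu> (\<lambda>z. indicator ((- S) \<times> W) z * (?M + 0 * \<bar>0\<bar> powr (p - 1)))"
    using integrable_far[OF barrier_subset(3)[OF b] \<rho> WS barrier_measurable(4,3)[OF b] finite_tail_const] by blast+
  have n: "(\<integral>\<^sup>+z. ennreal (indicator (W \<times> (- S)) z * ?M) \<partial>\<mu>) < \<infinity>"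
    "(\<integral>\<^sup>+z. ennreal (indicator ((- S) \<times> W) z * ?M) \<partial>\<mu>) < \<infinity>"
  proof -
    have "(\<integral>\<^sup>+z. ennreal (indicator X z * ?M) \<partial>\<mu>) < \<infinity>"
      if "integrable \<mu> (\<lambda>z. indicator X z * (?M + 0 * \<bar>0\<bar> powr (p - 1)))" for X :: "('a \<times> 'a) set"
    proof -
      have "(\<integral>\<^sup>+z. ennreal (indicator X z * ?M) \<partial>\<mu>) =
        (\<integral>\<^sup>+z. ennreal (norm (indicator X z * (?M + 0 * \<bar>0\<bar> powr (p - 1)))) \<partial>\<mu>)" by (intro nn_integral_cong) simp
      also have "... < \<infinity>" using that unfolding integrable_iff_bounded by (rule conjunct2)
      finally show ?thesis .
    qed
    from this[OF i1] this[OF i2] show "(\<integral>\<^sup>+z. ennreal (indicator (W \<times> (- S)) z * ?M) \<partial>\<mu>) < \<infinity>"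
      "(\<integral>\<^sup>+z. ennreal (indicator ((- S) \<times> W) z * ?M) \<partial>\<mu>) < \<infinity>" by auto
  qed
  have "energy_on N ?\<eta> <= (\<integral>\<^sup>+z. ennreal (\<bar>jump ?\<eta> z\<bar> powr p) * indicator (S \<times> S) z +
    (ennreal (indicator (W \<times> (- S)) z * ?M) + ennreal (indicator ((- S) \<times> W) z * ?M)) \<partial>\<mu>)" unfolding energy_on_def
  proof (rule nn_integral_mono)
    fix z :: "'a \<times> 'a" obtain x y where z: "z = (x, y)" by (cases z)
    have 0: "?\<eta> u = 0" if "u \<notin> W" for u using that by (simp add: barrier_gap_def)
    have M: "\<bar>?\<eta> u\<bar> powr p <= ?M" for u using bd p_pos by (intro powr_mono2) auto
    consider "x \<in> S" "y \<in> S" | "x \<in> W" "y \<notin> S" | "x \<notin> S" "y \<in> W" | "x \<notin> W" "y \<notin> W" using barrier_subset(1)[OF b] by blast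
    then show "ennreal (\<bar>jump ?\<eta> z\<bar> powr p) * indicator (N \<times> N) z <=
      ennreal (\<bar>jump ?\<eta> z\<bar> powr p) * indicator (S \<times> S) z +
      (ennreal (indicator (W \<times> (- S)) z * ?M) + ennreal (indicator ((- S) \<times> W) z * ?M))"
    proof cases
      case 1 then show ?thesis by (auto simp: z indicator_def)
    next
      case 2 then have "?\<eta> y = 0" using 0 barrier_subset(1)[OF b] by auto
      then show ?thesis using 2 M[of x] barrier_subset(1)[OF b] by (auto simp: z indicator_def intro!: ennreal_leI)
    next
      case 3 then have "?\<eta> x = 0" using 0 barrier_subset(1)[OF b] by auto
      then show ?thesis using 3 M[of y] barrier_subset(1)[OF b] by (auto simp: z indicator_def intro!: ennreal_leI)
    next
      case 4 then show ?thesis using 0 by (simp add: z)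
    qed
  qed
  also have "... = energy_on S ?\<eta> +
    ((\<integral>\<^sup>+z. ennreal (indicator (W \<times> (- S)) z * ?M) \<partial>\<mu>) + (\<integral>\<^sup>+z. ennreal (indicator ((- S) \<times> W) z * ?M) \<partial>\<mu>))"
    unfolding energy_on_def by (subst nn_integral_add, measurable) (subst nn_integral_add, auto)
  also have "... < \<infinity>" using eS n by simp
  finally show ?thesis using bd unfolding test_def finite_energy_def by (auto simp: barrier_gap_def)
qed

text \<open>For a point \<open>x\<close> below the barrier the integral in \<open>y\<close> is
  bounded by a constant: over \<open>S\<close> by the energy of a Lipschitz function, outside
  \<open>S\<close> by the kernel mass beyond distance \<open>\<rho>\<close> and by \<open>T\<close>.
  The integral in \<open>x\<close> then contributes the measure of the set below the
  barrier.\<close>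

lemma nn_integral_barrier_rhs:
  obtains C where "0 < C" "!!v S W \<psi> k L \<rho> T. barrier v S W \<psi> k L \<rho> T ==>
    (\<integral>\<^sup>+z. ennreal (barrier_rhs v S W \<psi> k z) \<partial>\<mu>) <= ennreal (C * barrier_bound L k \<rho> T) * emeasure lborel (below_barrier v W \<psi>)"
proof -
  obtain CE where CE: "0 < CE" "!!\<psi> L k \<rho> x. \<psi> \<in> borel_measurable borel ==> 0 <= L ==> 0 <= k ==> 0 < \<rho> ==>
    (!!y. \<bar>\<psi> x - \<psi> y\<bar> <= L * norm (x - y)) ==> (!!y. \<bar>\<psi> x - \<psi> y\<bar> <= k) ==>
    (\<integral>\<^sup>+y. ennreal (K x y) * ennreal (\<bar>\<psi> x - \<psi> y\<bar> powr p) \<partial>lborel)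
      <= ennreal (CE * (L powr p * \<rho> powr (p - q) + k powr p * \<rho> powr (- q)))" using nn_integral_Lipschitz_energy by blast
  obtain CF where CF: "0 < CF" "!!x r. 0 < r ==>
    (\<integral>\<^sup>+y. ennreal (K x y) * indicator (- ball x r) y \<partial>lborel) <= ennreal (CF * r powr (- q))" using nn_integral_K_far by blast
  define c1 c2 where "c1 = 3 powr p + 1" and "c2 = 2 powr (p - 1)"
  have c: "0 < c1" "0 < c2" by (auto simp: c1_def c2_def add_pos_pos)
  define C where "C = c1 * CE + c2 * CF + c2"
  have C: "0 < C" using c CE CF by (simp add: C_def add_pos_pos)
  show ?thesis
  proof (rule that[OF C])
    fix v S W \<psi> k L \<rho> T assume b: "barrier v S W \<psi> k L \<rho> T"
    note [measurable] = barrier_measurable[OF b]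
    define A where "A = below_barrier v W \<psi>"
    have [measurable]: "A \<in> sets borel" by (simp add: A_def barrier_measurable[OF b])
    have AW: "A \<subseteq> W" by (auto simp: A_def below_barrier_def)
    note k = barrierD(7)[OF b] and \<rho> = barrierD(4)[OF b] and T = barrierD(6)[OF b] and L = barrierD(5)[OF b]
    let ?m = "\<lambda>y. max (- v y) 0 powr (p - 1)"
    let ?E = "CE * (L powr p * \<rho> powr (p - q) + k powr p * \<rho> powr (- q))"
      and ?F = "k powr (p - 1) * (CF * \<rho> powr (- q)) + T"
      and ?P = "\<lambda>z. ennreal (c1 * \<bar>jump \<psi> z\<bar> powr p) * indicator (A \<times> S) z"
      and ?Q = "\<lambda>z. ennreal (k * c2 * (k powr (p - 1) + ?m (snd z))) * indicator (A \<times> (- S)) z"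
      and ?PI = "\<lambda>x. \<integral>\<^sup>+y. ennreal (K x y) * ennreal (c1 * \<bar>\<psi> x - \<psi> y\<bar> powr p) * indicator S y \<partial>lborel"
      and ?QI = "\<lambda>x. \<integral>\<^sup>+y. ennreal (K x y) * ennreal (k * c2 * (k powr (p - 1) + ?m y)) * indicator (- S) y \<partial>lborel"
    have 1: "(\<integral>\<^sup>+z. ?P z \<partial>\<mu>) <=
      ennreal (c1 * ?E) * emeasure lborel A"
    proof -
      have "(\<integral>\<^sup>+z. ?P z \<partial>\<mu>) =
        (\<integral>\<^sup>+x. ?PI x * indicator A x \<partial>lborel)" by (subst nn_integral_\<mu>_Times) auto
      also have "... <= ennreal (c1 * ?E) * emeasure lborel A"
      proof (rule nn_integral_mult_indicator_le)
        fix x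
        have "?PI x <=
          (\<integral>\<^sup>+y. ennreal c1 * (ennreal (K x y) * ennreal (\<bar>\<psi> x - \<psi> y\<bar> powr p)) \<partial>lborel)"
          using c by (intro nn_integral_mono) (auto simp: indicator_def ennreal_mult mult_ac)
        also have "... = ennreal c1 * (\<integral>\<^sup>+y. ennreal (K x y) * ennreal (\<bar>\<psi> x - \<psi> y\<bar> powr p) \<partial>lborel)" by (rule nn_integral_cmult) measurable
        also have "... <= ennreal c1 * ennreal ?E"
        proof (intro mult_left_mono CE(2) L k \<rho>)
          fix y
          show "\<bar>\<psi> x - \<psi> y\<bar> <= L * norm (x - y)" by (rule barrierD(8)[OF b])
          show "\<bar>\<psi> x - \<psi> y\<bar> <= k" using barrierD(9,10)[OF b, of x] barrierD(9,10)[OF b, of y] by linarith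
        qed auto
        also have "... = ennreal (c1 * ?E)" using c CE by (intro ennreal_mult[symmetric]) auto
        finally show "?PI x
          <= ennreal (c1 * ?E)" .
      qed simp
      finally show ?thesis .
    qed
    have 2: "(\<integral>\<^sup>+z. ?Q z \<partial>\<mu>) <=
      ennreal (k * c2 * ?F) * emeasure lborel A"
    proof -
      have "(\<integral>\<^sup>+z. ?Q z \<partial>\<mu>) =
        (\<integral>\<^sup>+x. ?QI x * indicator A x \<partial>lborel)" by (subst nn_integral_\<mu>_Times) auto
      also have "... <= ennreal (k * c2 * ?F) * emeasure lborel A"
      proof (rule nn_integral_mult_indicator_le)
        fix x assume "x \<in> A"
        then have x: "x \<in> W" using AW by auto
        then have far: "- S \<subseteq> - ball x \<rho>" using barrierD(12)[OF b x] by blast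
        have "?QI x <=
          (\<integral>\<^sup>+y. ennreal (k * c2 * k powr (p - 1)) * (ennreal (K x y) * indicator (- ball x \<rho>) y) +
            ennreal (k * c2) * (ennreal (K x y) * ennreal (?m y) * indicator (- S) y) \<partial>lborel)"
        proof (rule nn_integral_mono)
          fix y
          show "ennreal (K x y) * ennreal (k * c2 * (k powr (p - 1) + ?m y)) * indicator (- S) y <=
            ennreal (k * c2 * k powr (p - 1)) * (ennreal (K x y) * indicator (- ball x \<rho>) y) +
            ennreal (k * c2) * (ennreal (K x y) * ennreal (?m y) * indicator (- S) y)" using far k c by (cases "y \<in> S")
              (auto simp: ennreal_mult[symmetric] ennreal_plus[symmetric] algebra_simps subset_iff simp del: ennreal_plus mem_ball)
        qed
        also have "... = ennreal (k * c2 * k powr (p - 1)) * (\<integral>\<^sup>+y. ennreal (K x y) * indicator (- ball x \<rho>) y \<partial>lborel) +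
            ennreal (k * c2) * (\<integral>\<^sup>+y. ennreal (K x y) * ennreal (?m y) * indicator (- S) y \<partial>lborel)"
          by (subst nn_integral_add, measurable) (subst nn_integral_cmult, measurable, subst nn_integral_cmult, measurable)
        also have "... <= ennreal (k * c2 * k powr (p - 1)) * ennreal (CF * \<rho> powr (- q)) + ennreal (k * c2) * ennreal T"
          using b x \<rho> by (intro add_mono mult_left_mono CF(2)) (simp_all add: barrier_def)
        also have "... = ennreal (k * c2 * k powr (p - 1) * (CF * \<rho> powr (- q)) + k * c2 * T)"
          using k c CF T by (simp add: ennreal_mult[symmetric] ennreal_plus[symmetric] del: ennreal_plus)
        also have "... = ennreal (k * c2 * ?F)" by (simp add: algebra_simps)
        finally show "?QI x
          <= ennreal (k * c2 * ?F)" .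
      qed simp
      finally show ?thesis .
    qed
    have "(\<integral>\<^sup>+z. ennreal (barrier_rhs v S W \<psi> k z) \<partial>\<mu>) =
      (\<integral>\<^sup>+z. ?P z +
         ?Q z \<partial>\<mu>)" using k c by (intro nn_integral_cong) (auto simp: barrier_rhs_def A_def c1_def c2_def indicator_def)
    also have "... = (\<integral>\<^sup>+z. ?P z \<partial>\<mu>) +
         (\<integral>\<^sup>+z. ?Q z \<partial>\<mu>)" by (rule nn_integral_add) measurable
    also have "... <= ennreal (c1 * ?E) * emeasure lborel A +
         ennreal (k * c2 * ?F) * emeasure lborel A" by (intro add_mono 1 2)
    also have "... = ennreal (c1 * ?E +
         k * c2 * ?F) * emeasure lborel A" using c CE CF k T by (simp add: ennreal_plus distrib_right)
    also have "... <= ennreal (C * barrier_bound L k \<rho> T) * emeasure lborel A"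
    proof (intro mult_right_mono ennreal_leI)
      have kk: "k * k powr (p - 1) = k powr p" using k by (simp add: powr_mult_base)
      define X Y Z where "X = L powr p * \<rho> powr (p - q)" and "Y = k powr p * \<rho> powr (- q)" and "Z = k * T"
      have XYZ: "0 <= X" "0 <= Y" "0 <= Z" using k T by (auto simp: X_def Y_def Z_def)
      have "k * c2 * ?F = c2 * CF * ((k * k powr (p - 1)) * \<rho> powr (- q)) + c2 * Z" by (simp add: Z_def algebra_simps)
      then have "c1 * ?E + k * c2 * ?F
        = c1 * CE * (X + Y) + c2 * CF * Y + c2 * Z" unfolding kk by (simp add: X_def Y_def)
      also have "... <= c1 * CE * (X + Y + Z) + c2 * CF * (X + Y + Z) + c2 * (X + Y + Z)"
      proof -
        have "c1 * CE * (X + Y) <= c1 * CE * (X + Y + Z)" using XYZ c CE(1) by (intro mult_left_mono) auto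
        moreover have "c2 * CF * Y <= c2 * CF * (X + Y + Z)" using XYZ c CF(1) by (intro mult_left_mono) auto
        moreover have "c2 * Z <= c2 * (X + Y + Z)" using XYZ c by (intro mult_left_mono) auto
        ultimately show ?thesis by linarith
      qed
      also have "... = C * barrier_bound L k \<rho> T" by (simp add: C_def barrier_bound_def X_def Y_def Z_def algebra_simps)
      finally show "c1 * ?E + k * c2 * ?F
        <= C * barrier_bound L k \<rho> T" .
    qed simp
    finally show "(\<integral>\<^sup>+z. ennreal (barrier_rhs v S W \<psi> k z) \<partial>\<mu>) <=
      ennreal (C * barrier_bound L k \<rho> T) * emeasure lborel (below_barrier v W \<psi>)" by (simp add: A_def)
  qed
qed

text \<open>Both estimates below come from the test function \<open>barrier_gap v W \<psi>\<close>; on a pair with \<open>x\<close> below the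
  barrier, \<open>v x - v y <= (\<psi> x - \<psi> y) - (\<eta> x - \<eta> y)\<close>, with equality if also \<open>y\<close> is below it.\<close>

lemma form_barrier_le:
  assumes b: "barrier v S W \<psi> k L \<rho> T"
    and A: "x \<in> below_barrier v W \<psi>"
    and y: "y \<in> S ==> 0 <= v y" "y \<in> W - \<Omega> ==> \<psi> y <= v y" and x: "0 <= v x"
  shows "form v (barrier_gap v W \<psi>) (x, y) +
      2 powr (- p) * \<bar>barrier_gap v W \<psi> x - barrier_gap v W \<psi> y\<bar> powr p * indicator (S \<times> S) (x, y)
    <= barrier_rhs v S W \<psi> k (x, y)"
    and "0 <= h ==> y \<in> S ==> h <= v y ==> 2 * k <= h ==>
      form v (barrier_gap v W \<psi>) (x, y) + (h / 2) powr (p - 1) * barrier_gap v W \<psi> x <= 0"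
proof -
  let ?\<eta> = "barrier_gap v W \<psi>"
  have xW: "x \<in> W" "x \<in> \<Omega>" "v x < \<psi> x" using A by (auto simp: below_barrier_def)
  have xS: "x \<in> S" using xW barrier_subset(1)[OF b] by auto
  note \<psi> = barrierD(9-11)[OF b]
  have \<eta>x: "?\<eta> x = \<psi> x - v x" using xW by (simp add: barrier_gap_def)
  show "form v ?\<eta> (x, y) + 2 powr (- p) * \<bar>?\<eta> x - ?\<eta> y\<bar> powr p * indicator (S \<times> S) (x, y)
    <= barrier_rhs v S W \<psi> k (x, y)"
  proof (cases "y \<in> S")
    case True have "form v ?\<eta> (x, y) <= Jp p ((\<psi> x - \<psi> y) - (?\<eta> x - ?\<eta> y)) * (?\<eta> x - ?\<eta> y)"
    proof (cases "y \<in> below_barrier v W \<psi>")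
      case True then have "?\<eta> y = \<psi> y - v y" by (auto simp: below_barrier_def barrier_gap_def)
      then show ?thesis by (simp add: form_def \<eta>x)
    next
      case False then have \<eta>y: "?\<eta> y = 0" by (auto simp: below_barrier_def barrier_gap_def indicator_def max_def)
      have "\<psi> y <= v y" using False y \<open>y \<in> S\<close> \<psi>(3)[of y] by (cases "y \<in> W"; cases "y \<in> \<Omega>") (auto simp: below_barrier_def)
      then have "Jp p (v x - v y) <= Jp p ((\<psi> x - \<psi> y) - (?\<eta> x - ?\<eta> y))" using \<eta>x \<eta>y by (intro Jp_le p_gt) auto
      then show ?thesis unfolding form_def fst_conv snd_conv using \<eta>x \<eta>y xW by (intro mult_right_mono) auto
    qed
    also have "... <= (3 powr p + 1) * \<bar>\<psi> x - \<psi> y\<bar> powr p - 2 powr (- p) * \<bar>?\<eta> x - ?\<eta> y\<bar> powr p" by (rule Jp_barrier_le[OF p_gt])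
    finally show ?thesis using True xS A by (simp add: barrier_rhs_def)
  next
    case False then have \<eta>y: "?\<eta> y = 0" using barrier_subset(1)[OF b] by (auto simp: barrier_gap_def indicator_def)
    have "form v ?\<eta> (x, y) = Jp p (v x - v y) * ?\<eta> x" by (simp add: form_def \<eta>y)
    \<comment> \<open>Outside \<open>S\<close> only the negative part of \<open>v y\<close> is under
      control, while \<open>v x < \<psi> x <= k\<close>; so \<open>v x - v y\<close> is at most
      \<open>k\<close> plus that negative part.\<close>
    also have "... <= Jp p (k + max (- v y) 0) * ?\<eta> x" using xW \<eta>x \<psi>(2)[of x] by (intro mult_right_mono Jp_le p_gt) auto
    also have "... <= Jp p (k + max (- v y) 0) * k" using \<eta>x x \<psi>(1,2)[of x] by (intro mult_left_mono Jp_nonneg) auto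
    also have "... = (k + max (- v y) 0) powr (p - 1) * k" using \<psi>(1,2)[of x] by (subst Jp_nonneg_eq) auto
    also have "... <= (2 powr (p - 1) * (k powr (p - 1) + max (- v y) 0 powr (p - 1))) * k"
      using \<psi>(1,2)[of x] p_gt by (intro mult_right_mono powr_add_le) auto
    finally show ?thesis using False A by (simp add: barrier_rhs_def mult_ac)
  qed
  show "form v ?\<eta> (x, y) + (h / 2) powr (p - 1) * ?\<eta> x <= 0" if h: "0 <= h" "y \<in> S" "h <= v y" "2 * k <= h"
  proof -
    have "\<psi> y <= v y" using \<psi>(2)[of y] h \<psi>(1)[of y] by linarith
    then have \<eta>y: "?\<eta> y = 0" by (simp add: barrier_gap_def max_def)
    \<comment> \<open>Here \<open>v x < k <= h / 2\<close> and \<open>v y >= h\<close>, so the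
      difference is at most \<open>- (h / 2)\<close>.\<close>
    have "Jp p (v x - v y) <= Jp p (- (h / 2))" using h xW \<psi>(2)[of x] by (intro Jp_le p_gt) auto
    also have "... = - ((h / 2) powr (p - 1))" using h Jp_nonpos_eq[of "- (h / 2)" p] by simp
    finally have "Jp p (v x - v y) * ?\<eta> x <= - ((h / 2) powr (p - 1)) * ?\<eta> x" using \<eta>x xW by (intro mult_right_mono) auto
    then show ?thesis by (simp add: form_def \<eta>y)
  qed
qed

lemma barrier_gap_eq_0: "x \<notin> below_barrier v W \<psi> ==> barrier_gap v W \<psi> x = 0"
  by (auto simp: below_barrier_def barrier_gap_def indicator_def max_def)

lemma barrier_rhs_nonneg: "barrier v S W \<psi> k L \<rho> T ==> 0 <= barrier_rhs v S W \<psi> k z"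
  using barrierD(7)[of v S W \<psi> k L \<rho> T] by (simp add: barrier_rhs_def)

lemma barrier_rhs_measurable:
  assumes b: "barrier v S W \<psi> k L \<rho> T"
  shows "barrier_rhs v S W \<psi> k \<in> borel_measurable (borel \<Otimes>\<^sub>M borel)"
proof -
  note [measurable] = barrier_measurable[OF b]
  show ?thesis unfolding barrier_rhs_def[abs_def] by measurable
qed

text \<open>Both bounds keep a nonnegative quantity \<open>P\<close> on the left of the tested
  equation. The first keeps the energy of the gap. The second keeps the attraction exerted by a set
  \<open>E\<close> on which \<open>v\<close> is large, a term of good sign that is usually
  discarded; here it does the work of a logarithmic estimate.\<close>

lemma Caccioppoli:
  obtains C where "0 < C"
    "!!v S W \<psi> k L \<rho> T. barrier v S W \<psi> k L \<rho> T ==>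
      energy_on S (barrier_gap v W \<psi>) <= ennreal (C * barrier_bound L k \<rho> T) * emeasure lborel (below_barrier v W \<psi>)"
    "!!v S W \<psi> k L \<rho> T E h. barrier v S W \<psi> k L \<rho> T ==> E \<in> sets borel ==> E \<subseteq> S ==> 0 <= h ==> 2 * k <= h ==>
      (!!x. x \<in> E ==> h <= v x) ==>
      (\<integral>\<^sup>+z. ennreal ((h / 2) powr (p - 1) * barrier_gap v W \<psi> (fst z)) * indicator (below_barrier v W \<psi> \<times> E) z \<partial>\<mu>)
        <= ennreal (C * barrier_bound L k \<rho> T) * emeasure lborel (below_barrier v W \<psi>)"
proof -
  obtain C0 where C0: "0 < C0" "!!v S W \<psi> k L \<rho> T. barrier v S W \<psi> k L \<rho> T ==>
    (\<integral>\<^sup>+z. ennreal (barrier_rhs v S W \<psi> k z) \<partial>\<mu>) <= ennreal (C0 * barrier_bound L k \<rho> T) * emeasure lborel (below_barrier v W \<psi>)"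
    using nn_integral_barrier_rhs by blast
  \<comment> \<open>This undoes the factor \<open>2 powr (- p)\<close> in front of the energy of the
    gap; as it is at least 1, the second bound can share the resulting constant.\<close>
  define c where "c = (2::real) powr p"
  have c: "1 <= c" using p_pos by (simp add: c_def ge_one_powr_ge_zero)
  have key: "(\<integral>\<^sup>+z. ennreal (P z) \<partial>\<mu>) <= ennreal (2 * C0 * barrier_bound L k \<rho> T) * emeasure lborel (below_barrier v W \<psi>)"
    if b: "barrier v S W \<psi> k L \<rho> T" and [measurable]: "P \<in> borel_measurable (borel \<Otimes>\<^sub>M borel)" and P: "!!z. 0 <= P z"
      \<comment> \<open>The right-hand side is symmetrised because either of the two points may be
        the one below the barrier; the symmetry of the kernel makes both halves have the same
        integral.\<close>
      and le: "AE z in \<mu>. form v (barrier_gap v W \<psi>) z + P z <= barrier_rhs v S W \<psi> k z + barrier_rhs v S W \<psi> k (snd z, fst z)"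
    for v S W \<psi> k L \<rho> T P
  proof -
    note [measurable] = barrier_rhs_measurable[OF b]
    let ?Q = "barrier_rhs v S W \<psi> k"
    note sol = barrierD(2,3)[OF b]
    have "0 <= (LINT z|\<mu>. form v (barrier_gap v W \<psi>) z)" using barrierD(1)[OF b] barrier_test[OF b] by (simp add: solution_def)
    then have "(\<integral>\<^sup>+z. ennreal (P z) \<partial>\<mu>) <= (\<integral>\<^sup>+z. ennreal (?Q z + ?Q (snd z, fst z)) \<partial>\<mu>)" using P barrier_rhs_nonneg[OF b] le
      by (intro nn_integral_le_of_integral_nonneg[OF integrable_form_test[OF sol barrier_test[OF b]]]) auto
    also have "... = (\<integral>\<^sup>+z. ennreal (?Q z) \<partial>\<mu>) + (\<integral>\<^sup>+z. ennreal (?Q (snd z, fst z)) \<partial>\<mu>)"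
      using barrier_rhs_nonneg[OF b] by (subst nn_integral_add[symmetric]) (auto simp: ennreal_plus)
    also have "(\<integral>\<^sup>+z. ennreal (?Q (snd z, fst z)) \<partial>\<mu>) = (\<integral>\<^sup>+z. ennreal (?Q z) \<partial>\<mu>)" using nn_integral_\<mu>_swap[of "\<lambda>z. ennreal (?Q z)"] by simp
    also have "(\<integral>\<^sup>+z. ennreal (?Q z) \<partial>\<mu>) + (\<integral>\<^sup>+z. ennreal (?Q z) \<partial>\<mu>) = 2 * (\<integral>\<^sup>+z. ennreal (?Q z) \<partial>\<mu>)" by (simp add: mult_2)
    also have "... <= 2 * (ennreal (C0 * barrier_bound L k \<rho> T) * emeasure lborel (below_barrier v W \<psi>))" by (intro mult_left_mono C0(2) b) auto
    also have "... = ennreal (2 * C0 * barrier_bound L k \<rho> T) * emeasure lborel (below_barrier v W \<psi>)"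
      using ennreal_mult'[of 2 "C0 * barrier_bound L k \<rho> T"] by (simp add: mult.assoc)
    finally show ?thesis .
  qed
  have ae: "AE z in \<mu>. (fst z \<in> S --> 0 <= v (fst z)) \<and> (fst z \<in> W - \<Omega> --> \<psi> (fst z) <= v (fst z)) \<and>
      (snd z \<in> S --> 0 <= v (snd z)) \<and> (snd z \<in> W - \<Omega> --> \<psi> (snd z) <= v (snd z))"
    if b: "barrier v S W \<psi> k L \<rho> T" for v S W \<psi> k L \<rho> T
  proof -
    note 1 = barrierD(13)[OF b] and 2 = barrierD(14)[OF b]
    show ?thesis using AE_\<mu>_fst[OF 1] AE_\<mu>_fst[OF 2] AE_\<mu>_snd[OF 1] AE_\<mu>_snd[OF 2] by eventually_elim blast
  qed
  show ?thesis
  proof (rule that[of "c * (2 * C0)"])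
    show "0 < c * (2 * C0)" using c C0 by simp
  next
    fix v S W \<psi> k L \<rho> T assume b: "barrier v S W \<psi> k L \<rho> T"
    note [measurable] = barrier_measurable[OF b]
    let ?\<eta> = "barrier_gap v W \<psi>" and ?A = "below_barrier v W \<psi>" and ?Q = "barrier_rhs v S W \<psi> k"
    let ?P = "\<lambda>z. 2 powr (- p) * \<bar>jump ?\<eta> z\<bar> powr p * indicator (S \<times> S) z"
    have P_le: "(\<integral>\<^sup>+z. ennreal (?P z) \<partial>\<mu>) <= ennreal (2 * C0 * barrier_bound L k \<rho> T) * emeasure lborel ?A"
    proof (rule key[OF b])
      show "AE z in \<mu>. form v ?\<eta> z + ?P z <= ?Q z + ?Q (snd z, fst z)" using ae[OF b]
      proof eventually_elim
        case (elim z)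
        obtain x y where z: "z = (x, y)" by (cases z)
        have AS: "?A \<subseteq> S" using barrier_subset(1)[OF b] by (auto simp: below_barrier_def)
        consider "x \<in> ?A" | "y \<in> ?A" | "x \<notin> ?A" "y \<notin> ?A" by blast
        then show ?case
        proof cases
          case 1
          have "form v ?\<eta> (x, y) + ?P (x, y) <= ?Q (x, y)" using form_barrier_le(1)[OF b 1, of y] elim AS 1 by (auto simp: z)
          then show ?thesis using barrier_rhs_nonneg[OF b, of "(y, x)"] by (simp add: z)
        next
          case 2
          have "form v ?\<eta> (y, x) + ?P (y, x) <= ?Q (y, x)" using form_barrier_le(1)[OF b 2, of x] elim AS 2 by (auto simp: z)
          moreover have "?P (y, x) = ?P (x, y)" by (auto simp: indicator_def abs_minus_commute)
          ultimately show ?thesis using barrier_rhs_nonneg[OF b, of "(x, y)"] unfolding z fst_conv snd_conv form_swap[of v _ y x] by linarith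
        next
          case 3 then show ?thesis using barrier_rhs_nonneg[OF b] by (simp add: z form_def barrier_gap_eq_0)
        qed
      qed
    qed auto
    have "energy_on S ?\<eta> = (\<integral>\<^sup>+z. ennreal c * ennreal (?P z) \<partial>\<mu>)" unfolding energy_on_def c_def
      by (intro nn_integral_cong) (auto simp: indicator_def ennreal_mult[symmetric] powr_minus)
    also have "... = ennreal c * (\<integral>\<^sup>+z. ennreal (?P z) \<partial>\<mu>)" by (rule nn_integral_cmult) measurable
    also have "... <= ennreal c * (ennreal (2 * C0 * barrier_bound L k \<rho> T) * emeasure lborel ?A)" by (intro mult_left_mono P_le) simp
    also have "... = ennreal (c * (2 * C0) * barrier_bound L k \<rho> T) * emeasure lborel ?A" using c by (simp add: ennreal_mult' mult.assoc)
    finally show "energy_on S ?\<eta> <= ennreal (c * (2 * C0) * barrier_bound L k \<rho> T) * emeasure lborel ?A" .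
  next
    fix v S W \<psi> k L \<rho> T E h
    assume b: "barrier v S W \<psi> k L \<rho> T" and [measurable]: "E \<in> sets borel" and E: "E \<subseteq> S" and h: "0 <= h" "2 * k <= h"
      and vE: "!!x. x \<in> E ==> h <= v x"
    note [measurable] = barrier_measurable[OF b]
    let ?\<eta> = "barrier_gap v W \<psi>" and ?A = "below_barrier v W \<psi>" and ?Q = "barrier_rhs v S W \<psi> k"
    let ?P = "\<lambda>z. (h / 2) powr (p - 1) * ?\<eta> (fst z) * indicator (?A \<times> E) z"
    have \<eta>0: "0 <= ?\<eta> x" for x by (simp add: barrier_gap_def)
    have B0: "0 <= barrier_bound L k \<rho> T" using barrierD(5-7)[OF b] by (simp add: barrier_bound_def)
    have "(\<integral>\<^sup>+z. ennreal ((h / 2) powr (p - 1) * ?\<eta> (fst z)) * indicator (?A \<times> E) z \<partial>\<mu>) = (\<integral>\<^sup>+z. ennreal (?P z) \<partial>\<mu>)"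
      by (intro nn_integral_cong) (auto simp: indicator_def)
    also have "... <= ennreal (2 * C0 * barrier_bound L k \<rho> T) * emeasure lborel ?A"
    proof (rule key[OF b])
      show "AE z in \<mu>. form v ?\<eta> z + ?P z <= ?Q z + ?Q (snd z, fst z)" using ae[OF b]
      proof eventually_elim
        case (elim z)
        obtain x y where z: "z = (x, y)" by (cases z)
        have AS: "?A \<subseteq> S" using barrier_subset(1)[OF b] by (auto simp: below_barrier_def)
        have Q0: "0 <= ?Q u" for u by (rule barrier_rhs_nonneg[OF b])
        consider "x \<in> ?A" "y \<in> E" | "x \<in> ?A" "y \<notin> E" | "x \<notin> ?A" "y \<in> ?A" | "x \<notin> ?A" "y \<notin> ?A" by blast
        then show ?case
        proof cases
          case 1 have "form v ?\<eta> (x, y) + (h / 2) powr (p - 1) * ?\<eta> x <= 0"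
            using form_barrier_le(2)[OF b 1(1), of y h] elim AS 1 E h vE by (auto simp: z)
          then show ?thesis using Q0[of "(x, y)"] Q0[of "(y, x)"] 1 by (simp add: z)
        next
          case 2
          have "form v ?\<eta> (x, y) <= form v ?\<eta> (x, y) + 2 powr (- p) * \<bar>?\<eta> x - ?\<eta> y\<bar> powr p * indicator (S \<times> S) (x, y)" by simp
          also have "... <= ?Q (x, y)" using form_barrier_le(1)[OF b 2(1), of y] elim AS 2 by (auto simp: z)
          finally show ?thesis using Q0[of "(y, x)"] 2 by (simp add: z)
        next
          case 3
          have "form v ?\<eta> (y, x) <= form v ?\<eta> (y, x) + 2 powr (- p) * \<bar>?\<eta> y - ?\<eta> x\<bar> powr p * indicator (S \<times> S) (y, x)" by simp
          also have "... <= ?Q (y, x)" using form_barrier_le(1)[OF b 3(2), of x] elim AS 3 by (auto simp: z)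
          finally show ?thesis using Q0[of "(x, y)"] 3 by (simp add: z form_swap)
        next
          case 4 then show ?thesis using Q0 by (simp add: z form_def barrier_gap_eq_0)
        qed
      qed
    qed (use \<eta>0 in auto)
    also have "... <= ennreal (c * (2 * C0) * barrier_bound L k \<rho> T) * emeasure lborel ?A"
    proof (rule mult_right_mono, rule ennreal_leI)
      have "1 * (2 * C0 * barrier_bound L k \<rho> T) <= c * (2 * C0 * barrier_bound L k \<rho> T)" using c C0 B0 by (intro mult_right_mono) auto
      then show "2 * C0 * barrier_bound L k \<rho> T <= c * (2 * C0) * barrier_bound L k \<rho> T" by (simp add: mult.assoc)
    qed simp
    finally show "(\<integral>\<^sup>+z. ennreal ((h / 2) powr (p - 1) * ?\<eta> (fst z)) * indicator (?A \<times> E) z \<partial>\<mu>)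
        <= ennreal (c * (2 * C0) * barrier_bound L k \<rho> T) * emeasure lborel ?A" .
  qed
qed

end

section \<open>The growth lemma\<close>

definition cutoff :: "'a::euclidean_space => real => real => 'a => real" where
  "cutoff x0 a b x = max 0 (min 1 ((b - dist x0 x) / (b - a)))"

lemma cutoff_range: "0 <= cutoff x0 a b x" "cutoff x0 a b x <= 1" by (auto simp: cutoff_def)

lemma cutoff_eq_1: "a < b ==> dist x0 x <= a ==> cutoff x0 a b x = 1" by (simp add: cutoff_def)

lemma cutoff_eq_0: "a < b ==> b <= dist x0 x ==> cutoff x0 a b x = 0" by (auto simp: cutoff_def max_def min_def divide_simps)

lemma cutoff_Lipschitz:
  assumes "a < b"
  shows "\<bar>cutoff x0 a b x - cutoff x0 a b y\<bar> <= 1 / (b - a) * norm (x - y)"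
proof -
  have "\<bar>cutoff x0 a b x - cutoff x0 a b y\<bar> <= \<bar>(b - dist x0 x) / (b - a) - (b - dist x0 y) / (b - a)\<bar>" unfolding cutoff_def by linarith
  also have "... = \<bar>dist x0 y - dist x0 x\<bar> / (b - a)" using assms by (simp add: diff_divide_distrib[symmetric])
  also have "... <= norm (x - y) / (b - a)"
    using assms abs_dist_diff_le[of y x0 x] by (intro divide_right_mono) (auto simp: dist_commute dist_norm norm_minus_commute)
  finally show ?thesis by simp
qed

text \<open>By induction \<open>a j <= \<nu> * c ^ j\<close>. The ratio
  \<open>c = b powr (- 1 / \<beta>)\<close> is chosen so that \<open>b * c powr \<beta> = 1\<close>,
  which absorbs the growing factor, and \<open>\<nu>\<close> so that
  \<open>B * \<nu> powr \<beta> = c\<close>, which produces the next factor.\<close>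

lemma fast_decay:
  fixes a :: "nat => real"
  assumes B: "0 < B" and b: "1 < b" and \<beta>: "0 < \<beta>" and a0: "!!j. 0 <= a j"
    and step: "!!j. a (Suc j) <= B * b ^ j * a j powr (1 + \<beta>)"
    and init: "a 0 <= (b powr (- 1 / \<beta>) / B) powr (1 / \<beta>)"
  shows "a \<longlonglongrightarrow> 0"
proof -
  define c \<nu> where "c = b powr (- 1 / \<beta>)" and "\<nu> = (c / B) powr (1 / \<beta>)"
  have c: "0 < c" "c < 1" using b \<beta> by (auto simp: c_def intro!: powr_less_one)
  have c\<beta>: "c powr \<beta> = 1 / b" unfolding c_def powr_powr using b \<beta> by (simp add: powr_minus_divide)
  have \<nu>: "0 < \<nu>" using c B by (simp add: \<nu>_def)
  have \<nu>\<beta>: "\<nu> powr \<beta> = c / B" using c B \<beta> by (simp add: \<nu>_def powr_powr)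
  have bound: "a j <= \<nu> * c ^ j" for j
  proof (induction j)
    case 0 then show ?case using init by (simp add: \<nu>_def c_def)
  next
    case (Suc j) have "a (Suc j) <= B * b ^ j * a j powr (1 + \<beta>)" by (rule step)
    also have "... <= B * b ^ j * (\<nu> * c ^ j) powr (1 + \<beta>)" using B b \<beta> a0 Suc by (intro mult_left_mono powr_mono2) auto
    also have "(\<nu> * c ^ j) powr (1 + \<beta>) = (\<nu> * c ^ j) * (\<nu> powr \<beta> * (c powr \<beta>) ^ j)"
    proof -
      have "(c ^ j) powr \<beta> = (c powr \<beta>) ^ j" using c by (simp add: powr_realpow[symmetric] powr_powr mult.commute)
      then show ?thesis using \<nu> c by (simp add: powr_add powr_mult)
    qed
    also have "B * b ^ j * ((\<nu> * c ^ j) * (\<nu> powr \<beta> * (c powr \<beta>) ^ j)) = \<nu> * c ^ Suc j" unfolding c\<beta> \<nu>\<beta> using B b by (simp add: power_divide)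
    finally show ?case .
  qed
  have "(\<lambda>j. \<nu> * c ^ j) \<longlonglongrightarrow> \<nu> * 0" using c by (intro tendsto_mult tendsto_const LIMSEQ_realpow_zero) auto
  then show ?thesis using a0 bound by (intro tendsto_sandwich[of "\<lambda>_. 0" a sequentially "\<lambda>j. \<nu> * c ^ j" 0]) auto
qed

lemma emeasure_ball_powr:
  "0 < r ==> emeasure lborel (ball (x::'a::euclidean_space) r) = ennreal (unit_ball_vol (real DIM('a)) * r powr real DIM('a))"
  by (simp add: emeasure_ball powr_realpow)

context dirichlet_domain
begin

text \<open>The scale invariant hypothesis at working radius \<open>\<rho>\<close>:
  \<open>\<rho> powr (- q)\<close> is the order of the kernel mass beyond distance
  \<open>\<rho>\<close>, so the condition says that the negative tail acts at most like a constant
  of size \<open>\<kappa>\<close>.\<close>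

definition growth_setting :: "('a => real) => 'a => real => real => real => bool" where
  "growth_setting v x0 r \<rho> \<kappa> \<longleftrightarrow> solution v \<and> 0 < \<kappa> \<and> 0 < \<rho> \<and> 4 * \<rho> <= r \<and> ball x0 r \<subseteq> N \<and>
    (AE x in lborel. x \<in> ball x0 r --> 0 <= v x) \<and>
    (\<forall>x\<in>ball x0 (2 * \<rho>). (\<integral>\<^sup>+y. ennreal (K x y) * ennreal (max (- v y) 0 powr (p - 1)) * indicator (- ball x0 r) y \<partial>lborel)
      <= ennreal (\<rho> powr (- q) * \<kappa> powr (p - 1)))"

lemma growth_setting_mono:
  assumes "growth_setting v x0 r \<rho> \<kappa>" "\<kappa> <= \<kappa>'"
  shows "growth_setting v x0 r \<rho> \<kappa>'"
proof -
  have "\<rho> powr (- q) * \<kappa> powr (p - 1) <= \<rho> powr (- q) * \<kappa>' powr (p - 1)"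
    using assms p_gt by (intro mult_left_mono powr_mono2) (auto simp: growth_setting_def)
  from ennreal_leI[OF this] show ?thesis using assms unfolding growth_setting_def by (auto intro: order_trans)
qed

lemma barrier_cutoff:
  assumes g: "growth_setting v x0 r \<rho> \<kappa>" and ab: "a < b" "b <= 2 * \<rho>" and k: "0 <= k"
    and ext: "AE x in lborel. x \<in> ball x0 b - \<Omega> --> k <= v x"
  shows "barrier v (ball x0 r) (ball x0 b) (\<lambda>x. k * cutoff x0 a b x) k (k / (b - a)) \<rho> (\<rho> powr (- q) * \<kappa> powr (p - 1))" unfolding barrier_def
proof (intro conjI)
  have \<rho>: "0 < \<rho>" "4 * \<rho> <= r" using g by (auto simp: growth_setting_def)
  show "solution v" "ball x0 r \<subseteq> N" "0 < \<rho>" "AE x in lborel. x \<in> ball x0 r --> 0 <= v x" using g by (auto simp: growth_setting_def)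
  show "ball x0 r \<in> sets borel" "ball x0 b \<in> sets borel" by auto
  show "\<forall>x\<in>ball x0 b. ball x \<rho> \<subseteq> ball x0 r"
  proof safe
    fix x y assume "x \<in> ball x0 b" "y \<in> ball x \<rho>"
    then show "y \<in> ball x0 r" using dist_triangle[of x0 y x] ab \<rho> by simp
  qed
  show "0 <= k / (b - a)" using k ab by simp
  show "\<forall>x y. \<bar>k * cutoff x0 a b x - k * cutoff x0 a b y\<bar> <= k / (b - a) * norm (x - y)"
  proof (intro allI)
    fix x y
    have "\<bar>k * cutoff x0 a b x - k * cutoff x0 a b y\<bar> = k * \<bar>cutoff x0 a b x - cutoff x0 a b y\<bar>"
      using k by (simp add: abs_mult right_diff_distrib[symmetric])
    also have "... <= k * (1 / (b - a) * norm (x - y))" using k ab by (intro mult_left_mono cutoff_Lipschitz)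
    finally show "\<bar>k * cutoff x0 a b x - k * cutoff x0 a b y\<bar> <= k / (b - a) * norm (x - y)" by simp
  qed
  have le: "k * cutoff x0 a b x <= k" for x using mult_left_mono[OF cutoff_range(2) k] by simp
  then show "\<forall>x. 0 <= k * cutoff x0 a b x \<and> k * cutoff x0 a b x <= k" using k cutoff_range by (auto intro!: mult_nonneg_nonneg)
  show "\<forall>x. x \<notin> ball x0 b --> k * cutoff x0 a b x = 0" using ab by (auto simp: cutoff_eq_0)
  show "AE x in lborel. x \<in> ball x0 b - \<Omega> --> k * cutoff x0 a b x <= v x" using ext by eventually_elim (use le in \<open>auto intro: order_trans\<close>)
  show "0 <= \<rho> powr (- q) * \<kappa> powr (p - 1)" by simp
  show "\<forall>x\<in>ball x0 b. (\<integral>\<^sup>+y. ennreal (K x y) * ennreal (max (- v y) 0 powr (p - 1)) * indicator (- ball x0 r) y \<partial>lborel)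
      <= ennreal (\<rho> powr (- q) * \<kappa> powr (p - 1))" using g ab by (auto simp: growth_setting_def)
qed

text \<open>If the slope times the radius, the height and the tail level are all at most
  \<open>m\<close>, then the three terms have the common size
  \<open>m powr p * \<rho> powr (- q)\<close>.\<close>

lemma barrier_bound_le:
  assumes "0 <= L" "0 <= k" "0 < \<rho>" "L * \<rho> <= m" "k <= m" "0 <= \<kappa>" "\<kappa> <= m"
  shows "barrier_bound L k \<rho> (\<rho> powr (- q) * \<kappa> powr (p - 1)) <= 3 * m powr p * \<rho> powr (- q)"
proof -
  have "L powr p * \<rho> powr (p - q) = (L * \<rho>) powr p * \<rho> powr (- q)" using assms by (simp add: powr_mult powr_diff powr_minus_divide)
  also have "... <= m powr p * \<rho> powr (- q)" using assms p_pos by (intro mult_right_mono powr_mono2) auto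
  finally have 1: "L powr p * \<rho> powr (p - q) <= m powr p * \<rho> powr (- q)" .
  have 2: "k powr p * \<rho> powr (- q) <= m powr p * \<rho> powr (- q)" using assms p_pos by (intro mult_right_mono powr_mono2) auto
  have "k * \<kappa> powr (p - 1) <= m * m powr (p - 1)" using assms p_gt by (intro mult_mono powr_mono2) auto
  also have "... = m powr p" using assms by (simp add: powr_mult_base)
  finally have "k * \<kappa> powr (p - 1) * \<rho> powr (- q) <= m powr p * \<rho> powr (- q)" by (rule mult_right_mono) simp
  with 1 2 show ?thesis by (simp add: barrier_bound_def mult_ac)
qed

definition sublevel :: "('a => real) => 'a => real => real => 'a set" where
  "sublevel v x0 r l = {x \<in> ball x0 r \<inter> \<Omega>. v x < l}"

lemma sublevel_measurable:
  assumes "solution v" shows "sublevel v x0 r l \<in> sets borel"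
proof -
  have [measurable]: "v \<in> borel_measurable borel" using assms by measurable
  have "{x \<in> space borel. x \<in> ball x0 r \<inter> \<Omega> \<and> v x < l} \<in> sets borel" by measurable
  then show ?thesis by (simp add: sublevel_def)
qed

lemma sublevel_mono: "r <= r' ==> l <= l' ==> sublevel v x0 r l \<subseteq> sublevel v x0 r' l'" by (auto simp: sublevel_def)

lemma sublevel_ball: "sublevel v x0 r l \<subseteq> ball x0 r" by (auto simp: sublevel_def)

lemma emeasure_sublevel:
  assumes "solution v"
  shows "emeasure lborel (sublevel v x0 r l) = ennreal (measure lborel (sublevel v x0 r l))"
proof -
  have "bounded (sublevel v x0 r l)" using bounded_ball sublevel_ball by (rule bounded_subset)
  then have "emeasure lborel (sublevel v x0 r l) < \<infinity>" by (rule emeasure_bounded_finite)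
  then show ?thesis by (simp add: emeasure_eq_ennreal_measure less_top)
qed

lemma nn_integral_Times_ge:
  assumes [measurable]: "A \<in> sets borel" "B \<in> sets borel" and "0 <= c"
    and le: "!!x. x \<in> A ==> ennreal c <= (\<integral>\<^sup>+y. ennreal (K x y) * indicator B y \<partial>lborel)"
  shows "ennreal c * emeasure lborel A <= (\<integral>\<^sup>+z. indicator (A \<times> B) z \<partial>\<mu>)"
proof -
  have "ennreal c * emeasure lborel A = (\<integral>\<^sup>+x. ennreal c * indicator A x \<partial>lborel)" by (simp add: nn_integral_cmult_indicator)
  also have "... <= (\<integral>\<^sup>+x. (\<integral>\<^sup>+y. ennreal (K x y) * 1 * indicator B y \<partial>lborel) * indicator A x \<partial>lborel)"
    using le by (intro nn_integral_mono) (auto simp: indicator_def)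
  also have "... = (\<integral>\<^sup>+z. 1 * indicator (A \<times> B) z \<partial>\<mu>)" by (subst nn_integral_\<mu>_Times) auto
  finally show ?thesis by simp
qed

lemma K_lower_dist:
  assumes "x \<noteq> y" "norm (x - y) <= d"
  shows "inverse \<Lambda> * d powr (- (real DIM('a) + q)) <= K x y"
proof -
  have "inverse \<Lambda> * d powr (- (real DIM('a) + q)) <= inverse \<Lambda> * riesz q x y"
    using assms \<Lambda>_pos q_pos by (intro mult_left_mono riesz_antimono) auto
  then show ?thesis using K_lower[of x y] by linarith
qed

text \<open>No Sobolev inequality is needed: a point of a small sublevel set sees, at a distance comparable
  to the radius of a ball of that measure, mostly points of the complement.\<close>

lemma de_giorgi_step:
  obtains B where "0 < B" "!!v x0 r \<rho> \<kappa> e a b l l'. growth_setting v x0 r \<rho> \<kappa> ==>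
     AE x in lborel. x \<in> ball x0 \<rho> - \<Omega> --> \<kappa> <= v x ==> 0 < e ==> e <= 1 ==> 0 <= a ==> b <= \<rho> ==> 0 <= l' ==> l <= \<kappa> ==>
     b - a = \<rho> * e / 4 ==> l - l' = \<kappa> * e / 4 ==>
     measure lborel (sublevel v x0 a l') / \<rho> powr real DIM('a) <=
       B * e powr (- 2 * p) * (measure lborel (sublevel v x0 b l) / \<rho> powr real DIM('a)) powr (1 + q / real DIM('a))"
proof -
  obtain C where C: "0 < C"
    "!!v S W \<psi> k L \<rho> T. barrier v S W \<psi> k L \<rho> T ==>
      energy_on S (barrier_gap v W \<psi>) <= ennreal (C * barrier_bound L k \<rho> T) * emeasure lborel (below_barrier v W \<psi>)" by (rule Caccioppoli) blast
  define n w where "n = real DIM('a)" and "w = unit_ball_vol (real DIM('a))"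
  have n: "0 < n" and w: "0 < w" by (auto simp: n_def w_def)
  \<comment> \<open>The power of \<open>2 / w\<close> comes from the radius \<open>t\<close> of a
    ball of prescribed measure, \<open>16 powr p\<close> from the quotient of the upper and the
    lower scale \<open>4 * \<kappa> / e\<close> and \<open>\<kappa> * e / 4\<close>.\<close>
  define B where "B = 3 * C * \<Lambda> * 16 powr p * (2 / w) powr (1 + q / n)"
  have B: "0 < B" using C \<Lambda>_pos w by (simp add: B_def)
  show ?thesis
  proof (rule that[OF B])
    fix v x0 r \<rho> \<kappa> e a b l l'
    assume g: "growth_setting v x0 r \<rho> \<kappa>" and ext: "AE x in lborel. x \<in> ball x0 \<rho> - \<Omega> --> \<kappa> <= v x"
      and e: "0 < e" "e <= 1" and a: "0 <= a" and b: "b <= \<rho>" and l': "0 <= l'" and l: "l <= \<kappa>"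
      and ba: "b - a = \<rho> * e / 4" and ll: "l - l' = \<kappa> * e / 4"
    have \<rho>: "0 < \<rho>" and \<kappa>: "0 < \<kappa>" and r: "4 * \<rho> <= r" and sol: "solution v" using g by (auto simp: growth_setting_def)
    have pos: "0 < \<rho> * e / 4" "0 < \<kappa> * e / 4" using \<rho> \<kappa> e by auto
    have ab: "a < b" using ba pos by linarith
    have l'l: "l' < l" using ll pos by linarith
    define A A' S \<psi> \<eta> where "A = sublevel v x0 b l" and "A' = sublevel v x0 a l'" and "S = ball x0 r"
      and "\<psi> = (\<lambda>x. l * cutoff x0 a b x)" and "\<eta> = barrier_gap v (ball x0 b) \<psi>"
    have [measurable]: "A \<in> sets borel" "A' \<in> sets borel" "S \<in> sets borel" using sublevel_measurable[OF sol] by (auto simp: A_def A'_def S_def)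
    define \<alpha> \<alpha>' where "\<alpha> = measure lborel A" and "\<alpha>' = measure lborel A'"
    have em: "emeasure lborel A = ennreal \<alpha>" "emeasure lborel A' = ennreal \<alpha>'"
      using emeasure_sublevel[OF sol] by (auto simp: A_def A'_def \<alpha>_def \<alpha>'_def)
    have \<alpha>0: "0 <= \<alpha>" "0 <= \<alpha>'" by (auto simp: \<alpha>_def \<alpha>'_def)
    have A'A: "A' \<subseteq> A" using ab l'l by (auto simp: A_def A'_def sublevel_def)
    have "\<alpha>' / \<rho> powr n <= B * e powr (- 2 * p) * (\<alpha> / \<rho> powr n) powr (1 + q / n)"
    proof (cases "\<alpha> = 0")
      case True have "ennreal \<alpha>' <= ennreal \<alpha>" unfolding em[symmetric] by (rule emeasure_mono) (use A'A in auto)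
      then have "\<alpha>' = 0" using True \<alpha>0 by simp
      then show ?thesis using True by simp
    next
      case False then have \<alpha>: "0 < \<alpha>" using \<alpha>0 by simp
      \<comment> \<open>The ball of radius \<open>t\<close> has measure \<open>2 * \<alpha>\<close>,
        twice that of \<open>A\<close>; hence around any point at least the measure
        \<open>\<alpha>\<close> of such a ball lies outside \<open>A\<close>.\<close>
      define t where "t = (2 * \<alpha> / w) powr (1 / n)"
      have t: "0 < t" using \<alpha> w by (simp add: t_def)
      have tn: "w * t powr n = 2 * \<alpha>" using \<alpha> w n by (simp add: t_def powr_powr)
      have "ennreal \<alpha> <= emeasure lborel (ball x0 \<rho>)" unfolding em[symmetric] using b by (intro emeasure_mono) (auto simp: A_def sublevel_def)
      then have "\<alpha> <= w * \<rho> powr n" using \<rho> w by (simp add: emeasure_ball_powr n_def w_def)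
      then have "w * t powr n <= w * (2 * \<rho> powr n)" unfolding tn by simp
      then have "t powr n <= 2 * \<rho> powr n" using w by (rule mult_left_le_imp_le)
      also have "2 * \<rho> powr n <= 2 powr n * \<rho> powr n"
        by (intro mult_right_mono) (auto simp: n_def ge_one_powr_ge_zero powr_realpow self_le_power)
      also have "... = (2 * \<rho>) powr n" using \<rho> by (simp add: powr_mult)
      \<comment> \<open>Since \<open>A\<close> lies in the ball of radius \<open>\<rho>\<close>, the
        radius \<open>t\<close> is at most \<open>2 * \<rho>\<close>, so the ball of radius
        \<open>t\<close> around a point of \<open>A'\<close> stays inside \<open>S\<close>, where
        the energy is measured.\<close>
      finally have t\<rho>: "t <= 2 * \<rho>" using n t \<rho> powr_less_mono2[of n "2 * \<rho>" t] by linarith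
      have bar: "barrier v S (ball x0 b) \<psi> l (l / (b - a)) \<rho> (\<rho> powr (- q) * \<kappa> powr (p - 1))" unfolding S_def \<psi>_def
      proof (rule barrier_cutoff[OF g ab])
        show "b <= 2 * \<rho>" using b \<rho> by simp
        show "0 <= l" using l' l'l by simp
        show "AE x in lborel. x \<in> ball x0 b - \<Omega> --> l <= v x" using ext by eventually_elim (use b l in auto)
      qed
      have \<psi>l: "\<psi> x <= l" for x by (rule barrierD(10)[OF bar])
      have below: "below_barrier v (ball x0 b) \<psi> \<subseteq> A" using \<psi>l by (auto simp: below_barrier_def A_def sublevel_def intro: less_le_trans)
      \<comment> \<open>For a first point in \<open>A'\<close> and a second in \<open>S - A\<close>
        the gap drops from at least \<open>l - l' = \<kappa> * e / 4\<close> to 0, so these pairs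
        alone bound the energy from below.\<close>
      have "ennreal ((\<kappa> * e / 4) powr p) * (\<integral>\<^sup>+z. indicator (A' \<times> (S - A)) z \<partial>\<mu>) =
        (\<integral>\<^sup>+z. ennreal ((\<kappa> * e / 4) powr p) * indicator (A' \<times> (S - A)) z \<partial>\<mu>)" by (rule nn_integral_cmult[symmetric]) measurable
      also have "... <= energy_on S \<eta>" unfolding energy_on_def
      proof (rule nn_integral_mono)
        fix z :: "'a \<times> 'a" obtain x y where z: "z = (x, y)" by (cases z)
        show "ennreal ((\<kappa> * e / 4) powr p) * indicator (A' \<times> (S - A)) z <=
          ennreal (\<bar>jump \<eta> z\<bar> powr p) * indicator (S \<times> S) z"
        proof (cases "x \<in> A' \<and> y \<in> S - A")
          case True then have x: "x \<in> ball x0 a" "x \<in> \<Omega>" "v x < l'" by (auto simp: A'_def sublevel_def)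
          have "y \<notin> below_barrier v (ball x0 b) \<psi>" using True below by auto
          then have \<eta>y: "\<eta> y = 0" unfolding \<eta>_def by (rule barrier_gap_eq_0)
          have "\<psi> x = l" using x ab by (simp add: \<psi>_def cutoff_eq_1)
          then have "\<eta> x = l - v x" using x ab l'l by (simp add: \<eta>_def barrier_gap_def)
          then have "\<kappa> * e / 4 <= \<bar>\<eta> x - \<eta> y\<bar>" using x \<eta>y ll by linarith
          then have "(\<kappa> * e / 4) powr p <= \<bar>\<eta> x - \<eta> y\<bar> powr p" using pos p_pos by (intro powr_mono2) auto
          moreover have "x \<in> S" using x ab b r \<rho> by (auto simp: S_def)
          ultimately show ?thesis using True by (simp add: z ennreal_leI)
        qed (auto simp: z)
      qed
      also have "... <= ennreal (C * barrier_bound (l / (b - a)) l \<rho> (\<rho> powr (- q) * \<kappa> powr (p - 1))) * emeasure lborel (below_barrier v (ball x0 b) \<psi>)"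
        unfolding \<eta>_def by (rule C(2)[OF bar])
      also have "... <= ennreal (C * (3 * (4 * \<kappa> / e) powr p * \<rho> powr (- q))) * ennreal \<alpha>" unfolding em(1)[symmetric]
      proof (rule mult_mono)
        have "\<kappa> * 1 <= \<kappa> * (4 / e)" using e \<kappa> by (intro mult_left_mono) auto
        then have m: "\<kappa> <= 4 * \<kappa> / e" by (simp add: mult.commute)
        have "l / (b - a) * \<rho> = 4 * l / e" unfolding ba using e \<rho> by (simp add: field_simps)
        also have "... <= 4 * \<kappa> / e" using l e by (intro divide_right_mono) auto
        finally show "ennreal (C * barrier_bound (l / (b - a)) l \<rho> (\<rho> powr (- q) * \<kappa> powr (p - 1))) <= ennreal (C * (3 * (4 * \<kappa> / e) powr p * \<rho> powr (- q)))"
          using m l \<kappa> l' l'l ab \<rho> C(1) by (intro ennreal_leI mult_left_mono barrier_bound_le) auto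
        show "emeasure lborel (below_barrier v (ball x0 b) \<psi>) <= emeasure lborel A" by (intro emeasure_mono below) auto
      qed auto
      finally have up: "ennreal ((\<kappa> * e / 4) powr p) * (\<integral>\<^sup>+z. indicator (A' \<times> (S - A)) z \<partial>\<mu>)
          <= ennreal (C * (3 * (4 * \<kappa> / e) powr p * \<rho> powr (- q)) * \<alpha>)" using C \<alpha> by (simp add: ennreal_mult)
      define c where "c = inverse \<Lambda> * t powr (- (n + q))"
      have c: "0 < c" using \<Lambda>_pos t by (simp add: c_def)
      have "ennreal (c * \<alpha>) * emeasure lborel A' <= (\<integral>\<^sup>+z. indicator (A' \<times> (S - A)) z \<partial>\<mu>)"
      proof (rule nn_integral_Times_ge)
        show "0 <= c * \<alpha>" using c \<alpha> by simp
        fix x assume x: "x \<in> A'"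
        then have xb: "x \<in> ball x0 a" and xA: "x \<in> A" using A'A by (auto simp: A'_def sublevel_def)
        have bS: "ball x t \<subseteq> S"
        proof
          fix y assume "y \<in> ball x t"
          then show "y \<in> S" using xb dist_triangle[of x0 y x] t\<rho> ab b r \<rho> by (simp add: S_def)
        qed
        have "ennreal (2 * \<alpha>) <= emeasure lborel ((ball x t - A) \<union> A)"
        proof -
          have "ennreal (2 * \<alpha>) = emeasure lborel (ball x t)" using t tn by (simp add: emeasure_ball_powr n_def w_def)
          also have "... <= emeasure lborel ((ball x t - A) \<union> A)" by (rule emeasure_mono) auto
          finally show ?thesis .
        qed
        also have "... <= emeasure lborel (ball x t - A) + emeasure lborel A" by (rule emeasure_subadditive) auto
        finally have "ennreal \<alpha> + ennreal \<alpha> <= ennreal \<alpha> + emeasure lborel (ball x t - A)"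
          using \<alpha> by (simp add: em add.commute ennreal_plus[symmetric] del: ennreal_plus)
        then have "ennreal \<alpha> <= emeasure lborel (ball x t - A)" by (subst (asm) ennreal_add_left_cancel_le) auto
        then have "ennreal (c * \<alpha>) <= ennreal c * emeasure lborel (ball x t - A)" using c \<alpha> by (simp add: ennreal_mult mult_left_mono)
        also have "... = (\<integral>\<^sup>+y. ennreal c * indicator (ball x t - A) y \<partial>lborel)" by (subst nn_integral_cmult_indicator) auto
        also have "... <= (\<integral>\<^sup>+y. ennreal (K x y) * indicator (S - A) y \<partial>lborel)"
        proof (rule nn_integral_mono)
          fix y
          show "ennreal c * indicator (ball x t - A) y <= ennreal (K x y) * indicator (S - A) y"
          proof (cases "y \<in> ball x t - A")
            case True then have "c <= K x y" unfolding c_def n_def using xA by (intro K_lower_dist) (auto simp: dist_norm)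
            then show ?thesis using True bS by (auto simp: indicator_def intro!: ennreal_leI)
          qed simp
        qed
        finally show "ennreal (c * \<alpha>) <= (\<integral>\<^sup>+y. ennreal (K x y) * indicator (S - A) y \<partial>lborel)" .
      qed measurable
      then have "ennreal ((\<kappa> * e / 4) powr p) * (ennreal (c * \<alpha>) * ennreal \<alpha>') <= ennreal (C * (3 * (4 * \<kappa> / e) powr p * \<rho> powr (- q)) * \<alpha>)"
        unfolding em(2) by (intro order_trans[OF mult_left_mono up]) auto
      then have "(\<kappa> * e / 4) powr p * (c * \<alpha> * \<alpha>') <= C * (3 * (4 * \<kappa> / e) powr p * \<rho> powr (- q)) * \<alpha>"
        using C \<alpha> \<alpha>0 c by (simp add: ennreal_mult[symmetric] mult.assoc)
      then have "\<alpha> * ((\<kappa> * e / 4) powr p * c * \<alpha>') <= \<alpha> * (3 * C * (4 * \<kappa> / e) powr p * \<rho> powr (- q))" by (simp add: mult_ac)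
      then have main: "(\<kappa> * e / 4) powr p * c * \<alpha>' <= 3 * C * (4 * \<kappa> / e) powr p * \<rho> powr (- q)" using \<alpha> by simp
      define G where "G = (\<kappa> * e / 4) powr p"
      have G: "0 < G" using \<kappa> e by (simp add: G_def)
      \<comment> \<open>The quotient of the two scales is \<open>16 * e powr (- 2)\<close>, so the
        level \<open>\<kappa>\<close> drops out of the estimate.\<close>
      have ratio: "(4 * \<kappa> / e) powr p = G * (16 powr p * e powr (- 2 * p))"
      proof -
        have "4 * \<kappa> / e = (\<kappa> * e / 4) * (16 * e powr (- 2))" using e by (simp add: powr_minus powr_numeral field_simps power2_eq_square)
        then have "(4 * \<kappa> / e) powr p = G * (16 * e powr (- 2)) powr p" unfolding G_def using \<kappa> e by (simp only: powr_mult)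
        then show ?thesis using e by (simp add: powr_mult powr_powr)
      qed
      have "G * (c * \<alpha>') <= G * (3 * C * (16 powr p * e powr (- 2 * p)) * \<rho> powr (- q))"
        using main unfolding ratio by (simp add: G_def[symmetric] mult_ac)
      then have "c * \<alpha>' <= 3 * C * (16 powr p * e powr (- 2 * p)) * \<rho> powr (- q)" using G by simp
      then have "\<Lambda> * t powr (n + q) * (c * \<alpha>') <= \<Lambda> * t powr (n + q) * (3 * C * (16 powr p * e powr (- 2 * p)) * \<rho> powr (- q))"
        using \<Lambda>_pos by (intro mult_left_mono) auto
      moreover have "\<Lambda> * t powr (n + q) * (c * \<alpha>') = \<alpha>'"
      proof -
        have "t powr (n + q) * t powr (- (n + q)) = 1" using t by (simp only: powr_add[symmetric]) simp
        then show ?thesis unfolding c_def using \<Lambda>_pos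
          by (metis (no_types, opaque_lifting) less_irrefl mult.assoc mult.commute mult.left_neutral right_inverse)
      qed
      ultimately have fin: "\<alpha>' <= \<Lambda> * t powr (n + q) * (3 * C * (16 powr p * e powr (- 2 * p)) * \<rho> powr (- q))" by simp
      have "t powr (n + q) = (2 * \<alpha> / w) powr (1 + q / n)" using n by (simp add: t_def powr_powr add_divide_distrib)
      also have "2 * \<alpha> / w = 2 / w * (\<alpha> / \<rho> powr n * \<rho> powr n)" using \<rho> by simp
      also have "(...) powr (1 + q / n) = (2 / w) powr (1 + q / n) * (\<alpha> / \<rho> powr n) powr (1 + q / n) * \<rho> powr (n + q)"
      proof -
        have "(\<rho> powr n) powr (1 + q / n) = \<rho> powr (n + q)" using n by (simp add: powr_powr distrib_left)
        then show ?thesis by (simp only: powr_mult mult.assoc)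
      qed
      finally have tt: "t powr (n + q) = (2 / w) powr (1 + q / n) * (\<alpha> / \<rho> powr n) powr (1 + q / n) * \<rho> powr (n + q)" .
      have \<rho>\<rho>: "\<rho> powr (n + q) * \<rho> powr (- q) = \<rho> powr n" by (simp add: powr_add[symmetric])
      have "\<alpha>' <= B * e powr (- 2 * p) * (\<alpha> / \<rho> powr n) powr (1 + q / n) * (\<rho> powr (n + q) * \<rho> powr (- q))"
        using fin unfolding tt B_def by (simp add: mult_ac)
      then show ?thesis unfolding \<rho>\<rho> using \<rho> by (simp add: pos_divide_le_eq)
    qed
    then show "measure lborel (sublevel v x0 a l') / \<rho> powr real DIM('a) <=
       B * e powr (- 2 * p) * (measure lborel (sublevel v x0 b l) / \<rho> powr real DIM('a)) powr (1 + q / real DIM('a))"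
      by (simp add: \<alpha>_def \<alpha>'_def A_def A'_def n_def)
  qed
qed

text \<open>The measures of shrinking sublevel sets, normalised by the volume scale, satisfy a
  recursion of order \<open>1 + q / n\<close>. The threshold \<open>\<nu>\<close> is the one for
  which such a recursion forces convergence to 0, and it depends on neither the ball nor the
  level.\<close>

lemma de_giorgi:
  obtains \<nu> where "0 < \<nu>" "!!v x0 r \<rho> \<kappa>. growth_setting v x0 r \<rho> \<kappa> ==>
     AE x in lborel. x \<in> ball x0 \<rho> - \<Omega> --> \<kappa> <= v x ==>
     measure lborel (sublevel v x0 \<rho> \<kappa>) <= \<nu> * \<rho> powr real DIM('a) ==>
     AE x in lborel. x \<in> ball x0 (\<rho> / 2) --> \<kappa> / 2 <= v x"
proof -
  obtain B where B: "0 < B" "!!v x0 r \<rho> \<kappa> e a b l l'. growth_setting v x0 r \<rho> \<kappa> ==>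
     AE x in lborel. x \<in> ball x0 \<rho> - \<Omega> --> \<kappa> <= v x ==> 0 < e ==> e <= 1 ==> 0 <= a ==> b <= \<rho> ==> 0 <= l' ==> l <= \<kappa> ==>
     b - a = \<rho> * e / 4 ==> l - l' = \<kappa> * e / 4 ==>
     measure lborel (sublevel v x0 a l') / \<rho> powr real DIM('a) <=
       B * e powr (- 2 * p) * (measure lborel (sublevel v x0 b l) / \<rho> powr real DIM('a)) powr (1 + q / real DIM('a))"
    by (rule de_giorgi_step) blast
  define n \<beta> b where "n = real DIM('a)" and "\<beta> = q / n" and "b = (2::real) powr (2 * p)"
  have n: "0 < n" by (simp add: n_def)
  have \<beta>: "0 < \<beta>" using q_pos n by (simp add: \<beta>_def)
  have b: "1 < b" using p_pos by (simp add: b_def)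
  define \<nu> where "\<nu> = (b powr (- 1 / \<beta>) / B) powr (1 / \<beta>)"
  have \<nu>: "0 < \<nu>" using b B by (simp add: \<nu>_def)
  show ?thesis
  proof (rule that[OF \<nu>])
    fix v x0 r \<rho> \<kappa>
    assume g: "growth_setting v x0 r \<rho> \<kappa>" and ext: "AE x in lborel. x \<in> ball x0 \<rho> - \<Omega> --> \<kappa> <= v x"
      and init: "measure lborel (sublevel v x0 \<rho> \<kappa>) <= \<nu> * \<rho> powr real DIM('a)"
    have \<rho>: "0 < \<rho>" and \<kappa>: "0 < \<kappa>" and sol: "solution v" using g by (auto simp: growth_setting_def)
    \<comment> \<open>Radii and levels run down from \<open>\<rho>\<close> and
      \<open>\<kappa>\<close> to their halves. As \<open>e\<close> is halved in each step,
      consecutive values differ by \<open>\<rho> * e j / 4\<close> and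
      \<open>\<kappa> * e j / 4\<close>, the increments of the single step.\<close>
    define e :: "nat => real" where "e = (\<lambda>j. 1 / 2 ^ j)"
    have e: "0 < e j" "e j <= 1" "e (Suc j) = e j / 2" for j by (auto simp: e_def)
    define A where "A = (\<lambda>j. sublevel v x0 (\<rho> * (1 + e j) / 2) (\<kappa> * (1 + e j) / 2))"
    define a where "a = (\<lambda>j. measure lborel (A j) / \<rho> powr n)"
    have eb: "e j powr (- 2 * p) = b ^ j" for j
    proof -
      have "e j = 2 powr (- real j)" by (simp add: e_def powr_minus_divide powr_realpow)
      then show ?thesis using powr_realpow[of b j] b by (simp add: b_def powr_powr mult_ac)
    qed
    have "a \<longlonglongrightarrow> 0"
    proof (rule fast_decay[OF B(1) b \<beta>])
      show "0 <= a j" for j by (simp add: a_def)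
      show "a (Suc j) <= B * b ^ j * a j powr (1 + \<beta>)" for j unfolding a_def A_def \<beta>_def n_def eb[symmetric]
      proof (rule B(2)[OF g ext e(1,2)])
        show "0 <= \<rho> * (1 + e (Suc j)) / 2" "0 <= \<kappa> * (1 + e (Suc j)) / 2" using \<rho> \<kappa> e(1)[of "Suc j"] by auto
        show "\<rho> * (1 + e j) / 2 <= \<rho>" "\<kappa> * (1 + e j) / 2 <= \<kappa>"
          using mult_left_mono[OF e(2)[of j], of \<rho>] mult_left_mono[OF e(2)[of j], of \<kappa>] \<rho> \<kappa> by (auto simp: algebra_simps)
        show "\<rho> * (1 + e j) / 2 - \<rho> * (1 + e (Suc j)) / 2 = \<rho> * e j / 4"
          "\<kappa> * (1 + e j) / 2 - \<kappa> * (1 + e (Suc j)) / 2 = \<kappa> * e j / 4" unfolding e(3) by (simp_all add: field_simps)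
      qed
      have "A 0 = sublevel v x0 \<rho> \<kappa>" by (simp add: A_def e_def)
      then show "a 0 <= (b powr (- 1 / \<beta>) / B) powr (1 / \<beta>)" using init \<rho> unfolding \<nu>_def[symmetric] by (simp add: a_def n_def pos_divide_le_eq)
    qed
    \<comment> \<open>The limiting sublevel set is contained in all the sets \<open>A j\<close>, so
      its measure vanishes.\<close>
    define Z where "Z = sublevel v x0 (\<rho> / 2) (\<kappa> / 2)"
    have [measurable]: "Z \<in> sets borel" using sublevel_measurable[OF sol] by (simp add: Z_def)
    have "measure lborel Z / \<rho> powr n <= a j" for j
    proof -
      have "Z \<subseteq> A j" unfolding Z_def A_def using \<rho> \<kappa> e(1)[of j] by (intro sublevel_mono) auto
      moreover have "A j \<in> sets borel" using sublevel_measurable[OF sol] by (simp add: A_def)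
      ultimately have "emeasure lborel Z <= emeasure lborel (A j)" by (intro emeasure_mono) auto
      then have "measure lborel Z <= measure lborel (A j)" using emeasure_sublevel[OF sol] by (simp add: Z_def A_def)
      then show ?thesis unfolding a_def by (rule divide_right_mono) simp
    qed
    then have "measure lborel Z / \<rho> powr n <= 0" by (intro LIMSEQ_le_const[OF \<open>a \<longlonglongrightarrow> 0\<close>]) auto
    then have "measure lborel Z = 0" using \<rho> measure_nonneg[of lborel Z] by (auto simp: divide_le_0_iff powr_def)
    then have "emeasure lborel Z = 0" using emeasure_sublevel[OF sol] by (simp add: Z_def)
    then have "AE x in lborel. x \<notin> Z" by (intro AE_not_in) (auto simp: null_sets_def)
    then show "AE x in lborel. x \<in> ball x0 (\<rho> / 2) --> \<kappa> / 2 <= v x" using ext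
    proof eventually_elim
      case (elim x) show ?case
      proof
        assume x: "x \<in> ball x0 (\<rho> / 2)"
        show "\<kappa> / 2 <= v x"
        proof (cases "x \<in> \<Omega>")
          case True then show ?thesis using elim x by (auto simp: Z_def sublevel_def)
        next
          case False then show ?thesis using elim x \<rho> \<kappa> by auto
        qed
      qed
    qed
  qed
qed

text \<open>With a barrier of height \<open>k = \<theta> * h\<close>, the attraction by the set
  where \<open>v >= h\<close> costs about \<open>h powr (p - 1) * k\<close> per unit of measure of
  the set where \<open>v < k / 2\<close>, whereas at most about \<open>k powr p\<close> is
  available. So the latter set has density of order \<open>\<theta> powr (p - 1)\<close>, small
  enough for De Giorgi's iteration at level \<open>k / 2\<close>; the halving there explains the
  final fraction \<open>\<theta> / 4\<close>. The set where \<open>v >= h\<close> may lie outside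
  \<Omega>, as it does at boundary points.\<close>

lemma growth_lemma:
  assumes \<delta>: "0 < \<delta>"
  obtains \<tau> where "0 < \<tau>" "\<tau> < 1" "!!v x0 r \<rho> h. 0 < h ==> growth_setting v x0 r \<rho> (\<tau> * h) ==>
     AE x in lborel. x \<in> ball x0 (2 * \<rho>) - \<Omega> --> h <= v x ==>
     ennreal (\<delta> * \<rho> powr real DIM('a)) <= emeasure lborel {x \<in> ball x0 \<rho>. h <= v x} ==>
     AE x in lborel. x \<in> ball x0 (\<rho> / 2) --> \<tau> * h <= v x"
proof -
  obtain \<nu> where \<nu>: "0 < \<nu>" "!!v x0 r \<rho> \<kappa>. growth_setting v x0 r \<rho> \<kappa> ==>
     AE x in lborel. x \<in> ball x0 \<rho> - \<Omega> --> \<kappa> <= v x ==>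
     measure lborel (sublevel v x0 \<rho> \<kappa>) <= \<nu> * \<rho> powr real DIM('a) ==>
     AE x in lborel. x \<in> ball x0 (\<rho> / 2) --> \<kappa> / 2 <= v x" by (rule de_giorgi) blast
  obtain C where C: "0 < C"
    "!!v S W \<psi> k L \<rho> T E h. barrier v S W \<psi> k L \<rho> T ==> E \<in> sets borel ==> E \<subseteq> S ==> 0 <= h ==> 2 * k <= h ==>
      (!!x. x \<in> E ==> h <= v x) ==>
      (\<integral>\<^sup>+z. ennreal ((h / 2) powr (p - 1) * barrier_gap v W \<psi> (fst z)) * indicator (below_barrier v W \<psi> \<times> E) z \<partial>\<mu>)
        <= ennreal (C * barrier_bound L k \<rho> T) * emeasure lborel (below_barrier v W \<psi>)" by (rule Caccioppoli) blast
  define n w where "n = real DIM('a)" and "w = unit_ball_vol (real DIM('a))"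
  have n: "0 < n" and w: "0 < w" by (auto simp: n_def w_def)
  define C' where "C' = 3 * C * (w * 2 powr n) * \<Lambda> * 2 powr (n + q) * 2 powr (p - 1) * 2 / \<delta>"
  have C': "0 < C'" using C w \<Lambda>_pos \<delta> by (simp add: C'_def)
  \<comment> \<open>The bound 1/2 gives \<open>2 * k <= h\<close>, as required by the attraction
    estimate; the other entry pushes the density below the threshold \<open>\<nu>\<close>.\<close>
  define \<theta> where "\<theta> = min (1 / 2) ((\<nu> / C') powr (1 / (p - 1)))"
  have \<theta>: "0 < \<theta>" "\<theta> <= 1 / 2" using \<nu> C' by (auto simp: \<theta>_def)
  have \<theta>\<nu>: "C' * \<theta> powr (p - 1) <= \<nu>"
  proof -
    have "\<theta> powr (p - 1) <= ((\<nu> / C') powr (1 / (p - 1))) powr (p - 1)" using \<theta> p_gt by (intro powr_mono2) (auto simp: \<theta>_def)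
    also have "... = \<nu> / C'" using \<nu> C' p_gt by (simp add: powr_powr)
    finally show ?thesis using C' by (simp add: field_simps)
  qed
  show ?thesis
  proof (rule that[of "\<theta> / 4"])
    show "0 < \<theta> / 4" "\<theta> / 4 < 1" using \<theta> by auto
    fix v x0 r \<rho> h
    assume h: "0 < h" and g: "growth_setting v x0 r \<rho> (\<theta> / 4 * h)"
      and ext: "AE x in lborel. x \<in> ball x0 (2 * \<rho>) - \<Omega> --> h <= v x"
      and dens: "ennreal (\<delta> * \<rho> powr real DIM('a)) <= emeasure lborel {x \<in> ball x0 \<rho>. h <= v x}"
    have \<rho>: "0 < \<rho>" and r: "4 * \<rho> <= r" and sol: "solution v" using g by (auto simp: growth_setting_def)
    define k where "k = \<theta> * h"
    have k: "0 < k" "2 * k <= h" using \<theta> h by (auto simp: k_def)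
    define S W \<psi> E where "S = ball x0 r" and "W = ball x0 (2 * \<rho>)" and "\<psi> = (\<lambda>x. k * cutoff x0 \<rho> (2 * \<rho>) x)"
      and "E = {x \<in> ball x0 \<rho>. h <= v x}"
    define \<eta> where "\<eta> = barrier_gap v W \<psi>"
    define A0 where "A0 = sublevel v x0 \<rho> (k / 2)"
    have [measurable]: "v \<in> borel_measurable borel" using sol by measurable
    have "{x \<in> space borel. x \<in> ball x0 \<rho> \<and> h <= v x} \<in> sets borel" by measurable
    then have [measurable]: "E \<in> sets borel" by (simp add: E_def)
    have [measurable]: "A0 \<in> sets borel" using sublevel_measurable[OF sol] by (simp add: A0_def)
    have bar: "barrier v S W \<psi> k (k / \<rho>) \<rho> (\<rho> powr (- q) * (\<theta> / 4 * h) powr (p - 1))"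
    proof -
      have "barrier v (ball x0 r) (ball x0 (2 * \<rho>)) (\<lambda>x. k * cutoff x0 \<rho> (2 * \<rho>) x) k (k / (2 * \<rho> - \<rho>)) \<rho> (\<rho> powr (- q) * (\<theta> / 4 * h) powr (p - 1))"
      proof (rule barrier_cutoff[OF g])
        show "AE x in lborel. x \<in> ball x0 (2 * \<rho>) - \<Omega> --> k <= v x" using ext by eventually_elim (use k in auto)
      qed (use \<rho> k in auto)
      then show ?thesis by (simp add: S_def W_def \<psi>_def)
    qed
    note [measurable] = barrier_measurable[OF bar]
    let ?A = "below_barrier v W \<psi>" and ?H = "(h / 2) powr (p - 1)"
    have A0_sub: "A0 \<subseteq> ?A" and \<eta>_ge: "x \<in> A0 ==> k / 2 <= \<eta> x" for x
    proof -
      have *: "\<psi> x = k \<and> x \<in> W \<and> x \<in> \<Omega> \<and> v x < k / 2" if "x \<in> A0" for x using that \<rho> by (auto simp: A0_def sublevel_def \<psi>_def W_def cutoff_eq_1)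
      then show "A0 \<subseteq> ?A" using k by (fastforce simp: below_barrier_def)
      show "k / 2 <= \<eta> x" if "x \<in> A0" using *[OF that] by (auto simp: \<eta>_def barrier_gap_def max_def)
    qed
    define \<alpha> where "\<alpha> = measure lborel A0"
    have em: "emeasure lborel A0 = ennreal \<alpha>" and \<alpha>0: "0 <= \<alpha>" using emeasure_sublevel[OF sol] by (auto simp: A0_def \<alpha>_def)
    \<comment> \<open>A lower bound of the kernel for two distinct points of the ball of radius
      \<open>\<rho>\<close>, whose distance is at most \<open>2 * \<rho>\<close>.\<close>
    define c where "c = inverse \<Lambda> * (2 * \<rho>) powr (- (n + q))"
    have c: "0 < c" using \<Lambda>_pos \<rho> by (simp add: c_def)
    have "ennreal (?H * (k / 2)) * (ennreal (c * (\<delta> * \<rho> powr n)) * emeasure lborel A0)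
      <= ennreal (?H * (k / 2)) * (\<integral>\<^sup>+z. indicator (A0 \<times> E) z \<partial>\<mu>)"
    proof (intro mult_left_mono nn_integral_Times_ge)
      show "0 <= c * (\<delta> * \<rho> powr n)" using c \<delta> by simp
      fix x assume x: "x \<in> A0"
      have "ennreal (c * (\<delta> * \<rho> powr n)) = ennreal c * ennreal (\<delta> * \<rho> powr n)" using c \<delta> by (simp add: ennreal_mult)
      also have "... <= ennreal c * emeasure lborel E" using dens by (intro mult_left_mono) (auto simp: E_def n_def)
      also have "... = (\<integral>\<^sup>+y. ennreal c * indicator E y \<partial>lborel)" by (subst nn_integral_cmult_indicator) auto
      also have "... <= (\<integral>\<^sup>+y. ennreal (K x y) * indicator E y \<partial>lborel)"
      proof (rule nn_integral_mono)
        fix y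
        show "ennreal c * indicator E y <= ennreal (K x y) * indicator E y"
        proof (cases "y \<in> E")
          \<comment> \<open>The strict inequality serves to see that \<open>x\<close> and
            \<open>y\<close> differ, since the kernel vanishes on the diagonal.\<close>
          case True have "v x < v y" using True x k by (auto simp: E_def A0_def sublevel_def)
          moreover have "dist x y <= 2 * \<rho>" using True x dist_triangle[of x y x0] by (auto simp: E_def A0_def sublevel_def dist_commute)
          ultimately have "c <= K x y" unfolding c_def n_def by (intro K_lower_dist) (auto simp: dist_norm)
          then show ?thesis using True by (simp add: ennreal_leI)
        qed simp
      qed
      finally show "ennreal (c * (\<delta> * \<rho> powr n)) <= (\<integral>\<^sup>+y. ennreal (K x y) * indicator E y \<partial>lborel)" .
    qed auto
    also have "... = (\<integral>\<^sup>+z. ennreal (?H * (k / 2)) * indicator (A0 \<times> E) z \<partial>\<mu>)" by (rule nn_integral_cmult[symmetric]) measurable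
    also have "... <= (\<integral>\<^sup>+z. ennreal (?H * \<eta> (fst z)) * indicator (?A \<times> E) z \<partial>\<mu>)"
    proof (rule nn_integral_mono)
      fix z :: "'a \<times> 'a"
      show "ennreal (?H * (k / 2)) * indicator (A0 \<times> E) z <= ennreal (?H * \<eta> (fst z)) * indicator (?A \<times> E) z"
      proof (cases "z \<in> A0 \<times> E")
        case True then have "?H * (k / 2) <= ?H * \<eta> (fst z)" using \<eta>_ge by (intro mult_left_mono) auto
        then show ?thesis using True A0_sub by (auto simp: indicator_def intro!: ennreal_leI)
      qed simp
    qed
    also have "... <= ennreal (C * barrier_bound (k / \<rho>) k \<rho> (\<rho> powr (- q) * (\<theta> / 4 * h) powr (p - 1))) * emeasure lborel ?A" unfolding \<eta>_def
    proof (rule C(2)[OF bar])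
      show "E \<subseteq> S" using r \<rho> by (auto simp: E_def S_def)
      show "!!x. x \<in> E ==> h <= v x" by (simp add: E_def)
    qed (use h k in auto)
    also have "... <= ennreal (C * (3 * k powr p * \<rho> powr (- q))) * ennreal (w * (2 powr n * \<rho> powr n))"
    proof (rule mult_mono)
      have "\<theta> / 4 * h <= k" using \<theta> h by (simp add: k_def)
      then show "ennreal (C * barrier_bound (k / \<rho>) k \<rho> (\<rho> powr (- q) * (\<theta> / 4 * h) powr (p - 1))) <= ennreal (C * (3 * k powr p * \<rho> powr (- q)))"
        using k \<rho> C(1) \<theta> h by (intro ennreal_leI mult_left_mono barrier_bound_le) auto
      have "emeasure lborel ?A <= emeasure lborel W" by (intro emeasure_mono) (auto simp: below_barrier_def)
      then show "emeasure lborel ?A <= ennreal (w * (2 powr n * \<rho> powr n))" using \<rho> by (simp add: W_def emeasure_ball_powr w_def n_def powr_mult)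
    qed auto
    finally have "ennreal (?H * (k / 2)) * (ennreal (c * (\<delta> * \<rho> powr n)) * ennreal \<alpha>) <=
      ennreal (C * (3 * k powr p * \<rho> powr (- q))) * ennreal (w * (2 powr n * \<rho> powr n))" unfolding em .
    then have real: "?H * (k / 2) * (c * (\<delta> * \<rho> powr n) * \<alpha>) <= C * (3 * k powr p * \<rho> powr (- q)) * (w * (2 powr n * \<rho> powr n))"
      using C w c \<delta> \<alpha>0 k by (simp add: ennreal_mult[symmetric])
    have e1: "?H = h powr (p - 1) * 2 powr (- (p - 1))"  by (simp only: powr_minus[of 2 "p - 1"] powr_divide divide_inverse[symmetric])
    have e2: "k powr p = k * (\<theta> powr (p - 1) * h powr (p - 1))" using k h \<theta> powr_mult_base[of k "p - 1"] by (simp add: k_def powr_mult)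
    have e3: "c = inverse \<Lambda> * (2 powr (- (n + q)) * \<rho> powr (- n) * \<rho> powr (- q))" using \<rho> by (simp add: c_def powr_mult powr_add[symmetric])
    have "\<alpha> <= C' * \<theta> powr (p - 1) * \<rho> powr n"
    proof -
      define F where "F = k * h powr (p - 1) * \<rho> powr (- q)"
      have F: "0 < F" using k h \<rho> by (simp add: F_def)
      define P2 Q2 where "P2 = (2::real) powr (p - 1)" and "Q2 = (2::real) powr (n + q)"
      have PQ: "0 < P2" "0 < Q2" by (auto simp: P2_def Q2_def)
      have L: "?H * (k / 2) * (c * (\<delta> * \<rho> powr n) * \<alpha>) = F * (\<delta> * \<alpha> / (2 * P2 * \<Lambda> * Q2))"
      proof -
        have "\<rho> powr (- n) * \<rho> powr n = 1" using \<rho> by (simp add: powr_minus)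
        then have "?H * (k / 2) * (c * (\<delta> * \<rho> powr n) * \<alpha>) =
          h powr (p - 1) * 2 powr (- (p - 1)) * (k / 2) * (inverse \<Lambda> * (2 powr (- (n + q)) * \<rho> powr (- q)) * \<delta> * \<alpha>)" unfolding e1 e3 by algebra
        also have "... = F * (\<delta> * \<alpha> / (2 * P2 * \<Lambda> * Q2))"
        proof -
          have i: "2 powr (- (p - 1)) = inverse P2" "2 powr (- (n + q)) = inverse Q2" by (simp_all only: P2_def Q2_def powr_minus)
          show ?thesis unfolding i F_def using PQ \<Lambda>_pos by (simp add: divide_simps)
        qed
        finally show ?thesis .
      qed
      have R: "C * (3 * k powr p * \<rho> powr (- q)) * (w * (2 powr n * \<rho> powr n)) = F * (3 * C * \<theta> powr (p - 1) * (w * 2 powr n) * \<rho> powr n)"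
        unfolding e2 by (simp add: F_def)
      have "\<delta> * \<alpha> / (2 * P2 * \<Lambda> * Q2) <= 3 * C * \<theta> powr (p - 1) * (w * 2 powr n) * \<rho> powr n"
        using real F unfolding L R by (rule mult_left_le_imp_le)
      then have "\<alpha> <= 3 * C * \<theta> powr (p - 1) * (w * 2 powr n) * \<rho> powr n * (2 * P2 * \<Lambda> * Q2) / \<delta>"
        using \<delta> PQ \<Lambda>_pos by (simp add: pos_divide_le_eq pos_le_divide_eq mult_ac)
      also have "... = C' * \<theta> powr (p - 1) * \<rho> powr n" by (simp add: C'_def P2_def Q2_def)
      finally show ?thesis .
    qed
    also have "... <= \<nu> * \<rho> powr n" by (intro mult_right_mono \<theta>\<nu>) simp
    finally have small: "measure lborel (sublevel v x0 \<rho> (k / 2)) <= \<nu> * \<rho> powr real DIM('a)" by (simp add: \<alpha>_def A0_def n_def)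
    have g': "growth_setting v x0 r \<rho> (k / 2)" by (rule growth_setting_mono[OF g]) (use \<theta> h in \<open>simp add: k_def\<close>)
    have ext': "AE x in lborel. x \<in> ball x0 \<rho> - \<Omega> --> k / 2 <= v x" using ext by eventually_elim (use k \<rho> in auto)
    have "AE x in lborel. x \<in> ball x0 (\<rho> / 2) --> k / 2 / 2 <= v x" by (rule \<nu>(2)[OF g' ext' small])
    then show "AE x in lborel. x \<in> ball x0 (\<rho> / 2) --> \<theta> / 4 * h <= v x" by (simp add: k_def)
  qed
qed

end

section \<open>Continuity up to the boundary\<close>

lemma AE_ball_ex:
  fixes x :: "'a::euclidean_space"
  assumes "AE y in lborel. P y" "0 < r"
  shows "\<exists>y\<in>ball x r. P y"
proof (rule ccontr)
  assume "\<not> ?thesis"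
  then have "AE y in lborel. y \<notin> ball x r" using assms(1) by (auto elim!: eventually_mono)
  then have "emeasure lborel (ball x r) = 0" by (subst (asm) AE_iff_null_sets[symmetric]) auto
  moreover have "0 < unit_ball_vol (real DIM('a))" by simp
  ultimately show False using assms(2) by (simp add: emeasure_ball)
qed

text \<open>Balls around neighbouring points overlap in a set of positive measure, so there is a
  point at which both approximations hold, and the limits at the two centres are close; this is
  continuity of \<open>L\<close>. Almost everywhere equality follows by covering \<open>G\<close>
  with countably many of the balls, for each precision \<open>1 / (m + 1)\<close>.\<close>

lemma essential_limit:
  fixes u L :: "'a::euclidean_space => real"
  assumes "open G" and lim: "!!x e. x \<in> G ==> 0 < e ==> \<exists>r>0. AE y in lborel. y \<in> ball x r --> \<bar>u y - L x\<bar> <= e"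
  shows "continuous_on G L" "AE x in lborel. x \<in> G --> u x = L x"
proof -
  have close: "\<exists>r>0. (AE y in lborel. y \<in> ball x r --> \<bar>u y - L x\<bar> <= e) \<and> (\<forall>x'\<in>ball x r \<inter> G. \<bar>L x' - L x\<bar> <= 2 * e)"
    if x: "x \<in> G" and e: "0 < e" for x e
  proof -
    obtain r where r: "0 < r" "AE y in lborel. y \<in> ball x r --> \<bar>u y - L x\<bar> <= e" using lim[OF x e] by blast
    have "\<bar>L x' - L x\<bar> <= 2 * e" if x': "x' \<in> ball x r \<inter> G" for x'
    proof -
      obtain r' where r': "0 < r'" "AE y in lborel. y \<in> ball x' r' --> \<bar>u y - L x'\<bar> <= e" using lim[of x' e] x' e by blast
      define d where "d = min r' (r - dist x x')"
      have d: "0 < d" using r' x' by (simp add: d_def)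
      have "AE y in lborel. (y \<in> ball x r --> \<bar>u y - L x\<bar> <= e) \<and> (y \<in> ball x' r' --> \<bar>u y - L x'\<bar> <= e)"
        using r(2) r'(2) by eventually_elim blast
      from AE_ball_ex[OF this d, of x'] obtain y where y: "y \<in> ball x' d"
        "y \<in> ball x r --> \<bar>u y - L x\<bar> <= e" "y \<in> ball x' r' --> \<bar>u y - L x'\<bar> <= e" by blast
      have "y \<in> ball x r" "y \<in> ball x' r'" using y(1) dist_triangle[of x y x'] by (auto simp: d_def)
      then show ?thesis using y by linarith
    qed
    then show ?thesis using r by blast
  qed
  show "continuous_on G L" unfolding continuous_on_iff
  proof (intro ballI allI impI)
    fix x e :: real and x0 assume x: "x0 \<in> G" and e: "(0::real) < e"
    obtain r where r: "0 < r" "\<forall>x'\<in>ball x0 r \<inter> G. \<bar>L x' - L x0\<bar> <= 2 * (e / 4)" using close[OF x, of "e / 4"] e by auto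
    show "\<exists>d>0. \<forall>x'\<in>G. dist x' x0 < d --> dist (L x') (L x0) < e"
    proof (intro exI[of _ r] conjI ballI impI)
      fix x' assume "x' \<in> G" "dist x' x0 < r"
      then have "\<bar>L x' - L x0\<bar> <= 2 * (e / 4)" using r by (auto simp: dist_commute)
      then show "dist (L x') (L x0) < e" using e by (simp add: dist_real_def)
    qed (rule r(1))
  qed
  have *: "AE x in lborel. x \<in> G --> \<bar>u x - L x\<bar> <= 3 * e" if e: "0 < e" for e
  proof -
    have "\<forall>x\<in>G. \<exists>r. 0 < r \<and> (AE y in lborel. y \<in> ball x r --> \<bar>u y - L x\<bar> <= e) \<and>
      (\<forall>x'\<in>ball x r \<inter> G. \<bar>L x' - L x\<bar> <= 2 * e)" using close[OF _ e] by (rule ballI)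
    from bchoice[OF this] obtain r where r: "\<forall>x\<in>G. 0 < r x \<and> (AE y in lborel. y \<in> ball x (r x) --> \<bar>u y - L x\<bar> <= e) \<and>
      (\<forall>x'\<in>ball x (r x) \<inter> G. \<bar>L x' - L x\<bar> <= 2 * e)" ..
    note r = bspec[OF r, THEN conjunct1] bspec[OF r, THEN conjunct2, THEN conjunct1]
      bspec[OF r, THEN conjunct2, THEN conjunct2, THEN bspec]
    obtain F where F: "F \<subseteq> (\<lambda>x. ball x (r x)) ` G" "countable F" "\<Union>F = \<Union>((\<lambda>x. ball x (r x)) ` G)"
      using Lindelof[of "(\<lambda>x. ball x (r x)) ` G"] by auto
    have "AE y in lborel. \<forall>B\<in>F. y \<in> B --> y \<in> G --> \<bar>u y - L y\<bar> <= 3 * e"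
    proof (subst AE_ball_countable[OF F(2)], rule ballI)
      fix B assume "B \<in> F"
      then obtain x where x: "x \<in> G" "B = ball x (r x)" using F by auto
      show "AE y in lborel. y \<in> B --> y \<in> G --> \<bar>u y - L y\<bar> <= 3 * e" using r(2)[OF x(1)]
      proof eventually_elim
        case (elim y) show ?case
        proof (intro impI)
          assume "y \<in> B" "y \<in> G"
          then show "\<bar>u y - L y\<bar> <= 3 * e" using elim r(3)[OF x(1), of y] x by auto
        qed
      qed
    qed
    moreover have "G \<subseteq> \<Union>F" unfolding F(3) using r(1) by force
    ultimately show ?thesis by (auto elim!: eventually_mono)
  qed
  have "AE x in lborel. \<forall>m. x \<in> G --> \<bar>u x - L x\<bar> <= 3 * inverse (real (Suc m))" unfolding AE_all_countable using * by simp
  then show "AE x in lborel. x \<in> G --> u x = L x"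
  proof eventually_elim
    case (elim x) show ?case
    proof
      assume "x \<in> G"
      with elim have "\<bar>u x - L x\<bar> <= 3 * inverse (real (Suc m))" for m by blast
      moreover have "(\<lambda>m. 3 * inverse (real (Suc m))) \<longlonglongrightarrow> 0" using tendsto_mult[OF tendsto_const LIMSEQ_inverse_real_of_nat, of 3] by simp
      ultimately have "\<bar>u x - L x\<bar> <= 0" by (rule_tac LIMSEQ_le_const) blast+
      then show "u x = L x" by simp
    qed
  qed
qed

text \<open>\<open>m\<close> is the essential limit superior at \<open>x\<close>. The second clause,
  that no ball has an essential upper bound below \<open>m\<close>, is the form in which
  contradictions are reached.\<close>

lemma essential_upper_limit:
  fixes u :: "'a::euclidean_space => real"
  assumes r1: "0 < r1" and bd: "!!y. y \<in> ball x r1 ==> \<bar>u y\<bar> <= M"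
  shows "\<exists>m. (\<forall>e>0. \<exists>r>0. AE y in lborel. y \<in> ball x r --> u y <= m + e) \<and>
    (\<forall>c r. 0 < r --> (AE y in lborel. y \<in> ball x r --> u y <= c) --> m <= c)"
proof -
  define B where "B = {c. \<exists>r>0. AE y in lborel. y \<in> ball x r --> u y <= c}"
  have "M \<in> B" unfolding B_def using r1 bd by (auto intro!: exI[of _ r1] AE_I2 simp: abs_le_iff)
  then have ne: "B \<noteq> {}" by auto
  have low: "- M <= c" if "c \<in> B" for c
  proof -
    obtain r where r: "0 < r" "AE y in lborel. y \<in> ball x r --> u y <= c" using \<open>c \<in> B\<close> by (auto simp: B_def)
    obtain y where "y \<in> ball x (min r r1)" "y \<in> ball x r --> u y <= c" using AE_ball_ex[OF r(2), of "min r r1" x] r r1 by auto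
    then show ?thesis using bd[of y] by auto
  qed
  then have bb: "bdd_below B" by (intro bdd_belowI[of B "- M"])
  show ?thesis
  proof (rule exI[of _ "Inf B"], intro conjI allI impI)
    fix e :: real assume "0 < e"
    then obtain c where c: "c \<in> B" "c < Inf B + e" using cInf_lessD[OF ne, of "Inf B + e"] by auto
    then obtain r where r: "0 < r" "AE y in lborel. y \<in> ball x r --> u y <= c" by (auto simp: B_def)
    from r(2) have "AE y in lborel. y \<in> ball x r --> u y <= Inf B + e" by eventually_elim (use c in auto)
    then show "\<exists>r>0. AE y in lborel. y \<in> ball x r --> u y <= Inf B + e" using r(1) by blast
  next
    fix c r assume "(0::real) < r" "AE y in lborel. y \<in> ball x r --> u y <= c"
    then have "c \<in> B" by (auto simp: B_def)
    then show "Inf B <= c" using bb by (rule cInf_lower)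
  qed
qed

section \<open>Vanishing oscillation of solutions\<close>

context dirichlet_domain
begin

text \<open>The tail outside the fixed ball of radius \<open>r\<close> is a finite number, while the
  permitted size \<open>\<rho> powr (- q) * \<kappa> powr (p - 1)\<close> tends to infinity as
  \<open>\<rho>\<close> tends to 0. Hence every finite tail becomes admissible at small
  radii.\<close>

lemma growth_setting_exists:
  assumes sol: "solution v" and r: "0 < r" "ball x0 r \<subseteq> N" and v0: "AE x in lborel. x \<in> ball x0 r --> 0 <= v x"
    and \<kappa>: "0 < \<kappa>"
  obtains \<rho>0 where "0 < \<rho>0" "!!\<rho>. 0 < \<rho> ==> \<rho> < \<rho>0 ==> growth_setting v x0 r \<rho> \<kappa>"
proof -
  have [measurable]: "v \<in> borel_measurable borel" using sol by measurable
  have "!!x. x \<in> ball x0 (r / 2) ==> ball x (r / 2) \<subseteq> ball x0 r"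
  proof
    fix x y assume "x \<in> ball x0 (r / 2)" "y \<in> ball x (r / 2)"
    then show "y \<in> ball x0 r" using dist_triangle[of x0 y x] by simp
  qed
  from K_le_tail_weight[OF bounded_ball _ this] r
  obtain C where C: "0 < C" "!!x y. x \<in> ball x0 (r / 2) ==> y \<notin> ball x0 r ==> K x y <= C * tail_weight q y" by (metis half_gt_zero)
  have "(\<integral>\<^sup>+y. ennreal (\<bar>v y\<bar> powr (p - 1)) * ennreal (tail_weight q y) \<partial>lborel) < \<infinity>" using sol by (auto simp: solution_def finite_tail_def)
  then obtain T where T: "0 <= T" "(\<integral>\<^sup>+y. ennreal (\<bar>v y\<bar> powr (p - 1)) * ennreal (tail_weight q y) \<partial>lborel) = ennreal T"
    by (cases "\<integral>\<^sup>+y. ennreal (\<bar>v y\<bar> powr (p - 1)) * ennreal (tail_weight q y) \<partial>lborel" rule: ennreal_cases) auto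
  have bd: "(\<integral>\<^sup>+y. ennreal (K x y) * ennreal (max (- v y) 0 powr (p - 1)) * indicator (- ball x0 r) y \<partial>lborel) <= ennreal (C * T)"
    if x: "x \<in> ball x0 (r / 2)" for x
  proof -
    have "(\<integral>\<^sup>+y. ennreal (K x y) * ennreal (max (- v y) 0 powr (p - 1)) * indicator (- ball x0 r) y \<partial>lborel) <=
      (\<integral>\<^sup>+y. ennreal C * (ennreal (\<bar>v y\<bar> powr (p - 1)) * ennreal (tail_weight q y)) \<partial>lborel)"
    proof (rule nn_integral_mono)
      fix y
      show "ennreal (K x y) * ennreal (max (- v y) 0 powr (p - 1)) * indicator (- ball x0 r) y <=
        ennreal C * (ennreal (\<bar>v y\<bar> powr (p - 1)) * ennreal (tail_weight q y))"
      proof (cases "y \<in> ball x0 r")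
        case False have "max (- v y) 0 powr (p - 1) <= \<bar>v y\<bar> powr (p - 1)" using p_gt by (intro powr_mono2) auto
        with C(2)[OF x False] have "K x y * max (- v y) 0 powr (p - 1) <= (C * tail_weight q y) * \<bar>v y\<bar> powr (p - 1)"
          using C(1) by (intro mult_mono) auto
        then show ?thesis using False C(1) by (simp add: ennreal_mult[symmetric] mult_ac ennreal_leI)
      qed simp
    qed
    also have "... = ennreal C * ennreal T" unfolding T(2)[symmetric] by (rule nn_integral_cmult) measurable
    finally show ?thesis using C T by (simp add: ennreal_mult)
  qed
  \<comment> \<open>The tail condition follows from \<open>\<rho> powr q <= X\<close>; the summand 1
    keeps the denominator positive when the tail vanishes.\<close>
  define X where "X = \<kappa> powr (p - 1) / (C * T + 1)"
  have CT: "0 < C * T + 1" using C T by (simp add: add_nonneg_pos)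
  have X: "0 < X" using CT \<kappa> by (simp add: X_def)
  show ?thesis
  proof (rule that[of "min (r / 4) (X powr (1 / q))"])
    show "0 < min (r / 4) (X powr (1 / q))" using r X by simp
    fix \<rho> assume \<rho>: "0 < \<rho>" "\<rho> < min (r / 4) (X powr (1 / q))"
    have "\<rho> powr q <= (X powr (1 / q)) powr q" using \<rho> q_pos by (intro powr_mono2) auto
    also have "... = X"
    proof -
      have "1 / q * q = 1" using q_pos by (metis less_irrefl nonzero_eq_divide_eq)
      then show ?thesis unfolding powr_powr using X by simp
    qed
    finally have "C * T + 1 <= \<kappa> powr (p - 1) / \<rho> powr q" using CT \<rho> by (simp add: X_def field_simps)
    then have "C * T <= \<rho> powr (- q) * \<kappa> powr (p - 1)" by (simp add: powr_minus field_simps)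
    then have "\<forall>x\<in>ball x0 (2 * \<rho>). (\<integral>\<^sup>+y. ennreal (K x y) * ennreal (max (- v y) 0 powr (p - 1)) * indicator (- ball x0 r) y \<partial>lborel)
      <= ennreal (\<rho> powr (- q) * \<kappa> powr (p - 1))" using \<rho> by (intro ballI order_trans[OF bd ennreal_leI]) auto
    then show "growth_setting v x0 r \<rho> \<kappa>" unfolding growth_setting_def using sol \<kappa> \<rho> r v0 by auto
  qed
qed

text \<open>Density is required only along arbitrarily small radii, since a single good radius
  suffices. This matters in the interior, where it may vary with the radius which of two
  complementary sets is the large one.\<close>

lemma lower_bound_improvement:
  assumes \<delta>: "0 < \<delta>"
  obtains \<tau> where "0 < \<tau>" "\<tau> < 1" "!!v x0 r h. solution v ==> 0 < h ==> 0 < r ==> ball x0 r \<subseteq> N ==>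
     AE x in lborel. x \<in> ball x0 r --> 0 <= v x ==> AE x in lborel. x \<in> ball x0 r - \<Omega> --> h <= v x ==>
     (!!\<rho>1. 0 < \<rho>1 ==> \<exists>\<rho>. 0 < \<rho> \<and> \<rho> < \<rho>1 \<and> ennreal (\<delta> * \<rho> powr real DIM('a)) <= emeasure lborel {x \<in> ball x0 \<rho>. h <= v x}) ==>
     \<exists>r'>0. AE x in lborel. x \<in> ball x0 r' --> \<tau> * h <= v x"
proof -
  obtain \<tau> where \<tau>: "0 < \<tau>" "\<tau> < 1" "!!v x0 r \<rho> h. 0 < h ==> growth_setting v x0 r \<rho> (\<tau> * h) ==>
     AE x in lborel. x \<in> ball x0 (2 * \<rho>) - \<Omega> --> h <= v x ==>
     ennreal (\<delta> * \<rho> powr real DIM('a)) <= emeasure lborel {x \<in> ball x0 \<rho>. h <= v x} ==>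
     AE x in lborel. x \<in> ball x0 (\<rho> / 2) --> \<tau> * h <= v x" by (rule growth_lemma[OF \<delta>]) blast
  show ?thesis
  proof (rule that[OF \<tau>(1,2)])
    fix v x0 r h
    assume sol: "solution v" and h: "0 < h" and r: "0 < r" "ball x0 r \<subseteq> N"
      and v0: "AE x in lborel. x \<in> ball x0 r --> 0 <= v x" and ext: "AE x in lborel. x \<in> ball x0 r - \<Omega> --> h <= v x"
      and dens: "!!\<rho>1. 0 < \<rho>1 ==> \<exists>\<rho>. 0 < \<rho> \<and> \<rho> < \<rho>1 \<and> ennreal (\<delta> * \<rho> powr real DIM('a)) <= emeasure lborel {x \<in> ball x0 \<rho>. h <= v x}"
    have "0 < \<tau> * h" using \<tau> h by simp
    then obtain \<rho>0 where \<rho>0: "0 < \<rho>0" "!!\<rho>. 0 < \<rho> ==> \<rho> < \<rho>0 ==> growth_setting v x0 r \<rho> (\<tau> * h)"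
      by (rule growth_setting_exists[OF sol r v0]) blast
    obtain \<rho> where \<rho>: "0 < \<rho>" "\<rho> < \<rho>0" "ennreal (\<delta> * \<rho> powr real DIM('a)) <= emeasure lborel {x \<in> ball x0 \<rho>. h <= v x}"
      using dens[OF \<rho>0(1)] by blast
    have g: "growth_setting v x0 r \<rho> (\<tau> * h)" by (rule \<rho>0(2)[OF \<rho>(1,2)])
    then have "2 * \<rho> <= r" using \<rho> by (auto simp: growth_setting_def)
    from ext have "AE x in lborel. x \<in> ball x0 (2 * \<rho>) - \<Omega> --> h <= v x" by eventually_elim (use \<open>2 * \<rho> <= r\<close> in auto)
    from \<tau>(3)[OF h g this \<rho>(3)] show "\<exists>r'>0. AE x in lborel. x \<in> ball x0 r' --> \<tau> * h <= v x" using \<rho>(1) by (intro exI[of _ "\<rho> / 2"]) auto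
  qed
qed

lemma solution_bounded_near:
  assumes "solution v" "x0 \<in> interior N"
  obtains r M where "0 < r" "ball x0 r \<subseteq> N" "!!y. y \<in> ball x0 r ==> \<bar>v y\<bar> <= M"
proof -
  obtain r where r: "0 < r" "ball x0 r \<subseteq> N" using assms(2) by (auto simp: mem_interior)
  obtain M where "\<forall>x\<in>N. \<bar>v x\<bar> <= M" using assms(1) by (auto simp: solution_def finite_energy_def)
  then show ?thesis using r by (intro that[of r M]) auto
qed

text \<open>Here \<open>mu\<close> and \<open>- ml'\<close> are the essential limits superior and
  inferior. If they differed, then one of the sets above and below the middle value would fill half
  of the ball for arbitrarily small radii; accordingly the limit inferior could be raised or the
  limit superior lowered.\<close>

lemma interior_limit:
  assumes sol: "solution u" and x0: "x0 \<in> \<Omega>"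
  shows "\<exists>l. \<forall>e>0. \<exists>r>0. AE y in lborel. y \<in> ball x0 r --> \<bar>u y - l\<bar> <= e"
proof -
  have [measurable]: "u \<in> borel_measurable borel" using sol by measurable
  have x0N: "x0 \<in> interior N" using x0 ball_\<Omega>[OF x0] d0_pos by (auto simp: mem_interior)
  obtain r1 M where r1: "0 < r1" "ball x0 r1 \<subseteq> N" "!!y. y \<in> ball x0 r1 ==> \<bar>u y\<bar> <= M" using solution_bounded_near[OF sol x0N] by blast
  obtain r2 where r2: "0 < r2" "ball x0 r2 \<subseteq> \<Omega>" using open_\<Omega> x0 by (auto simp: open_contains_ball)
  from essential_upper_limit[OF r1(1,3)] obtain mu where
    mu: "(\<forall>e>0. \<exists>r>0. AE y in lborel. y \<in> ball x0 r --> u y <= mu + e) \<and>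
    (\<forall>c r. 0 < r --> (AE y in lborel. y \<in> ball x0 r --> u y <= c) --> mu <= c)" ..
  note mu = conjunct1[OF mu, rule_format] conjunct2[OF mu, rule_format]
  have "!!y. y \<in> ball x0 r1 ==> \<bar>- u y\<bar> <= M" using r1(3) by simp
  from essential_upper_limit[OF r1(1) this] obtain ml' where
    ml': "(\<forall>e>0. \<exists>r>0. AE y in lborel. y \<in> ball x0 r --> - u y <= ml' + e) \<and>
    (\<forall>c r. 0 < r --> (AE y in lborel. y \<in> ball x0 r --> - u y <= c) --> ml' <= c)" ..
  note ml' = conjunct1[OF ml', rule_format] conjunct2[OF ml', rule_format]
  have le: "mu <= - ml'"
  proof (rule ccontr)
    assume neg: "\<not> ?thesis"
    \<comment> \<open>Half the gap between the two limits: on the respective half set,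
      \<open>u\<close> differs by at least \<open>h\<close> from the limit that is to be
      improved.\<close>
    define h where "h = (mu + ml') / 2"
    have h: "0 < h" using neg by (simp add: h_def)
    define w where "w = unit_ball_vol (real DIM('a))"
    have w: "0 < w / 2" by (simp add: w_def)
    obtain \<tau> where \<tau>: "0 < \<tau>" "\<tau> < 1" "!!v x0 r h. solution v ==> 0 < h ==> 0 < r ==> ball x0 r \<subseteq> N ==>
     AE x in lborel. x \<in> ball x0 r --> 0 <= v x ==> AE x in lborel. x \<in> ball x0 r - \<Omega> --> h <= v x ==>
     (!!\<rho>1. 0 < \<rho>1 ==> \<exists>\<rho>. 0 < \<rho> \<and> \<rho> < \<rho>1 \<and> ennreal (w / 2 * \<rho> powr real DIM('a)) <= emeasure lborel {x \<in> ball x0 \<rho>. h <= v x}) ==>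
     \<exists>r'>0. AE x in lborel. x \<in> ball x0 r' --> \<tau> * h <= v x" by (rule lower_bound_improvement[OF w]) blast
    \<comment> \<open>The slack \<open>e\<close> makes the shifted function nonnegative near
      \<open>x0\<close>. The gain \<open>\<tau> * h\<close> is twice the slack, so the limit
      improves by \<open>e\<close>.\<close>
    define e where "e = \<tau> * h / 2"
    have e: "0 < e" using \<tau> h by (simp add: e_def)
    obtain r3 where r3: "0 < r3" "AE y in lborel. y \<in> ball x0 r3 --> u y <= mu + e" using mu(1)[OF e] by blast
    obtain r4 where r4: "0 < r4" "AE y in lborel. y \<in> ball x0 r4 --> - u y <= ml' + e" using ml'(1)[OF e] by blast
    define r where "r = min r2 (min r3 r4)"
    have r: "0 < r" "ball x0 r \<subseteq> \<Omega>" using r2 r3 r4 by (auto simp: r_def)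
    have rN: "ball x0 r \<subseteq> N" using r \<Omega>_subset_N by blast
    define mid where "mid = (mu - ml') / 2"
    let ?D = "\<lambda>X \<rho>. ennreal (w / 2 * \<rho> powr real DIM('a)) <= emeasure lborel (X \<inter> ball x0 \<rho>)"
    have up: "{x. mid <= u x} \<in> sets borel" "{x. u x <= mid} \<in> sets borel" by measurable
    have half: "?D {x. mid <= u x} \<rho> \<or> ?D {x. u x <= mid} \<rho>" if \<rho>: "0 < \<rho>" for \<rho>
    proof (rule ccontr)
      assume "\<not> ?thesis"
      then have "emeasure lborel ({x. mid <= u x} \<inter> ball x0 \<rho>) + emeasure lborel ({x. u x <= mid} \<inter> ball x0 \<rho>)
        < ennreal (w / 2 * \<rho> powr real DIM('a)) + ennreal (w / 2 * \<rho> powr real DIM('a))" by (intro add_strict_mono) (auto simp: not_le)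
      also have "... = ennreal (w * \<rho> powr real DIM('a))" using w by (simp flip: ennreal_plus)
      also have "... = emeasure lborel (ball x0 \<rho>)" using \<rho> by (simp add: emeasure_ball_powr w_def)
      also have "... <= emeasure lborel (({x. mid <= u x} \<inter> ball x0 \<rho>) \<union> ({x. u x <= mid} \<inter> ball x0 \<rho>))" using up by (intro emeasure_mono) auto
      also have "... <= emeasure lborel ({x. mid <= u x} \<inter> ball x0 \<rho>) + emeasure lborel ({x. u x <= mid} \<inter> ball x0 \<rho>)"
        using up by (intro emeasure_subadditive) auto
      finally show False by simp
    qed
    have freq: "(\<forall>\<rho>1>0. \<exists>\<rho>. 0 < \<rho> \<and> \<rho> < \<rho>1 \<and> ?D {x. mid <= u x} \<rho>) \<or> (\<forall>\<rho>1>0. \<exists>\<rho>. 0 < \<rho> \<and> \<rho> < \<rho>1 \<and> ?D {x. u x <= mid} \<rho>)"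
    proof (rule ccontr)
      assume "\<not> ?thesis"
      then obtain a b where ab: "0 < a" "!!\<rho>. 0 < \<rho> ==> \<rho> < a ==> \<not> ?D {x. mid <= u x} \<rho>"
        "0 < b" "!!\<rho>. 0 < \<rho> ==> \<rho> < b ==> \<not> ?D {x. u x <= mid} \<rho>" by blast
      then show False using half[of "min a b / 2"] ab(2)[of "min a b / 2"] ab(4)[of "min a b / 2"] by auto
    qed
    have dens: "\<exists>\<rho>. 0 < \<rho> \<and> \<rho> < \<rho>1 \<and> ennreal (w / 2 * \<rho> powr real DIM('a)) <= emeasure lborel {x \<in> ball x0 \<rho>. h <= v x}"
      if X: "\<forall>\<rho>1>0. \<exists>\<rho>. 0 < \<rho> \<and> \<rho> < \<rho>1 \<and> ?D X \<rho>" and sub: "!!x. x \<in> X ==> h <= v x" and v: "v \<in> borel_measurable borel" and "0 < \<rho>1" for X v \<rho>1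
    proof -
      obtain \<rho> where \<rho>: "0 < \<rho>" "\<rho> < \<rho>1" "?D X \<rho>" using X \<open>0 < \<rho>1\<close> by blast
      note [measurable] = v
      have "{x \<in> space borel. x \<in> ball x0 \<rho> \<and> h <= v x} \<in> sets borel" by measurable
      then have "emeasure lborel (X \<inter> ball x0 \<rho>) <= emeasure lborel {x \<in> ball x0 \<rho>. h <= v x}" using sub by (intro emeasure_mono) auto
      then show ?thesis using \<rho> by (meson order_trans)
    qed
    have ext: "AE x in lborel. x \<in> ball x0 r - \<Omega> --> h <= v x" for v using r by (intro AE_I2) auto
    show False using freq
    proof
      assume X: "\<forall>\<rho>1>0. \<exists>\<rho>. 0 < \<rho> \<and> \<rho> < \<rho>1 \<and> ?D {x. mid <= u x} \<rho>"
      define v where "v = (\<lambda>x. (ml' + e) + u x)"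
      have vs: "solution v" unfolding v_def by (rule solution_shift[OF sol])
      have v0: "AE x in lborel. x \<in> ball x0 r --> 0 <= v x" using r4(2) by eventually_elim (auto simp: v_def r_def)
      have "h <= v x" if "x \<in> {x. mid <= u x}" for x using that e by (auto simp: v_def h_def mid_def field_simps)
      from dens[OF X this solution_measurable[OF vs]] have "\<exists>r'>0. AE x in lborel. x \<in> ball x0 r' --> \<tau> * h <= v x"
        by (intro \<tau>(3)[OF vs h r(1) rN v0 ext])
      then obtain r' where r': "0 < r'" "AE x in lborel. x \<in> ball x0 r' --> \<tau> * h <= v x" by blast
      from r'(2) have "AE x in lborel. x \<in> ball x0 r' --> - u x <= ml' - e" by eventually_elim (auto simp: v_def e_def)
      from ml'(2)[OF r'(1) this] show False using e by simp
    next
      assume X: "\<forall>\<rho>1>0. \<exists>\<rho>. 0 < \<rho> \<and> \<rho> < \<rho>1 \<and> ?D {x. u x <= mid} \<rho>"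
      define v where "v = (\<lambda>x. (mu + e) - u x)"
      have vs: "solution v" unfolding v_def by (rule solution_minus[OF sol])
      have v0: "AE x in lborel. x \<in> ball x0 r --> 0 <= v x" using r3(2) by eventually_elim (auto simp: v_def r_def)
      have "h <= v x" if "x \<in> {x. u x <= mid}" for x using that e by (auto simp: v_def h_def mid_def field_simps)
      from dens[OF X this solution_measurable[OF vs]] have "\<exists>r'>0. AE x in lborel. x \<in> ball x0 r' --> \<tau> * h <= v x"
        by (intro \<tau>(3)[OF vs h r(1) rN v0 ext])
      then obtain r' where r': "0 < r'" "AE x in lborel. x \<in> ball x0 r' --> \<tau> * h <= v x" by blast
      from r'(2) have "AE x in lborel. x \<in> ball x0 r' --> u x <= mu - e" by eventually_elim (auto simp: v_def e_def)
      from mu(2)[OF r'(1) this] show False using e by simp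
    qed
  qed
  show ?thesis
  proof (rule exI[of _ mu], intro allI impI)
    fix e :: real assume e: "0 < e"
    obtain r3 where r3: "0 < r3" "AE y in lborel. y \<in> ball x0 r3 --> u y <= mu + e" using mu(1)[OF e] by blast
    obtain r4 where r4: "0 < r4" "AE y in lborel. y \<in> ball x0 r4 --> - u y <= ml' + e" using ml'(1)[OF e] by blast
    have "AE y in lborel. y \<in> ball x0 (min r3 r4) --> \<bar>u y - mu\<bar> <= e" using r3(2) r4(2)
    proof eventually_elim
      case (elim y) then show ?case using le by auto
    qed
    then show "\<exists>r>0. AE y in lborel. y \<in> ball x0 r --> \<bar>u y - mu\<bar> <= e" using r3 r4 by (intro exI[of _ "min r3 r4"]) auto
  qed
qed

definition exterior_density :: "real => bool" where
  "exterior_density \<delta> \<longleftrightarrow> (\<exists>r0>0. \<forall>x0\<in>frontier \<Omega>. \<forall>\<rho>. 0 < \<rho> --> \<rho> < r0 -->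
    ennreal (\<delta> * \<rho> powr real DIM('a)) <= emeasure lborel (ball x0 \<rho> - \<Omega>))"

text \<open>If the limit superior exceeded \<open>g x0\<close>, then \<open>mu + e - u\<close> would
  be at least \<open>h\<close> at all nearby points outside \<Omega>, by continuity of
  \<open>g\<close>. The exterior thus supplies both the pointwise condition off \<Omega> and,
  through its density, the large set that the growth lemma requires.\<close>

lemma boundary_upper_limit:
  assumes sol: "solution u" and x0: "x0 \<in> frontier \<Omega>" "x0 \<in> interior N" and \<delta>: "0 < \<delta>" "exterior_density \<delta>"
    and ug: "!!x. x \<notin> \<Omega> ==> u x = g x" and g: "isCont g x0" and e: "0 < e"
  shows "\<exists>r>0. AE y in lborel. y \<in> ball x0 r --> u y <= g x0 + e"
proof -
  have [measurable]: "u \<in> borel_measurable borel" using sol by measurable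
  obtain r1 M where r1: "0 < r1" "ball x0 r1 \<subseteq> N" "!!y. y \<in> ball x0 r1 ==> \<bar>u y\<bar> <= M" using solution_bounded_near[OF sol x0(2)] by blast
  from essential_upper_limit[OF r1(1,3)] obtain mu where
    mu: "(\<forall>e>0. \<exists>r>0. AE y in lborel. y \<in> ball x0 r --> u y <= mu + e) \<and>
    (\<forall>c r. 0 < r --> (AE y in lborel. y \<in> ball x0 r --> u y <= c) --> mu <= c)" ..
  note mu = conjunct1[OF mu, rule_format] conjunct2[OF mu, rule_format]
  have le: "mu <= g x0"
  proof (rule ccontr)
    assume neg: "\<not> ?thesis"
    define h where "h = (mu - g x0) / 2"
    have h: "0 < h" using neg by (simp add: h_def)
    obtain \<tau> where \<tau>: "0 < \<tau>" "\<tau> < 1" "!!v x0 r h. solution v ==> 0 < h ==> 0 < r ==> ball x0 r \<subseteq> N ==>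
     AE x in lborel. x \<in> ball x0 r --> 0 <= v x ==> AE x in lborel. x \<in> ball x0 r - \<Omega> --> h <= v x ==>
     (!!\<rho>1. 0 < \<rho>1 ==> \<exists>\<rho>. 0 < \<rho> \<and> \<rho> < \<rho>1 \<and> ennreal (\<delta> * \<rho> powr real DIM('a)) <= emeasure lborel {x \<in> ball x0 \<rho>. h <= v x}) ==>
     \<exists>r'>0. AE x in lborel. x \<in> ball x0 r' --> \<tau> * h <= v x" by (rule lower_bound_improvement[OF \<delta>(1)]) blast
    define e where "e = \<tau> * h / 2"
    have e: "0 < e" using \<tau> h by (simp add: e_def)
    obtain r3 where r3: "0 < r3" "AE y in lborel. y \<in> ball x0 r3 --> u y <= mu + e" using mu(1)[OF e] by blast
    obtain r2 where r2: "0 < r2" "!!y. dist y x0 < r2 ==> \<bar>g y - g x0\<bar> < h" using g h unfolding continuous_at_eps_delta dist_real_def by blast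
    define r where "r = min r1 (min r2 r3)"
    have r: "0 < r" "ball x0 r \<subseteq> N" using r1 r2 r3 by (auto simp: r_def)
    define v where "v = (\<lambda>x. (mu + e) - u x)"
    have vs: "solution v" unfolding v_def by (rule solution_minus[OF sol])
    note [measurable] = solution_measurable[OF vs]
    have v0: "AE x in lborel. x \<in> ball x0 r --> 0 <= v x" using r3(2) by eventually_elim (auto simp: v_def r_def)
    have ext: "h <= v x" if "x \<in> ball x0 r - \<Omega>" for x
    proof -
      have "u x = g x" using ug that by auto
      moreover have "\<bar>g x - g x0\<bar> < h" using that by (intro r2(2)) (auto simp: r_def dist_commute)
      then have "g x - g x0 < h" by (simp add: abs_less_iff)
      ultimately show ?thesis using e by (simp add: v_def h_def field_simps)
    qed
    obtain r0 where r0: "0 < r0" "!!\<rho>. 0 < \<rho> ==> \<rho> < r0 ==> ennreal (\<delta> * \<rho> powr real DIM('a)) <= emeasure lborel (ball x0 \<rho> - \<Omega>)"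
      using \<delta>(2) x0(1) by (auto simp: exterior_density_def)
    have "\<exists>r'>0. AE x in lborel. x \<in> ball x0 r' --> \<tau> * h <= v x"
    proof (rule \<tau>(3)[OF vs h r v0])
      show "AE x in lborel. x \<in> ball x0 r - \<Omega> --> h <= v x" using ext by (intro AE_I2) auto
      fix \<rho>1 :: real assume \<rho>1: "0 < \<rho>1"
      define \<rho> where "\<rho> = min \<rho>1 (min r r0) / 2"
      have \<rho>: "0 < \<rho>" "\<rho> < \<rho>1" "\<rho> < r" "\<rho> < r0" using \<rho>1 r r0 by (auto simp: \<rho>_def)
      have "{x \<in> space borel. x \<in> ball x0 \<rho> \<and> h <= v x} \<in> sets borel" by measurable
      then have "emeasure lborel (ball x0 \<rho> - \<Omega>) <= emeasure lborel {x \<in> ball x0 \<rho>. h <= v x}" using ext \<rho> by (intro emeasure_mono) auto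
      with r0(2)[OF \<rho>(1,4)] show "\<exists>\<rho>. 0 < \<rho> \<and> \<rho> < \<rho>1 \<and> ennreal (\<delta> * \<rho> powr real DIM('a)) <= emeasure lborel {x \<in> ball x0 \<rho>. h <= v x}"
        using \<rho> by (meson order_trans)
    qed
    then obtain r' where r': "0 < r'" "AE x in lborel. x \<in> ball x0 r' --> \<tau> * h <= v x" by blast
    from r'(2) have "AE x in lborel. x \<in> ball x0 r' --> u x <= mu - e" by eventually_elim (auto simp: v_def e_def)
    from mu(2)[OF r'(1) this] show False using e by simp
  qed
  obtain r3 where r3: "0 < r3" "AE y in lborel. y \<in> ball x0 r3 --> u y <= mu + e" using mu(1)[OF e] by blast
  from r3(2) have "AE y in lborel. y \<in> ball x0 r3 --> u y <= g x0 + e" by eventually_elim (use le in auto)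
  then show ?thesis using r3(1) by blast
qed

lemma boundary_limit:
  assumes sol: "solution u" and x0: "x0 \<in> frontier \<Omega>" "x0 \<in> interior N" and \<delta>: "0 < \<delta>" "exterior_density \<delta>"
    and ug: "!!x. x \<notin> \<Omega> ==> u x = g x" and g: "isCont g x0" and e: "0 < e"
  shows "\<exists>r>0. AE y in lborel. y \<in> ball x0 r --> \<bar>u y - g x0\<bar> <= e"
proof -
  obtain r1 where r1: "0 < r1" "AE y in lborel. y \<in> ball x0 r1 --> u y <= g x0 + e" using boundary_upper_limit[OF assms] by blast
  obtain r2 where r2: "0 < r2" "AE y in lborel. y \<in> ball x0 r2 --> - u y <= - g x0 + e"
    using boundary_upper_limit[OF solution_uminus[OF sol] x0 \<delta>, of "\<lambda>x. - g x" e] ug g e by auto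
  have "AE y in lborel. y \<in> ball x0 (min r1 r2) --> \<bar>u y - g x0\<bar> <= e" using r1(2) r2(2) by eventually_elim auto
  then show ?thesis using r1 r2 by (intro exI[of _ "min r1 r2"]) auto
qed

theorem solution_continuous_version:
  assumes sol: "solution u" and \<delta>: "0 < \<delta>" "exterior_density \<delta>"
    and ug: "!!x. x \<notin> \<Omega> ==> u x = g x" and g: "continuous_on (interior N) g"
  obtains U where "continuous_on (interior N) U" "AE x in lborel. x \<in> interior N --> u x = U x"
    "!!x. x \<in> interior N - \<Omega> ==> U x = g x"
proof -
  have ex: "\<exists>l. (x \<notin> \<Omega> --> l = g x) \<and> (\<forall>e>0. \<exists>r>0. AE y in lborel. y \<in> ball x r --> \<bar>u y - l\<bar> <= e)"
    if x: "x \<in> interior N" for x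
  proof -
    have gx: "isCont g x" using g x continuous_on_eq_continuous_at[OF open_interior] by blast
    consider "x \<in> \<Omega>" | "x \<in> frontier \<Omega>" "x \<notin> \<Omega>" | "x \<notin> closure \<Omega>" using open_\<Omega> by (auto simp: frontier_def interior_open)
    then show ?thesis
    proof cases
      case 1 then show ?thesis using interior_limit[OF sol 1] by blast
    next
      case 2 then show ?thesis using boundary_limit[OF sol 2(1) x \<delta> ug gx] by blast
    next
      case 3 have "\<exists>r>0. AE y in lborel. y \<in> ball x r --> \<bar>u y - g x\<bar> <= e" if e: "0 < e" for e
      proof -
        obtain r1 where r1: "0 < r1" "!!y. dist y x < r1 ==> \<bar>g y - g x\<bar> < e" using gx e unfolding continuous_at_eps_delta dist_real_def by blast
        have "open (- closure \<Omega>)" by (simp add: open_Compl)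
        then obtain r2 where r2: "0 < r2" "ball x r2 \<subseteq> - closure \<Omega>" using 3 by (auto simp: open_contains_ball)
        have "\<bar>u y - g x\<bar> <= e" if y: "y \<in> ball x (min r1 r2)" for y
        proof -
          have "y \<notin> \<Omega>" using y r2(2) closure_subset[of \<Omega>] by auto
          then show ?thesis using ug r1(2)[of y] y by (auto simp: dist_commute)
        qed
        then show ?thesis using r1 r2 by (intro exI[of _ "min r1 r2"]) auto
      qed
      then show ?thesis using 3 closure_subset by blast
    qed
  qed
  then obtain U where U: "!!x. x \<in> interior N ==> x \<notin> \<Omega> ==> U x = g x"
    "!!x e. x \<in> interior N ==> 0 < e ==> \<exists>r>0. AE y in lborel. y \<in> ball x r --> \<bar>u y - U x\<bar> <= e" by metis
  show ?thesis by (rule that[of U]) (use essential_limit[OF open_interior U(2)] U(1) in auto)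
qed

end

section \<open>Existence for boundary data of finite energy\<close>

context nonlocal_kernel
begin

text \<open>The function \<open>\<eta>\<close> is nondecreasing in \<open>v - w\<close>, so whenever
  its jump is nonzero it has the sign of the difference of the jumps of \<open>v\<close> and
  \<open>w\<close>. Strict monotonicity of \<open>Jp\<close> then identifies the case of
  equality.\<close>

lemma form_diff_nonneg:
  assumes "\<eta> = (\<lambda>x. max (v x - w x - e) 0)"
  shows "0 <= form v \<eta> z - form w \<eta> z" "form v \<eta> z - form w \<eta> z = 0 ==> \<eta> (fst z) = \<eta> (snd z)"
proof -
  define a b where "a = v (fst z) - v (snd z)" and "b = w (fst z) - w (snd z)"
  have eq: "form v \<eta> z - form w \<eta> z = (Jp p a - Jp p b) * (jump \<eta> z)" by (simp add: form_def a_def b_def algebra_simps)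
  have 1: "b < a" if "\<eta> (snd z) < \<eta> (fst z)" using that unfolding assms a_def b_def by linarith
  have 2: "a < b" if "\<eta> (fst z) < \<eta> (snd z)" using that unfolding assms a_def b_def by linarith
  have 3: "0 < form v \<eta> z - form w \<eta> z" if "\<eta> (fst z) \<noteq> \<eta> (snd z)"
  proof (cases "\<eta> (snd z) < \<eta> (fst z)")
    case True then show ?thesis unfolding eq using Jp_less[OF p_gt 1[OF True]] by simp
  next
    case False then have *: "\<eta> (fst z) < \<eta> (snd z)" using that by simp
    then show ?thesis unfolding eq using Jp_less[OF p_gt 2[OF *]] by (simp add: mult_neg_neg)
  qed
  then show "0 <= form v \<eta> z - form w \<eta> z" by (cases "\<eta> (fst z) = \<eta> (snd z)") (auto simp: form_def)
  show "form v \<eta> z - form w \<eta> z = 0 ==> \<eta> (fst z) = \<eta> (snd z)" using 3 by fastforce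
qed

text \<open>The kernel couples every pair of distinct points, so a vanishing jump links almost every
  point directly to the set \<open>Z\<close>, without any chain of intermediate points.\<close>

lemma AE_const_on_pairs:
  fixes \<eta> :: "'a => real"
  assumes "AE z in \<mu>. \<eta> (fst z) = \<eta> (snd z)" and [measurable]: "Z \<in> sets borel" and Z: "emeasure lborel Z \<noteq> 0"
    and \<eta>: "!!x. x \<in> Z ==> \<eta> x = 0"
  shows "AE x in lborel. \<eta> x = 0" using AE_\<mu>D[OF assms(1)]
proof eventually_elim
  case (elim x) show ?case
  proof (rule ccontr)
    assume ne: "\<eta> x \<noteq> 0"
    have "AE y in lborel. y \<notin> Z" using elim
    proof eventually_elim
      case (elim y) then show ?case using ne \<eta>[of y] by auto
    qed
    then have "emeasure lborel Z = 0" by (subst (asm) AE_iff_null_sets[symmetric]) auto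
    then show False using Z by simp
  qed
qed

text \<open>Stated for two functions whose forms against the one test function \<open>\<eta>\<close>
  have equal integrals, so that it applies both to solutions of finite energy and to solutions known
  only locally.\<close>

lemma comparison:
  assumes \<eta>: "\<eta> = (\<lambda>x. max (v x - w x - e) 0)"
    and int: "integrable \<mu> (form v \<eta>)" "integrable \<mu> (form w \<eta>)" and eq: "(LINT z|\<mu>. form v \<eta> z) = (LINT z|\<mu>. form w \<eta> z)"
    and Z: "Z \<in> sets borel" "emeasure lborel Z \<noteq> 0" "!!x. x \<in> Z ==> \<eta> x = 0"
  shows "AE x in lborel. v x <= w x + e"
proof -
  have "(LINT z|\<mu>. form v \<eta> z - form w \<eta> z) = 0" using int eq by simp
  then have "AE z in \<mu>. form v \<eta> z - form w \<eta> z = 0" using form_diff_nonneg(1)[OF \<eta>] int by (subst (asm) integral_nonneg_eq_0_iff_AE) auto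
  then have "AE z in \<mu>. \<eta> (fst z) = \<eta> (snd z)" by eventually_elim (rule form_diff_nonneg(2)[OF \<eta>])
  then have "AE x in lborel. \<eta> x = 0" by (rule AE_const_on_pairs[OF _ Z(1,2)]) (rule Z(3))
  then show ?thesis by eventually_elim (auto simp: \<eta> max_def split: if_splits)
qed

end

context dirichlet_domain
begin

lemma finite_energy_times_indicator:
  assumes h: "finite_energy N h" and h0: "!!x. x \<in> N - \<Omega> ==> h x = 0"
  shows "test (\<lambda>x. indicator \<Omega> x * h x)"
proof -
  have [measurable]: "h \<in> borel_measurable borel" using h by (simp add: finite_energy_def)
  have eq: "indicator \<Omega> x * h x = h x" if "x \<in> N" for x using that h0 by (auto simp: indicator_def)
  have "finite_energy N (\<lambda>x. indicator \<Omega> x * h x)" by (rule finite_energy_dominate[OF h h, of _ 1]) (auto simp: eq)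
  then show ?thesis by (simp add: test_def)
qed

lemma solution_comparison:
  assumes u: "solution u" and w: "solution w" and e: "!!x. x \<notin> \<Omega> ==> u x <= w x + e"
  shows "AE x in lborel. u x <= w x + e"
proof (rule comparison[OF refl _ _ _ _ emeasure_N_minus_\<Omega>])
  let ?\<eta> = "\<lambda>x. max (u x - w x - e) 0"
  have "finite_energy N ?\<eta>" using u w by (intro finite_energy_pos_part finite_energy_diff) (auto simp: solution_def)
  moreover have "?\<eta> x = 0" if "x \<notin> \<Omega>" for x using e[OF that] by simp
  ultimately have t: "test ?\<eta>" by (simp add: test_def)
  then show "integrable \<mu> (form u ?\<eta>)" "integrable \<mu> (form w ?\<eta>)" using u w by (auto intro!: integrable_form_test simp: solution_def)
  show "(LINT z|\<mu>. form u ?\<eta> z) = (LINT z|\<mu>. form w ?\<eta> z)" using u w t by (simp add: solution_def)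
  show "N - \<Omega> \<in> sets borel" by auto
  show "?\<eta> x = 0" if "x \<in> N - \<Omega>" for x using e[of x] that by simp
qed

lemma integrable_test_energy: "test \<eta> ==> integrable \<mu> (\<lambda>z. \<bar>jump \<eta> z\<bar> powr p)"
  by (rule integrable_energy_extend[OF bounded_\<Omega> d0_pos ball_\<Omega> sets_\<Omega> sets_N]) (auto simp: test_def)

end

section \<open>The direct method for bounded competitors\<close>

locale dirichlet_data = dirichlet_domain s p \<Lambda> K \<Omega> N d0
  for s p \<Lambda> :: real and K :: "'a::euclidean_space => 'a => real" and \<Omega> N d0 +
  fixes g :: "'a => real"
  assumes g_energy: "finite_energy N g" and g_tail: "finite_tail g"
begin

lemma g_measurable [measurable]: "g \<in> borel_measurable borel" using g_tail by measurable

text \<open>The energy itself may be infinite because of the interaction with the far field; only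
  its difference with the energy of the boundary datum is minimised.\<close>

definition excess :: "('a => real) => 'a \<times> 'a => real" where
  "excess v z = \<bar>jump v z\<bar> powr p - \<bar>jump g z\<bar> powr p"

definition admissible :: "real => ('a => real) => bool" where
  "admissible M v \<longleftrightarrow> finite_energy N v \<and> (\<forall>x. x \<notin> \<Omega> --> v x = g x) \<and> (\<forall>x\<in>\<Omega>. \<bar>v x\<bar> <= M)"

text \<open>Origin of the factors: \<open>p\<close> from the derivative of the power,
  \<open>2 powr (p - 1)\<close> from splitting the power of a sum, and 4 from two such powers and
  from \<open>\<bar>v x - g x\<bar> <= 2 * M\<close>.\<close>

definition far_const :: "real => real" where
  "far_const M = 4 * p * M * 2 powr (p - 1)"

text \<open>It does not depend on the competitor, and its sum with \<open>excess v\<close> is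
  nonnegative for every competitor; that is what Fatou's lemma needs along a minimising
  sequence.\<close>

definition majorant :: "real => 'a \<times> 'a => real" where
  "majorant M z = indicator (N \<times> N) z * \<bar>jump g z\<bar> powr p +
    (indicator (\<Omega> \<times> (- N)) z * (far_const M * M powr (p - 1) + far_const M * \<bar>g (snd z)\<bar> powr (p - 1)) +
     indicator ((- N) \<times> \<Omega>) z * (far_const M * M powr (p - 1) + far_const M * \<bar>g (fst z)\<bar> powr (p - 1)))"

lemma excess_measurable:
  assumes [measurable]: "v \<in> borel_measurable borel"
  shows "excess v \<in> borel_measurable (borel \<Otimes>\<^sub>M borel)" unfolding excess_def[abs_def] by measurable

lemma integrable_majorant: "integrable \<mu> (majorant M)" unfolding majorant_def[abs_def]
  using integrable_far[OF bounded_\<Omega> d0_pos ball_\<Omega> _ _ g_tail] integrable_energy[OF g_energy] by (intro Bochner_Integration.integrable_add) auto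

lemma admissible_measurable [measurable_dest]: "admissible M v ==> v \<in> borel_measurable borel" by (simp add: admissible_def finite_energy_def)

lemma admissible_tail:
  assumes "admissible M v" shows "finite_tail v"
proof (rule finite_tail_dominate[OF g_tail, of _ "\<bar>M\<bar>"])
  show "v \<in> borel_measurable borel" using assms by measurable
  show "AE y in lborel. \<bar>v y\<bar> <= \<bar>M\<bar> + \<bar>g y\<bar>"
  proof (rule AE_I2)
    fix y show "\<bar>v y\<bar> <= \<bar>M\<bar> + \<bar>g y\<bar>" using assms by (cases "y \<in> \<Omega>") (force simp: admissible_def)+
  qed
qed

lemma excess_bounds:
  assumes v: "!!x. x \<notin> \<Omega> ==> v x = g x" "!!x. x \<in> \<Omega> ==> \<bar>v x\<bar> <= M" and g: "!!x. x \<in> N ==> \<bar>g x\<bar> <= M"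
  shows "indicator (N \<times> N) z * \<bar>jump v z\<bar> powr p <= excess v z + majorant M z"
    and "\<bar>excess v z\<bar> <= indicator (N \<times> N) z * \<bar>jump v z\<bar> powr p + majorant M z"
proof -
  obtain x y where z: "z = (x, y)" by (cases z)
  have far: "\<bar>excess v (x, y)\<bar> <= far_const M * M powr (p - 1) + far_const M * \<bar>g y\<bar> powr (p - 1)"
    if x: "x \<in> \<Omega>" and y: "y \<notin> N" for x y
  proof -
    have xy: "v y = g y" "\<bar>v x\<bar> <= M" "\<bar>g x\<bar> <= M" using x y v g \<Omega>_subset_N by auto
    have M: "0 <= M" using xy by linarith
    have b: "\<bar>a - g y\<bar> powr (p - 1) <= 2 powr (p - 1) * (M powr (p - 1) + \<bar>g y\<bar> powr (p - 1))" if "\<bar>a\<bar> <= M" for a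
    proof -
      have "\<bar>a - g y\<bar> powr (p - 1) <= (M + \<bar>g y\<bar>) powr (p - 1)" using that p_gt by (intro powr_mono2) auto
      also have "... <= 2 powr (p - 1) * (M powr (p - 1) + \<bar>g y\<bar> powr (p - 1))" using M p_gt by (intro powr_add_le) auto
      finally show ?thesis .
    qed
    have "\<bar>excess v (x, y)\<bar> <= p * (\<bar>g x - g y\<bar> powr (p - 1) + \<bar>v x - g y\<bar> powr (p - 1)) * \<bar>(v x - g y) - (g x - g y)\<bar>"
      unfolding excess_def fst_conv snd_conv xy(1) by (rule abs_powr_diff_bound[OF p_gt])
    also have "... <= p * (2 * (2 powr (p - 1) * (M powr (p - 1) + \<bar>g y\<bar> powr (p - 1)))) * (2 * M)"
      using b[OF xy(2)] b[OF xy(3)] xy p_pos by (intro mult_mono) auto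
    also have "... = far_const M * M powr (p - 1) + far_const M * \<bar>g y\<bar> powr (p - 1)" by (simp add: far_const_def algebra_simps)
    finally show ?thesis .
  qed
  have sym: "excess v (y, x) = excess v (x, y)" by (simp add: excess_def abs_minus_commute)
  consider "x \<in> N" "y \<in> N" | "x \<in> \<Omega>" "y \<notin> N" | "x \<notin> N" "y \<in> \<Omega>" | "x \<notin> \<Omega>" "y \<notin> \<Omega>" "\<not> (x \<in> N \<and> y \<in> N)" using \<Omega>_subset_N by blast
  then have "indicator (N \<times> N) z * \<bar>jump v z\<bar> powr p <= excess v z + majorant M z \<and>
    \<bar>excess v z\<bar> <= indicator (N \<times> N) z * \<bar>jump v z\<bar> powr p + majorant M z"
  proof cases
    case 1 then show ?thesis using \<Omega>_subset_N by (auto simp: z majorant_def indicator_def excess_def abs_le_iff)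
  next
    case 2 then have "majorant M z = far_const M * M powr (p - 1) + far_const M * \<bar>g y\<bar> powr (p - 1)"
      using \<Omega>_subset_N by (auto simp: z majorant_def)
    then show ?thesis using far[OF 2] 2 by (simp add: z abs_le_iff)
  next
    case 3 then have "majorant M z = far_const M * M powr (p - 1) + far_const M * \<bar>g x\<bar> powr (p - 1)"
      using \<Omega>_subset_N by (auto simp: z majorant_def)
    then show ?thesis using far[OF 3(2,1)] 3 by (simp add: z abs_le_iff sym)
  next
    case 4 then have "majorant M z = 0" "excess v z = 0" using v by (auto simp: z majorant_def excess_def)
    then show ?thesis using 4 by (auto simp: z indicator_def)
  qed
  then show "indicator (N \<times> N) z * \<bar>jump v z\<bar> powr p <= excess v z + majorant M z"
    "\<bar>excess v z\<bar> <= indicator (N \<times> N) z * \<bar>jump v z\<bar> powr p + majorant M z" by blast+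
qed

lemma integrable_excess:
  assumes a: "admissible M v" and g: "!!x. x \<in> N ==> \<bar>g x\<bar> <= M"
  shows "integrable \<mu> (excess v)"
proof -
  have fe: "finite_energy N v" using a by (simp add: admissible_def)
  have "integrable \<mu> (\<lambda>z. indicator (N \<times> N) z * \<bar>jump v z\<bar> powr p + majorant M z)"
    by (intro Bochner_Integration.integrable_add integrable_energy[OF fe] integrable_majorant) auto
  then show ?thesis
  proof (rule Bochner_Integration.integrable_bound)
    show "excess v \<in> borel_measurable \<mu>" using excess_measurable a by measurable
    have "\<bar>excess v z\<bar> <= indicator (N \<times> N) z * \<bar>jump v z\<bar> powr p + majorant M z" for z
      by (rule excess_bounds(2)) (use a g in \<open>auto simp: admissible_def\<close>)
    then show "AE z in \<mu>. norm (excess v z) <= norm (indicator (N \<times> N) z * \<bar>jump v z\<bar> powr p + majorant M z)"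
      by (intro AE_I2) (smt (verit) real_norm_def)
  qed
qed

text \<open>No weak compactness is used. The convexity defect of two late members of a minimising
  sequence has small integral. On pairs whose second point lies in \<open>N - \<Omega>\<close>,
  where all competitors equal \<open>g\<close>, the difference of the two jumps is the difference of
  the values at the first point. The sequence is therefore Cauchy in measure and, being bounded, in
  the mean over \<Omega>.\<close>

lemma minimiser_exists:
  assumes g: "!!x. x \<in> N ==> \<bar>g x\<bar> <= M"
  obtains V where "admissible M V" "!!v. admissible M v ==> (LINT z|\<mu>. excess V z) <= (LINT z|\<mu>. excess v z)"
proof -
  define E where "E v = (LINT z|\<mu>. excess v z)" for v
  define Mj where "Mj = (LINT z|\<mu>. majorant M z)"
  have nonneg: "0 <= excess v z + majorant M z" if "admissible M v" for v z
  proof -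
    have "indicator (N \<times> N) z * \<bar>jump v z\<bar> powr p <= excess v z + majorant M z"
      by (rule excess_bounds(1)) (use that g in \<open>auto simp: admissible_def\<close>)
    then show ?thesis by (smt (verit) indicator_pos_le mult_nonneg_nonneg powr_ge_zero)
  qed
  have E_low: "0 <= E v + Mj" if "admissible M v" for v
  proof -
    have "0 <= (LINT z|\<mu>. excess v z + majorant M z)" using nonneg[OF that] by (intro integral_nonneg_AE) auto
    then show ?thesis using integrable_excess[OF that g] integrable_majorant by (simp add: E_def Mj_def)
  qed
  have adm_g: "admissible M g" using g_energy g \<Omega>_subset_N by (auto simp: admissible_def)
  define m where "m = Inf (E ` {v. admissible M v})"
  have bdd: "bdd_below (E ` {v. admissible M v})" using E_low by (intro bdd_belowI[of _ "- Mj"]) force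
  have m_le: "m <= E v" if "admissible M v" for v unfolding m_def using bdd that by (intro cInf_lower) auto
  have "\<exists>v. admissible M v \<and> E v < m + 1 / real (Suc i)" for i
  proof -
    have "Inf (E ` {v. admissible M v}) < m + 1 / real (Suc i)" unfolding m_def by simp
    then show ?thesis using cInf_lessD[of "E ` {v. admissible M v}"] adm_g by blast
  qed
  then obtain v where v: "!!i. admissible M (v i)" "!!i. E (v i) < m + 1 / real (Suc i)" by metis
  have [measurable]: "v i \<in> borel_measurable borel" for i using v(1) by measurable
  have v_out: "x \<notin> \<Omega> ==> v i x = g x" and v_in: "x \<in> \<Omega> ==> \<bar>v i x\<bar> <= M" for i x using v(1)[of i] by (auto simp: admissible_def)
  have v_N: "x \<in> N ==> \<bar>v i x\<bar> <= M" for i x using v_out[of x i] v_in[of x i] g[of x] by (cases "x \<in> \<Omega>") auto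
  define \<omega> where "\<omega> = measure lborel \<Omega>"
  have \<omega>: "emeasure lborel \<Omega> = ennreal \<omega>" "0 <= \<omega>"
    using emeasure_bounded_finite[OF bounded_\<Omega>] by (auto simp: \<omega>_def emeasure_eq_ennreal_measure less_top)
  have \<Omega>_fm: "\<Omega> \<in> fmeasurable lborel" using emeasure_bounded_finite[OF bounded_\<Omega>] by (intro fmeasurableI) auto
  \<comment> \<open>The midpoint of two competitors is again a competitor, so its energy is at least
    \<open>m\<close>; the identity for the defect turns near minimality into smallness of its
    integral.\<close>
  have mid: "(E (v i) + E (v j)) / 2 - m \<ge> (LINT z|\<mu>. convexity_defect p (jump (v i) z) (jump (v j) z))"
    and int_def: "integrable \<mu> (\<lambda>z. convexity_defect p (jump (v i) z) (jump (v j) z))" for i j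
  proof -
    define w where "w = (\<lambda>x. (v i x + v j x) / 2)"
    have w: "admissible M w" unfolding admissible_def
    proof (intro conjI allI impI ballI)
      have "finite_energy N (\<lambda>x. 1 / 2 * (v i x + v j x))"
        using v(1)[of i] v(1)[of j] by (intro finite_energy_cmult finite_energy_add) (auto simp: admissible_def)
      then show "finite_energy N w" by (simp add: w_def)
      show "w x = g x" if "x \<notin> \<Omega>" for x using v_out[OF that] by (simp add: w_def)
      show "\<bar>w x\<bar> <= M" if "x \<in> \<Omega>" for x using v_in[OF that, of i] v_in[OF that, of j] by (auto simp: w_def abs_le_iff)
    qed
    have eq: "convexity_defect p (jump (v i) z) (jump (v j) z) = (excess (v i) z + excess (v j) z) / 2 - excess w z" for z
    proof -
      have mideq: "(jump (v i) z + (jump (v j) z)) / 2 = w (fst z) - w (snd z)" by (simp add: w_def field_simps)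
      show ?thesis unfolding convexity_defect_def mideq excess_def by (simp add: field_simps)
    qed
    note ints = integrable_excess[OF v(1)[of i] g] integrable_excess[OF v(1)[of j] g] integrable_excess[OF w g]
    show "integrable \<mu> (\<lambda>z. convexity_defect p (jump (v i) z) (jump (v j) z))" unfolding eq using ints by auto
    have "(LINT z|\<mu>. (excess (v i) z + excess (v j) z) / 2 - excess w z) = (E (v i) + E (v j)) / 2 - E w" using ints by (simp add: E_def)
    then show "(E (v i) + E (v j)) / 2 - m \<ge> (LINT z|\<mu>. convexity_defect p (jump (v i) z) (jump (v j) z))" unfolding eq using m_le[OF w] by simp
  qed
  \<comment> \<open>The bounded set \<open>N - \<Omega>\<close> has positive measure, so each point
    of \<Omega> interacts with it by at least a fixed amount; a small defect hence means a small set
    of disagreement.\<close>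
  obtain c where c: "0 < c" "!!A. A \<in> sets borel ==> A \<subseteq> \<Omega> ==> ennreal c * emeasure lborel A <= emeasure \<mu> (A \<times> (N - \<Omega>))"
  proof -
    obtain R where R: "0 < R" "!!x. x \<in> N ==> norm x <= R" using bounded_N by (auto simp: bounded_pos)
    define \<theta> where "\<theta> = measure lborel (N - \<Omega>)"
    have fin: "emeasure lborel (N - \<Omega>) < \<infinity>" using bounded_N by (intro emeasure_bounded_finite) (auto intro: bounded_subset)
    then have \<theta>: "emeasure lborel (N - \<Omega>) = ennreal \<theta>" by (simp add: \<theta>_def emeasure_eq_ennreal_measure less_top)
    have \<theta>0: "0 < \<theta>" using emeasure_N_minus_\<Omega> \<theta> by (cases "\<theta> = 0") (auto simp: \<theta>_def zero_less_measure_iff)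
    define c where "c = inverse \<Lambda> * (2 * R) powr (- (real DIM('a) + q))"
    have c: "0 < c" using \<Lambda>_pos R by (simp add: c_def)
    show ?thesis
    proof (rule that[of "c * \<theta>"])
      show "0 < c * \<theta>" using c \<theta>0 by simp
      fix A assume [measurable]: "A \<in> sets borel" and A: "A \<subseteq> \<Omega>"
      have "ennreal (c * \<theta>) * emeasure lborel A <= (\<integral>\<^sup>+z. indicator (A \<times> (N - \<Omega>)) z \<partial>\<mu>)"
      proof (rule nn_integral_Times_ge)
        show "0 <= c * \<theta>" using c \<theta>0 by simp
        fix x assume x: "x \<in> A"
        have "ennreal (c * \<theta>) = (\<integral>\<^sup>+y. ennreal c * indicator (N - \<Omega>) y \<partial>lborel)"
          using c \<theta>0 by (simp add: nn_integral_cmult_indicator \<theta> ennreal_mult)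
        also have "... <= (\<integral>\<^sup>+y. ennreal (K x y) * indicator (N - \<Omega>) y \<partial>lborel)"
        proof (rule nn_integral_mono)
          fix y
          show "ennreal c * indicator (N - \<Omega>) y <= ennreal (K x y) * indicator (N - \<Omega>) y"
          proof (cases "y \<in> N - \<Omega>")
            case True have "x \<in> N" using x A \<Omega>_subset_N by auto
            then have "norm (x - y) <= 2 * R" using norm_triangle_ineq4[of x y] R(2)[of x] R(2)[of y] True by auto
            then have "c <= K x y" unfolding c_def using True x A by (intro K_lower_dist) auto
            then show ?thesis using True by (simp add: ennreal_leI)
          qed simp
        qed
        finally show "ennreal (c * \<theta>) <= (\<integral>\<^sup>+y. ennreal (K x y) * indicator (N - \<Omega>) y \<partial>lborel)" .
      qed auto
      then show "ennreal (c * \<theta>) * emeasure lborel A <= emeasure \<mu> (A \<times> (N - \<Omega>))" by simp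
    qed
  qed
  define sq where "sq i x = indicator \<Omega> x * v i x" for i x
  have sq_int: "integrable lborel (sq i)" for i
  proof (rule Bochner_Integration.integrable_bound[of _ "\<lambda>x. M * indicator \<Omega> x"])
    show "integrable lborel (\<lambda>x. M * indicator \<Omega> x)"
      using \<Omega>_fm by (intro integrable_mult_right integrable_real_indicator) (auto simp: fmeasurable_def)
    show "sq i \<in> borel_measurable lborel" unfolding sq_def[abs_def] by measurable
    show "AE x in lborel. norm (sq i x) <= norm (M * indicator \<Omega> x)"
      using order_trans[OF v_in abs_ge_self] by (intro AE_I2) (auto simp: sq_def indicator_def)
  qed
  have cauchy: "\<exists>I. \<forall>i\<ge>I. \<forall>j\<ge>I. (LINT x|lborel. norm (sq i x - sq j x)) < e" if e: "0 < e" for e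
  proof (cases "\<Omega> = {}")
    case True then show ?thesis using e by (simp add: sq_def)
  next
    case False then have M: "0 <= M" using v_in[of _ 0] by fastforce
    \<comment> \<open>The two halves of \<open>e\<close>: where the functions differ by less than
      \<open>t\<close>, the contribution is at most \<open>t * \<omega> < e / 2\<close>; where they
      differ by more, they differ by at most \<open>2 * M\<close>, and the bound \<open>X\<close>
      below makes the measure of that set less than \<open>e / (4 * (M + 1))\<close>.\<close>
    define t where "t = e / (2 * (\<omega> + 1))"
    have t: "0 < t" using e \<omega> by (simp add: t_def add_nonneg_pos)
    obtain d where d: "0 < d" "!!a b. \<bar>a\<bar> <= 2 * M ==> \<bar>b\<bar> <= 2 * M ==> t <= \<bar>a - b\<bar> ==> d <= convexity_defect p a b"
      by (rule convexity_defect_lower_bound[OF p_gt t]) blast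
    define X where "X = e * (d * c) / (4 * (M + 1))"
    have X: "0 < X" using e d c M by (simp add: X_def)
    obtain I where I: "inverse (real (Suc I)) < X" using reals_Archimedean[OF X] by blast
    show ?thesis
    proof (intro exI[of _ I] allI impI)
      fix i j assume ij: "I <= i" "I <= j"
      define A where "A = {x \<in> \<Omega>. t <= \<bar>v i x - v j x\<bar>}"
      have "{x \<in> space borel. x \<in> \<Omega> \<and> t <= \<bar>v i x - v j x\<bar>} \<in> sets borel" by measurable
      then have [measurable]: "A \<in> sets borel" by (simp add: A_def)
      have A\<Omega>: "A \<subseteq> \<Omega>" by (auto simp: A_def)
      define \<alpha> where "\<alpha> = measure lborel A"
      have "emeasure lborel A < \<infinity>" using bounded_\<Omega> A\<Omega> by (intro emeasure_bounded_finite) (auto intro: bounded_subset)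
      then have \<alpha>: "emeasure lborel A = ennreal \<alpha>" "0 <= \<alpha>" by (auto simp: \<alpha>_def emeasure_eq_ennreal_measure less_top)
      let ?D = "\<lambda>z. convexity_defect p (jump (v i) z) (jump (v j) z)"
      have D0: "0 <= ?D z" for z by (rule convexity_defect_nonneg[OF p_gt])
      have "ennreal (d * c * \<alpha>) = ennreal d * (ennreal c * emeasure lborel A)" using d c \<alpha> by (simp add: ennreal_mult mult.assoc)
      also have "... <= ennreal d * emeasure \<mu> (A \<times> (N - \<Omega>))" using A\<Omega> by (intro mult_left_mono c(2)) auto
      also have "... = (\<integral>\<^sup>+z. ennreal d * indicator (A \<times> (N - \<Omega>)) z \<partial>\<mu>)" by (subst nn_integral_cmult_indicator) auto
      also have "... <= (\<integral>\<^sup>+z. ennreal (?D z) \<partial>\<mu>)"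
      proof (rule nn_integral_mono)
        fix z :: "'a \<times> 'a" obtain x y where z: "z = (x, y)" by (cases z)
        show "ennreal d * indicator (A \<times> (N - \<Omega>)) z <= ennreal (?D z)"
        proof (cases "x \<in> A \<and> y \<in> N - \<Omega>")
          case True then have x: "x \<in> N" "y \<in> N" using A\<Omega> \<Omega>_subset_N by auto
          have "d <= convexity_defect p (v i x - v i y) (v j x - v j y)"
          proof (rule d(2))
            show "\<bar>v i x - v i y\<bar> <= 2 * M" "\<bar>v j x - v j y\<bar> <= 2 * M"
              using v_N[OF x(1), of i] v_N[OF x(2), of i] v_N[OF x(1), of j] v_N[OF x(2), of j] by linarith+
            have "v i y = v j y" using True v_out[of y] by simp
            then show "t <= \<bar>v i x - v i y - (v j x - v j y)\<bar>" using True by (simp add: A_def)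
          qed
          then show ?thesis using True by (simp add: z ennreal_leI)
        qed (auto simp: z)
      qed
      also have "... = ennreal (LINT z|\<mu>. ?D z)" using D0 int_def by (intro nn_integral_eq_integral) auto
      finally have "d * c * \<alpha> <= (LINT z|\<mu>. ?D z)" using Bochner_Integration.integral_nonneg[where M = \<mu> and f = "?D"] D0 by simp
      also have "... <= (E (v i) + E (v j)) / 2 - m" by (rule mid)
      also have "... <= inverse (real (Suc I))"
      proof -
        have *: "E (v k) <= m + inverse (real (Suc I))" if "I <= k" for k
        proof -
          have "1 / real (Suc k) <= inverse (real (Suc I))" unfolding inverse_eq_divide using that by (intro divide_left_mono) auto
          with v(2)[of k] show ?thesis by (rule_tac order_trans[OF less_imp_le add_left_mono])
        qed
        define y where "y = inverse (real (Suc I))"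
        have "E (v i) <= m + y" "E (v j) <= m + y" using *[OF ij(1)] *[OF ij(2)] by (simp_all add: y_def)
        then show ?thesis unfolding y_def[symmetric] by (simp add: field_simps)
      qed
      also have "... < X" by (rule I)
      finally have "\<alpha> * (d * c) < e / (4 * (M + 1)) * (d * c)" by (simp add: X_def mult_ac)
      moreover have "0 <= d * c" using d(1) c(1) by simp
      ultimately have \<alpha>X: "\<alpha> < e / (4 * (M + 1))" by (rule mult_right_less_imp_less)
      have "(LINT x|lborel. norm (sq i x - sq j x)) <= (LINT x|lborel. t * indicator \<Omega> x + 2 * M * indicator A x)"
      proof (rule integral_mono)
        show "integrable lborel (\<lambda>x. norm (sq i x - sq j x))" using sq_int by auto
        show "integrable lborel (\<lambda>x. t * indicator \<Omega> x + 2 * M * indicator A x)" using \<Omega>_fm \<open>emeasure lborel A < \<infinity>\<close>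
          by (intro Bochner_Integration.integrable_add integrable_mult_right integrable_real_indicator) (auto simp: fmeasurable_def)
        fix x
        show "norm (sq i x - sq j x) <= t * indicator \<Omega> x + 2 * M * indicator A x"
          using v_in[of x i] v_in[of x j] t by (auto simp: sq_def A_def indicator_def)
      qed
      also have "... = t * \<omega> + 2 * M * \<alpha>" using \<Omega>_fm \<open>emeasure lborel A < \<infinity>\<close>
        by (subst Bochner_Integration.integral_add) (auto simp: \<omega>_def \<alpha>_def fmeasurable_def)
      also have "... < e"
      proof -
        have "t * \<omega> < e / 2" using e \<omega> by (simp add: t_def divide_simps)
        moreover have "2 * M * \<alpha> <= 2 * M * (e / (4 * (M + 1)))" using \<alpha>X M by (intro mult_left_mono) auto
        moreover have "2 * M * (e / (4 * (M + 1))) <= e / 2" using M e by (simp add: divide_simps)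
        ultimately show ?thesis by linarith
      qed
      finally show "(LINT x|lborel. norm (sq i x - sq j x)) < e" .
    qed
  qed
  obtain r where r: "strict_mono r" "AE x in lborel. Cauchy (\<lambda>i. sq (r i) x)" by (rule cauchy_L1_AE_cauchy_subseq[OF sq_int cauchy])
  \<comment> \<open>Clipping gives the bound \<open>M\<close> at every point of \<Omega>, also where
    the sequence diverges and \<open>lim\<close> has an arbitrary value.\<close>
  define V where "V x = (if x \<in> \<Omega> then max (- M) (min M (lim (\<lambda>i. sq (r i) x))) else g x)" for x
  have [measurable]: "sq i \<in> borel_measurable borel" for i unfolding sq_def[abs_def] by measurable
  have [measurable]: "(\<lambda>x. lim (\<lambda>i. sq (r i) x)) \<in> borel_measurable borel" by (rule borel_measurable_lim_metric) measurable
  have V_meas [measurable]: "V \<in> borel_measurable borel" unfolding V_def[abs_def] by measurable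
  have conv: "AE x in lborel. (\<lambda>i. v (r i) x) \<longlonglongrightarrow> V x" using r(2)
  proof eventually_elim
    case (elim x) show ?case
    proof (cases "x \<in> \<Omega>")
      case True then have eq: "(\<lambda>i. sq (r i) x) = (\<lambda>i. v (r i) x)" by (simp add: sq_def)
      have lim: "(\<lambda>i. v (r i) x) \<longlonglongrightarrow> lim (\<lambda>i. v (r i) x)" using elim unfolding eq by (simp add: Cauchy_convergent_iff convergent_LIMSEQ_iff)
      have "lim (\<lambda>i. v (r i) x) <= M" "- M <= lim (\<lambda>i. v (r i) x)"
        using v_in[OF True] by (auto intro!: LIMSEQ_le_const2[OF lim] LIMSEQ_le_const[OF lim] simp: abs_le_iff minus_le_iff)
      then show ?thesis using lim True by (simp add: V_def eq max_def min_def)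
    next
      case False then show ?thesis using v_out by (simp add: V_def)
    qed
  qed
  have V_out: "x \<notin> \<Omega> ==> V x = g x" for x by (simp add: V_def)
  have V_in: "x \<in> \<Omega> ==> \<bar>V x\<bar> <= M" for x using v_in[of x 0] by (auto simp: V_def)
  have Vb: "indicator (N \<times> N) z * \<bar>jump V z\<bar> powr p <= excess V z + majorant M z" for z by (rule excess_bounds(1)) (use V_out V_in g in auto)
  have V0: "0 <= excess V z + majorant M z" for z using Vb[of z] by (smt (verit) indicator_pos_le mult_nonneg_nonneg powr_ge_zero)
  have [measurable]: "excess V \<in> borel_measurable \<mu>" "excess (v i) \<in> borel_measurable \<mu>" "majorant M \<in> borel_measurable \<mu>" for i
    using excess_measurable integrable_majorant by auto
  have lim_excess: "AE z in \<mu>. (\<lambda>i. ennreal (excess (v (r i)) z + majorant M z)) \<longlonglongrightarrow> ennreal (excess V z + majorant M z)"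
    using AE_\<mu>_fst[OF conv] AE_\<mu>_snd[OF conv]
  proof eventually_elim
    case (elim z) have "(\<lambda>i. \<bar>jump (v (r i)) z\<bar> powr p) \<longlonglongrightarrow> \<bar>jump V z\<bar> powr p"
      using elim p_pos by (intro tendsto_powr' tendsto_rabs tendsto_diff tendsto_const) auto
    then show ?case unfolding excess_def by (intro tendsto_ennrealI tendsto_add tendsto_diff tendsto_const)
  qed
  have "(\<integral>\<^sup>+z. ennreal (excess V z + majorant M z) \<partial>\<mu>) = (\<integral>\<^sup>+z. liminf (\<lambda>i. ennreal (excess (v (r i)) z + majorant M z)) \<partial>\<mu>)"
    using lim_excess by (intro nn_integral_cong_AE) (auto elim!: eventually_mono simp: lim_imp_Liminf)
  also have "... <= liminf (\<lambda>i. \<integral>\<^sup>+z. ennreal (excess (v (r i)) z + majorant M z) \<partial>\<mu>)" by (rule nn_integral_liminf) measurable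
  also have "(\<lambda>i. \<integral>\<^sup>+z. ennreal (excess (v (r i)) z + majorant M z) \<partial>\<mu>) = (\<lambda>i. ennreal (E (v (r i)) + Mj))"
  proof
    fix i
    have ints: "integrable \<mu> (excess (v (r i)))" by (rule integrable_excess[OF v(1) g])
    have "(\<integral>\<^sup>+z. ennreal (excess (v (r i)) z + majorant M z) \<partial>\<mu>) = ennreal (LINT z|\<mu>. excess (v (r i)) z + majorant M z)"
      using nonneg[OF v(1)] ints integrable_majorant by (intro nn_integral_eq_integral) auto
    then show "(\<integral>\<^sup>+z. ennreal (excess (v (r i)) z + majorant M z) \<partial>\<mu>) = ennreal (E (v (r i)) + Mj)"
      using ints integrable_majorant by (simp add: E_def Mj_def)
  qed
  also have "liminf (\<lambda>i. ennreal (E (v (r i)) + Mj)) <= ennreal (m + Mj)"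
  proof -
    have "(\<lambda>i. E (v i)) \<longlonglongrightarrow> m"
    proof (rule tendsto_sandwich[of "\<lambda>_. m" _ _ "\<lambda>i. m + 1 / real (Suc i)"])
      show "(\<lambda>i. m + 1 / real (Suc i)) \<longlonglongrightarrow> m" using tendsto_add[OF tendsto_const LIMSEQ_inverse_real_of_nat, of m] by (simp add: inverse_eq_divide)
    qed (use m_le[OF v(1)] v(2) in \<open>auto intro!: always_eventually less_imp_le\<close>)
    then have "(\<lambda>i. E (v (r i))) \<longlonglongrightarrow> m" using filterlim_compose[OF _ filterlim_subseq[OF r(1)]] by fast
    then have "(\<lambda>i. ennreal (E (v (r i)) + Mj)) \<longlonglongrightarrow> ennreal (m + Mj)" by (intro tendsto_ennrealI tendsto_add tendsto_const)
    then show ?thesis by (simp add: lim_imp_Liminf)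
  qed
  finally have up: "(\<integral>\<^sup>+z. ennreal (excess V z + majorant M z) \<partial>\<mu>) <= ennreal (m + Mj)" .
  have "energy_on N V <= (\<integral>\<^sup>+z. ennreal (excess V z + majorant M z) \<partial>\<mu>)" unfolding energy_on_def
  proof (rule nn_integral_mono)
    fix z
    show "ennreal (\<bar>jump V z\<bar> powr p) * indicator (N \<times> N) z <= ennreal (excess V z + majorant M z)"
      using Vb[of z] by (auto simp: indicator_def intro!: ennreal_leI)
  qed
  also have "... < \<infinity>" using up by (rule order_le_less_trans) simp
  finally have eV: "energy_on N V < \<infinity>" .
  have bV: "\<exists>M. \<forall>x\<in>N. \<bar>V x\<bar> <= M"
  proof (intro exI ballI)
    fix x assume "x \<in> N" then show "\<bar>V x\<bar> <= M" using V_in V_out g by (cases "x \<in> \<Omega>") auto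
  qed
  have adm: "admissible M V" using eV bV V_meas V_out V_in by (auto simp: admissible_def finite_energy_def)
  have iV: "integrable \<mu> (excess V)" by (rule integrable_excess[OF adm g])
  have "ennreal (E V + Mj) = (\<integral>\<^sup>+z. ennreal (excess V z + majorant M z) \<partial>\<mu>)"
    using V0 iV integrable_majorant by (subst nn_integral_eq_integral) (auto simp: E_def Mj_def)
  also note up
  finally have "ennreal (E V + Mj) <= ennreal (m + Mj)" .
  \<comment> \<open>Comparing the images under \<open>ennreal\<close> yields a comparison of the
    real numbers only once \<open>m + Mj\<close> is known to be nonnegative.\<close>
  moreover have "- Mj <= m" unfolding m_def using adm_g E_low by (intro cInf_greatest) force+
  ultimately have "E V <= m" by (simp add: ennreal_le_iff)
  then show ?thesis using m_le by (intro that[OF adm]) (auto simp: E_def intro: order_trans)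
qed

end

section \<open>Removing the constraint\<close>

context dirichlet_data
begin

text \<open>One-sided difference quotients of the excess are nonnegative in the mean and converge to
  \<open>p\<close> times the form. The last hypothesis says that small positive multiples of
  \<open>\<eta>\<close> respect the constraint.\<close>

lemma variational_inequality:
  assumes g: "!!x. x \<in> N ==> \<bar>g x\<bar> <= M" and adm: "admissible M V"
    and min: "!!v. admissible M v ==> (LINT z|\<mu>. excess V z) <= (LINT z|\<mu>. excess v z)"
    and \<eta>: "test \<eta>" and t0: "0 < t0" "!!t x. 0 < t ==> t < t0 ==> x \<in> \<Omega> ==> \<bar>V x + t * \<eta> x\<bar> <= M"
  shows "0 <= (LINT z|\<mu>. form V \<eta> z)"
proof -
  have feV: "finite_energy N V" and ftV: "finite_tail V" using adm admissible_tail by (auto simp: admissible_def)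
  have fe\<eta>: "finite_energy N \<eta>" and \<eta>0: "!!x. x \<notin> \<Omega> ==> \<eta> x = 0" using \<eta> by (auto simp: test_def)
  \<comment> \<open>The double successor makes all values strictly smaller than
    \<open>min t0 1\<close>.\<close>
  define t :: "nat => real" where "t n = min t0 1 * inverse (real (Suc (Suc n)))" for n
  have t: "0 < t n" "t n < t0" "t n < 1" for n
  proof -
    have m: "0 < min t0 1" using t0 by simp
    have i: "0 < inverse (real (Suc (Suc n)))" "inverse (real (Suc (Suc n))) < 1" by (auto simp: inverse_less_1_iff)
    show "0 < t n" unfolding t_def using m i by (intro mult_pos_pos)
    have "t n < min t0 1 * 1" unfolding t_def using m i by (intro mult_strict_left_mono)
    then show "t n < t0" "t n < 1" by auto
  qed
  have t_lim: "t \<longlonglongrightarrow> 0"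
    unfolding t_def[abs_def] using tendsto_mult[OF tendsto_const LIMSEQ_Suc[OF LIMSEQ_inverse_real_of_nat], of "min t0 1"] by simp
  define w where "w n = (\<lambda>x. V x + t n * \<eta> x)" for n
  have w: "admissible M (w n)" for n unfolding admissible_def w_def
  proof (intro conjI allI impI ballI)
    show "finite_energy N (\<lambda>x. V x + t n * \<eta> x)" by (intro finite_energy_add finite_energy_cmult feV fe\<eta>) auto
    show "V x + t n * \<eta> x = g x" if "x \<notin> \<Omega>" for x using \<eta>0[OF that] adm that by (simp add: admissible_def)
    show "\<bar>V x + t n * \<eta> x\<bar> <= M" if "x \<in> \<Omega>" for x using t0(2)[OF t(1,2) that] .
  qed
  define f where "f n z = (excess (w n) z - excess V z) / t n" for n z
  have ints: "integrable \<mu> (excess (w n))" "integrable \<mu> (excess V)" for n using integrable_excess[OF w g] integrable_excess[OF adm g] by auto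
  have f_nonneg: "0 <= (LINT z|\<mu>. f n z)" for n
  proof -
    have "(LINT z|\<mu>. f n z) = ((LINT z|\<mu>. excess (w n) z) - (LINT z|\<mu>. excess V z)) / t n" unfolding f_def using ints by simp
    then show ?thesis using min[OF w, of n] t(1)[of n] by simp
  qed
  have iform: "integrable \<mu> (form V \<eta>)" by (rule integrable_form_test[OF feV ftV \<eta>])
  \<comment> \<open>These constants come from bounding the power of
    \<open>\<bar>a + t n * b\<bar>\<close> by \<open>2 powr (p - 1)\<close> times the sum of the
    powers of \<open>\<bar>a\<bar>\<close> and \<open>\<bar>b\<bar>\<close>, which uses
    \<open>t n < 1\<close>.\<close>
  let ?c = "p * (1 + 2 powr (p - 1))" and ?d = "p * 2 powr (p - 1)"
  have "(\<lambda>n. LINT z|\<mu>. f n z) \<longlonglongrightarrow> (LINT z|\<mu>. p * form V \<eta> z)"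
  proof (rule integral_dominated_convergence)
    show "(\<lambda>z. p * form V \<eta> z) \<in> borel_measurable \<mu>" using iform by auto
    show "f n \<in> borel_measurable \<mu>" for n unfolding f_def[abs_def] using ints by auto
    show "integrable \<mu> (\<lambda>z. ?c * \<bar>form V \<eta> z\<bar> + ?d * \<bar>jump \<eta> z\<bar> powr p)" using iform integrable_test_energy[OF \<eta>] by auto
    show "AE z in \<mu>. (\<lambda>n. f n z) \<longlonglongrightarrow> p * form V \<eta> z"
    proof (rule AE_I2)
      fix z
      define a b where "a = V (fst z) - V (snd z)" and "b = \<eta> (fst z) - \<eta> (snd z)"
      have "((\<lambda>h. \<bar>a + h * b\<bar> powr p) has_real_derivative p * Jp p (a + 0 * b) * b) (at 0)"
        by (rule DERIV_chain2[where f = "\<lambda>t. \<bar>t\<bar> powr p", OF DERIV_abs_powr[OF p_gt]]) (auto intro!: derivative_eq_intros)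
      then have "((\<lambda>h. (\<bar>a + h * b\<bar> powr p - \<bar>a\<bar> powr p) / h) \<longlongrightarrow> p * Jp p a * b) (at 0)" by (simp add: DERIV_def)
      moreover have "filterlim t (at 0) sequentially"
        using t_lim t(1) by (auto simp: filterlim_at intro!: always_eventually less_imp_neq[symmetric])
      ultimately have "(\<lambda>n. (\<bar>a + t n * b\<bar> powr p - \<bar>a\<bar> powr p) / t n) \<longlonglongrightarrow> p * Jp p a * b" by (rule filterlim_compose)
      moreover have "f n z = (\<bar>a + t n * b\<bar> powr p - \<bar>a\<bar> powr p) / t n" for n by (simp add: f_def excess_def w_def a_def b_def algebra_simps)
      ultimately show "(\<lambda>n. f n z) \<longlonglongrightarrow> p * form V \<eta> z" by (simp add: form_def a_def b_def mult.assoc)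
    qed
    show "AE z in \<mu>. norm (f n z) <= ?c * \<bar>form V \<eta> z\<bar> + ?d * \<bar>jump \<eta> z\<bar> powr p" for n
    proof (rule AE_I2)
      fix z
      define a b where "a = V (fst z) - V (snd z)" and "b = \<eta> (fst z) - \<eta> (snd z)"
      have fe: "f n z = (\<bar>a + t n * b\<bar> powr p - \<bar>a\<bar> powr p) / t n" by (simp add: f_def excess_def w_def a_def b_def algebra_simps)
      have tb: "\<bar>t n * b\<bar> <= \<bar>b\<bar>" using mult_right_mono[of "t n" 1 "\<bar>b\<bar>"] t[of n] by (simp add: abs_mult)
      have "\<bar>a + t n * b\<bar> powr (p - 1) <= (\<bar>a\<bar> + \<bar>b\<bar>) powr (p - 1)" using tb p_gt by (intro powr_mono2) auto
      also have "... <= 2 powr (p - 1) * (\<bar>a\<bar> powr (p - 1) + \<bar>b\<bar> powr (p - 1))" using p_gt by (intro powr_add_le) auto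
      finally have 1: "\<bar>a + t n * b\<bar> powr (p - 1) <= 2 powr (p - 1) * (\<bar>a\<bar> powr (p - 1) + \<bar>b\<bar> powr (p - 1))" .
      have "\<bar>\<bar>a + t n * b\<bar> powr p - \<bar>a\<bar> powr p\<bar> <= p * (\<bar>a\<bar> powr (p - 1) + \<bar>a + t n * b\<bar> powr (p - 1)) * \<bar>t n * b\<bar>"
        using abs_powr_diff_bound[OF p_gt, of "a + t n * b" a] by simp
      also have "... <= p * (\<bar>a\<bar> powr (p - 1) + 2 powr (p - 1) * (\<bar>a\<bar> powr (p - 1) + \<bar>b\<bar> powr (p - 1))) * \<bar>t n * b\<bar>"
        using 1 p_pos by (intro mult_right_mono mult_left_mono) auto
      also have "... = t n * (?c * (\<bar>a\<bar> powr (p - 1) * \<bar>b\<bar>) + ?d * (\<bar>b\<bar> powr (p - 1) * \<bar>b\<bar>))"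
        using t(1)[of n] by (simp add: abs_mult algebra_simps)
      also have "\<bar>b\<bar> powr (p - 1) * \<bar>b\<bar> = \<bar>b\<bar> powr p" using powr_mult_base[of "\<bar>b\<bar>" "p - 1"] by (simp add: mult.commute)
      also have "\<bar>a\<bar> powr (p - 1) * \<bar>b\<bar> = \<bar>form V \<eta> z\<bar>" by (simp add: form_def a_def b_def abs_mult abs_Jp)
      finally have "\<bar>\<bar>a + t n * b\<bar> powr p - \<bar>a\<bar> powr p\<bar> <= t n * (?c * \<bar>form V \<eta> z\<bar> + ?d * \<bar>b\<bar> powr p)" .
      then have "\<bar>f n z\<bar> <= ?c * \<bar>form V \<eta> z\<bar> + ?d * \<bar>b\<bar> powr p"
        unfolding fe using t(1)[of n] by (simp add: abs_divide pos_divide_le_eq mult.commute)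
      then show "norm (f n z) <= ?c * \<bar>form V \<eta> z\<bar> + ?d * \<bar>jump \<eta> z\<bar> powr p" by (simp add: b_def)
    qed
  qed
  then have "0 <= (LINT z|\<mu>. p * form V \<eta> z)" by (rule LIMSEQ_le_const) (use f_nonneg in auto)
  then show ?thesis using p_pos by (simp add: zero_le_mult_iff)
qed

text \<open>The quantification over \<open>f\<close> makes the same level serve for \<open>g\<close> and \<open>- g\<close>.\<close>

definition supersolution_level :: "real => bool" where
  "supersolution_level M \<longleftrightarrow> 0 < M \<and> (\<forall>x\<in>N. \<bar>g x\<bar> <= M) \<and> (\<forall>x\<in>\<Omega>. \<forall>f. (\<forall>y. \<bar>f y\<bar> = \<bar>g y\<bar>) -->
    (\<integral>\<^sup>+y. ennreal (K x y) * ennreal (- Jp p (M - f y)) * indicator (- N) y \<partial>lborel) <=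
    (\<integral>\<^sup>+y. ennreal (K x y) * ennreal (Jp p (M - f y)) * indicator (- N) y \<partial>lborel))"

text \<open>As the level grows, the harmful part of the tail, coming from points with
  \<open>\<bar>g y\<bar> > M\<close>, tends to 0 by dominated convergence. The helpful part, coming
  from a fixed set outside \<open>N\<close> on which \<open>\<bar>g\<bar>\<close> is bounded by
  \<open>m\<close>, stays above a positive constant because \<open>M - f y >= 1\<close>
  there.\<close>

lemma supersolution_level_exists:
  obtains M where "supersolution_level M"
proof -
  obtain M0 where M0: "!!x. x \<in> N ==> \<bar>g x\<bar> <= M0" using g_energy by (auto simp: finite_energy_def)
  obtain C1 where C1: "0 < C1" "!!x y. x \<in> \<Omega> ==> y \<notin> N ==> K x y <= C1 * tail_weight q y"
    using K_le_tail_weight[OF bounded_\<Omega> d0_pos ball_\<Omega>] by blast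
  obtain C2 where C2: "0 < C2" "!!x y. x \<in> \<Omega> ==> x \<noteq> y ==> tail_weight q y <= C2 * K x y" using tail_weight_le_K[OF bounded_\<Omega>] by blast
  let ?G = "\<lambda>y. \<bar>g y\<bar> powr (p - 1) * tail_weight q y"
  have iG: "integrable lborel ?G" using g_tail by (intro integrableI_bounded) (auto simp: finite_tail_def ennreal_mult)
  define S where "S k = (LINT y|lborel. ?G y * indicator {y. real k < \<bar>g y\<bar>} y)" for k :: nat
  have [measurable]: "{y. real k < \<bar>g y\<bar>} \<in> sets borel" "{y. \<bar>g y\<bar> <= real k} \<in> sets borel" for k by measurable
  have iS: "integrable lborel (\<lambda>y. ?G y * indicator {y. real k < \<bar>g y\<bar>} y)" for k by (intro integrable_real_mult_indicator iG) auto
  have "S \<longlonglongrightarrow> (LINT y|(lborel::'a measure). 0)" unfolding S_def[abs_def]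
  proof (rule integral_dominated_convergence[where w = ?G])
    show "AE y in lborel. (\<lambda>k. ?G y * indicator {y. real k < \<bar>g y\<bar>} y) \<longlonglongrightarrow> 0"
    proof (rule AE_I2)
      fix y
      obtain k0 :: nat where "\<bar>g y\<bar> <= real k0" using real_arch_simple by blast
      then have "\<forall>\<^sub>F k in sequentially. ?G y * indicator {y. real k < \<bar>g y\<bar>} y = 0" by (intro eventually_sequentiallyI[of k0]) auto
      then show "(\<lambda>k. ?G y * indicator {y. real k < \<bar>g y\<bar>} y) \<longlonglongrightarrow> 0" by (rule tendsto_eventually)
    qed
    show "AE y in lborel. norm (?G y * indicator {y. real k < \<bar>g y\<bar>} y) <= ?G y" for k by (intro AE_I2) (auto simp: indicator_def)
  qed (use iG in auto)
  then have S: "S \<longlonglongrightarrow> 0" by simp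
  \<comment> \<open>These sets exhaust the complement of \<open>N\<close>; were all of them null,
    the whole space would have the finite measure of \<open>N\<close>.\<close>
  obtain m :: nat where m: "emeasure lborel ({y. \<bar>g y\<bar> <= real m} - N) \<noteq> 0"
  proof (rule ccontr)
    assume "\<not> thesis"
    then have 0: "emeasure lborel ({y. \<bar>g y\<bar> <= real m} - N) = 0" for m using that by blast
    have "(\<Union>m. {y. \<bar>g y\<bar> <= real m} - N) \<in> null_sets lborel" using 0 by (intro null_sets_UN) (auto simp: null_sets_def)
    moreover have "(\<Union>m. {y. \<bar>g y\<bar> <= real m} - N) = - N" using real_arch_simple by auto
    ultimately have "emeasure lborel (- N) = 0" by auto
    then have "emeasure lborel (N \<union> - N) <= emeasure lborel N + 0" using emeasure_subadditive[of N lborel "- N"] by simp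
    then show False using emeasure_bounded_finite[OF bounded_N] by (simp add: top_unique)
  qed
  define A where "A = {y. \<bar>g y\<bar> <= real m} - N"
  have [measurable]: "A \<in> sets borel" unfolding A_def by measurable
  let ?\<kappa> = "\<integral>\<^sup>+y. ennreal (tail_weight q y) * indicator A y \<partial>lborel"
  have "?\<kappa> <= (\<integral>\<^sup>+y. ennreal (tail_weight q (y::'a)) \<partial>lborel)" by (intro nn_integral_mono) (auto simp: indicator_def)
  then have "?\<kappa> < \<infinity>" using tail_weight_finite[OF q_pos, where 'a='a] by (rule order_le_less_trans)
  then obtain \<kappa> where \<kappa>: "?\<kappa> = ennreal \<kappa>" "0 <= \<kappa>" by (cases ?\<kappa> rule: ennreal_cases) auto
  have "?\<kappa> \<noteq> 0"
  proof
    assume "?\<kappa> = 0"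
    then have "AE y in lborel. ennreal (tail_weight q y) * indicator A y = 0" by (subst (asm) nn_integral_0_iff_AE) auto
    then have "AE y in lborel. y \<notin> A"
    proof eventually_elim
      case (elim y) show ?case
      proof
        assume "y \<in> A"
        then have "tail_weight q y <= 0" using elim by (simp add: ennreal_eq_0_iff)
        then show False using tail_weight_pos[of q y] by linarith
      qed
    qed
    then have "emeasure lborel A = 0" by (subst (asm) AE_iff_null_sets[symmetric]) auto
    then show False using m by (simp add: A_def)
  qed
  then have \<kappa>0: "0 < \<kappa>" using \<kappa> by (cases "\<kappa> = 0") auto
  \<comment> \<open>\<open>C1\<close> bounds the kernel by the weight in the harmful part,
    \<open>C2\<close> bounds the weight by the kernel in the helpful part; this threshold balances
    the two.\<close>
  have "0 < \<kappa> / (C1 * C2)" using \<kappa>0 C1 C2 by simp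
  then obtain k1 where k1: "!!k. k1 <= k ==> S k < \<kappa> / (C1 * C2)" using order_tendstoD(2)[OF S] by (auto simp: eventually_sequentially)
  obtain k2 :: nat where k2: "M0 <= real k2" using real_arch_simple by blast
  define k where "k = max k1 (max k2 (m + 1))"
  define M where "M = real k"
  have k: "k1 <= k" "M0 <= M" "real m + 1 <= M" "0 < M" using k2 by (auto simp: k_def M_def)
  have "(\<integral>\<^sup>+y. ennreal (K x y) * ennreal (- Jp p (M - f y)) * indicator (- N) y \<partial>lborel) <=
    (\<integral>\<^sup>+y. ennreal (K x y) * ennreal (Jp p (M - f y)) * indicator (- N) y \<partial>lborel)"
    if x: "x \<in> \<Omega>" and f: "\<forall>y. \<bar>f y\<bar> = \<bar>g y\<bar>" for x f
  proof -
    have "(\<integral>\<^sup>+y. ennreal (K x y) * ennreal (- Jp p (M - f y)) * indicator (- N) y \<partial>lborel) <=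
      (\<integral>\<^sup>+y. ennreal C1 * ennreal (?G y * indicator {y. real k < \<bar>g y\<bar>} y) \<partial>lborel)"
    proof (rule nn_integral_mono)
      fix y
      show "ennreal (K x y) * ennreal (- Jp p (M - f y)) * indicator (- N) y <=
         ennreal C1 * ennreal (?G y * indicator {y. real k < \<bar>g y\<bar>} y)"
      proof (cases "y \<in> N \<or> f y <= M")
        case True then have "y \<in> N \<or> - Jp p (M - f y) <= 0" using Jp_nonneg[of "M - f y" p] by auto
        then show ?thesis by (auto simp: ennreal_neg)
      next
        case False then have fy: "M < f y" "y \<notin> N" by auto
        have "- Jp p (M - f y) = (f y - M) powr (p - 1)" using fy by (subst Jp_nonpos_eq) auto
        also have "... <= \<bar>g y\<bar> powr (p - 1)" using fy f k p_gt by (intro powr_mono2) (auto simp: f[rule_format, symmetric])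
        finally have J: "- Jp p (M - f y) <= \<bar>g y\<bar> powr (p - 1)" .
        have "real k < \<bar>g y\<bar>" using fy f[rule_format, of y] by (simp add: M_def)
        moreover have "K x y * (- Jp p (M - f y)) <= (C1 * tail_weight q y) * \<bar>g y\<bar> powr (p - 1)"
          using C1 x fy J Jp_nonpos[of "M - f y" p] by (intro mult_mono) auto
        moreover have "0 <= - Jp p (M - f y)" using Jp_nonpos[of "M - f y" p] fy by simp
        ultimately show ?thesis using fy C1(1) by (simp add: ennreal_mult[symmetric] mult_ac ennreal_leI)
      qed
    qed
    also have "... = ennreal C1 * (\<integral>\<^sup>+y. ennreal (?G y * indicator {y. real k < \<bar>g y\<bar>} y) \<partial>lborel)" by (rule nn_integral_cmult) measurable
    also have "... = ennreal C1 * ennreal (S k)" unfolding S_def by (subst nn_integral_eq_integral[OF iS]) auto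
    also have "... = ennreal (C1 * S k)" using C1 by (simp add: ennreal_mult')
    also have "... <= ennreal (inverse C2 * \<kappa>)" using k1[OF k(1)] C1 C2 by (intro ennreal_leI) (simp add: field_simps)
    also have "... = ennreal (inverse C2) * ?\<kappa>" using C2 \<kappa> by (simp add: ennreal_mult)
    also have "... = (\<integral>\<^sup>+y. ennreal (inverse C2) * (ennreal (tail_weight q y) * indicator A y) \<partial>lborel)"
      by (rule nn_integral_cmult[symmetric]) measurable
    also have "... <= (\<integral>\<^sup>+y. ennreal (K x y) * ennreal (Jp p (M - f y)) * indicator (- N) y \<partial>lborel)"
    proof (rule nn_integral_mono)
      fix y
      show "ennreal (inverse C2) * (ennreal (tail_weight q y) * indicator A y) <=
        ennreal (K x y) * ennreal (Jp p (M - f y)) * indicator (- N) y"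
      proof (cases "y \<in> A")
        case True then have y: "y \<notin> N" "\<bar>g y\<bar> <= real m" by (auto simp: A_def)
        then have ne: "x \<noteq> y" using x \<Omega>_subset_N by auto
        have "f y <= real m" using y f[rule_format, of y] by linarith
        then have "1 <= (M - f y) powr (p - 1)" using k p_gt by (intro ge_one_powr_ge_zero) auto
        then have J: "1 <= Jp p (M - f y)" using k \<open>f y <= real m\<close> by (subst Jp_nonneg_eq) auto
        have "inverse C2 * tail_weight q y <= K x y" using C2(2)[OF x ne] C2(1) by (simp add: field_simps)
        also have "... <= K x y * Jp p (M - f y)" using J mult_left_mono[OF J, of "K x y"] by simp
        finally show ?thesis using y True C2(1) J by (simp add: ennreal_mult[symmetric] ennreal_leI)
      qed simp
    qed
    finally show ?thesis .
  qed
  then have "supersolution_level M" using k M0 by (force simp: supersolution_level_def)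
  then show ?thesis by (rule that)
qed

text \<open>Testing with the excess of \<open>V\<close> over \<open>M\<close>: its far interaction
  is at least that of the constant \<open>M\<close>, which is nonnegative by the choice of the
  level. What remains controls \<open>\<eta> powr p\<close> on pairs in
  \<open>\<Omega> \<times> (N - \<Omega>)\<close> and forces \<open>\<eta>\<close> to vanish. The
  function \<open>f\<close> stands for \<open>g\<close> or \<open>- g\<close>.\<close>

lemma upper_level_bound:
  assumes lev: "supersolution_level M" and feV: "finite_energy N V" and ftV: "finite_tail V"
    and V: "!!y. y \<notin> \<Omega> ==> V y = f y" and f: "!!y. \<bar>f y\<bar> = \<bar>g y\<bar>" and [measurable]: "f \<in> borel_measurable borel"
    and \<eta>: "\<eta> = (\<lambda>x. indicator \<Omega> x * max (V x - M) 0)" and le: "(LINT z|\<mu>. form V \<eta> z) <= 0"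
  shows "test \<eta>" "AE x in lborel. \<eta> x = 0"
proof -
  have M: "0 < M" "!!x. x \<in> N ==> \<bar>g x\<bar> <= M" using lev by (auto simp: supersolution_level_def)
  have fN: "f x <= M" if "x \<in> N" for x using M(2)[OF that] f[of x] by linarith
  show t: "test \<eta>" unfolding \<eta>
  proof (rule finite_energy_times_indicator)
    show "finite_energy N (\<lambda>x. max (V x - M) 0)" by (intro finite_energy_pos_part finite_energy_diff feV) auto
    show "max (V x - M) 0 = 0" if "x \<in> N - \<Omega>" for x using V[of x] fN[of x] that by auto
  qed
  have [measurable]: "V \<in> borel_measurable borel" "\<eta> \<in> borel_measurable borel" using feV t by (auto simp: test_def finite_energy_def)
  have \<eta>0: "0 <= \<eta> x" for x by (simp add: \<eta>)
  have \<eta>out: "x \<notin> \<Omega> ==> \<eta> x = 0" for x by (simp add: \<eta>)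
  have \<eta>N: "\<eta> x = max (V x - M) 0" if "x \<in> N" for x using that V[of x] fN[of x] by (cases "x \<in> \<Omega>") (auto simp: \<eta>)
  have \<eta>V: "0 < \<eta> x ==> V x = M + \<eta> x" for x by (cases "x \<in> \<Omega>") (auto simp: \<eta> max_def split: if_splits)
  obtain M\<eta> where M\<eta>: "!!x. x \<in> N ==> \<bar>\<eta> x\<bar> <= M\<eta>" using t by (auto simp: test_def finite_energy_def)
  define J1 J2 where "J1 y = max (Jp p (M - f y)) 0" and "J2 y = max (- Jp p (M - f y)) 0" for y
  have [measurable]: "J1 \<in> borel_measurable borel" "J2 \<in> borel_measurable borel" unfolding J1_def[abs_def] J2_def[abs_def] by measurable
  have J12: "0 <= J1 y" "0 <= J2 y" "J1 y - J2 y = Jp p (M - f y)" for y by (auto simp: J1_def J2_def)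
  \<comment> \<open>\<open>A\<close> is the term to be shown zero; \<open>B1\<close> and
    \<open>B2\<close> are the positive and the negative part of the far interaction of the constant
    \<open>M\<close>. They are kept apart so that extended nonnegative integrals can be used, where
    the finiteness of the integral of \<open>B2\<close> suffices for cancellation.\<close>
  define A B1 B2 where "A z = indicator (\<Omega> \<times> (N - \<Omega>)) z * \<eta> (fst z) powr p"
    and "B1 z = \<eta> (fst z) * J1 (snd z) * indicator (\<Omega> \<times> (- N)) z"
    and "B2 z = \<eta> (fst z) * J2 (snd z) * indicator (\<Omega> \<times> (- N)) z" for z :: "'a \<times> 'a"
  have [measurable]: "A \<in> borel_measurable (borel \<Otimes>\<^sub>M borel)" "B1 \<in> borel_measurable (borel \<Otimes>\<^sub>M borel)" "B2 \<in> borel_measurable (borel \<Otimes>\<^sub>M borel)"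
    unfolding A_def[abs_def] B1_def[abs_def] B2_def[abs_def] by measurable
  have AB: "0 <= A z" "0 <= B1 z" "0 <= B2 z" for z using \<eta>0 J12 by (auto simp: A_def B1_def B2_def)
  have far: "B1 (x, y) - B2 (x, y) <= form V \<eta> (x, y)" if x: "x \<in> \<Omega>" and y: "y \<notin> N" for x y
  proof -
    have y\<Omega>: "y \<notin> \<Omega>" using y \<Omega>_subset_N by auto
    have "B1 (x, y) - B2 (x, y) = \<eta> x * (J1 y - J2 y)" using x y by (simp add: B1_def B2_def algebra_simps)
    also have "... = Jp p (M - f y) * \<eta> x" by (simp add: J12)
    also have "... <= Jp p (V x - V y) * \<eta> x"
    proof (cases "\<eta> x = 0")
      case False then have "0 < \<eta> x" using \<eta>0[of x] by simp
      then show ?thesis using \<eta>V[of x] V[OF y\<Omega>] by (intro mult_right_mono Jp_le p_gt) auto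
    qed simp
    finally show ?thesis by (simp add: form_def \<eta>out[OF y\<Omega>])
  qed
  have near: "A (x, y) <= form V \<eta> (x, y)" if x: "x \<in> N" and y: "y \<in> N" for x y
  proof (cases "x \<in> \<Omega> \<and> y \<notin> \<Omega>")
    case True have "\<eta> x powr p = Jp p (\<eta> x) * \<eta> x" using \<eta>0[of x] by (simp add: Jp_mult_self)
    also have "... <= Jp p (V x - V y) * \<eta> x"
    proof (cases "\<eta> x = 0")
      case False then have "0 < \<eta> x" using \<eta>0[of x] by simp
      then show ?thesis using \<eta>V[of x] V[of y] fN[OF y] True by (intro mult_right_mono Jp_le p_gt) auto
    qed simp
    finally show ?thesis using True y \<eta>out[of y] by (simp add: A_def form_def)
  next
    case False have "0 <= Jp p (V x - V y) * (\<eta> x - \<eta> y)"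
    proof (cases "V y <= V x")
      case True then show ?thesis unfolding \<eta>N[OF x] \<eta>N[OF y] by (intro mult_nonneg_nonneg Jp_nonneg) auto
    next
      case False then show ?thesis unfolding \<eta>N[OF x] \<eta>N[OF y] by (intro mult_nonpos_nonpos Jp_nonpos) auto
    qed
    then show ?thesis using False y by (auto simp: A_def form_def indicator_def)
  qed
  have key: "- form V \<eta> z + (A z + (B1 z + B1 (snd z, fst z))) <= B2 z + B2 (snd z, fst z)" for z
  proof -
    obtain x y where z: "z = (x, y)" by (cases z)
    consider "x \<in> N" "y \<in> N" | "x \<in> \<Omega>" "y \<notin> N" | "x \<notin> N" "y \<in> \<Omega>" | "x \<notin> \<Omega>" "y \<notin> \<Omega>" using \<Omega>_subset_N by blast
    then show ?thesis
    proof cases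
      case 1 then show ?thesis using near[OF 1] by (simp add: z B1_def B2_def)
    next
      case 2 then show ?thesis using far[OF 2] \<Omega>_subset_N by (auto simp: z A_def B1_def B2_def indicator_def)
    next
      case 3
      then show ?thesis using far[OF 3(2,1)] \<Omega>_subset_N form_swap[of V \<eta> x y] by (auto simp: z A_def B1_def B2_def indicator_def)
    next
      case 4 then show ?thesis using \<eta>out by (simp add: z A_def B1_def B2_def form_def)
    qed
  qed
  have iform: "integrable \<mu> (form V \<eta>)" by (rule integrable_form_test[OF feV ftV t])
  have main: "(\<integral>\<^sup>+z. ennreal (A z + (B1 z + B1 (snd z, fst z))) \<partial>\<mu>) <= (\<integral>\<^sup>+z. ennreal (B2 z + B2 (snd z, fst z)) \<partial>\<mu>)"
    by (rule nn_integral_le_of_integral_nonneg[where f = "\<lambda>z. - form V \<eta> z"]) (use iform le key AB in auto)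
  have dbl: "(\<integral>\<^sup>+z. ennreal (B z + B (snd z, fst z)) \<partial>\<mu>) = 2 * (\<integral>\<^sup>+z. ennreal (B z) \<partial>\<mu>)"
    if [measurable]: "B \<in> borel_measurable (borel \<Otimes>\<^sub>M borel)" and B: "!!z. 0 <= B z" for B
  proof -
    have "(\<integral>\<^sup>+z. ennreal (B z + B (snd z, fst z)) \<partial>\<mu>) = (\<integral>\<^sup>+z. ennreal (B z) \<partial>\<mu>) + (\<integral>\<^sup>+z. ennreal (B (snd z, fst z)) \<partial>\<mu>)"
      using B by (subst nn_integral_add[symmetric]) (auto simp: ennreal_plus)
    then show ?thesis using nn_integral_\<mu>_swap[of "\<lambda>z. ennreal (B z)"] by (simp add: mult_2)
  qed
  have split: "(\<integral>\<^sup>+z. ennreal (A z + (B1 z + B1 (snd z, fst z))) \<partial>\<mu>) = (\<integral>\<^sup>+z. ennreal (A z) \<partial>\<mu>) + 2 * (\<integral>\<^sup>+z. ennreal (B1 z) \<partial>\<mu>)"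
    unfolding dbl[symmetric, OF \<open>B1 \<in> _\<close> AB(2)] using AB
    by (subst nn_integral_add[symmetric]) (auto simp: ennreal_plus[symmetric] simp del: ennreal_plus)
  have "(\<integral>\<^sup>+z. ennreal (B2 z) \<partial>\<mu>) <= (\<integral>\<^sup>+z. ennreal (B1 z) \<partial>\<mu>)"
  proof -
    have e: "(\<integral>\<^sup>+z. ennreal (\<eta> (fst z) * J (snd z) * indicator (\<Omega> \<times> (- N)) z) \<partial>\<mu>) =
      (\<integral>\<^sup>+x. (ennreal (\<eta> x) * (\<integral>\<^sup>+y. ennreal (K x y) * ennreal (J y) * indicator (- N) y \<partial>lborel)) * indicator \<Omega> x \<partial>lborel)"
      if [measurable]: "J \<in> borel_measurable borel" and J: "!!y. 0 <= J y" for J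
    proof -
      have "(\<integral>\<^sup>+z. ennreal (\<eta> (fst z) * J (snd z) * indicator (\<Omega> \<times> (- N)) z) \<partial>\<mu>) =
        (\<integral>\<^sup>+z. ennreal (\<eta> (fst z) * J (snd z)) * indicator (\<Omega> \<times> (- N)) z \<partial>\<mu>)" by (intro nn_integral_cong) (auto simp: indicator_def)
      also have "... = (\<integral>\<^sup>+x. (\<integral>\<^sup>+y. ennreal (K x y) * ennreal (\<eta> x * J y) * indicator (- N) y \<partial>lborel) * indicator \<Omega> x \<partial>lborel)"
        by (subst nn_integral_\<mu>_Times) auto
      also have "... = (\<integral>\<^sup>+x. (\<integral>\<^sup>+y. ennreal (\<eta> x) * (ennreal (K x y) * ennreal (J y) * indicator (- N) y) \<partial>lborel) * indicator \<Omega> x \<partial>lborel)"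
        using \<eta>0 J by (simp add: ennreal_mult mult_ac)
      also have "... = (\<integral>\<^sup>+x. (ennreal (\<eta> x) * (\<integral>\<^sup>+y. ennreal (K x y) * ennreal (J y) * indicator (- N) y \<partial>lborel)) * indicator \<Omega> x \<partial>lborel)"
        by (subst nn_integral_cmult) auto
      finally show ?thesis .
    qed
    have mx: "ennreal (max a 0) = ennreal a" for a by (auto simp: max_def ennreal_neg)
    show ?thesis unfolding B1_def B2_def unfolding e[OF \<open>J1 \<in> _\<close> J12(1)] e[OF \<open>J2 \<in> _\<close> J12(2)] unfolding J1_def J2_def mx
    proof (rule nn_integral_mono)
      fix x
      show "ennreal (\<eta> x) * (\<integral>\<^sup>+y. ennreal (K x y) * ennreal (- Jp p (M - f y)) * indicator (- N) y \<partial>lborel) * indicator \<Omega> x <=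
        ennreal (\<eta> x) * (\<integral>\<^sup>+y. ennreal (K x y) * ennreal (Jp p (M - f y)) * indicator (- N) y \<partial>lborel) * indicator \<Omega> x"
        using lev f by (cases "x \<in> \<Omega>") (auto simp: supersolution_level_def intro!: mult_left_mono)
    qed
  qed
  moreover have "(\<integral>\<^sup>+z. ennreal (B2 z) \<partial>\<mu>) < \<infinity>"
  proof -
    have i: "integrable \<mu> (\<lambda>z. indicator (\<Omega> \<times> (- N)) z * (0 + M\<eta> * \<bar>g (snd z)\<bar> powr (p - 1)))"
      using integrable_far(1)[OF bounded_\<Omega> d0_pos ball_\<Omega> _ _ g_tail, of 0 M\<eta>] by auto
    have "(\<integral>\<^sup>+z. ennreal (B2 z) \<partial>\<mu>) <= (\<integral>\<^sup>+z. ennreal (norm (indicator (\<Omega> \<times> (- N)) z * (0 + M\<eta> * \<bar>g (snd z)\<bar> powr (p - 1)))) \<partial>\<mu>)"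
    proof (intro nn_integral_mono ennreal_leI)
      fix z :: "'a \<times> 'a" obtain x y where z: "z = (x, y)" by (cases z)
      show "B2 z <= norm (indicator (\<Omega> \<times> (- N)) z * (0 + M\<eta> * \<bar>g (snd z)\<bar> powr (p - 1)))"
      proof (cases "x \<in> \<Omega> \<and> y \<notin> N")
        case True have "J2 y <= \<bar>g y\<bar> powr (p - 1)"
        proof (cases "f y <= M")
          case True then have "J2 y = 0" using Jp_nonneg[of "M - f y" p] by (simp add: J2_def)
          then show ?thesis by simp
        next
          case False then have "- Jp p (M - f y) = (f y - M) powr (p - 1)" by (subst Jp_nonpos_eq) auto
          also have "... <= \<bar>g y\<bar> powr (p - 1)" using False f[of y] M p_gt by (intro powr_mono2) auto
          finally show ?thesis by (simp add: J2_def)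
        qed
        then have "\<eta> x * J2 y <= M\<eta> * \<bar>g y\<bar> powr (p - 1)" using \<eta>0[of x] M\<eta>[of x] True \<Omega>_subset_N J12(2)[of y] by (intro mult_mono) auto
        also have "... <= \<bar>M\<eta>\<bar> * \<bar>g y\<bar> powr (p - 1)" by (intro mult_right_mono) auto
        finally show ?thesis using True by (simp add: z B2_def abs_mult)
      qed (auto simp: z B2_def)
    qed
    also have "... < \<infinity>" using i unfolding integrable_iff_bounded by (rule conjunct2)
    finally show ?thesis .
  qed
  ultimately have "(\<integral>\<^sup>+z. ennreal (A z) \<partial>\<mu>) = 0"
  proof -
    let ?a = "\<integral>\<^sup>+z. ennreal (A z) \<partial>\<mu>" and ?b1 = "\<integral>\<^sup>+z. ennreal (B1 z) \<partial>\<mu>" and ?b2 = "\<integral>\<^sup>+z. ennreal (B2 z) \<partial>\<mu>"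
    assume le12: "?b2 <= ?b1" and fin: "?b2 < \<infinity>"
    have m: "?a + 2 * ?b1 <= 2 * ?b2" using main unfolding split dbl[OF \<open>B2 \<in> _\<close> AB(3)] .
    have f2: "2 * ?b2 < \<infinity>" using fin by (simp add: ennreal_mult_less_top)
    have "2 * ?b2 + ?a <= ?a + 2 * ?b1" using le12 by (subst add.commute) (intro add_left_mono mult_left_mono, auto)
    also note m
    finally have "2 * ?b2 + ?a <= 2 * ?b2 + 0" by simp
    then show "?a = 0" using f2 by (subst (asm) ennreal_add_left_cancel_le) auto
  qed
  then have "AE z in \<mu>. ennreal (A z) = 0" by (subst (asm) nn_integral_0_iff_AE) auto
  then have "AE z in \<mu>. fst z \<in> \<Omega> --> snd z \<in> N - \<Omega> --> \<eta> (fst z) = 0"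
  proof eventually_elim
    case (elim z) then have "A z = 0" using AB(1)[of z] by (simp add: ennreal_eq_0_iff)
    then show ?case by (cases z) (auto simp: A_def)
  qed
  from AE_\<mu>D[OF this] show "AE x in lborel. \<eta> x = 0"
  proof eventually_elim
    case (elim x) show ?case
    proof (rule ccontr)
      assume ne: "\<eta> x \<noteq> 0"
      then have x: "x \<in> \<Omega>" using \<eta>out by auto
      from elim have "AE y in lborel. y \<notin> N - \<Omega>" by eventually_elim (use ne x in auto)
      then have "N - \<Omega> \<in> null_sets lborel" by (subst (asm) AE_iff_null_sets[symmetric]) auto
      then show False using emeasure_N_minus_\<Omega> by auto
    qed
  qed
qed

text \<open>The constraint is \<open>M + 1\<close>, one more than the supersolution level. Once the
  minimiser is known to be bounded by \<open>M\<close> almost everywhere, perturbations of either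
  sign fit below the constraint and the variational inequality becomes an equation.\<close>

theorem solution_exists:
  obtains V where "solution V" "!!x. x \<notin> \<Omega> ==> V x = g x"
proof -
  obtain M where lev: "supersolution_level M" by (rule supersolution_level_exists)
  have M: "0 < M" "!!x. x \<in> N ==> \<bar>g x\<bar> <= M" using lev by (auto simp: supersolution_level_def)
  have g1: "\<bar>g x\<bar> <= M + 1" if "x \<in> N" for x using M(2)[OF that] by simp
  obtain V where V: "admissible (M + 1) V" "!!v. admissible (M + 1) v ==> (LINT z|\<mu>. excess V z) <= (LINT z|\<mu>. excess v z)"
    using minimiser_exists[OF g1] by blast
  have feV: "finite_energy N V" and V_out: "!!x. x \<notin> \<Omega> ==> V x = g x" and V_in: "!!x. x \<in> \<Omega> ==> \<bar>V x\<bar> <= M + 1"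
    using V(1) by (auto simp: admissible_def)
  have ftV: "finite_tail V" by (rule admissible_tail[OF V(1)])
  note [measurable] = finite_tail_measurable[OF ftV]
  have vi: "0 <= (LINT z|\<mu>. form V \<eta> z)"
    if "test \<eta>" "0 < t0" "!!t x. 0 < t ==> t < t0 ==> x \<in> \<Omega> ==> \<bar>V x + t * \<eta> x\<bar> <= M + 1" for \<eta> t0
    by (rule variational_inequality[of "M + 1" V \<eta> t0]) (fact g1 V that)+
  have t_of: "test (\<lambda>x. indicator \<Omega> x * max (c * V x - M) 0)" if c: "\<bar>c\<bar> = 1" for c
  proof (rule finite_energy_times_indicator)
    show "finite_energy N (\<lambda>x. max (c * V x - M) 0)" by (intro finite_energy_pos_part finite_energy_diff finite_energy_cmult feV) auto
    show "max (c * V x - M) 0 = 0" if x: "x \<in> N - \<Omega>" for x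
    proof -
      have "\<bar>c * V x\<bar> <= M" using V_out[of x] M(2)[of x] x c by (simp add: abs_mult)
      then show ?thesis by auto
    qed
  qed
  define \<eta>1 where "\<eta>1 = (\<lambda>x. indicator \<Omega> x * max (V x - M) 0)"
  have t1: "test (\<lambda>x. - \<eta>1 x)" using t_of[of 1] finite_energy_uminus[of N \<eta>1] by (auto simp: test_def \<eta>1_def)
  \<comment> \<open>Where \<open>V\<close> exceeds \<open>M\<close> this perturbation moves it
    towards \<open>M\<close> without overshooting, since \<open>t < 1\<close>; so the constraint is
    respected before any better bound on \<open>V\<close> is available.\<close>
  have "0 <= (LINT z|\<mu>. form V (\<lambda>x. - \<eta>1 x) z)"
  proof (rule vi[OF t1])
    show "(0::real) < 1" by simp
    fix t x :: real and y assume t: "0 < t" "t < 1" and y: "y \<in> \<Omega>"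
    have "0 <= t * max (V y - M) 0" "t * max (V y - M) 0 <= max (V y - M) 0" using t mult_right_mono[of t 1 "max (V y - M) 0"] by auto
    then have "t * \<eta>1 y <= max (V y - M) 0" "0 <= t * \<eta>1 y" using y by (auto simp: \<eta>1_def)
    then show "\<bar>V y + t * - \<eta>1 y\<bar> <= M + 1" using V_in[OF y] M(1) by (auto simp: max_def abs_le_iff split: if_splits)
  qed
  then have "(LINT z|\<mu>. form V \<eta>1 z) <= 0" by (simp add: form_uminus_right)
  then have ae1: "AE x in lborel. \<eta>1 x = 0" by (intro upper_level_bound(2)[OF lev feV ftV V_out refl g_measurable \<eta>1_def]) auto
  define \<eta>2 where "\<eta>2 = (\<lambda>x. indicator \<Omega> x * max (- V x - M) 0)"
  have t2: "test \<eta>2" using t_of[of "- 1"] by (simp add: \<eta>2_def)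
  have "0 <= (LINT z|\<mu>. form V \<eta>2 z)"
  proof (rule vi[OF t2])
    show "(0::real) < 1" by simp
    fix t x :: real and y assume t: "0 < t" "t < 1" and y: "y \<in> \<Omega>"
    have "0 <= t * max (- V y - M) 0" "t * max (- V y - M) 0 <= max (- V y - M) 0" using t mult_right_mono[of t 1 "max (- V y - M) 0"] by auto
    then have "t * \<eta>2 y <= max (- V y - M) 0" "0 <= t * \<eta>2 y" using y by (auto simp: \<eta>2_def)
    then show "\<bar>V y + t * \<eta>2 y\<bar> <= M + 1" using V_in[OF y] M(1) by (auto simp: max_def abs_le_iff split: if_splits)
  qed
  then have le2: "(LINT z|\<mu>. form (\<lambda>x. - V x) \<eta>2 z) <= 0" by (simp add: form_uminus)
  have ae2: "AE x in lborel. \<eta>2 x = 0"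
  proof (rule upper_level_bound(2)[OF lev finite_energy_uminus[OF feV sets_N] _ _ _ _ \<eta>2_def le2])
    show "finite_tail (\<lambda>x. - V x)" using finite_tail_affine[OF ftV, of "- 1" 0] by simp
    show "- V y = - g y" if "y \<notin> \<Omega>" for y using V_out[OF that] by simp
  qed auto
  have aeV: "AE x in lborel. x \<in> \<Omega> --> \<bar>V x\<bar> <= M"
    using ae1 ae2 by eventually_elim (auto simp: \<eta>1_def \<eta>2_def max_def abs_le_iff split: if_splits)
  have EL: "0 <= (LINT z|\<mu>. form V \<eta> z)" if t: "test \<eta>" for \<eta>
  proof -
    have fe: "finite_energy N \<eta>" and out: "!!x. x \<notin> \<Omega> ==> \<eta> x = 0" using t by (auto simp: test_def)
    have [measurable]: "\<eta> \<in> borel_measurable borel" using fe by (simp add: finite_energy_def)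
    obtain B where B: "!!x. x \<in> N ==> \<bar>\<eta> x\<bar> <= B" using fe by (auto simp: finite_energy_def)
    \<comment> \<open>The admissibility of a perturbation is a condition at every point. Setting the
      test function to 0 on the null set of \<Omega> where \<open>\<bar>V\<bar> > M\<close> meets it
      without changing the integral.\<close>
    define \<eta>' where "\<eta>' = (\<lambda>x. if \<bar>V x\<bar> <= M then \<eta> x else 0)"
    have [measurable]: "\<eta>' \<in> borel_measurable borel" unfolding \<eta>'_def by measurable
    have eq: "AE x in lborel. \<eta>' x = \<eta> x" using aeV by eventually_elim (auto simp: \<eta>'_def out)
    have eq2: "AE x in lborel. x \<in> N --> \<eta>' x = \<eta> x" using eq by eventually_elim auto
    have B': "\<bar>\<eta>' x\<bar> <= \<bar>B\<bar>" if "x \<in> N" for x using B[OF that] by (auto simp: \<eta>'_def)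
    have "energy_on N \<eta>' < \<infinity>" using energy_on_cong_AE[OF _ _ _ eq2] fe by (simp add: finite_energy_def)
    then have "finite_energy N \<eta>'" using B' by (auto simp: finite_energy_def)
    then have t': "test \<eta>'" using out by (simp add: test_def \<eta>'_def)
    have "0 <= (LINT z|\<mu>. form V \<eta>' z)"
    proof (rule vi[OF t'])
      show "0 < 1 / (\<bar>B\<bar> + 1)" by simp
      fix t x assume h: "0 < t" "t < 1 / (\<bar>B\<bar> + 1)" and x: "x \<in> \<Omega>"
      show "\<bar>V x + t * \<eta>' x\<bar> <= M + 1"
      proof (cases "\<bar>V x\<bar> <= M")
        case True have "\<bar>t * \<eta>' x\<bar> <= t * (\<bar>B\<bar> + 1)" using B'[of x] x \<Omega>_subset_N h by (auto simp: abs_mult intro!: mult_left_mono)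
        also have "... < 1" using h by (simp add: pos_less_divide_eq add_nonneg_pos)
        finally show ?thesis using True by linarith
      next
        case False then show ?thesis using V_in[OF x] by (simp add: \<eta>'_def)
      qed
    qed
    also have "(LINT z|\<mu>. form V \<eta>' z) = (LINT z|\<mu>. form V \<eta> z)"
    proof (rule integral_cong_AE)
      show "AE z in \<mu>. form V \<eta>' z = form V \<eta> z" using AE_\<mu>_fst[OF eq] AE_\<mu>_snd[OF eq] by eventually_elim (simp add: form_def)
    qed auto
    finally show ?thesis .
  qed
  have "solution V" unfolding solution_def
  proof (intro conjI feV ftV allI impI)
    fix \<eta> assume t: "test \<eta>"
    have "test (\<lambda>x. - \<eta> x)" using t finite_energy_uminus[of N \<eta>] by (auto simp: test_def)
    from EL[OF this] EL[OF t] show "(LINT z|\<mu>. form V \<eta> z) = 0" by (simp add: form_uminus_right)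
  qed
  then show ?thesis using V_out by (rule that)
qed

end

section \<open>Passing to the limit in the weak formulation\<close>

text \<open>A variant of Vitali's theorem: the functions are dominated up to remainders of integral
  at most \<open>e\<close>. Clipping at \<open>\<bar>H\<bar>\<close> changes each integral by at
  most \<open>e\<close>, for the limit by Fatou's lemma, and the clipped functions converge by
  dominated convergence.\<close>

lemma integral_tendsto_nearly_dominated:
  fixes f :: "nat => 'b => real"
  assumes [measurable]: "F \<in> borel_measurable M" and int: "!!j. integrable M (f j)"
    and lim: "AE z in M. (\<lambda>j. f j z) \<longlonglongrightarrow> F z"
    and dom: "!!e. 0 < e ==> \<exists>H R. integrable M H \<and> (\<forall>j. R j \<in> borel_measurable M \<and>
      (\<integral>\<^sup>+z. ennreal (R j z) \<partial>M) <= ennreal e \<and> (AE z in M. \<bar>f j z\<bar> <= H z + R j z))"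
  shows "integrable M F" "(\<lambda>j. LINT z|M. f j z) \<longlonglongrightarrow> (LINT z|M. F z)"
proof -
  have [measurable]: "f j \<in> borel_measurable M" for j using int by auto
  show intF: "integrable M F"
  proof (rule integrableI_bounded)
    obtain H R where H: "integrable M H" and R: "!!j. R j \<in> borel_measurable M"
      "!!j. (\<integral>\<^sup>+z. ennreal (R j z) \<partial>M) <= ennreal 1" "!!j. AE z in M. \<bar>f j z\<bar> <= H z + R j z" using dom[of 1] by auto
    note [measurable] = R(1)
    have [measurable]: "H \<in> borel_measurable M" using H by auto
    have "(\<integral>\<^sup>+z. ennreal (norm (F z)) \<partial>M) = (\<integral>\<^sup>+z. liminf (\<lambda>j. ennreal \<bar>f j z\<bar>) \<partial>M)" using lim
    proof (intro nn_integral_cong_AE, eventually_elim)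
      case (elim z) then have "(\<lambda>j. ennreal \<bar>f j z\<bar>) \<longlonglongrightarrow> ennreal \<bar>F z\<bar>" by (intro tendsto_ennrealI tendsto_rabs)
      from lim_imp_Liminf[OF sequentially_bot this] show ?case by simp
    qed
    also have "... <= liminf (\<lambda>j. \<integral>\<^sup>+z. ennreal \<bar>f j z\<bar> \<partial>M)" by (rule nn_integral_liminf) measurable
    also have "... <= liminf (\<lambda>j::nat. (\<integral>\<^sup>+z. ennreal \<bar>H z\<bar> \<partial>M) + 1)"
    proof (intro Liminf_mono always_eventually allI)
      fix j
      have "(\<integral>\<^sup>+z. ennreal \<bar>f j z\<bar> \<partial>M) <= (\<integral>\<^sup>+z. ennreal \<bar>H z\<bar> + ennreal (R j z) \<partial>M)" using R(3)[of j]
      proof (intro nn_integral_mono_AE, eventually_elim)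
        case (elim z) then have "\<bar>f j z\<bar> <= \<bar>H z\<bar> + max (R j z) 0" by linarith
        then have "ennreal \<bar>f j z\<bar> <= ennreal \<bar>H z\<bar> + ennreal (max (R j z) 0)" by (simp add: ennreal_plus[symmetric] del: ennreal_plus)
        then show ?case by (auto simp: max_def ennreal_neg split: if_splits)
      qed
      also have "... = (\<integral>\<^sup>+z. ennreal \<bar>H z\<bar> \<partial>M) + (\<integral>\<^sup>+z. ennreal (R j z) \<partial>M)" by (rule nn_integral_add) auto
      also have "... <= (\<integral>\<^sup>+z. ennreal \<bar>H z\<bar> \<partial>M) + 1" using R(2)[of j] by (intro add_left_mono) simp
      finally show "(\<integral>\<^sup>+z. ennreal \<bar>f j z\<bar> \<partial>M) <= (\<integral>\<^sup>+z. ennreal \<bar>H z\<bar> \<partial>M) + 1" .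
    qed
    also have "... = (\<integral>\<^sup>+z. ennreal \<bar>H z\<bar> \<partial>M) + 1" by (simp add: Liminf_const)
    also have "... < \<infinity>" using H by (simp add: integrable_iff_bounded)
    finally show "(\<integral>\<^sup>+z. ennreal (norm (F z)) \<partial>M) < \<infinity>" .
  qed fact
  show "(\<lambda>j. LINT z|M. f j z) \<longlonglongrightarrow> (LINT z|M. F z)"
  proof (rule LIMSEQ_I)
    fix e :: real assume e: "0 < e"
    obtain H R where H: "integrable M H" and R: "!!j. R j \<in> borel_measurable M"
      "!!j. (\<integral>\<^sup>+z. ennreal (R j z) \<partial>M) <= ennreal (e / 4)" "!!j. AE z in M. \<bar>f j z\<bar> <= H z + R j z" using dom[of "e / 4"] e by auto
    note [measurable] = R(1)
    have [measurable]: "H \<in> borel_measurable M" using H by auto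
    define c where "c z t = max (- \<bar>H z\<bar>) (min \<bar>H z\<bar> t)" for z t
    have cb: "\<bar>c z t\<bar> <= \<bar>H z\<bar>" for z t by (auto simp: c_def)
    have [measurable]: "(\<lambda>z. c z (f j z)) \<in> borel_measurable M" "(\<lambda>z. c z (F z)) \<in> borel_measurable M" for j unfolding c_def by measurable
    have ic: "integrable M (\<lambda>z. c z (h z))" if "h \<in> borel_measurable M" for h
    proof (rule Bochner_Integration.integrable_bound[OF H])
      note [measurable] = that
      show "(\<lambda>z. c z (h z)) \<in> borel_measurable M" unfolding c_def by measurable
    qed (use cb in auto)
    have diff: "(\<integral>\<^sup>+z. ennreal \<bar>f j z - c z (f j z)\<bar> \<partial>M) <= ennreal (e / 4)" for j
    proof -
      have "(\<integral>\<^sup>+z. ennreal \<bar>f j z - c z (f j z)\<bar> \<partial>M) <= (\<integral>\<^sup>+z. ennreal (R j z) \<partial>M)" using R(3)[of j]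
      proof (intro nn_integral_mono_AE, eventually_elim)
        case (elim z) then have "\<bar>f j z - c z (f j z)\<bar> <= max (R j z) 0" unfolding c_def by linarith
        then have "ennreal \<bar>f j z - c z (f j z)\<bar> <= ennreal (max (R j z) 0)" by (rule ennreal_leI)
        then show ?case by (auto simp: max_def ennreal_neg split: if_splits)
      qed
      then show ?thesis using R(2) by (rule order_trans)
    qed
    have diffF: "(\<integral>\<^sup>+z. ennreal \<bar>F z - c z (F z)\<bar> \<partial>M) <= ennreal (e / 4)"
    proof -
      have "(\<integral>\<^sup>+z. ennreal \<bar>F z - c z (F z)\<bar> \<partial>M) = (\<integral>\<^sup>+z. liminf (\<lambda>j. ennreal \<bar>f j z - c z (f j z)\<bar>) \<partial>M)" using lim
      proof (intro nn_integral_cong_AE, eventually_elim)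
        case (elim z) then have "(\<lambda>j. ennreal \<bar>f j z - c z (f j z)\<bar>) \<longlonglongrightarrow> ennreal \<bar>F z - c z (F z)\<bar>"
          unfolding c_def by (intro tendsto_ennrealI tendsto_rabs tendsto_diff tendsto_max tendsto_min tendsto_const)
        from lim_imp_Liminf[OF sequentially_bot this] show ?case by simp
      qed
      also have "... <= liminf (\<lambda>j. \<integral>\<^sup>+z. ennreal \<bar>f j z - c z (f j z)\<bar> \<partial>M)" by (rule nn_integral_liminf) measurable
      also have "... <= liminf (\<lambda>j::nat. ennreal (e / 4))" using diff by (intro Liminf_mono always_eventually) auto
      also have "... = ennreal (e / 4)" by (simp add: Liminf_const)
      finally show ?thesis .
    qed
    have small: "\<bar>(LINT z|M. h z) - (LINT z|M. c z (h z))\<bar> <= e / 4"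
      if h: "integrable M h" and d: "(\<integral>\<^sup>+z. ennreal \<bar>h z - c z (h z)\<bar> \<partial>M) <= ennreal (e / 4)" for h
    proof -
      have ich: "integrable M (\<lambda>z. c z (h z))" using h by (intro ic) auto
      then have i: "integrable M (\<lambda>z. h z - c z (h z))" using h by auto
      have "\<bar>(LINT z|M. h z) - (LINT z|M. c z (h z))\<bar> = \<bar>LINT z|M. h z - c z (h z)\<bar>" using h ich by simp
      also have "... <= (LINT z|M. \<bar>h z - c z (h z)\<bar>)" by (rule integral_abs_bound)
      also have "... <= e / 4"
      proof -
        have "ennreal (LINT z|M. \<bar>h z - c z (h z)\<bar>) = (\<integral>\<^sup>+z. ennreal \<bar>h z - c z (h z)\<bar> \<partial>M)"
          using i by (intro nn_integral_eq_integral[symmetric]) auto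
        with d have "ennreal (LINT z|M. \<bar>h z - c z (h z)\<bar>) <= ennreal (e / 4)" by simp
        then show ?thesis using e by (simp add: ennreal_le_iff)
      qed
      finally show ?thesis .
    qed
    have "(\<lambda>j. LINT z|M. c z (f j z)) \<longlonglongrightarrow> (LINT z|M. c z (F z))"
    proof (rule integral_dominated_convergence[where w = "\<lambda>z. \<bar>H z\<bar>"])
      show "AE z in M. (\<lambda>j. c z (f j z)) \<longlonglongrightarrow> c z (F z)" using lim unfolding c_def by eventually_elim (intro tendsto_max tendsto_min tendsto_const)
    qed (use H cb in auto)
    from LIMSEQ_D[OF this, of "e / 4"] e obtain J where J: "!!j. J <= j ==> \<bar>(LINT z|M. c z (f j z)) - (LINT z|M. c z (F z))\<bar> < e / 4" by auto
    show "\<exists>J. \<forall>j\<ge>J. norm ((LINT z|M. f j z) - (LINT z|M. F z)) < e"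
    proof (intro exI allI impI)
      fix j assume "J <= j"
      from J[OF this] small[OF int diff, of j] small[OF intF diffF] e
      show "norm ((LINT z|M. f j z) - (LINT z|M. F z)) < e" unfolding real_norm_def by linarith
    qed
  qed
qed

section \<open>Functions of class C^k\<close>

lemma Ck_SucI:
  assumes "!!x. (f has_derivative f' x) (at x)" "!!i. i \<in> Basis ==> Ck k (\<lambda>x. f' x i)"
  shows "Ck (Suc k) f"
proof -
  have "frechet_derivative f (at x) = f' x" for x using frechet_derivative_at[OF assms(1)] by metis
  then show ?thesis using assms by (auto simp: differentiable_def)
qed

lemma Ck_SucD:
  assumes "Ck (Suc k) f"
  shows "(f has_derivative frechet_derivative f (at x)) (at x)"
    "i \<in> Basis ==> Ck k (\<lambda>x. frechet_derivative f (at x) i)" using assms frechet_derivative_works by auto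

lemma Ck_mono_Suc: "Ck (Suc k) f ==> Ck k f"
proof (induction k arbitrary: f)
  case 0 then show ?case by (auto simp: differentiable_imp_continuous_within continuous_at_imp_continuous_on)
next
  case (Suc k) then show ?case by (metis Ck.simps(2))
qed

lemma Ck_const: "Ck k (\<lambda>x. c)" by (induction k arbitrary: c) (auto intro!: Ck_SucI[where f' = "\<lambda>_ _. 0"] simp del: Ck.simps(2))

lemma Ck_linear: "bounded_linear f ==> Ck k f"
proof (cases k)
  case (Suc j)
  assume "bounded_linear f"
  then show ?thesis unfolding Suc by (intro Ck_SucI[where f' = "\<lambda>_. f"] bounded_linear_imp_has_derivative Ck_const)
qed (auto intro: linear_continuous_on)

lemma Ck_inner: "Ck k (\<lambda>x. x \<bullet> b)" by (rule Ck_linear[OF bounded_linear_inner_left])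

lemma Ck_add: "Ck k f ==> Ck k g ==> Ck k (\<lambda>x. f x + g x)"
proof (induction k arbitrary: f g)
  case 0 then show ?case by (auto intro!: continuous_intros)
next
  case (Suc k) show ?case
  proof (rule Ck_SucI)
    show "((\<lambda>x. f x + g x) has_derivative (\<lambda>h. frechet_derivative f (at x) h + frechet_derivative g (at x) h)) (at x)" for x
      by (intro has_derivative_add Ck_SucD(1)[OF Suc.prems(1)] Ck_SucD(1)[OF Suc.prems(2)])
    show "Ck k (\<lambda>x. frechet_derivative f (at x) i + frechet_derivative g (at x) i)" if "i \<in> Basis" for i
      by (intro Suc.IH Ck_SucD(2)[OF Suc.prems(1) that] Ck_SucD(2)[OF Suc.prems(2) that])
  qed
qed

lemma Ck_mult: "Ck k f ==> Ck k g ==> Ck k (\<lambda>x. f x * g x)"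
proof (induction k arbitrary: f g)
  case 0 then show ?case by (auto intro!: continuous_intros)
next
  case (Suc k) show ?case
  proof (rule Ck_SucI)
    show "((\<lambda>x. f x * g x) has_derivative (\<lambda>h. f x * frechet_derivative g (at x) h + frechet_derivative f (at x) h * g x)) (at x)" for x
      by (intro has_derivative_mult Ck_SucD(1)[OF Suc.prems(1)] Ck_SucD(1)[OF Suc.prems(2)])
    show "Ck k (\<lambda>x. f x * frechet_derivative g (at x) i + frechet_derivative f (at x) i * g x)" if "i \<in> Basis" for i
      by (intro Ck_add Suc.IH Ck_mono_Suc[OF Suc.prems(1)] Ck_mono_Suc[OF Suc.prems(2)]
        Ck_SucD(2)[OF Suc.prems(1) that] Ck_SucD(2)[OF Suc.prems(2) that])
  qed
qed

lemma real_polynomial_function_Ck: "real_polynomial_function f ==> Ck k f"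
  by (induction rule: real_polynomial_function.induct) (auto intro: Ck_linear Ck_const Ck_add Ck_mult)

lemma Ck_Lipschitz_on_cball:
  fixes \<eta> :: "'a::euclidean_space => real"
  assumes "Ck (Suc 0) \<eta>"
  obtains L where "0 <= L" "!!x y. norm x <= R ==> norm y <= R ==> \<bar>\<eta> x - \<eta> y\<bar> <= L * norm (x - y)"
proof -
  let ?D = "\<lambda>x. frechet_derivative \<eta> (at x)"
  have diff: "(\<eta> has_derivative ?D x) (at x)" for x using assms by (simp add: frechet_derivative_works[symmetric])
  have c: "continuous_on UNIV (\<lambda>x. ?D x i)" if "i \<in> Basis" for i using assms that by simp
  have "\<exists>B. \<forall>i\<in>Basis. \<forall>x\<in>cball 0 R. \<bar>?D x i\<bar> <= B i"
  proof -
    have "\<forall>i\<in>Basis. \<exists>b. \<forall>x\<in>cball 0 R. \<bar>?D x i\<bar> <= b"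
    proof
      fix i :: 'a assume i: "i \<in> Basis"
      have "compact ((\<lambda>x. ?D x i) ` cball 0 R)" by (intro compact_continuous_image continuous_on_subset[OF c[OF i]]) auto
      then have "bounded ((\<lambda>x. ?D x i) ` cball 0 R)" by (rule compact_imp_bounded)
      then show "\<exists>b. \<forall>x\<in>cball 0 R. \<bar>?D x i\<bar> <= b" by (auto simp: bounded_iff)
    qed
    then show ?thesis by (rule bchoice)
  qed
  then obtain B where B: "!!i x. i \<in> Basis ==> x \<in> cball 0 R ==> \<bar>?D x i\<bar> <= B i" by blast
  define L where "L = (\<Sum>i\<in>Basis. \<bar>B i\<bar>)"
  show ?thesis
  proof (rule that[of L])
    show "0 <= L" by (simp add: L_def sum_nonneg)
    fix x y :: 'a assume xy: "norm x <= R" "norm y <= R"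
    have "norm (\<eta> x - \<eta> y) <= L * norm (x - y)"
    proof (rule differentiable_bound[where S = "cball 0 R" and f' = ?D])
      fix z :: 'a assume z: "z \<in> cball 0 R"
      show "(\<eta> has_derivative ?D z) (at z within cball 0 R)" using diff by (rule has_derivative_at_withinI)
      have "onorm (?D z) <= (\<Sum>i\<in>Basis. norm (?D z i))" using diff by (intro onorm_componentwise has_derivative_bounded_linear)
      also have "... <= L" unfolding L_def by (intro sum_mono) (simp add: order_trans[OF B[OF _ z] abs_ge_self])
      finally show "onorm (?D z) <= L" .
    qed (use xy in auto)
    then show "\<bar>\<eta> x - \<eta> y\<bar> <= L * norm (x - y)" by simp
  qed
qed

section \<open>Limits of forms and energies\<close>

context nonlocal_kernel
begin

lemma form_tendsto:
  assumes "!!x. (\<lambda>j. v j x) \<longlonglongrightarrow> V x" "!!x. (\<lambda>j. \<eta> j x) \<longlonglongrightarrow> \<zeta> x"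
  shows "(\<lambda>j. form (v j) (\<eta> j) z) \<longlonglongrightarrow> form V \<zeta> z"
proof -
  have "(\<lambda>j. Jp p (jump (v j) z)) \<longlonglongrightarrow> Jp p (jump V z)" by (rule isCont_tendsto_compose[OF isCont_Jp[OF p_gt]]) (intro tendsto_diff assms)
  then show ?thesis unfolding form_def by (intro tendsto_mult tendsto_diff assms)
qed

lemma energy_on_scaled:
  assumes "v \<in> borel_measurable borel" "D \<in> sets borel" "energy_on D v <= ennreal A" "0 <= c" "0 <= A"
  shows "(\<lambda>z. c * (indicator (D \<times> D) z * \<bar>jump v z\<bar> powr p)) \<in> borel_measurable \<mu>"
    "(\<integral>\<^sup>+z. ennreal (c * (indicator (D \<times> D) z * \<bar>jump v z\<bar> powr p)) \<partial>\<mu>) <= ennreal (c * A)"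
proof -
  note [measurable] = assms(1,2)
  show "(\<lambda>z. c * (indicator (D \<times> D) z * \<bar>jump v z\<bar> powr p)) \<in> borel_measurable \<mu>" by measurable
  have "(\<integral>\<^sup>+z. ennreal (c * (indicator (D \<times> D) z * \<bar>jump v z\<bar> powr p)) \<partial>\<mu>) =
    (\<integral>\<^sup>+z. ennreal c * (ennreal (\<bar>jump v z\<bar> powr p) * indicator (D \<times> D) z) \<partial>\<mu>)"
    using assms(4) by (intro nn_integral_cong) (auto simp: indicator_def ennreal_mult)
  also have "... = ennreal c * energy_on D v" unfolding energy_on_def by (rule nn_integral_cmult) measurable
  also have "... <= ennreal c * ennreal A" by (intro mult_left_mono assms) auto
  finally show "(\<integral>\<^sup>+z. ennreal (c * (indicator (D \<times> D) z * \<bar>jump v z\<bar> powr p)) \<partial>\<mu>) <= ennreal (c * A)" using assms by (simp add: ennreal_mult)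
qed

text \<open>By Young's inequality one of the two factors may be given an arbitrarily small weight, so a uniform
  energy bound for the converging factor suffices.\<close>

lemma integral_form_tendsto:
  assumes "bounded W" "0 < d" and WD: "!!x. x \<in> W ==> ball x d \<subseteq> D"
    and W [measurable]: "W \<in> sets borel" and D [measurable]: "D \<in> sets borel" and G: "finite_tail G"
    and v: "!!j. finite_energy D (v j)" "!!j x. x \<in> D ==> \<bar>v j x\<bar> <= Mv" "!!j x. x \<notin> D ==> \<bar>v j x\<bar> <= \<bar>G x\<bar>"
    and \<eta>: "!!j. finite_energy D (\<eta> j)" "!!j x. x \<in> W ==> \<bar>\<eta> j x\<bar> <= M" "!!j x. x \<notin> W ==> \<eta> j x = 0"
    and lim: "!!x. (\<lambda>j. v j x) \<longlonglongrightarrow> V x" "!!x. (\<lambda>j. \<eta> j x) \<longlonglongrightarrow> \<zeta> x"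
    and A: "0 <= A" "(\<forall>j. v j = V \<and> energy_on D (\<eta> j) <= ennreal A) \<or> (\<forall>j. \<eta> j = \<zeta> \<and> energy_on D (v j) <= ennreal A)"
  shows "integrable \<mu> (form V \<zeta>)" "(\<lambda>j. LINT z|\<mu>. form (v j) (\<eta> j) z) \<longlonglongrightarrow> (LINT z|\<mu>. form V \<zeta> z)"
proof -
  have WD': "W \<subseteq> D" using WD \<open>0 < d\<close> by force
  have vm [measurable]: "v j \<in> borel_measurable borel" and \<eta>m [measurable]: "\<eta> j \<in> borel_measurable borel" for j
    using v(1) \<eta>(1) by (auto simp: finite_energy_def)
  have Vm [measurable]: "V \<in> borel_measurable borel" "\<zeta> \<in> borel_measurable borel"
    using borel_measurable_LIMSEQ_real[OF lim(1) vm] borel_measurable_LIMSEQ_real[OF lim(2) \<eta>m] by auto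
  have tail: "finite_tail (v j)" for j
  proof (rule finite_tail_dominate[OF G vm])
    show "AE y in lborel. \<bar>v j y\<bar> <= \<bar>Mv\<bar> + \<bar>G y\<bar>"
    proof (rule AE_I2)
      fix y show "\<bar>v j y\<bar> <= \<bar>Mv\<bar> + \<bar>G y\<bar>" using v(2)[of y j] v(3)[of y j] by (cases "y \<in> D") auto
    qed
  qed
  have int: "integrable \<mu> (form (v j) (\<eta> j))" for j by (rule integrable_form[OF assms(1,2) WD W D v(1) tail \<eta>(1)]) (use \<eta> in auto)
  have ifar: "integrable \<mu> (form_far W D M Mv G)" by (rule integrable_form_far[OF assms(1,2) WD W D G])
  have bd: "\<bar>form (v j) (\<eta> j) z\<bar> <= t * (indicator (D \<times> D) z * \<bar>jump (v j) z\<bar> powr p) +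
    t powr (1 - p) * (indicator (D \<times> D) z * \<bar>jump (\<eta> j) z\<bar> powr p) + form_far W D M Mv G z" if "0 < t" for t j z
    by (rule abs_form_le[OF WD' that]) (use \<eta> v in auto)
  have dom: "\<exists>H R. integrable \<mu> H \<and> (\<forall>j. R j \<in> borel_measurable \<mu> \<and>
      (\<integral>\<^sup>+z. ennreal (R j z) \<partial>\<mu>) <= ennreal e \<and> (AE z in \<mu>. \<bar>form (v j) (\<eta> j) z\<bar> <= H z + R j z))" if e: "0 < e" for e using A(2)
  proof
    assume *: "\<forall>j. v j = V \<and> energy_on D (\<eta> j) <= ennreal A"
    \<comment> \<open>The factor with merely bounded energy is here the test function, whose weight
      in Young's inequality is \<open>t powr (1 - p)\<close>; this choice makes it equal to
      \<open>e / (A + 1)\<close>. In the other case the weight is \<open>t\<close> itself.\<close>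
    define t where "t = (e / (A + 1)) powr (1 / (1 - p))"
    have t: "0 < t" using e A by (simp add: t_def add_nonneg_pos)
    have tp: "t powr (1 - p) = e / (A + 1)" using e A p_gt by (simp add: t_def powr_powr)
    have "e * A <= e * (A + 1)" using e by simp
    then have tA: "t powr (1 - p) * A <= e" unfolding tp using A e by (simp add: pos_divide_le_eq add_nonneg_pos)
    let ?H = "\<lambda>z. t * (indicator (D \<times> D) z * \<bar>jump V z\<bar> powr p) + form_far W D M Mv G z"
    let ?R = "\<lambda>j z. t powr (1 - p) * (indicator (D \<times> D) z * \<bar>jump (\<eta> j) z\<bar> powr p)"
    show ?thesis
    proof (rule exI[of _ ?H], rule exI[of _ ?R], intro conjI allI)
      have "finite_energy D V" using * v(1) by metis
      then show "integrable \<mu> ?H" using ifar by (intro Bochner_Integration.integrable_add integrable_mult_right integrable_energy) auto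
      show "?R j \<in> borel_measurable \<mu>" for j by measurable
      show "(\<integral>\<^sup>+z. ennreal (?R j z) \<partial>\<mu>) <= ennreal e" for j
        using * A(1) tA by (intro order_trans[OF energy_on_scaled(2)[OF \<eta>m D, of j A] ennreal_leI]) auto
      show "AE z in \<mu>. \<bar>form (v j) (\<eta> j) z\<bar> <= ?H z + ?R j z" for j using bd[OF t, of j] * by (intro AE_I2) (simp add: algebra_simps)
    qed
  next
    assume *: "\<forall>j. \<eta> j = \<zeta> \<and> energy_on D (v j) <= ennreal A"
    define t where "t = e / (A + 1)"
    have t: "0 < t" using e A by (simp add: t_def add_nonneg_pos)
    have "e * A <= e * (A + 1)" using e by simp
    then have tA: "t * A <= e" unfolding t_def using A e by (simp add: pos_divide_le_eq add_nonneg_pos)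
    let ?H = "\<lambda>z. t powr (1 - p) * (indicator (D \<times> D) z * \<bar>jump \<zeta> z\<bar> powr p) + form_far W D M Mv G z"
    let ?R = "\<lambda>j z. t * (indicator (D \<times> D) z * \<bar>jump (v j) z\<bar> powr p)"
    show ?thesis
    proof (rule exI[of _ ?H], rule exI[of _ ?R], intro conjI allI)
      have "finite_energy D \<zeta>" using * \<eta>(1) by metis
      then show "integrable \<mu> ?H" using ifar by (intro Bochner_Integration.integrable_add integrable_mult_right integrable_energy) auto
      show "?R j \<in> borel_measurable \<mu>" for j by measurable
      show "(\<integral>\<^sup>+z. ennreal (?R j z) \<partial>\<mu>) <= ennreal e" for j
        using * A(1) tA t by (intro order_trans[OF energy_on_scaled(2)[OF vm D, of j A] ennreal_leI]) auto
      show "AE z in \<mu>. \<bar>form (v j) (\<eta> j) z\<bar> <= ?H z + ?R j z" for j using bd[OF t, of j] * by (intro AE_I2) (simp add: algebra_simps)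
    qed
  qed
  have Fm: "form V \<zeta> \<in> borel_measurable \<mu>" by measurable
  have l: "AE z in \<mu>. (\<lambda>j. form (v j) (\<eta> j) z) \<longlonglongrightarrow> form V \<zeta> z" by (intro AE_I2 form_tendsto lim)
  show "integrable \<mu> (form V \<zeta>)" "(\<lambda>j. LINT z|\<mu>. form (v j) (\<eta> j) z) \<longlonglongrightarrow> (LINT z|\<mu>. form V \<zeta> z)"
    using integral_tendsto_nearly_dominated[OF Fm int l dom] by blast+
qed

lemma energy_on_liminf:
  assumes [measurable]: "!!j. v j \<in> borel_measurable borel" "D \<in> sets borel"
    and lim: "!!x. (\<lambda>j. v j x) \<longlonglongrightarrow> V x" and A: "!!j. energy_on D (v j) <= A"
  shows "energy_on D V <= A"
proof -
  have "energy_on D V = (\<integral>\<^sup>+z. liminf (\<lambda>j. ennreal (\<bar>jump (v j) z\<bar> powr p) * indicator (D \<times> D) z) \<partial>\<mu>)" unfolding energy_on_def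
  proof (rule nn_integral_cong)
    fix z
    have "(\<lambda>j. ennreal (\<bar>jump (v j) z\<bar> powr p * indicator (D \<times> D) z)) \<longlonglongrightarrow>
      ennreal (\<bar>jump V z\<bar> powr p * indicator (D \<times> D) z)"
      using p_pos by (intro tendsto_ennrealI tendsto_mult tendsto_powr' tendsto_rabs tendsto_diff lim tendsto_const) auto
    then have "(\<lambda>j. ennreal (\<bar>jump (v j) z\<bar> powr p) * indicator (D \<times> D) z) \<longlonglongrightarrow>
      ennreal (\<bar>jump V z\<bar> powr p) * indicator (D \<times> D) z" by (auto simp: indicator_def)
    then show "ennreal (\<bar>jump V z\<bar> powr p) * indicator (D \<times> D) z =
      liminf (\<lambda>j. ennreal (\<bar>jump (v j) z\<bar> powr p) * indicator (D \<times> D) z)" by (simp add: lim_imp_Liminf)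
  qed
  also have "... <= liminf (\<lambda>j. energy_on D (v j))" unfolding energy_on_def by (rule nn_integral_liminf) measurable
  also have "... <= liminf (\<lambda>j::nat. A)" using A by (intro Liminf_mono always_eventually) auto
  also have "... = A" by (simp add: Liminf_const)
  finally show ?thesis .
qed

end

lemma continuous_AE_le:
  fixes f :: "'a::euclidean_space => real"
  assumes "open G" "continuous_on G f" and ae: "AE x in lborel. x \<in> G --> f x <= c" and x: "x \<in> G"
  shows "f x <= c"
proof (rule ccontr)
  assume "\<not> ?thesis"
  then have "0 < f x - c" by simp
  moreover have "isCont f x" using assms continuous_on_eq_continuous_at by blast
  ultimately obtain r1 where r1: "0 < r1" "!!y. dist y x < r1 ==> \<bar>f y - f x\<bar> < f x - c" unfolding continuous_at_eps_delta dist_real_def by blast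
  obtain r2 where r2: "0 < r2" "ball x r2 \<subseteq> G" using assms by (auto simp: open_contains_ball)
  obtain y where y: "y \<in> ball x (min r1 r2)" "y \<in> G --> f y <= c" using AE_ball_ex[OF ae, of "min r1 r2" x] r1 r2 by auto
  then have "\<bar>f y - f x\<bar> < f x - c" by (intro r1(2)) (auto simp: dist_commute)
  moreover have "y \<in> G" using y r2 by auto
  ultimately show False using y(2) by linarith
qed

lemma infdist_less_ex:
  assumes "A \<noteq> {}" "infdist x A < d"
  shows "\<exists>a\<in>A. dist x a < d" using assms by (auto simp: infdist_notempty cINF_less_iff)

section \<open>Solutions for continuous data as uniform limits\<close>

context dirichlet_domain
begin

lemma \<Omega>_subset_interior_N: "\<Omega> \<subseteq> interior N" using ball_\<Omega> d0_pos unfolding subset_iff mem_interior by metis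

lemma solution_cong_AE:
  assumes u: "solution u" and [measurable]: "w \<in> borel_measurable borel" and eq: "AE x in lborel. w x = u x"
    and M: "!!x. x \<in> N ==> \<bar>w x\<bar> <= M"
  shows "solution w" unfolding solution_def
proof (intro conjI allI impI)
  have [measurable]: "u \<in> borel_measurable borel" using u by measurable
  have "energy_on N w = energy_on N u" by (rule energy_on_cong_AE) (use eq in \<open>auto elim!: eventually_mono\<close>)
  then show "finite_energy N w" using u M by (auto simp: solution_def finite_energy_def)
  have "AE x in lborel. \<bar>w x\<bar> <= 0 + \<bar>u x\<bar>" using eq by eventually_elim simp
  then show "finite_tail w" using u by (intro finite_tail_dominate[of u w 0]) (auto simp: solution_def)
  fix \<eta> assume t: "test \<eta>"
  then have [measurable]: "\<eta> \<in> borel_measurable borel" by (auto simp: test_def finite_energy_def)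
  have "(LINT z|\<mu>. form w \<eta> z) = (LINT z|\<mu>. form u \<eta> z)"
  proof (rule integral_cong_AE)
    show "AE z in \<mu>. form w \<eta> z = form u \<eta> z" using AE_\<mu>_fst[OF eq] AE_\<mu>_snd[OF eq] by eventually_elim (simp add: form_def)
  qed auto
  then show "(LINT z|\<mu>. form w \<eta> z) = 0" using u t by (simp add: solution_def)
qed

lemma continuous_solution:
  assumes sol: "solution u" and \<delta>: "0 < \<delta>" "exterior_density \<delta>"
    and ug: "!!x. x \<notin> \<Omega> ==> u x = g x" and g: "continuous_on (interior N) g"
  obtains w where "solution w" "continuous_on (interior N) w" "!!x. x \<notin> \<Omega> ==> w x = g x"
proof -
  have [measurable]: "u \<in> borel_measurable borel" using sol by measurable
  obtain U where U: "continuous_on (interior N) U" "AE x in lborel. x \<in> interior N --> u x = U x"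
    "!!x. x \<in> interior N - \<Omega> ==> U x = g x" using solution_continuous_version[OF sol \<delta> ug g] by blast
  \<comment> \<open>Only the values inside \<Omega> are replaced, so the exterior values remain
    exact and the function remains Borel measurable.\<close>
  define w where "w x = (if x \<in> \<Omega> then U x else u x)" for x
  have wU: "w x = U x" if "x \<in> interior N" for x using that U(3)[of x] ug[of x] by (auto simp: w_def)
  have cw: "continuous_on (interior N) w" using U(1) wU by (simp cong: continuous_on_cong)
  have "(\<lambda>x. indicator \<Omega> x *\<^sub>R U x) \<in> borel_measurable borel"
    using U(1) \<Omega>_subset_interior_N by (intro borel_measurable_continuous_on_indicator) (auto intro: continuous_on_subset)
  then have "(\<lambda>x. indicator \<Omega> x *\<^sub>R U x + indicator (- \<Omega>) x * u x) \<in> borel_measurable borel" by measurable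
  also have "(\<lambda>x. indicator \<Omega> x *\<^sub>R U x + indicator (- \<Omega>) x * u x) = w" by (auto simp: w_def fun_eq_iff)
  finally have wm: "w \<in> borel_measurable borel" .
  have eq: "AE x in lborel. w x = u x" using U(2) by eventually_elim (use \<Omega>_subset_interior_N in \<open>auto simp: w_def\<close>)
  obtain M where M: "!!x. x \<in> N ==> \<bar>u x\<bar> <= M" using sol by (auto simp: solution_def finite_energy_def)
  \<comment> \<open>A bound at every point of \<open>N\<close> is required, while equality with
    \<open>u\<close> holds almost everywhere; continuity carries the bound to all points of
    \<Omega>.\<close>
  have Mw: "\<bar>w x\<bar> <= M" if "x \<in> N" for x
  proof (cases "x \<in> \<Omega>")
    case True have "AE x in lborel. x \<in> interior N --> \<bar>w x\<bar> <= M" using eq by eventually_elim (use M interior_subset in auto)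
    moreover have "continuous_on (interior N) (\<lambda>x. \<bar>w x\<bar>)" using cw by (intro continuous_intros)
    ultimately show ?thesis using True \<Omega>_subset_interior_N by (intro continuous_AE_le[of "interior N" "\<lambda>x. \<bar>w x\<bar>"]) auto
  next
    case False then show ?thesis using M[OF that] by (simp add: w_def)
  qed
  show ?thesis by (rule that[OF solution_cong_AE[OF sol wm eq Mw] cw]) (auto simp: w_def ug)
qed

lemma approximate_solution:
  assumes [measurable]: "g \<in> borel_measurable borel" and gt: "finite_tail g" and gc: "continuous_on N g"
    and \<delta>: "0 < \<delta>" "exterior_density \<delta>" and e: "0 < e"
  obtains w where "solution w" "continuous_on (interior N) w" "!!x. x \<in> N - \<Omega> ==> \<bar>w x - g x\<bar> <= e"
    "!!x. x \<notin> N ==> w x = g x"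
proof -
  obtain P where P: "real_polynomial_function P" "!!x. x \<in> N ==> \<bar>g x - P x\<bar> < e"
    using Stone_Weierstrass_real_polynomial_function[OF compact_N gc e] by blast
  obtain R where R: "!!x. x \<in> N ==> norm x <= R" using bounded_N by (auto simp: bounded_iff)
  obtain L where LM: "0 <= L" "!!x y. norm x <= R ==> norm y <= R ==> \<bar>P x - P y\<bar> <= L * norm (x - y)"
    using Ck_Lipschitz_on_cball[OF real_polynomial_function_Ck[OF P(1)]] by blast
  \<comment> \<open>Only inside \<open>N\<close> is the datum replaced by a polynomial, which is
    Lipschitz there and hence of finite energy. The jump at the boundary of \<open>N\<close> is
    harmless, as energy is measured inside \<open>N\<close>, and far away the datum is
    unchanged.\<close>
  define h where "h x = (if x \<in> N then P x else g x)" for x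
  have cP: "continuous_on S P" for S using continuous_real_polymonial_function[OF P(1)] by (simp add: continuous_at_imp_continuous_on)
  then have [measurable]: "P \<in> borel_measurable borel" by (intro borel_measurable_continuous_onI)
  have hm [measurable]: "h \<in> borel_measurable borel" unfolding h_def[abs_def] by measurable
  have h_energy: "finite_energy N h" using LM R by (intro finite_energy_Lipschitz[of _ _ L]) (auto simp: h_def bounded_N)
  have h_tail: "finite_tail h"
  proof (rule finite_tail_dominate[OF gt hm])
    show "AE y in lborel. \<bar>h y\<bar> <= e + \<bar>g y\<bar>"
    proof (rule AE_I2)
      fix y show "\<bar>h y\<bar> <= e + \<bar>g y\<bar>" using P(2)[of y] e by (auto simp: h_def)
    qed
  qed
  interpret D: dirichlet_data s p \<Lambda> K \<Omega> N d0 h by unfold_locales (fact h_energy h_tail)+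
  obtain V where V: "solution V" "!!x. x \<notin> \<Omega> ==> V x = h x" using D.solution_exists by blast
  have "continuous_on (interior N) h"
    using cP[of "interior N"] interior_subset[of N] by (subst continuous_on_cong[OF refl, of _ _ P]) (auto simp: h_def)
  then obtain w where w: "solution w" "continuous_on (interior N) w" "!!x. x \<notin> \<Omega> ==> w x = h x"
    using continuous_solution[OF V(1) \<delta> V(2)] by blast
  show ?thesis
  proof (rule that[OF w(1,2)])
    show "\<bar>w x - g x\<bar> <= e" if "x \<in> N - \<Omega>" for x using w(3)[of x] P(2)[of x] that by (auto simp: h_def)
    show "w x = g x" if "x \<notin> N" for x using w(3)[of x] that \<Omega>_subset_N by (auto simp: h_def)
  qed
qed

text \<open>The shifted function \<open>b + u\<close> takes values in \<open>[0, 2 * b]\<close> on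
  \<open>N\<close>. A barrier equal to \<open>3 * b\<close> on \<open>W\<close> lies above it, so on
  \<open>W\<close> the gap is \<open>2 * b - u\<close> and has the energy of \<open>u\<close>. The
  bound depends on \<open>u\<close> only through \<open>B\<close> and \<open>G\<close> and is thus
  uniform along an approximating sequence.\<close>

lemma local_energy_bound:
  assumes G: "finite_tail G" and [measurable]: "W \<in> sets borel" and d: "0 < d" and W: "!!x. x \<in> W ==> ball x d \<subseteq> \<Omega>"
  shows "\<exists>A\<ge>0. \<forall>u. solution u --> (\<forall>x\<in>N. \<bar>u x\<bar> <= B) --> (\<forall>x. x \<notin> N --> \<bar>u x\<bar> <= \<bar>G x\<bar>) --> energy_on W u <= ennreal A"
proof (cases "W = {}")
  case True then show ?thesis by (intro exI[of _ 0]) (auto simp: energy_on_def)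
next
  case False have [measurable]: "G \<in> borel_measurable borel" using G by measurable
  \<comment> \<open>The maximum makes the height of the barrier positive.\<close>
  define b where "b = max B 1"
  have b: "0 < b" "B <= b" by (auto simp: b_def)
  define W' where "W' = {x. infdist x W < d}"
  have W'\<Omega>: "W' \<subseteq> \<Omega>"
  proof
    fix x assume "x \<in> W'"
    then obtain a where "a \<in> W" "dist x a < d" using infdist_less_ex[OF False] by (auto simp: W'_def)
    then show "x \<in> \<Omega>" using W[of a] by (auto simp: dist_commute)
  qed
  have "open W'" unfolding W'_def by (intro open_Collect_less continuous_intros)
  then have [measurable]: "W' \<in> sets borel" by simp
  have WW': "W \<subseteq> W'" using d by (auto simp: W'_def)
  \<comment> \<open>The barrier falls from \<open>3 * b\<close> on \<open>W\<close> to 0 at distance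
    \<open>d\<close>, hence within \<Omega>; at points of \<open>W\<close> it exceeds the shifted
    solution by at least \<open>b\<close>.\<close>
  define \<psi> where "\<psi> x = 3 * b * max 0 (1 - infdist x W / d)" for x
  define L where "L = 3 * b / d"
  have L: "0 <= L" using b d by (simp add: L_def)
  have \<psi>L: "\<bar>\<psi> x - \<psi> y\<bar> <= L * norm (x - y)" for x y
  proof -
    have "\<bar>max 0 (1 - infdist x W / d) - max 0 (1 - infdist y W / d)\<bar> <= \<bar>infdist x W / d - infdist y W / d\<bar>" by linarith
    also have "... = \<bar>infdist x W - infdist y W\<bar> / d" using d by (simp add: diff_divide_distrib[symmetric])
    also have "... <= norm (x - y) / d" using d infdist_triangle_abs[of x W y] by (intro divide_right_mono) (auto simp: dist_norm)
    finally have "3 * b * \<bar>max 0 (1 - infdist x W / d) - max 0 (1 - infdist y W / d)\<bar> <= 3 * b * (norm (x - y) / d)"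
      using b by (intro mult_left_mono) auto
    then show ?thesis using b by (simp add: \<psi>_def L_def abs_mult right_diff_distrib[symmetric])
  qed
  have \<psi>r: "0 <= \<psi> x \<and> \<psi> x <= 3 * b" for x
  proof -
    have "max 0 (1 - infdist x W / d) <= 1" using d infdist_nonneg[of x W] by (auto simp: field_simps)
    then have "3 * b * max 0 (1 - infdist x W / d) <= 3 * b * 1" using b by (intro mult_left_mono) auto
    then show ?thesis using b by (simp add: \<psi>_def)
  qed
  have \<psi>0: "\<psi> x = 0" if "x \<notin> W'" for x using that d by (auto simp: \<psi>_def W'_def field_simps)
  have \<psi>W: "\<psi> x = 3 * b" if "x \<in> W" for x using that by (simp add: \<psi>_def)
  obtain C1 where C1: "0 < C1" "!!x y. x \<in> \<Omega> ==> y \<notin> N ==> K x y <= C1 * tail_weight q y"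
    using K_le_tail_weight[OF bounded_\<Omega> d0_pos ball_\<Omega>] by blast
  have "(\<integral>\<^sup>+y. ennreal (\<bar>G y\<bar> powr (p - 1)) * ennreal (tail_weight q y) \<partial>lborel) < \<infinity>" using G by (simp add: finite_tail_def)
  then obtain T0 where T0: "0 <= T0" "(\<integral>\<^sup>+y. ennreal (\<bar>G y\<bar> powr (p - 1)) * ennreal (tail_weight q y) \<partial>lborel) = ennreal T0"
    by (cases "\<integral>\<^sup>+y. ennreal (\<bar>G y\<bar> powr (p - 1)) * ennreal (tail_weight q y) \<partial>lborel" rule: ennreal_cases) auto
  obtain C where C: "0 < C" "!!v S W \<psi> k L \<rho> T. barrier v S W \<psi> k L \<rho> T ==>
      energy_on S (barrier_gap v W \<psi>) <= ennreal (C * barrier_bound L k \<rho> T) * emeasure lborel (below_barrier v W \<psi>)" by (rule Caccioppoli) blast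
  define \<beta> where "\<beta> = C * barrier_bound L (3 * b) d0 (C1 * T0)"
  have "ennreal \<beta> * emeasure lborel N < \<infinity>" using emeasure_bounded_finite[OF bounded_N] by (simp add: ennreal_mult_less_top)
  then obtain A where A: "0 <= A" "ennreal \<beta> * emeasure lborel N = ennreal A" by (cases "ennreal \<beta> * emeasure lborel N" rule: ennreal_cases) auto
  show ?thesis
  proof (intro exI[of _ A] conjI A(1) allI impI)
    fix u assume u: "solution u" and uN': "\<forall>x\<in>N. \<bar>u x\<bar> <= B" and uG': "\<forall>x. x \<notin> N --> \<bar>u x\<bar> <= \<bar>G x\<bar>"
    note uN = bspec[OF uN'] and uG = uG'[rule_format]
    have [measurable]: "u \<in> borel_measurable borel" using u by measurable
    define v where "v x = b + u x" for x
    have vs: "solution v" unfolding v_def[abs_def] by (rule solution_shift[OF u])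
    have vN: "0 <= v x" "v x <= 2 * b" if "x \<in> N" for x using uN[OF that] b by (auto simp: v_def)
    have bar: "barrier v N W' \<psi> (3 * b) L d0 (C1 * T0)" unfolding barrier_def
    proof (intro conjI)
      show "\<forall>x\<in>W'. ball x d0 \<subseteq> N" using W'\<Omega> ball_\<Omega> by blast
      show "AE x in lborel. x \<in> N --> 0 <= v x" using vN by auto
      show "AE x in lborel. x \<in> W' - \<Omega> --> \<psi> x <= v x" using W'\<Omega> by auto
      show "0 <= C1 * T0" using C1 T0 by simp
      show "\<forall>x\<in>W'. (\<integral>\<^sup>+y. ennreal (K x y) * ennreal (max (- v y) 0 powr (p - 1)) * indicator (- N) y \<partial>lborel) <= ennreal (C1 * T0)"
      proof
        fix x assume "x \<in> W'"
        then have x: "x \<in> \<Omega>" using W'\<Omega> by auto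
        have "(\<integral>\<^sup>+y. ennreal (K x y) * ennreal (max (- v y) 0 powr (p - 1)) * indicator (- N) y \<partial>lborel) <=
          (\<integral>\<^sup>+y. ennreal C1 * (ennreal (\<bar>G y\<bar> powr (p - 1)) * ennreal (tail_weight q y)) \<partial>lborel)"
        proof (rule nn_integral_mono)
          fix y
          show "ennreal (K x y) * ennreal (max (- v y) 0 powr (p - 1)) * indicator (- N) y <=
            ennreal C1 * (ennreal (\<bar>G y\<bar> powr (p - 1)) * ennreal (tail_weight q y))"
          proof (cases "y \<in> N")
            case False have "max (- v y) 0 <= \<bar>G y\<bar>" using uG[OF False] b by (auto simp: v_def)
            then have "max (- v y) 0 powr (p - 1) <= \<bar>G y\<bar> powr (p - 1)" using p_gt by (intro powr_mono2) auto
            with C1(2)[OF x False] have "K x y * max (- v y) 0 powr (p - 1) <= (C1 * tail_weight q y) * \<bar>G y\<bar> powr (p - 1)"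
              using C1(1) by (intro mult_mono) auto
            then show ?thesis using False C1(1) by (simp add: ennreal_mult[symmetric] mult_ac ennreal_leI)
          qed simp
        qed
        also have "... = ennreal C1 * ennreal T0" unfolding T0(2)[symmetric] by (rule nn_integral_cmult) measurable
        finally show "(\<integral>\<^sup>+y. ennreal (K x y) * ennreal (max (- v y) 0 powr (p - 1)) * indicator (- N) y \<partial>lborel) <= ennreal (C1 * T0)"
          using C1 T0 by (simp add: ennreal_mult)
      qed
    qed (use vs L \<psi>L \<psi>r \<psi>0 d0_pos in auto)
    have gap: "barrier_gap v W' \<psi> x = 2 * b - u x" if x: "x \<in> W" for x
    proof -
      have "x \<in> W'" "x \<in> \<Omega>" using x WW' W'\<Omega> by auto
      moreover have "x \<in> N" using \<open>x \<in> \<Omega>\<close> \<Omega>_subset_N by auto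
      ultimately show ?thesis using \<psi>W[OF x] vN[of x] b by (simp add: barrier_gap_def v_def)
    qed
    have "energy_on W u = energy_on W (barrier_gap v W' \<psi>)"
      unfolding energy_on_def by (intro nn_integral_cong) (auto simp: indicator_def gap abs_minus_commute)
    also have "... <= energy_on N (barrier_gap v W' \<psi>)" using WW' W'\<Omega> \<Omega>_subset_N by (intro energy_on_mono) auto
    also have "... <= ennreal \<beta> * emeasure lborel (below_barrier v W' \<psi>)" unfolding \<beta>_def by (rule C(2)[OF bar])
    also have "... <= ennreal \<beta> * emeasure lborel N" using \<Omega>_subset_N by (intro mult_left_mono emeasure_mono) (auto simp: below_barrier_def)
    finally show "energy_on W u <= ennreal A" unfolding A(2) .
  qed
qed

text \<open>For a merely continuous datum the energy may be infinite up to the boundary. The last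
  two conclusions therefore concern sets and test functions at positive distance from the complement
  of \<Omega>, for which the local energy bound survives in the limit.\<close>

theorem continuous_solution_exists:
  assumes [measurable]: "g \<in> borel_measurable borel" and gt: "finite_tail g" and gc: "continuous_on N g"
    and \<delta>: "0 < \<delta>" "exterior_density \<delta>"
  obtains V where "V \<in> borel_measurable borel" "!!x. x \<notin> \<Omega> ==> V x = g x" "continuous_on (interior N) V"
    "finite_tail V"
    "!!W d. W \<in> sets borel ==> 0 < d ==> (!!x. x \<in> W ==> ball x d \<subseteq> \<Omega>) ==> finite_energy W V"
    "!!W d \<eta>. W \<in> sets borel ==> 0 < d ==> (!!x. x \<in> W ==> ball x d \<subseteq> \<Omega>) ==> finite_energy N \<eta> ==>
      (!!x. x \<notin> W ==> \<eta> x = 0) ==> integrable \<mu> (form V \<eta>) \<and> (LINT z|\<mu>. form V \<eta> z) = 0"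
proof -
  define E where "E j = (1 / 2 :: real) ^ j" for j :: nat
  have E: "0 < E j" "E j <= 1" for j by (auto simp: E_def power_le_one)
  have E0: "E \<longlonglongrightarrow> 0" unfolding E_def[abs_def] by (rule LIMSEQ_realpow_zero) auto
  have "\<exists>w. solution w \<and> continuous_on (interior N) w \<and> (\<forall>x\<in>N - \<Omega>. \<bar>w x - g x\<bar> <= E j) \<and> (\<forall>x. x \<notin> N --> w x = g x)" for j
    by (rule approximate_solution[OF assms E(1)[of j]]) blast
  then obtain w where w: "!!j. solution (w j)" "!!j. continuous_on (interior N) (w j)"
    "!!j x. x \<in> N - \<Omega> ==> \<bar>w j x - g x\<bar> <= E j" "!!j x. x \<notin> N ==> w j x = g x" by metis
  have wm [measurable]: "w j \<in> borel_measurable borel" for j using w(1) by measurable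
  have w_out: "\<bar>w j x - g x\<bar> <= E j" if "x \<notin> \<Omega>" for j x using w(3)[of x j] w(4)[of x j] that E(1)[of j] by (cases "x \<in> N") auto
  \<comment> \<open>Comparison holds almost everywhere; continuity turns it into an inequality at
    every point, so that the approximating solutions are uniformly Cauchy.\<close>
  have le: "w i x <= w j x + (E i + E j)" for i j x
  proof (cases "x \<in> \<Omega>")
    case True have "AE x in lborel. w i x <= w j x + (E i + E j)"
    proof (rule solution_comparison[OF w(1) w(1)])
      fix x assume "x \<notin> \<Omega>"
      from w_out[OF this, of i] w_out[OF this, of j] show "w i x <= w j x + (E i + E j)" by linarith
    qed
    then have "AE x in lborel. x \<in> interior N --> w i x - w j x <= E i + E j" by eventually_elim auto
    from continuous_AE_le[OF open_interior _ this] w(2) True \<Omega>_subset_interior_N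
    have "w i x - w j x <= E i + E j" by (auto intro: continuous_on_diff)
    then show ?thesis by simp
  next
    case False
    from w_out[OF this, of i] w_out[OF this, of j] show "w i x <= w j x + (E i + E j)" by linarith
  qed
  have dist_w: "\<bar>w i x - w j x\<bar> <= E i + E j" for i j x using le[of i x j] le[of j x i] by linarith
  have "Cauchy (\<lambda>j. w j x)" for x
  proof (rule metric_CauchyI)
    fix e :: real assume "0 < e"
    then obtain J where J: "!!j. J <= j ==> E j < e / 2" using order_tendstoD(2)[OF E0, of "e / 2"] by (auto simp: eventually_sequentially)
    show "\<exists>M. \<forall>m\<ge>M. \<forall>n\<ge>M. dist (w m x) (w n x) < e"
    proof (intro exI[of _ J] allI impI)
      fix m n assume "J <= m" "J <= n"
      from J[OF this(1)] J[OF this(2)] dist_w[of m x n] show "dist (w m x) (w n x) < e" unfolding dist_real_def by linarith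
    qed
  qed
  note cau = this
  define V where "V x = lim (\<lambda>j. w j x)" for x
  have V: "(\<lambda>j. w j x) \<longlonglongrightarrow> V x" for x using cau[of x] by (simp add: V_def Cauchy_convergent_iff convergent_LIMSEQ_iff)
  have Vw: "\<bar>w i x - V x\<bar> <= E i" for i x
  proof (rule LIMSEQ_le)
    show "(\<lambda>j. \<bar>w i x - w j x\<bar>) \<longlonglongrightarrow> \<bar>w i x - V x\<bar>" by (intro tendsto_rabs tendsto_diff tendsto_const V)
    show "(\<lambda>j. E i + E j) \<longlonglongrightarrow> E i" using tendsto_add[OF tendsto_const E0, of "E i"] by simp
  qed (use dist_w in auto)
  have Vm [measurable]: "V \<in> borel_measurable borel" by (rule borel_measurable_LIMSEQ_real[OF V wm])
  have V_out: "V x = g x" if "x \<notin> \<Omega>" for x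
  proof -
    have "\<bar>V x - g x\<bar> <= 0"
    proof (rule LIMSEQ_le)
      show "(\<lambda>j. \<bar>w j x - g x\<bar>) \<longlonglongrightarrow> \<bar>V x - g x\<bar>" by (intro tendsto_rabs tendsto_diff tendsto_const V)
    qed (use E0 w_out[OF that] in auto)
    then show ?thesis by simp
  qed
  have Vc: "continuous_on (interior N) V"
  proof (rule uniform_limit_theorem[of _ w sequentially])
    show "uniform_limit (interior N) w V sequentially"
    proof (rule uniform_limitI)
      fix e :: real assume "0 < e"
      then have "\<forall>\<^sub>F j in sequentially. E j < e" using order_tendstoD(2)[OF E0] by blast
      then show "\<forall>\<^sub>F n in sequentially. \<forall>x\<in>interior N. dist (w n x) (V x) < e"
        by eventually_elim (use Vw in \<open>auto simp: dist_real_def intro: le_less_trans\<close>)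
    qed
  qed (use w(2) in auto)
  obtain M where M: "!!x. x \<in> N ==> \<bar>w 0 x\<bar> <= M" using w(1)[of 0] by (auto simp: solution_def finite_energy_def)
  define B where "B = M + 2"
  have wB: "\<bar>w j x\<bar> <= B" if "x \<in> N" for j x using M[OF that] dist_w[of j x 0] E(2)[of j] E(2)[of 0] unfolding B_def by linarith
  have VB: "\<bar>V x\<bar> <= B" if "x \<in> N" for x using M[OF that] Vw[of 0 x] E(2)[of 0] unfolding B_def by linarith
  \<comment> \<open>A common bound for all the approximating solutions: they are bounded by
    \<open>B\<close> in \<open>N\<close> and equal to \<open>g\<close> outside.\<close>
  define G where "G x = \<bar>B\<bar> + \<bar>g x\<bar>" for x
  have Gt: "finite_tail G" by (rule finite_tail_dominate[OF gt, of _ "\<bar>B\<bar>"]) (auto simp: G_def[abs_def])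
  have wG: "\<bar>w j x\<bar> <= \<bar>G x\<bar>" for j x using wB[of x j] w(4)[of x j] by (cases "x \<in> N") (auto simp: G_def)
  have Vt: "finite_tail V"
  proof (rule finite_tail_dominate[OF gt Vm, of "\<bar>B\<bar>"])
    show "AE y in lborel. \<bar>V y\<bar> <= \<bar>B\<bar> + \<bar>g y\<bar>"
    proof (rule AE_I2)
      fix y show "\<bar>V y\<bar> <= \<bar>B\<bar> + \<bar>g y\<bar>" using VB[of y] V_out[of y] \<Omega>_subset_N by (cases "y \<in> \<Omega>") auto
    qed
  qed
  have en: "\<exists>A\<ge>0. \<forall>j. energy_on W (w j) <= ennreal A"
    if W: "W \<in> sets borel" "0 < d" "!!x. x \<in> W ==> ball x d \<subseteq> \<Omega>" for W d
  proof -
    obtain A where A: "0 <= A" "\<forall>u. solution u --> (\<forall>x\<in>N. \<bar>u x\<bar> <= B) --> (\<forall>x. x \<notin> N --> \<bar>u x\<bar> <= \<bar>G x\<bar>) --> energy_on W u <= ennreal A"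
      using local_energy_bound[OF Gt W, of B] by auto
    then show ?thesis using w(1) wB wG by (intro exI[of _ A]) auto
  qed
  have WN: "W \<subseteq> N" if "0 < d" "!!x. x \<in> W ==> ball x d \<subseteq> \<Omega>" for W and d :: real using that \<Omega>_subset_N by force
  show ?thesis
  proof (rule that[OF Vm V_out Vc Vt])
    fix W and d :: real assume W: "W \<in> sets borel" "0 < d" "!!x. x \<in> W ==> ball x d \<subseteq> \<Omega>"
    obtain A where A: "0 <= A" "!!j. energy_on W (w j) <= ennreal A" using en[OF W] by blast
    have "energy_on W V <= ennreal A" by (rule energy_on_liminf[OF wm W(1) V A(2)])
    then have "energy_on W V < \<infinity>" by (rule order_le_less_trans) simp
    then show "finite_energy W V" using VB WN[OF W(2,3)] Vm by (auto simp: finite_energy_def)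
  next
    fix W and d :: real and \<eta>
    assume W: "W \<in> sets borel" "0 < d" "!!x. x \<in> W ==> ball x d \<subseteq> \<Omega>" and \<eta>: "finite_energy N \<eta>" "!!x. x \<notin> W ==> \<eta> x = 0"
    show "integrable \<mu> (form V \<eta>) \<and> (LINT z|\<mu>. form V \<eta> z) = 0"
    proof (cases "W = {}")
      case True then have "\<eta> = (\<lambda>x. 0)" using \<eta>(2) by auto
      then show ?thesis by (simp add: form_def[abs_def])
    next
      case False
      \<comment> \<open>An intermediate neighbourhood: \<open>W\<close> has distance
        \<open>d / 2\<close> from the outside of \<open>D\<close>, as needed for the far terms, and
        \<open>D\<close> has distance \<open>d / 2\<close> from the outside of \<Omega>, as needed
        for the energy bound.\<close>
      define D where "D = {x. infdist x W < d / 2}"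
      have "open D" unfolding D_def by (intro open_Collect_less continuous_intros)
      then have Dm: "D \<in> sets borel" by simp
      have d2: "0 < d / 2" using W(2) by simp
      have WD: "ball x (d / 2) \<subseteq> D" if "x \<in> W" for x
      proof
        fix y assume "y \<in> ball x (d / 2)"
        then show "y \<in> D" using infdist_le[OF that, of y] by (simp add: D_def dist_commute)
      qed
      have D\<Omega>: "ball x (d / 2) \<subseteq> \<Omega>" if xD: "x \<in> D" for x
      proof
        fix y assume y: "y \<in> ball x (d / 2)"
        obtain a where a: "a \<in> W" "dist x a < d / 2" using infdist_less_ex[OF False, of x "d / 2"] xD unfolding D_def by blast
        have "dist a y < d" using y a dist_triangle[of a y x] by (auto simp: dist_commute)
        then show "y \<in> \<Omega>" using W(3)[OF a(1)] by auto
      qed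
      obtain A where A: "0 <= A" "!!j. energy_on D (w j) <= ennreal A" using en[OF Dm d2 D\<Omega>] by blast
      have DN: "D \<subseteq> N" by (rule WN[OF d2 D\<Omega>])
      obtain M\<eta> where M\<eta>: "!!x. x \<in> N ==> \<bar>\<eta> x\<bar> <= M\<eta>" using \<eta>(1) by (auto simp: finite_energy_def)
      have fw: "finite_energy D (w j)" for j using w(1)[of j] DN by (auto simp: solution_def intro: finite_energy_mono)
      have f\<eta>: "finite_energy D \<eta>" by (rule finite_energy_mono[OF \<eta>(1) DN])
      have WsN: "W \<subseteq> N" by (rule WN[OF W(2,3)])
      have bW: "bounded W" using bounded_N WsN by (rule bounded_subset)
      have M\<eta>W: "\<bar>\<eta> x\<bar> <= M\<eta>" if "x \<in> W" for x using M\<eta> WsN that by auto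
      have t: "test \<eta>" using \<eta> W by (force simp: test_def)
      note lim = integral_form_tendsto[where v = w and V = V and \<eta> = "\<lambda>_. \<eta>" and \<zeta> = \<eta>, OF bW d2 WD W(1) Dm Gt fw _ wG f\<eta> _ \<eta>(2) V tendsto_const A(1)]
      have "integrable \<mu> (form V \<eta>)" by (rule lim(1)[of B M\<eta>]) (use wB DN M\<eta>W A(2) in auto)
      moreover have "(\<lambda>j. LINT z|\<mu>. form (w j) \<eta> z) \<longlonglongrightarrow> (LINT z|\<mu>. form V \<eta> z)" by (rule lim(2)[of B M\<eta>]) (use wB DN M\<eta>W A(2) in auto)
      moreover have "(LINT z|\<mu>. form (w j) \<eta> z) = 0" for j using w(1)[of j] t by (simp add: solution_def)
      ultimately show ?thesis by (simp add: LIMSEQ_const_iff)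
    qed
  qed
qed

end

section \<open>Mollification\<close>

text \<open>The powers of \<open>inverse t\<close> make the family closed under differentiation: the
  derivative combines the members \<open>m + 2\<close> and \<open>m + 1\<close>. Smoothness then
  follows by one induction over all \<open>m\<close> simultaneously.\<close>

definition flat_exp :: "nat => real => real" where
  "flat_exp m t = (if 0 < t then inverse t ^ m * exp (- inverse t) else 0)"

lemma flat_exp_tendsto_0: "(flat_exp m \<longlongrightarrow> 0) (at 0)"
proof (rule filterlim_split_at)
  show "(flat_exp m \<longlongrightarrow> 0) (at_left 0)" by (rule tendsto_eventually) (auto simp: flat_exp_def eventually_at_filter)
  have "((\<lambda>t::real. inverse t ^ m / exp (inverse t)) \<longlongrightarrow> 0) (at_right 0)"
    by (rule filterlim_compose[OF tendsto_power_div_exp_0 filterlim_inverse_at_top_right])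
  then show "(flat_exp m \<longlongrightarrow> 0) (at_right 0)"
    by (rule Lim_transform_eventually) (auto simp: flat_exp_def eventually_at_filter exp_minus divide_inverse)
qed

lemma flat_exp_DERIV: "(flat_exp m has_real_derivative flat_exp (m + 2) t - real m * flat_exp (m + 1) t) (at t)"
proof -
  consider "0 < t" | "t < 0" | "t = 0" by linarith
  then show ?thesis
  proof cases
    case 1 have "((\<lambda>t. inverse t ^ m * exp (- inverse t)) has_real_derivative
      inverse t ^ m * (exp (- inverse t) * (inverse t * inverse t)) + (real m * (- (inverse t * inverse t)) * inverse t ^ (m - 1)) * exp (- inverse t)) (at t)"
      using 1 by (auto intro!: derivative_eq_intros simp: algebra_simps)
    then have "(flat_exp m has_real_derivative
      inverse t ^ m * (exp (- inverse t) * (inverse t * inverse t)) + (real m * (- (inverse t * inverse t)) * inverse t ^ (m - 1)) * exp (- inverse t)) (at t)"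
      by (rule has_field_derivative_transform_within_open[of _ _ _ "{0<..}"]) (use 1 in \<open>auto simp: flat_exp_def\<close>)
    moreover have "inverse t ^ m * (exp (- inverse t) * (inverse t * inverse t)) + (real m * (- (inverse t * inverse t)) * inverse t ^ (m - 1)) * exp (- inverse t)
        = flat_exp (m + 2) t - real m * flat_exp (m + 1) t" using 1 by (cases m) (auto simp: flat_exp_def algebra_simps)
    ultimately show ?thesis by simp
  next
    case 2 have "(flat_exp m has_real_derivative 0) (at t)"
      by (rule has_field_derivative_transform_within_open[of "\<lambda>_. 0" _ _ "{..<0}"]) (use 2 in \<open>auto simp: flat_exp_def\<close>)
    then show ?thesis using 2 by (simp add: flat_exp_def)
  next
    case 3
    \<comment> \<open>The difference quotient at 0 is the next member of the family, which tends to
      0.\<close>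
    have "((\<lambda>h. (flat_exp m h - flat_exp m 0) / (h - 0)) \<longlongrightarrow> 0) (at 0)" by (rule Lim_transform_eventually[OF flat_exp_tendsto_0[of "Suc m"]])
        (auto simp: flat_exp_def eventually_at_filter divide_inverse)
    then have "(flat_exp m has_real_derivative 0) (at 0)" by (simp add: has_field_derivative_iff)
    then show ?thesis using 3 by (simp add: flat_exp_def)
  qed
qed

lemma Ck_flat_exp: "Ck k (\<lambda>x::'a::euclidean_space. flat_exp m (c - x \<bullet> x))"
proof (induction k arbitrary: m)
  case 0 have "continuous_on UNIV (flat_exp m)" using flat_exp_DERIV by (meson DERIV_isCont continuous_at_imp_continuous_on)
  then have "continuous_on UNIV (\<lambda>x::'a. flat_exp m (c - x \<bullet> x))" by (rule continuous_on_compose2) (auto intro!: continuous_intros)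
  then show ?case by simp
next
  case (Suc k) show ?case
  proof (rule Ck_SucI)
    fix x :: 'a
    have "((\<lambda>x::'a. c - x \<bullet> x) has_derivative (\<lambda>h. - 2 * (x \<bullet> h))) (at x)" by (auto intro!: derivative_eq_intros simp: inner_commute)
    from has_derivative_compose[OF this flat_exp_DERIV[unfolded has_field_derivative_def]]
    show "((\<lambda>x::'a. flat_exp m (c - x \<bullet> x)) has_derivative
      (\<lambda>h. (flat_exp (m + 2) (c - x \<bullet> x) + - real m * flat_exp (m + 1) (c - x \<bullet> x)) * (- 2 * (x \<bullet> h)))) (at x)" by simp
  next
    fix i :: 'a
    show "Ck k (\<lambda>x. (flat_exp (m + 2) (c - x \<bullet> x) + - real m * flat_exp (m + 1) (c - x \<bullet> x)) * (- 2 * (x \<bullet> i)))"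
      by (intro Ck_mult Ck_add Ck_const Ck_inner Suc.IH)
  qed
qed

text \<open>All derivatives fall on \<open>\<beta>\<close>, and a partial derivative of the integral
  has the same shape with a partial derivative in place of \<open>\<beta>\<close>, which drives the
  induction.\<close>

lemma Ck_convolution:
  fixes \<eta> \<beta> :: "'a::euclidean_space => real"
  assumes \<eta>: "continuous_on UNIV \<eta>" and \<beta>: "!!k. Ck k \<beta>"
  shows "Ck k (\<lambda>x. integral (cbox a b) (\<lambda>t. \<eta> t * \<beta> (x - t)))" using \<beta>
proof (induction k arbitrary: \<beta>)
  case 0 have "continuous_on UNIV \<beta>" using 0[of 0] by simp
  then have "continuous_on UNIV (\<lambda>x. integral (cbox a b) (\<lambda>t. \<eta> t * \<beta> (x - t)))" by (intro integral_continuous_on_param)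
      (auto simp: case_prod_unfold intro!: continuous_intros continuous_on_compose2[OF \<eta>] continuous_on_compose2[of UNIV \<beta>])
  then show ?case by simp
next
  case (Suc k)
  \<comment> \<open>Differentiation under the integral sign is applied with derivatives in the space
    of bounded linear maps; continuity there is checked componentwise.\<close>
  define B where "B y = Blinfun (frechet_derivative \<beta> (at y))" for y
  have d: "(\<beta> has_derivative frechet_derivative \<beta> (at y)) (at y)" for y by (rule Ck_SucD(1)[OF Suc.prems[of 1, unfolded One_nat_def]])
  have B: "blinfun_apply (B y) = frechet_derivative \<beta> (at y)" for y
    unfolding B_def by (rule bounded_linear_Blinfun_apply[OF has_derivative_bounded_linear[OF d]])
  have cB: "continuous_on UNIV B"
  proof (rule continuous_on_blinfun_componentwise)
    fix i :: 'a assume "i \<in> Basis"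
    from Ck_SucD(2)[OF Suc.prems[of 1, unfolded One_nat_def] this]
    show "continuous_on UNIV (\<lambda>y. blinfun_apply (B y) i)" unfolding B by simp
  qed
  have c\<beta>: "continuous_on UNIV \<beta>" using Suc.prems[of 0] by simp
  define fx where "fx x t = \<eta> t *\<^sub>R B (x - t)" for x t
  have cfx: "continuous_on (UNIV \<times> cbox a b) (\<lambda>(x, t). fx x t)" unfolding fx_def case_prod_unfold
    by (auto intro!: continuous_intros continuous_on_compose2[OF \<eta>] continuous_on_compose2[OF cB])
  have der: "((\<lambda>x. integral (cbox a b) (\<lambda>t. \<eta> t * \<beta> (x - t))) has_derivative blinfun_apply (integral (cbox a b) (fx x))) (at x)" for x
  proof (rule leibniz_rule[where U = UNIV and f = "\<lambda>x t. \<eta> t * \<beta> (x - t)", OF _ _ cfx])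
    fix x t :: 'a
    have "((\<lambda>x. \<beta> (x - t)) has_derivative frechet_derivative \<beta> (at (x - t))) (at x)"
    proof -
      have "((\<lambda>x. x - t) has_derivative (\<lambda>h. h)) (at x)" by (auto intro!: derivative_eq_intros)
      from has_derivative_compose[OF this d] show ?thesis .
    qed
    then have "((\<lambda>x. \<eta> t * \<beta> (x - t)) has_derivative (\<lambda>h. \<eta> t * frechet_derivative \<beta> (at (x - t)) h)) (at x)" by (rule has_derivative_mult_right)
    then show "((\<lambda>x. \<eta> t * \<beta> (x - t)) has_derivative blinfun_apply (fx x t)) (at x)" unfolding fx_def by (simp add: B scaleR_blinfun.rep_eq)
  next
    fix x :: 'a
    show "(\<lambda>t. \<eta> t * \<beta> (x - t)) integrable_on cbox a b"
      by (intro integrable_continuous continuous_intros continuous_on_compose2[OF \<eta>] continuous_on_compose2[OF c\<beta>]) auto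
  qed auto
  have ifx: "fx x integrable_on cbox a b" for x unfolding fx_def[abs_def]
    by (intro integrable_continuous continuous_intros continuous_on_compose2[OF \<eta>] continuous_on_compose2[OF cB]) auto
  show ?case
  proof (rule Ck_SucI[OF der])
    fix i :: 'a assume i: "i \<in> Basis"
    have "blinfun_apply (integral (cbox a b) (fx x)) i = integral (cbox a b) (\<lambda>t. \<eta> t * frechet_derivative \<beta> (at (x - t)) i)" for x
      unfolding blinfun_apply_integral[OF ifx] by (simp add: fx_def B scaleR_blinfun.rep_eq)
    moreover have "Ck k (\<lambda>x. integral (cbox a b) (\<lambda>t. \<eta> t * frechet_derivative \<beta> (at (x - t)) i))"
      by (rule Suc.IH[of "\<lambda>y. frechet_derivative \<beta> (at y) i"]) (rule Ck_SucD(2)[OF Suc.prems i])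
    ultimately show "Ck k (\<lambda>x. blinfun_apply (integral (cbox a b) (fx x)) i)" by simp
  qed
qed

section \<open>Convolution with a smooth density of small support\<close>

lemma distr_lborel_reflect:
  fixes x :: "'a::euclidean_space"
  shows "distr lborel borel (\<lambda>s. x - s) = lborel"
proof -
  have "lborel = density (distr lborel borel (\<lambda>s. x - s)) (\<lambda>_. 1)" using lborel_affine[of "- 1" x] by simp
  then show ?thesis by (simp add: density_1)
qed

lemma integral_lborel_reflect:
  fixes x :: "'a::euclidean_space" and f :: "'a => real"
  assumes [measurable]: "f \<in> borel_measurable borel"
  shows "(LINT s|lborel. f (x - s)) = (LINT s|lborel. f s)" "integrable lborel (\<lambda>s. f (x - s)) \<longleftrightarrow> integrable lborel f"
  using integral_distr[of "\<lambda>s. x - s" lborel borel f] integrable_distr_eq[of "\<lambda>s. x - s" lborel borel f] by (simp_all add: distr_lborel_reflect)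

lemma nn_integral_lborel_shift:
  fixes c :: "'a::euclidean_space" and f :: "'a => ennreal"
  assumes [measurable]: "f \<in> borel_measurable borel"
  shows "(\<integral>\<^sup>+x. f (c + x) \<partial>lborel) = (\<integral>\<^sup>+x. f x \<partial>lborel)" using nn_integral_distr[of "(+) c" lborel borel f] by (simp add: lborel_distr_plus)

definition bump :: "real => 'a::euclidean_space => real" where
  "bump r x = flat_exp 0 (r\<^sup>2 - x \<bullet> x)"

lemma bump_nonneg: "0 <= bump r x" by (simp add: bump_def flat_exp_def)

lemma bump_eq_0: "0 < r ==> r <= norm x ==> bump r x = 0"
  using power_mono[of r "norm x" 2] by (simp add: bump_def flat_exp_def power2_norm_eq_inner)

lemma bump_pos: "norm x < r ==> 0 < bump r x" using power_strict_mono[of "norm x" r 2] by (simp add: bump_def flat_exp_def power2_norm_eq_inner)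

lemma Ck_bump: "Ck k (bump r)" unfolding bump_def[abs_def] by (rule Ck_flat_exp)

lemma continuous_on_bump: "continuous_on S (bump r)" using Ck_bump[of 0 r] by (auto intro: continuous_on_subset)

lemma bump_measurable [measurable]: "bump r \<in> borel_measurable borel" by (rule borel_measurable_continuous_onI[OF continuous_on_bump])

lemma integrable_compact_support:
  fixes f :: "'a::euclidean_space => real"
  assumes "continuous_on UNIV f" "bounded {x. f x \<noteq> 0}"
  shows "integrable lborel f"
proof -
  obtain R where R: "!!x. f x \<noteq> 0 ==> norm x <= R" using assms(2) by (auto simp: bounded_iff)
  have "integrable lborel (\<lambda>x. indicator (cball 0 R) x *\<^sub>R f x)"
    using assms(1) by (intro borel_integrable_compact) (auto intro: continuous_on_subset)
  also have "(\<lambda>x. indicator (cball 0 R) x *\<^sub>R f x) = f" using R by (force simp: indicator_def fun_eq_iff)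
  finally show ?thesis .
qed

definition mollifier :: "real => 'a::euclidean_space => real" where
  "mollifier r x = bump r x / (LINT s|(lborel::'a measure). bump r s)"

text \<open>The translation sits on \<open>\<eta>\<close>, so that the value is an average of
  translates of \<open>\<eta>\<close> with a probability density, convenient for Jensen's
  inequality; substituting moves it to the smooth factor when derivatives are needed.\<close>

definition mollify :: "real => ('a::euclidean_space => real) => 'a => real" where
  "mollify r \<eta> x = (LINT s|lborel. mollifier r s * \<eta> (x - s))"

lemma bump_integral_pos:
  assumes "0 < r"
  shows "integrable lborel (bump r :: 'a::euclidean_space => real)" "0 < (LINT s|(lborel::'a measure). bump r s)"
proof -
  have "{x :: 'a. bump r x \<noteq> 0} \<subseteq> ball 0 r" using bump_eq_0[OF assms] by (force simp: not_le)
  then show i: "integrable lborel (bump r :: 'a => real)" by (intro integrable_compact_support continuous_on_bump) (auto intro: bounded_subset)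
  have "(LINT s|(lborel::'a measure). bump r s) \<noteq> 0"
  proof
    assume "(LINT s|(lborel::'a measure). bump r s) = 0"
    then have "AE s in (lborel::'a measure). bump r s = 0" using integral_nonneg_eq_0_iff_AE[OF i] bump_nonneg by auto
    then have "AE s in (lborel::'a measure). s \<notin> ball 0 r" by eventually_elim (use bump_pos in force)
    then have "emeasure lborel (ball (0::'a) r) = 0" by (subst (asm) AE_iff_null_sets[symmetric]) auto
    moreover have "0 < unit_ball_vol (real DIM('a))" by simp
    ultimately show False using assms by (simp add: emeasure_ball)
  qed
  moreover have "0 <= (LINT s|(lborel::'a measure). bump r s)" using bump_nonneg by (intro integral_nonneg_AE) auto
  ultimately show "0 < (LINT s|(lborel::'a measure). bump r s)" by linarith
qed

lemma mollifier_measurable [measurable]: "mollifier r \<in> borel_measurable borel" unfolding mollifier_def[abs_def] by measurable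

lemma mollifier_props:
  assumes r: "0 < r"
  shows "0 <= mollifier r (x::'a::euclidean_space)" "r <= norm x ==> mollifier r x = 0"
    "integrable lborel (mollifier r :: 'a => real)" "(LINT s|(lborel::'a measure). mollifier r s) = 1"
  using bump_integral_pos[OF r, where 'a='a] bump_nonneg[of r x] bump_eq_0[OF r, of x] by (auto simp: mollifier_def[abs_def])

lemma integrable_mollifier_mult:
  fixes f :: "'a::euclidean_space => real"
  assumes r: "0 < r" and [measurable]: "f \<in> borel_measurable borel" and M: "!!x. \<bar>f x\<bar> <= M"
  shows "integrable lborel (\<lambda>s. mollifier r s * f s)"
proof (rule Bochner_Integration.integrable_bound)
  show "integrable lborel (\<lambda>s::'a. M * mollifier r s)" using mollifier_props(3)[OF r] by (rule integrable_mult_right)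
  show "AE s in lborel. norm (mollifier r s * f s) <= norm (M * mollifier r s)"
  proof (rule AE_I2)
    fix s :: 'a
    have "\<bar>f s\<bar> * mollifier r s <= \<bar>M\<bar> * mollifier r s" using M[of s] mollifier_props(1)[OF r, of s] by (intro mult_right_mono) auto
    then show "norm (mollifier r s * f s) <= norm (M * mollifier r s)" using mollifier_props(1)[OF r, of s] by (simp add: abs_mult mult.commute)
  qed
qed measurable

lemma mollify_eq_integral:
  fixes \<eta> :: "'a::euclidean_space => real"
  assumes r: "0 < r" and \<eta>: "continuous_on UNIV \<eta>" and supp: "{x. \<eta> x \<noteq> 0} \<subseteq> cbox a b"
  shows "mollify r \<eta> = (\<lambda>x. inverse (LINT s|(lborel::'a measure). bump r s) * integral (cbox a b) (\<lambda>t. \<eta> t * bump r (x - t)))"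
proof
  fix x
  let ?c = "LINT s|(lborel::'a measure). bump r s"
  have [measurable]: "\<eta> \<in> borel_measurable borel" by (rule borel_measurable_continuous_onI[OF \<eta>])
  have "mollify r \<eta> x = (LINT s|lborel. (\<lambda>t. mollifier r (x - t) * \<eta> t) (x - s))" unfolding mollify_def by simp
  also have "... = (LINT t|lborel. mollifier r (x - t) * \<eta> t)" by (rule integral_lborel_reflect(1)) measurable
  also have "... = inverse ?c * (LINT t|lborel. \<eta> t * bump r (x - t))"
    unfolding mollifier_def divide_inverse by (subst integral_mult_right_zero[symmetric]) (simp add: mult_ac)
  also have "(LINT t|lborel. \<eta> t * bump r (x - t)) = (LINT t:cbox a b|lborel. \<eta> t * bump r (x - t))"
    unfolding set_lebesgue_integral_def using supp by (intro Bochner_Integration.integral_cong) (auto simp: indicator_def)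
  also have "... = integral (cbox a b) (\<lambda>t. \<eta> t * bump r (x - t))"
  proof (rule set_borel_integral_eq_integral(2))
    show "set_integrable lborel (cbox a b) (\<lambda>t. \<eta> t * bump r (x - t))" unfolding set_integrable_def
      by (intro borel_integrable_compact continuous_intros continuous_on_compose2[OF \<eta>] continuous_on_compose2[OF continuous_on_bump[of UNIV]]) auto
  qed
  finally show "mollify r \<eta> x = inverse ?c * integral (cbox a b) (\<lambda>t. \<eta> t * bump r (x - t))" .
qed

lemma Ck_mollify:
  fixes \<eta> :: "'a::euclidean_space => real"
  assumes r: "0 < r" and \<eta>: "continuous_on UNIV \<eta>" and "bounded {x. \<eta> x \<noteq> 0}"
  shows "Ck k (mollify r \<eta>)"
proof -
  obtain a where "{x. \<eta> x \<noteq> 0} \<subseteq> cbox (- a) a" using bounded_subset_cbox_symmetric[OF assms(3)] by blast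
  then have supp: "{x. \<eta> x \<noteq> 0} \<subseteq> cbox (- a) a" .
  show ?thesis unfolding mollify_eq_integral[OF r \<eta> supp] by (intro Ck_mult Ck_const Ck_convolution \<eta> Ck_bump)
qed

lemma mollify_support:
  fixes \<eta> :: "'a::euclidean_space => real"
  assumes r: "0 < r" and "mollify r \<eta> x \<noteq> 0"
  shows "\<exists>a. \<eta> a \<noteq> 0 \<and> dist x a < r"
proof (rule ccontr)
  assume *: "\<not> ?thesis"
  have "mollifier r s * \<eta> (x - s) = 0" for s
  proof (cases "r <= norm s")
    case True then show ?thesis using mollifier_props(2)[OF r True] by simp
  next
    case False then have "dist x (x - s) < r" by (simp add: dist_norm)
    then show ?thesis using * by auto
  qed
  then have "mollify r \<eta> x = (LINT s|(lborel::'a measure). 0)" unfolding mollify_def by (intro Bochner_Integration.integral_cong) auto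
  then show False using assms(2) by simp
qed

text \<open>The first and the third claim are instances of one estimate for the distance of an
  average from a constant \<open>c\<close>, with \<open>c = 0\<close> and
  \<open>c = \<eta> x\<close>.\<close>

lemma mollify_bounds:
  fixes \<eta> :: "'a::euclidean_space => real"
  assumes r: "0 < r" and \<eta>: "continuous_on UNIV \<eta>" and M: "!!x. \<bar>\<eta> x\<bar> <= M"
  shows "\<bar>mollify r \<eta> x\<bar> <= M" "(!!x. 0 <= \<eta> x) ==> 0 <= mollify r \<eta> x"
    "(!!s. norm s < r ==> \<bar>\<eta> (x - s) - \<eta> x\<bar> <= e) ==> \<bar>mollify r \<eta> x - \<eta> x\<bar> <= e"
proof -
  have [measurable]: "\<eta> \<in> borel_measurable borel" by (rule borel_measurable_continuous_onI[OF \<eta>])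
  note mp = mollifier_props[OF r, where 'a = 'a]
  have dev: "\<bar>mollify r \<eta> x - c\<bar> <= B" if "!!s. norm s < r ==> \<bar>\<eta> (x - s) - c\<bar> <= B" for c B
  proof -
    have i: "integrable lborel (\<lambda>s. mollifier r s * (\<eta> (x - s) - c))"
    proof (rule integrable_mollifier_mult[OF r, of _ "M + \<bar>c\<bar>"])
      show "\<bar>\<eta> (x - s) - c\<bar> <= M + \<bar>c\<bar>" for s using M[of "x - s"] by linarith
    qed measurable
    have i2: "integrable lborel (\<lambda>s. mollifier r s * \<eta> (x - s))" by (rule integrable_mollifier_mult[OF r, of _ M]) (use M in auto)
    have "mollify r \<eta> x - c = (LINT s|lborel. mollifier r s * \<eta> (x - s)) - (LINT s|(lborel::'a measure). mollifier r s * c)"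
      using mp(4) by (simp add: mollify_def)
    also have "... = (LINT s|lborel. mollifier r s * (\<eta> (x - s) - c))"
      using i2 mp(3) by (subst Bochner_Integration.integral_diff[symmetric]) (auto simp: algebra_simps)
    also have "\<bar>...\<bar> <= (LINT s|lborel. \<bar>mollifier r s * (\<eta> (x - s) - c)\<bar>)" by (rule integral_abs_bound)
    also have "... <= (LINT s|(lborel::'a measure). mollifier r s * B)"
    proof (rule integral_mono)
      show "integrable lborel (\<lambda>s. \<bar>mollifier r s * (\<eta> (x - s) - c)\<bar>)" using i by auto
      show "integrable lborel (\<lambda>s::'a. mollifier r s * B)" using mp(3) by auto
      show "\<bar>mollifier r s * (\<eta> (x - s) - c)\<bar> <= mollifier r s * B" for s
        using that[of s] mp(1)[of s] mp(2)[of s] by (cases "norm s < r") (auto simp: abs_mult intro!: mult_left_mono)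
    qed
    also have "... = B" using mp(4) by simp
    finally show ?thesis .
  qed
  show "\<bar>mollify r \<eta> x\<bar> <= M" using dev[of 0 M] M by simp
  show "(!!s. norm s < r ==> \<bar>\<eta> (x - s) - \<eta> x\<bar> <= e) ==> \<bar>mollify r \<eta> x - \<eta> x\<bar> <= e" by (rule dev)
  show "(!!x. 0 <= \<eta> x) ==> 0 <= mollify r \<eta> x" unfolding mollify_def using mp(1) by (intro integral_nonneg_AE) auto
qed

lemma mollify_tendsto:
  fixes \<eta> :: "'a::euclidean_space => real"
  assumes \<eta>: "continuous_on UNIV \<eta>" and M: "!!x. \<bar>\<eta> x\<bar> <= M" and r: "!!j. 0 < r j" "r \<longlonglongrightarrow> 0"
  shows "(\<lambda>j. mollify (r j) \<eta> x) \<longlonglongrightarrow> \<eta> x"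
proof (rule LIMSEQ_I)
  fix e :: real assume e: "0 < e"
  have "isCont \<eta> x" using \<eta> by (simp add: continuous_on_eq_continuous_at)
  then obtain d where d: "0 < d" "!!y. dist y x < d ==> \<bar>\<eta> y - \<eta> x\<bar> < e / 2"
    unfolding continuous_at_eps_delta dist_real_def using e half_gt_zero by blast
  obtain J where J: "!!j. J <= j ==> r j < d" using order_tendstoD(2)[OF r(2) d(1)] by (auto simp: eventually_sequentially)
  show "\<exists>J. \<forall>j\<ge>J. norm (mollify (r j) \<eta> x - \<eta> x) < e"
  proof (intro exI[of _ J] allI impI)
    fix j assume j: "J <= j"
    have "\<bar>mollify (r j) \<eta> x - \<eta> x\<bar> <= e / 2"
    proof (rule mollify_bounds(3)[OF r(1) \<eta> M])
      fix s :: 'a assume "norm s < r j"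
      then have "dist (x - s) x < d" using J[OF j] by (simp add: dist_norm)
      then show "\<bar>\<eta> (x - s) - \<eta> x\<bar> <= e / 2" using d(2) less_imp_le by blast
    qed
    then show "norm (mollify (r j) \<eta> x - \<eta> x) < e" using e by simp
  qed
qed

text \<open>Jensen's inequality for the probability density \<open>mollifier r\<close>: the tangent
  inequality of the power at the mean \<open>m\<close> is integrated, and its linear term averages
  to 0.\<close>

lemma mollify_diff_powr_le:
  fixes \<eta> :: "'a::euclidean_space => real"
  assumes r: "0 < r" and \<eta>: "continuous_on UNIV \<eta>" and M: "!!x. \<bar>\<eta> x\<bar> <= M" and p: "1 < p"
  shows "ennreal (\<bar>mollify r \<eta> x - mollify r \<eta> y\<bar> powr p) <=
    (\<integral>\<^sup>+s. ennreal (mollifier r s) * ennreal (\<bar>\<eta> (x - s) - \<eta> (y - s)\<bar> powr p) \<partial>lborel)"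
proof -
  have [measurable]: "\<eta> \<in> borel_measurable borel" by (rule borel_measurable_continuous_onI[OF \<eta>])
  note mp = mollifier_props[OF r, where 'a = 'a]
  have M0: "0 <= M" using M[of 0] by linarith
  let ?X = "\<lambda>s::'a. \<eta> (x - s) - \<eta> (y - s)"
  define m where "m = mollify r \<eta> x - mollify r \<eta> y"
  have b: "\<bar>?X s\<bar> <= 2 * M" for s :: 'a using M[of "x - s"] M[of "y - s"] by linarith
  have i1: "integrable lborel (\<lambda>s. mollifier r s * \<eta> (x - s))" "integrable lborel (\<lambda>s. mollifier r s * \<eta> (y - s))"
    by (rule integrable_mollifier_mult[OF r, of _ M]; use M in auto)+
  have iX: "integrable lborel (\<lambda>s. mollifier r s * ?X s)" using b by (intro integrable_mollifier_mult[OF r, of _ "2 * M"]) auto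
  have mX: "(LINT s|lborel. mollifier r s * ?X s) = m"
    unfolding m_def mollify_def using i1 by (subst Bochner_Integration.integral_diff[symmetric]) (auto simp: algebra_simps)
  have iP: "integrable lborel (\<lambda>s. mollifier r s * \<bar>?X s\<bar> powr p)"
    using b p by (intro integrable_mollifier_mult[OF r, of _ "(2 * M) powr p"]) (auto intro!: powr_mono2)
  have "0 <= (LINT s|lborel. mollifier r s * (\<bar>?X s\<bar> powr p - \<bar>m\<bar> powr p - p * Jp p m * (?X s - m)))"
  proof (intro integral_nonneg_AE AE_I2 mult_nonneg_nonneg mp(1))
    show "0 <= \<bar>?X s\<bar> powr p - \<bar>m\<bar> powr p - p * Jp p m * (?X s - m)" for s using abs_powr_subgradient[OF p, of m "?X s"] by linarith
  qed
  also have "... = (LINT s|lborel. mollifier r s * \<bar>?X s\<bar> powr p - \<bar>m\<bar> powr p * mollifier r s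
      - (p * Jp p m) * (mollifier r s * ?X s) + (p * Jp p m * m) * mollifier r s)"
    by (intro Bochner_Integration.integral_cong) (auto simp: algebra_simps)
  also have "... = (LINT s|lborel. mollifier r s * \<bar>?X s\<bar> powr p) - \<bar>m\<bar> powr p"
  proof -
    have i3: "integrable lborel (\<lambda>s::'a. c * mollifier r s)" for c using mp(3) by (rule integrable_mult_right)
    have i4: "integrable lborel (\<lambda>s::'a. c * (mollifier r s * ?X s))" for c using iX by (rule integrable_mult_right)
    show ?thesis by (simp only: Bochner_Integration.integral_add Bochner_Integration.integral_diff Bochner_Integration.integrable_diff iP i3 i4
        integral_mult_right_zero mX mp(4) mult_1_right)
  qed
  finally have "\<bar>m\<bar> powr p <= (LINT s|lborel. mollifier r s * \<bar>?X s\<bar> powr p)" by simp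
  then have "ennreal (\<bar>m\<bar> powr p) <= ennreal (LINT s|lborel. mollifier r s * \<bar>?X s\<bar> powr p)" by (rule ennreal_leI)
  also have "... = (\<integral>\<^sup>+s. ennreal (mollifier r s * \<bar>?X s\<bar> powr p) \<partial>lborel)" using mp(1) by (intro nn_integral_eq_integral[symmetric] iP) auto
  also have "... = (\<integral>\<^sup>+s. ennreal (mollifier r s) * ennreal (\<bar>?X s\<bar> powr p) \<partial>lborel)" using mp(1) by (simp add: ennreal_mult)
  finally show ?thesis by (simp add: m_def)
qed

section \<open>Uniqueness\<close>

lemma riesz_translate: "riesz q (c + x) (c + y) = riesz q x y" by (simp add: riesz_def)

context nonlocal_kernel
begin

lemma nn_integral_riesz_le:
  fixes \<phi> :: "'a => 'a => ennreal"
  assumes [measurable]: "(\<lambda>z. \<phi> (fst z) (snd z)) \<in> borel_measurable (borel \<Otimes>\<^sub>M borel)"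
  defines "I \<equiv> \<integral>\<^sup>+x. \<integral>\<^sup>+y. ennreal (riesz q x y) * \<phi> x y \<partial>lborel \<partial>lborel" and "J \<equiv> \<integral>\<^sup>+z. \<phi> (fst z) (snd z) \<partial>\<mu>"
  shows "I <= ennreal \<Lambda> * J" "J <= ennreal \<Lambda> * I"
proof -
  have [measurable]: "\<phi> x \<in> borel_measurable borel" for x using measurable_Pair2[OF assms(1), of x] by simp
  have J: "J = (\<integral>\<^sup>+x. \<integral>\<^sup>+y. ennreal (K x y) * \<phi> x y \<partial>lborel \<partial>lborel)" unfolding J_def by (subst nn_integral_\<mu>) auto
  have c: "(\<integral>\<^sup>+x. ennreal \<Lambda> * (\<integral>\<^sup>+y. ennreal (k x y) * \<phi> x y \<partial>lborel) \<partial>lborel) =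
      ennreal \<Lambda> * (\<integral>\<^sup>+x. \<integral>\<^sup>+y. ennreal (k x y) * \<phi> x y \<partial>lborel \<partial>lborel)"
    if [measurable]: "(\<lambda>z. k (fst z) (snd z)) \<in> borel_measurable (borel \<Otimes>\<^sub>M borel)" for k :: "'a => 'a => real"
    by (intro nn_integral_cmult) (simp add: split_beta' lborel.borel_measurable_nn_integral)
  have "riesz q x y <= \<Lambda> * K x y" for x y using K_lower[of x y] \<Lambda>_pos by (simp add: field_simps)
  then show "I <= ennreal \<Lambda> * J"
    unfolding I_def J using \<Lambda>_pos by (subst c[symmetric], measurable) (intro nn_integral_mono nn_integral_weight_le, auto)
  show "J <= ennreal \<Lambda> * I" unfolding I_def J by (subst c[symmetric], measurable) (intro nn_integral_mono nn_integral_K_le, auto)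
qed

text \<open>For a translation invariant kernel, Jensen's inequality and Tonelli's theorem bound the
  energy of an average of translates by the energy of the function. As \<open>K\<close> need not be
  invariant, the estimate passes to the Riesz kernel and back, each passage costing a factor
  \<open>\<Lambda>\<close>.\<close>

lemma energy_on_mollify_le:
  assumes r: "0 < r" and \<eta>: "continuous_on UNIV \<eta>" and M: "!!x. \<bar>\<eta> x\<bar> <= M" and A: "0 <= A"
    and en: "(\<integral>\<^sup>+z. ennreal (\<bar>jump \<eta> z\<bar> powr p) \<partial>\<mu>) <= ennreal A"
    and mm [measurable]: "mollify r \<eta> \<in> borel_measurable borel"
  shows "energy_on D (mollify r \<eta>) <= ennreal (\<Lambda> * (\<Lambda> * A))"
proof -
  have [measurable]: "\<eta> \<in> borel_measurable borel" by (rule borel_measurable_continuous_onI[OF \<eta>])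
  note mp = mollifier_props[OF r, where 'a = 'a]
  let ?m = "mollify r \<eta>"
  define \<phi> where "\<phi> x y = ennreal (\<bar>\<eta> x - \<eta> y\<bar> powr p)" for x y
  have [measurable (raw)]: "(\<lambda>z. \<phi> (f z) (h z)) \<in> borel_measurable X"
    if "f \<in> borel_measurable X" "h \<in> borel_measurable X" for f h and X :: "'z measure" using that unfolding \<phi>_def by measurable
  define I where "I = (\<integral>\<^sup>+x. \<integral>\<^sup>+y. ennreal (riesz q x y) * \<phi> x y \<partial>lborel \<partial>lborel)"
  have "I <= ennreal \<Lambda> * (\<integral>\<^sup>+z. \<phi> (fst z) (snd z) \<partial>\<mu>)" unfolding I_def by (rule nn_integral_riesz_le(1)) measurable
  also have "... <= ennreal \<Lambda> * ennreal A" using en by (intro mult_left_mono) (auto simp: \<phi>_def)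
  finally have I: "I <= ennreal (\<Lambda> * A)" using \<Lambda>_pos A by (simp add: ennreal_mult)
  have shift: "(\<integral>\<^sup>+x. \<integral>\<^sup>+y. ennreal (riesz q x y) * \<phi> (x - s) (y - s) \<partial>lborel \<partial>lborel) = I" for s
  proof -
    have "(\<integral>\<^sup>+x. \<integral>\<^sup>+y. ennreal (riesz q x y) * \<phi> (x - s) (y - s) \<partial>lborel \<partial>lborel) =
      (\<integral>\<^sup>+x. \<integral>\<^sup>+y. ennreal (riesz q (s + x) y) * \<phi> (s + x - s) (y - s) \<partial>lborel \<partial>lborel)"
      by (subst nn_integral_lborel_shift[of _ s, symmetric]) auto
    also have "... = I" unfolding I_def
    proof (rule nn_integral_cong)
      fix x
      have "(\<integral>\<^sup>+y. ennreal (riesz q (s + x) y) * \<phi> (s + x - s) (y - s) \<partial>lborel) =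
        (\<integral>\<^sup>+y. ennreal (riesz q (s + x) (s + y)) * \<phi> (s + x - s) (s + y - s) \<partial>lborel)"
        by (subst nn_integral_lborel_shift[of _ s, symmetric]) auto
      then show "(\<integral>\<^sup>+y. ennreal (riesz q (s + x) y) * \<phi> (s + x - s) (y - s) \<partial>lborel) = (\<integral>\<^sup>+y. ennreal (riesz q x y) * \<phi> x y \<partial>lborel)"
        by (simp add: riesz_translate)
    qed
    finally show ?thesis .
  qed
  let ?F = "\<lambda>x y s. ennreal (mollifier r s) * (ennreal (riesz q x y) * \<phi> (x - s) (y - s))"
  have "energy_on D ?m <= (\<integral>\<^sup>+z. ennreal (\<bar>jump ?m z\<bar> powr p) \<partial>\<mu>)" unfolding energy_on_def by (intro nn_integral_mono) (auto simp: indicator_def)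
  also have "... <= ennreal \<Lambda> * (\<integral>\<^sup>+x. \<integral>\<^sup>+y. ennreal (riesz q x y) * ennreal (\<bar>?m x - ?m y\<bar> powr p) \<partial>lborel \<partial>lborel)"
    by (rule nn_integral_riesz_le(2)) measurable
  also have "... <= ennreal \<Lambda> * (\<integral>\<^sup>+x. \<integral>\<^sup>+y. \<integral>\<^sup>+s. ?F x y s \<partial>lborel \<partial>lborel \<partial>lborel)"
  proof (intro mult_left_mono nn_integral_mono)
    fix x y
    have "ennreal (riesz q x y) * ennreal (\<bar>?m x - ?m y\<bar> powr p) <=
      ennreal (riesz q x y) * (\<integral>\<^sup>+s. ennreal (mollifier r s) * \<phi> (x - s) (y - s) \<partial>lborel)"
      unfolding \<phi>_def by (intro mult_left_mono mollify_diff_powr_le[OF r \<eta> M p_gt]) auto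
    also have "... = (\<integral>\<^sup>+s. ennreal (riesz q x y) * (ennreal (mollifier r s) * \<phi> (x - s) (y - s)) \<partial>lborel)"
      by (rule nn_integral_cmult[symmetric]) measurable
    finally show "ennreal (riesz q x y) * ennreal (\<bar>?m x - ?m y\<bar> powr p) <= (\<integral>\<^sup>+s. ?F x y s \<partial>lborel)" by (simp add: mult_ac)
  qed auto
  also have "(\<integral>\<^sup>+x. \<integral>\<^sup>+y. \<integral>\<^sup>+s. ?F x y s \<partial>lborel \<partial>lborel \<partial>lborel) = (\<integral>\<^sup>+x. \<integral>\<^sup>+s. \<integral>\<^sup>+y. ?F x y s \<partial>lborel \<partial>lborel \<partial>lborel)"
    by (intro nn_integral_cong lborel_pair.Fubini') measurable
  also have "... = (\<integral>\<^sup>+s. \<integral>\<^sup>+x. \<integral>\<^sup>+y. ?F x y s \<partial>lborel \<partial>lborel \<partial>lborel)" by (rule lborel_pair.Fubini') measurable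
  also have "... = (\<integral>\<^sup>+s. ennreal (mollifier r s) * I \<partial>(lborel :: 'a measure))"
  proof (rule nn_integral_cong)
    fix s
    have "(\<integral>\<^sup>+x. \<integral>\<^sup>+y. ?F x y s \<partial>lborel \<partial>lborel) =
      (\<integral>\<^sup>+x. ennreal (mollifier r s) * (\<integral>\<^sup>+y. ennreal (riesz q x y) * \<phi> (x - s) (y - s) \<partial>lborel) \<partial>lborel)"
      by (intro nn_integral_cong nn_integral_cmult) measurable
    also have "... = ennreal (mollifier r s) * I" unfolding shift[symmetric, of s] by (rule nn_integral_cmult) measurable
    finally show "(\<integral>\<^sup>+x. \<integral>\<^sup>+y. ?F x y s \<partial>lborel \<partial>lborel) = ennreal (mollifier r s) * I" .
  qed
  also have "... = (\<integral>\<^sup>+s. ennreal (mollifier r s) \<partial>(lborel :: 'a measure)) * I" by (rule nn_integral_multc) measurable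
  also have "(\<integral>\<^sup>+s. ennreal (mollifier r s) \<partial>(lborel :: 'a measure)) = 1" using mp by (subst nn_integral_eq_integral) auto
  also have "ennreal \<Lambda> * (1 * I) <= ennreal \<Lambda> * ennreal (\<Lambda> * A)" using I by (simp add: mult_left_mono)
  finally show ?thesis using \<Lambda>_pos A by (simp add: ennreal_mult)
qed

end

section \<open>Local solutions\<close>

context dirichlet_domain
begin

text \<open>The notion in which existence and uniqueness meet: the energy is finite only away from
  the boundary of \<Omega>, and test functions are smooth and nonnegative. Local boundedness,
  contained in \<open>finite_energy\<close>, will come from continuity.\<close>

definition local_solution :: "('a => real) => bool" where
  "local_solution u \<longleftrightarrow> finite_tail u \<and>
    (\<forall>W d. W \<in> sets borel --> 0 < d --> (\<forall>x\<in>W. ball x d \<subseteq> \<Omega>) --> finite_energy W u) \<and>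
    (\<forall>\<phi>\<in>test_functions \<Omega>. (\<forall>x. 0 <= \<phi> x) --> (LINT z|\<mu>. form u \<phi> z) = 0)"

text \<open>The equation extends from smooth to continuous test functions of compact support in
  \<Omega> and locally finite energy. Mollifications are smooth and converge pointwise with a
  uniform energy bound, so the limit passes with the solution fixed and the test function
  varying.\<close>

lemma local_solution_form:
  assumes u: "local_solution u" and \<eta>: "continuous_on UNIV \<eta>" and \<eta>0: "!!x. 0 <= \<eta> x"
    and supp: "compactly_contained {x. \<eta> x \<noteq> 0} \<Omega>"
    and fe: "!!W d. W \<in> sets borel ==> 0 < d ==> \<forall>x\<in>W. ball x d \<subseteq> \<Omega> ==> finite_energy W \<eta>"
  shows "integrable \<mu> (form u \<eta>)" "(LINT z|\<mu>. form u \<eta> z) = 0"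
proof -
  define S where "S = closure {x. \<eta> x \<noteq> 0}"
  have S: "compact S" "S \<subseteq> \<Omega>" using supp by (auto simp: S_def compactly_contained_def)
  have \<eta>S: "\<eta> x = 0" if "x \<notin> S" for x using that closure_subset[of "{x. \<eta> x \<noteq> 0}"] by (auto simp: S_def)
  have "integrable \<mu> (form u \<eta>) \<and> (LINT z|\<mu>. form u \<eta> z) = 0"
  proof (cases "S = {}")
    case True then have "\<eta> = (\<lambda>x. 0)" using \<eta>S by auto
    then show ?thesis by (simp add: form_def[abs_def])
  next
    case False
    obtain e where e: "0 < e" "(\<Union>x\<in>S. ball x e) \<subseteq> \<Omega>" using compact_subset_open_imp_ball_epsilon_subset[OF S(1) open_\<Omega> S(2)] by blast
    \<comment> \<open>A quarter leaves room for three steps: mollification enlarges the support by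
      less than \<open>d\<close> and stays in \<open>W\<close>, \<open>D\<close> contains the
      \<open>d\<close>-neighbourhood of \<open>W\<close>, and the \<open>d\<close>-neighbourhood of
      \<open>D\<close> is within distance \<open>3 * d < e\<close> of the support.\<close>
    define d where "d = e / 4"
    have d: "0 < d" using e by (simp add: d_def)
    define W D where "W = (\<Union>a\<in>S. ball a d)" and "D = (\<Union>a\<in>S. ball a (2 * d))"
    have Wm: "W \<in> sets borel" and Dm: "D \<in> sets borel" by (auto simp: W_def D_def intro!: borel_open)
    have WD: "ball x d \<subseteq> D" if xW: "x \<in> W" for x
    proof
      fix y assume y: "y \<in> ball x d"
      obtain a where a: "a \<in> S" "dist a x < d" using xW by (auto simp: W_def)
      have "dist a y < 2 * d" using a y dist_triangle[of a y x] by simp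
      then show "y \<in> D" using a by (auto simp: D_def)
    qed
    have D\<Omega>: "ball x d \<subseteq> \<Omega>" if xD: "x \<in> D" for x
    proof
      fix y assume y: "y \<in> ball x d"
      obtain a where a: "a \<in> S" "dist a x < 2 * d" using xD by (auto simp: D_def)
      have "dist x y < d" using y by simp
      then have "dist a y < e" using a(2) dist_triangle[of a y x] e(1) unfolding d_def by linarith
      then show "y \<in> \<Omega>" using a(1) e(2) by (auto simp: subset_iff)
    qed
    have D\<Omega>': "D \<subseteq> \<Omega>" using D\<Omega> d by force
    have WD': "W \<subseteq> D" using WD d by force
    have bW: "bounded W" using bounded_\<Omega> D\<Omega>' WD' by (meson bounded_subset order_trans)
    have SW: "S \<subseteq> W" using d by (auto simp: W_def)
    have feD: "finite_energy D \<eta>" by (rule fe[OF Dm d]) (use D\<Omega> in auto)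
    obtain M0 where M0: "!!x. x \<in> D ==> \<bar>\<eta> x\<bar> <= M0" using feD by (auto simp: finite_energy_def)
    define M where "M = max M0 0"
    have M: "\<bar>\<eta> x\<bar> <= M" for x using M0[of x] \<eta>S[of x] SW WD' by (cases "x \<in> S") (auto simp: M_def le_max_iff_disj)
    have \<eta>W: "\<eta> x = 0" if "x \<notin> W" for x using \<eta>S SW that by auto
    have iE: "integrable \<mu> (\<lambda>z. \<bar>jump \<eta> z\<bar> powr p)" by (rule integrable_energy_extend[OF bW d WD Wm Dm feD \<eta>W])
    define A where "A = (LINT z|\<mu>. \<bar>jump \<eta> z\<bar> powr p)"
    have A: "0 <= A" unfolding A_def by (intro integral_nonneg_AE) auto
    have enA: "(\<integral>\<^sup>+z. ennreal (\<bar>jump \<eta> z\<bar> powr p) \<partial>\<mu>) <= ennreal A" unfolding A_def using iE by (subst nn_integral_eq_integral) auto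
    define r where "r j = d * inverse (real (Suc (Suc j)))" for j
    have r: "0 < r j" "r j < d" for j
    proof -
      show "0 < r j" using d by (simp add: r_def)
      have "d * inverse (real (Suc (Suc j))) < d * 1" using d by (intro mult_strict_left_mono) (auto simp: inverse_less_1_iff)
      then show "r j < d" by (simp add: r_def)
    qed
    have r0: "r \<longlonglongrightarrow> 0" unfolding r_def[abs_def] using tendsto_mult[OF tendsto_const LIMSEQ_Suc[OF LIMSEQ_inverse_real_of_nat], of d] by simp
    define \<eta>' where "\<eta>' j = mollify (r j) \<eta>" for j
    have bS: "bounded {x. \<eta> x \<noteq> 0}" using bW SW \<eta>S by (intro bounded_subset[OF bW]) auto
    have Ck: "Ck k (\<eta>' j)" for k j unfolding \<eta>'_def by (rule Ck_mollify[OF r(1) \<eta> bS])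
    have cont: "continuous_on UNIV (\<eta>' j)" for j using Ck[of 0 j] by simp
    have m\<eta>': "\<eta>' j \<in> borel_measurable borel" for j by (rule borel_measurable_continuous_onI[OF cont])
    have supp': "\<exists>a\<in>S. dist x a < r j" if "\<eta>' j x \<noteq> 0" for j x using mollify_support[OF r(1), of j \<eta> x] that \<eta>S unfolding \<eta>'_def by blast
    have \<eta>'W: "\<eta>' j x = 0" if "x \<notin> W" for j x
    proof (rule ccontr)
      assume "\<eta>' j x \<noteq> 0"
      then obtain a where "a \<in> S" "dist x a < r j" using supp' by blast
      then have "x \<in> W" using r(2)[of j] by (auto simp: W_def dist_commute intro!: bexI[of _ a])
      then show False using that by simp
    qed
    have test: "\<eta>' j \<in> test_functions \<Omega>" for j unfolding test_functions_def compactly_contained_def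
    proof (intro CollectI conjI allI Ck)
      have sub: "closure {x. \<eta>' j x \<noteq> 0} \<subseteq> {x. infdist x S <= d}"
      proof (rule closure_minimal)
        show "{x. \<eta>' j x \<noteq> 0} \<subseteq> {x. infdist x S <= d}"
        proof
          fix x assume "x \<in> {x. \<eta>' j x \<noteq> 0}"
          then obtain a where "a \<in> S" "dist x a < r j" using supp' by blast
          then show "x \<in> {x. infdist x S <= d}" using r(2)[of j] by (auto intro: infdist_le2)
        qed
        show "closed {x. infdist x S <= d}" by (intro closed_Collect_le continuous_intros)
      qed
      also have "... \<subseteq> D"
      proof
        fix x assume "x \<in> {x. infdist x S <= d}"
        then have "infdist x S < 2 * d" using d by simp
        then obtain a where "a \<in> S" "dist x a < 2 * d" using infdist_less_ex[OF False] by blast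
        then show "x \<in> D" by (auto simp: D_def dist_commute intro!: bexI[of _ a])
      qed
      finally have cD: "closure {x. \<eta>' j x \<noteq> 0} \<subseteq> D" .
      then show "closure {x. \<eta>' j x \<noteq> 0} \<subseteq> \<Omega>" using D\<Omega>' by blast
      then have "bounded (closure {x. \<eta>' j x \<noteq> 0})" using bounded_\<Omega> by (rule bounded_subset[rotated])
      then show "compact (closure {x. \<eta>' j x \<noteq> 0})" by (simp add: compact_eq_bounded_closed)
    qed
    have \<eta>'0: "0 <= \<eta>' j x" and \<eta>'M: "\<bar>\<eta>' j x\<bar> <= M" for j x unfolding \<eta>'_def using mollify_bounds(1,2)[OF r(1) \<eta> M] \<eta>0 by auto
    have en': "energy_on D (\<eta>' j) <= ennreal (\<Lambda> * (\<Lambda> * A))" for j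
      unfolding \<eta>'_def by (rule energy_on_mollify_le[OF r(1) \<eta> M A enA m\<eta>'[unfolded \<eta>'_def]])
    have fe': "finite_energy D (\<eta>' j)" for j using m\<eta>' \<eta>'M order_le_less_trans[OF en'[of j]] by (auto simp: finite_energy_def)
    have fuD: "finite_energy D u" using u Dm d D\<Omega> unfolding local_solution_def by blast
    have ut: "finite_tail u" using u by (simp add: local_solution_def)
    obtain Mu where Mu: "!!x. x \<in> D ==> \<bar>u x\<bar> <= Mu" using fuD by (auto simp: finite_energy_def)
    have A': "0 <= \<Lambda> * (\<Lambda> * A)" using \<Lambda>_pos A by simp
    have lim\<eta>: "(\<lambda>j. \<eta>' j x) \<longlonglongrightarrow> \<eta> x" for x unfolding \<eta>'_def by (rule mollify_tendsto[OF \<eta> M r(1) r0])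
    note lim = integral_form_tendsto[where v = "\<lambda>_. u" and V = u and \<eta> = \<eta>' and \<zeta> = \<eta>, OF bW d WD Wm Dm ut fuD Mu order_refl fe' \<eta>'M \<eta>'W tendsto_const lim\<eta> A']
    have "integrable \<mu> (form u \<eta>)" by (rule lim(1)) (use en' in auto)
    moreover have "(\<lambda>j. LINT z|\<mu>. form u (\<eta>' j) z) \<longlonglongrightarrow> (LINT z|\<mu>. form u \<eta> z)" by (rule lim(2)) (use en' in auto)
    moreover have "(LINT z|\<mu>. form u (\<eta>' j) z) = 0" for j using u test[of j] \<eta>'0[of j] by (simp add: local_solution_def)
    ultimately show ?thesis by (simp add: LIMSEQ_const_iff)
  qed
  then show "integrable \<mu> (form u \<eta>)" "(LINT z|\<mu>. form u \<eta> z) = 0" by auto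
qed

lemma local_solution_le:
  assumes u: "local_solution u" and v: "local_solution v" and c: "continuous_on \<Omega>' u" "continuous_on \<Omega>' v"
    and \<Omega>': "open \<Omega>'" "closure \<Omega> \<subseteq> \<Omega>'" and eq: "!!x. x \<notin> \<Omega> ==> u x = v x"
  shows "u x <= v x"
proof (cases "x \<in> \<Omega>")
  case False then show ?thesis using eq by simp
next
  case x: True
  have "u x - v x <= e" if e: "0 < e" for e
  proof -
    define \<eta> where "\<eta> = (\<lambda>x. max (u x - v x - e) 0)"
    have \<eta>out: "\<eta> x = 0" if "x \<notin> \<Omega>" for x using eq[OF that] e by (simp add: \<eta>_def)
    have c1: "continuous_on \<Omega>' \<eta>" unfolding \<eta>_def by (intro continuous_intros c)
    have c2: "continuous_on (- closure \<Omega>) \<eta>" by (subst continuous_on_cong[OF refl, of _ _ "\<lambda>_. 0"]) (use \<eta>out closure_subset in auto)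
    \<comment> \<open>Continuity of \<open>u\<close> and \<open>v\<close> is known in
      \<open>\<Omega>'\<close> only; off the closure of \<Omega> the test function is 0, and the two
      open sets cover the space.\<close>
    have "continuous_on (\<Omega>' \<union> - closure \<Omega>) \<eta>" by (rule continuous_on_open_Un[OF \<Omega>'(1) _ c1 c2]) (simp add: open_Compl)
    moreover have "\<Omega>' \<union> - closure \<Omega> = UNIV" using \<Omega>'(2) by auto
    ultimately have c\<eta>: "continuous_on UNIV \<eta>" by simp
    define C where "C = {x \<in> closure \<Omega>. e <= u x - v x}"
    have "closed C" unfolding C_def by (intro continuous_closed_imp_Cauchy_continuous closed_Collect_le | rule continuous_on_closed_Collect_le)+
        (auto intro!: continuous_intros continuous_on_subset[OF c(1) \<Omega>'(2)] continuous_on_subset[OF c(2) \<Omega>'(2)])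
    moreover have "bounded C" using bounded_closure[OF bounded_\<Omega>] by (rule bounded_subset) (auto simp: C_def)
    ultimately have cC: "compact C" by (simp add: compact_eq_bounded_closed)
    \<comment> \<open>At points of the closure outside the open set \<Omega> the functions agree, so
      their difference cannot reach \<open>e > 0\<close>.\<close>
    have C\<Omega>: "C \<subseteq> \<Omega>" using eq e by (force simp: C_def)
    have "{x. \<eta> x \<noteq> 0} \<subseteq> C"
    proof
      fix x assume "x \<in> {x. \<eta> x \<noteq> 0}"
      then have "x \<in> \<Omega>" using \<eta>out by blast
      moreover have "e <= u x - v x" using \<open>x \<in> {x. \<eta> x \<noteq> 0}\<close> by (auto simp: \<eta>_def max_def split: if_splits)
      ultimately show "x \<in> C" using closure_subset by (auto simp: C_def)
    qed
    then have cl: "closure {x. \<eta> x \<noteq> 0} \<subseteq> C" using \<open>closed C\<close> by (rule closure_minimal)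
    have "bounded (closure {x. \<eta> x \<noteq> 0})" using \<open>bounded C\<close> cl by (rule bounded_subset)
    then have supp: "compactly_contained {x. \<eta> x \<noteq> 0} \<Omega>" unfolding compactly_contained_def using cl C\<Omega> by (auto simp: compact_eq_bounded_closed)
    have fe: "finite_energy W \<eta>" if "W \<in> sets borel" "0 < d" "\<forall>x\<in>W. ball x d \<subseteq> \<Omega>" for W and d :: real
    proof -
      have "finite_energy W u" "finite_energy W v" using u v that unfolding local_solution_def by blast+
      then show ?thesis unfolding \<eta>_def using that(1) by (intro finite_energy_pos_part finite_energy_diff) auto
    qed
    have \<eta>0: "0 <= \<eta> x" for x by (simp add: \<eta>_def)
    note fu = local_solution_form[OF u c\<eta> \<eta>0 supp fe] and fv = local_solution_form[OF v c\<eta> \<eta>0 supp fe]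
    have "AE x in lborel. u x <= v x + e"
    proof (rule comparison[OF \<eta>_def])
      show "integrable \<mu> (form u \<eta>)" "integrable \<mu> (form v \<eta>)" "(LINT z|\<mu>. form u \<eta> z) = (LINT z|\<mu>. form v \<eta> z)" using fu fv by auto
      show "N - \<Omega> \<in> sets borel" "emeasure lborel (N - \<Omega>) \<noteq> 0" using emeasure_N_minus_\<Omega> by auto
      show "\<eta> x = 0" if "x \<in> N - \<Omega>" for x using \<eta>out that by blast
    qed
    then have ae: "AE x in lborel. x \<in> \<Omega> --> u x - v x <= e" by eventually_elim auto
    have "\<Omega> \<subseteq> \<Omega>'" using \<Omega>'(2) closure_subset by blast
    then have "continuous_on \<Omega> (\<lambda>x. u x - v x)" using c by (intro continuous_intros) (auto intro: continuous_on_subset)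
    from continuous_AE_le[OF open_\<Omega> this ae x] show ?thesis .
  qed
  from this[of "(u x - v x) / 2"] show ?thesis by (cases "u x <= v x") auto
qed

end

section \<open>Transfer to Lebesgue measurable data\<close>

lemma borel_measurable_completion_AE:
  assumes f: "f \<in> borel_measurable M" and eq: "AE x in M. g x = f x"
  shows "g \<in> borel_measurable (completion M)"
proof (rule measurableI)
  fix A :: "'b set" assume A: "A \<in> sets borel"
  show "g -` A \<inter> space (completion M) \<in> sets (completion M)"
  proof (rule completion.in_sets_AE)
    show "f -` A \<inter> space M \<in> sets (completion M)" using measurable_sets[OF f A] by auto
    show "AE x in completion M. (x \<in> f -` A \<inter> space M) = (x \<in> g -` A \<inter> space (completion M))"
      unfolding AE_completion_iff using eq by eventually_elim simp
  qed auto
qed simp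

lemma integral_lebesgue_AE:
  fixes f g :: "'a::euclidean_space => real"
  assumes [measurable]: "f \<in> borel_measurable borel" and eq: "AE x in lborel. g x = f x"
  shows "integrable lebesgue g \<longleftrightarrow> integrable lborel f" "(LINT x|lebesgue. g x) = (LINT x|lborel. f x)"
proof -
  have f: "f \<in> borel_measurable lborel" by simp
  have gm: "g \<in> borel_measurable lebesgue" by (rule borel_measurable_completion_AE[OF f eq])
  have fm: "f \<in> borel_measurable lebesgue" by (rule borel_measurable_completion_AE[OF f]) simp
  have eq': "AE x in lebesgue. g x = f x" using eq by (simp add: AE_completion_iff)
  show "integrable lebesgue g \<longleftrightarrow> integrable lborel f" using integrable_cong_AE[OF gm fm eq'] integrable_completion[OF f] by simp
  show "(LINT x|lebesgue. g x) = (LINT x|lborel. f x)" using integral_cong_AE[OF gm fm eq'] integral_completion[OF f] by simp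
qed

lemma AE_lborel_fst: "AE x in lborel. P x ==> AE z in lborel. P (fst (z :: 'a::euclidean_space \<times> 'a))"
  and AE_lborel_snd: "AE x in lborel. P x ==> AE z in lborel. P (snd (z :: 'a::euclidean_space \<times> 'a))"
  unfolding lborel_prod[symmetric] by (auto intro: null_sets_fst)

lemma AE_lborel_swap:
  fixes P :: "'a::euclidean_space \<times> 'a => bool"
  assumes "AE z in lborel. P z"
  shows "AE z in lborel. P (snd z, fst z)"
proof -
  have "AE z in (lborel \<Otimes>\<^sub>M lborel). P z" using assms unfolding lborel_prod .
  then have "AE z in distr (lborel \<Otimes>\<^sub>M lborel) (lborel \<Otimes>\<^sub>M lborel) (\<lambda>(x, y). (y, x)). P z" by (subst (asm) lborel_pair.distr_pair_swap)
  then have "AE z in (lborel \<Otimes>\<^sub>M lborel). P (case z of (x, y) => (y, x))" by (rule AE_distrD[rotated]) measurable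
  then show ?thesis unfolding lborel_prod split_beta' .
qed

lemma AE_lborel_off_diagonal: "AE z in lborel. fst z \<noteq> snd (z :: 'a::euclidean_space \<times> 'a)"
proof -
  have "AE z in (lborel \<Otimes>\<^sub>M lborel). fst z \<noteq> snd (z :: 'a \<times> 'a)"
  proof (rule lborel_pair.AE_pair_measure)
    show "{z \<in> space (lborel \<Otimes>\<^sub>M lborel). fst z \<noteq> snd (z :: 'a \<times> 'a)} \<in> sets (lborel \<Otimes>\<^sub>M lborel)" by measurable
    show "AE x in lborel. AE y in lborel. fst (x, y) \<noteq> snd (x, y :: 'a)" using AE_lborel_singleton by (auto simp: eq_commute)
  qed
  then show ?thesis unfolding lborel_prod .
qed

lemma powr_divide_riesz: "a / norm (x - y) powr (real DIM('a) + q) = riesz q x y * a" for x y :: "'a::euclidean_space"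
  unfolding riesz_def powr_minus_divide by simp

text \<open>A Borel representative is symmetrised by averaging and then clipped between the two
  multiples of the Riesz kernel, so that symmetry and bounds hold at every pair. Nothing changes off
  a null set, because \<open>K\<close> is symmetric and satisfies the bounds almost everywhere; the
  diagonal is null.\<close>

lemma elliptic_kernel_representative:
  fixes K :: "'a::euclidean_space => 'a => real"
  assumes par: "0 < s" "s < 1" "1 < p" "1 <= \<Lambda>" and K: "elliptic_kernel s p \<Lambda> K"
  obtains K' where "nonlocal_kernel s p \<Lambda> K'" "AE z in lborel. K (fst z) (snd z) = K' (fst z) (snd z)"
proof -
  let ?R = "riesz (s * p) :: 'a => 'a => real"
  have "(\<lambda>(x, y). K x y) \<in> borel_measurable lebesgue" using K by (simp add: elliptic_kernel_def)
  then obtain k where k: "k \<in> borel_measurable lborel" "AE z in lborel. (case z of (x, y) => K x y) = k z"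
    using completion_ex_borel_measurable_real by blast
  have km [measurable]: "k \<in> borel_measurable (borel \<Otimes>\<^sub>M borel)" using k(1) by (simp add: borel_prod)
  define K' where "K' x y = max (inverse \<Lambda> * ?R x y) (min (\<Lambda> * ?R x y) ((k (x, y) + k (y, x)) / 2))" for x y
  show ?thesis
  proof (rule that[of K'])
    show "nonlocal_kernel s p \<Lambda> K'"
    proof (unfold_locales, fact+)
      show "(\<lambda>z. K' (fst z) (snd z)) \<in> borel_measurable (borel \<Otimes>\<^sub>M borel)" unfolding K'_def by measurable
      show "K' x y = K' y x" for x y by (simp add: K'_def riesz_commute[of _ x y] add.commute)
      show "inverse \<Lambda> * ?R x y <= K' x y" for x y by (simp add: K'_def)
      have "inverse \<Lambda> * ?R x y <= \<Lambda> * ?R x y" for x y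
        using par(4) by (intro mult_right_mono) (auto intro: order_trans[of _ 1] simp: inverse_le_1_iff)
      then show "K' x y <= \<Lambda> * ?R x y" for x y by (simp add: K'_def)
    qed
    have b: "AE (x, y) in lborel. inverse \<Lambda> <= K x y * norm (x - y) powr (real DIM('a) + s * p) \<and>
      K x y * norm (x - y) powr (real DIM('a) + s * p) <= \<Lambda>" using K unfolding elliptic_kernel_def AE_completion_iff by blast
    show "AE z in lborel. K (fst z) (snd z) = K' (fst z) (snd z)" using b AE_lborel_swap[OF k(2)] k(2) AE_lborel_off_diagonal
    proof eventually_elim
      case (elim z)
      obtain x y where z: "z = (x, y)" by (cases z)
      have sym: "K y x = K x y" using K by (simp add: elliptic_kernel_def)
      have xy: "x \<noteq> y" "k (x, y) = K x y" "k (y, x) = K x y" using elim sym by (auto simp: z)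
      define n where "n = norm (x - y) powr (real DIM('a) + s * p)"
      have n: "0 < n" using xy by (simp add: n_def)
      have R: "?R x y = 1 / n" unfolding riesz_def n_def powr_minus_divide ..
      have "inverse \<Lambda> <= K x y * n" "K x y * n <= \<Lambda>" using elim by (auto simp: z n_def)
      then have "inverse \<Lambda> * ?R x y <= K x y" "K x y <= \<Lambda> * ?R x y" using n unfolding R by (simp_all add: pos_divide_le_eq pos_le_divide_eq)
      then show ?case by (simp add: z K'_def xy)
    qed
  qed
qed

text \<open>On the open set \<open>U\<close> the function is continuous and can be kept as it is; a
  representative is inserted only outside \<open>U\<close>. The exact agreement on \<open>U\<close>
  preserves continuity.\<close>

lemma borel_representative:
  fixes f :: "'a::euclidean_space => real"
  assumes f: "f \<in> borel_measurable lebesgue" and U: "open U" "continuous_on U f"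
  obtains f' where "f' \<in> borel_measurable borel" "AE x in lborel. f x = f' x" "!!x. x \<in> U ==> f' x = f x"
proof -
  obtain h where h: "h \<in> borel_measurable lborel" "AE x in lborel. f x = h x" using completion_ex_borel_measurable_real[OF f] by blast
  have [measurable]: "h \<in> borel_measurable borel" "U \<in> sets borel" using h U by auto
  have [measurable]: "(\<lambda>x. indicator U x *\<^sub>R f x) \<in> borel_measurable borel" using U by (intro borel_measurable_continuous_on_indicator) auto
  show ?thesis
  proof (rule that[of "\<lambda>x. indicator U x *\<^sub>R f x + indicator (- U) x * h x"])
    show "AE x in lborel. f x = indicator U x *\<^sub>R f x + indicator (- U) x * h x" using h(2) by eventually_elim (simp add: indicator_def)
    show "(\<lambda>x. indicator U x *\<^sub>R f x + indicator (- U) x * h x) \<in> borel_measurable borel" by (rule borel_measurable_add) (fact, measurable)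
  qed simp
qed

lemma exterior_density_lebesgue:
  fixes \<Omega> :: "'a::euclidean_space set"
  assumes "measure_density_condition (UNIV - \<Omega>)" and [measurable]: "\<Omega> \<in> sets borel"
  obtains \<delta> r0 where "0 < \<delta>" "0 < r0" "!!x0 \<rho>. x0 \<in> frontier \<Omega> ==> 0 < \<rho> ==> \<rho> < r0 ==>
    ennreal (\<delta> * \<rho> powr real DIM('a)) <= emeasure lborel (ball x0 \<rho> - \<Omega>)"
proof -
  obtain r0 \<delta> where r0: "0 < r0" and \<delta>: "0 < \<delta>" and I: "!!x0. x0 \<in> frontier (UNIV - \<Omega>) ==>
      \<delta> <= (INF r\<in>{0<..<r0}. measure lebesgue ((UNIV - \<Omega>) \<inter> ball x0 r) / measure lebesgue (ball x0 r))"
    using assms(1) unfolding measure_density_condition_def by auto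
  let ?\<omega> = "unit_ball_vol (real DIM('a))"
  have \<omega>: "0 < ?\<omega>" by simp
  show ?thesis
  proof (rule that[of "\<delta> * ?\<omega>" r0])
    show "0 < \<delta> * ?\<omega>" "0 < r0" using \<delta> \<omega> r0 by (auto simp del: unit_ball_vol_pos)
    fix x0 \<rho> assume x0: "x0 \<in> frontier \<Omega>" and \<rho>: "0 < \<rho>" "\<rho> < r0"
    let ?g = "\<lambda>r. measure lebesgue ((UNIV - \<Omega>) \<inter> ball x0 r) / measure lebesgue (ball x0 r)"
    have "x0 \<in> frontier (UNIV - \<Omega>)" using x0 by (simp add: Compl_eq_Diff_UNIV[symmetric] frontier_complement)
    then have "\<delta> <= Inf (?g ` {0<..<r0})" by (rule I)
    also have "... <= ?g \<rho>" using \<rho> by (intro cINF_lower bdd_belowI[of _ 0]) auto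
    finally have le: "\<delta> <= ?g \<rho>" .
    have e: "(UNIV - \<Omega>) \<inter> ball x0 \<rho> = ball x0 \<rho> - \<Omega>" by auto
    have m: "measure lebesgue A = measure lborel A" if "A \<in> sets borel" for A :: "'a set" using that by (simp add: measure_completion)
    have B: "measure lborel (ball x0 \<rho>) = ?\<omega> * \<rho> powr real DIM('a)" using \<rho> by (simp add: content_ball powr_realpow)
    have "0 < measure lborel (ball x0 \<rho>)" unfolding B using \<rho> by simp
    then have "\<delta> * measure lborel (ball x0 \<rho>) <= measure lborel (ball x0 \<rho> - \<Omega>)" using le by (simp add: e m pos_le_divide_eq)
    then have "ennreal (\<delta> * ?\<omega> * \<rho> powr real DIM('a)) <= ennreal (measure lborel (ball x0 \<rho> - \<Omega>))"
      unfolding B by (intro ennreal_leI) (simp add: mult.assoc)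
    also have "... = emeasure lborel (ball x0 \<rho> - \<Omega>)"
    proof (rule emeasure_eq_ennreal_measure[symmetric])
      have "emeasure lborel (ball x0 \<rho> - \<Omega>) <= emeasure lborel (ball x0 \<rho>)" by (intro emeasure_mono) auto
      also have "... < top" using emeasure_bounded_finite[of "ball x0 \<rho>"] by simp
      finally show "emeasure lborel (ball x0 \<rho> - \<Omega>) \<noteq> top" by simp
    qed
    finally show "ennreal (\<delta> * ?\<omega> * \<rho> powr real DIM('a)) <= emeasure lborel (ball x0 \<rho> - \<Omega>)" .
  qed
qed

section \<open>Tail space, weak formulation and Gagliardo seminorm\<close>

context nonlocal_kernel
begin

lemma finite_tail_from_tail_space:
  assumes f: "f \<in> tail_space s p" and [measurable]: "v \<in> borel_measurable borel" and eq: "AE x in lborel. f x = v x"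
  shows "finite_tail v"
proof -
  let ?w = "\<lambda>x. \<bar>v x\<bar> powr (p - 1) * tail_weight q x"
  have "integrable lebesgue (\<lambda>x. \<bar>f x\<bar> powr (p - 1) * (1 + norm x) powr (- real DIM('a) - q))" using f by (simp add: tail_space_def)
  moreover have "AE x in lborel. \<bar>f x\<bar> powr (p - 1) * (1 + norm x) powr (- real DIM('a) - q) = ?w x"
    using eq by eventually_elim (simp add: tail_weight_def)
  ultimately have "integrable lborel ?w" by (subst (asm) integral_lebesgue_AE(1)[of ?w]) auto
  then have "(\<integral>\<^sup>+x. ennreal (norm (?w x)) \<partial>lborel) < \<infinity>" by (simp add: integrable_iff_bounded)
  moreover have "(\<integral>\<^sup>+x. ennreal (norm (?w x)) \<partial>lborel) = (\<integral>\<^sup>+y. ennreal (\<bar>v y\<bar> powr (p - 1)) * ennreal (tail_weight q y) \<partial>lborel)"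
    by (intro nn_integral_cong) (simp add: tail_weight_def ennreal_mult)
  ultimately show ?thesis by (simp add: finite_tail_def)
qed

text \<open>The weight is bounded below on compact sets, so local integrability of the power follows
  from the weighted integrability.\<close>

lemma tail_space_from_finite_tail:
  assumes v: "finite_tail v" and eq: "AE x in lborel. f x = v x"
  shows "f \<in> tail_space s p"
proof -
  have [measurable]: "v \<in> borel_measurable borel" using v by (simp add: finite_tail_def)
  let ?w = "\<lambda>x. \<bar>v x\<bar> powr (p - 1) * tail_weight q x"
  have "(\<integral>\<^sup>+x. ennreal (norm (?w x)) \<partial>lborel) = (\<integral>\<^sup>+y. ennreal (\<bar>v y\<bar> powr (p - 1)) * ennreal (tail_weight q y) \<partial>lborel)"
    by (intro nn_integral_cong) (simp add: tail_weight_def ennreal_mult)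
  then have i: "integrable lborel ?w" using v by (intro integrableI_bounded) (auto simp: finite_tail_def)
  have "set_integrable lebesgue C (\<lambda>x. \<bar>f x\<bar> powr (p - 1))" if C: "compact C" for C
  proof -
    obtain R where R: "0 < R" "!!x. x \<in> C ==> norm x <= R" using compact_imp_bounded[OF C] by (auto simp: bounded_pos)
    have [measurable]: "C \<in> sets borel" using C by (simp add: borel_compact)
    let ?c = "(1 + R) powr (real DIM('a) + q)"
    have "integrable lborel (\<lambda>x. indicator C x * \<bar>v x\<bar> powr (p - 1))"
    proof (rule Bochner_Integration.integrable_bound[OF integrable_mult_right[OF i, of ?c]])
      show "AE x in lborel. norm (indicator C x * \<bar>v x\<bar> powr (p - 1)) <= norm (?c * ?w x)"
      proof (intro AE_I2)
        fix x
        have "1 <= ?c * tail_weight q x" if "x \<in> C"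
        proof -
          have "(1 + norm x) powr (real DIM('a) + q) <= ?c" using R(2)[OF that] q_pos by (intro powr_mono2) auto
          moreover have "0 < 1 + norm x" by (rule add_pos_nonneg) auto
          ultimately show ?thesis unfolding tail_weight_def powr_minus_divide by simp
        qed
        then have "\<bar>v x\<bar> powr (p - 1) * 1 <= \<bar>v x\<bar> powr (p - 1) * (?c * tail_weight q x)" if "x \<in> C" using that by (intro mult_left_mono) auto
        then show "norm (indicator C x * \<bar>v x\<bar> powr (p - 1)) <= norm (?c * ?w x)" by (auto simp: indicator_def mult_ac abs_mult tail_weight_def)
      qed
    qed measurable
    moreover have "AE x in lborel. indicator C x *\<^sub>R \<bar>f x\<bar> powr (p - 1) = indicator C x * \<bar>v x\<bar> powr (p - 1)" using eq by eventually_elim simp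
    ultimately show ?thesis unfolding set_integrable_def by (subst integral_lebesgue_AE(1)) auto
  qed
  moreover have "integrable lebesgue (\<lambda>x. \<bar>f x\<bar> powr (p - 1) * (1 + norm x) powr (- real DIM('a) - q))"
  proof (subst integral_lebesgue_AE(1)[of ?w])
    show "AE x in lborel. \<bar>f x\<bar> powr (p - 1) * (1 + norm x) powr (- real DIM('a) - q) = ?w x"
      using eq by eventually_elim (simp add: tail_weight_def)
  qed (use i in auto)
  moreover have "f \<in> borel_measurable lebesgue" by (rule borel_measurable_completion_AE[OF _ eq]) simp
  ultimately show ?thesis by (simp add: tail_space_def)
qed

lemma energy_integrand_form:
  assumes K0: "AE z in lborel. K0 (fst z) (snd z) = K (fst z) (snd z)" and eq: "AE x in lborel. u x = v x"
    and [measurable]: "v \<in> borel_measurable borel" "\<eta> \<in> borel_measurable borel"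
  shows "integrable lebesgue (energy_integrand K0 p u \<eta>) \<longleftrightarrow> integrable \<mu> (form v \<eta>)"
    and "(LINT z|lebesgue. energy_integrand K0 p u \<eta> z) = (LINT z|\<mu>. form v \<eta> z)"
proof -
  let ?f = "\<lambda>z. K (fst z) (snd z) *\<^sub>R form v \<eta> z"
  have f: "?f \<in> borel_measurable borel" unfolding borel_prod[symmetric] by measurable
  have ae: "AE z in lborel. energy_integrand K0 p u \<eta> z = ?f z" using K0 AE_lborel_fst[OF eq] AE_lborel_snd[OF eq]
    by eventually_elim (simp add: energy_integrand_def split_beta' form_def Jp_def mult_ac)
  have \<mu>: "\<mu> = density lborel (\<lambda>z. ennreal (K (fst z) (snd z)))" by (simp add: \<mu>_def lborel_prod)
  have m: "form v \<eta> \<in> borel_measurable lborel" "(\<lambda>z. K (fst z) (snd z)) \<in> borel_measurable lborel" by (simp_all add: borel_prod[symmetric])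
  show "integrable lebesgue (energy_integrand K0 p u \<eta>) \<longleftrightarrow> integrable \<mu> (form v \<eta>)"
    unfolding integral_lebesgue_AE(1)[OF f ae] \<mu> by (subst integrable_density[OF m]) auto
  show "(LINT z|lebesgue. energy_integrand K0 p u \<eta> z) = (LINT z|\<mu>. form v \<eta> z)"
    unfolding integral_lebesgue_AE(2)[OF f ae] \<mu> by (subst integral_density[OF m]) auto
qed

lemma nn_integral_Gagliardo:
  fixes v :: "'a => real"
  assumes [measurable]: "v \<in> borel_measurable borel" "D \<in> sets borel"
  shows "(\<integral>\<^sup>+x. \<integral>\<^sup>+y. ennreal (riesz q x y) * (ennreal (\<bar>v x - v y\<bar> powr p) * indicator (D \<times> D) (x, y)) \<partial>lborel \<partial>lborel) =
    (\<integral>\<^sup>+z. ennreal (indicator (D \<times> D) z * (\<bar>jump v z\<bar> powr p / norm (fst z - snd z) powr (real DIM('a) + q))) \<partial>lborel)"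
proof -
  have "(\<integral>\<^sup>+x. \<integral>\<^sup>+y. ennreal (riesz q x y) * (ennreal (\<bar>v x - v y\<bar> powr p) * indicator (D \<times> D) (x, y)) \<partial>lborel \<partial>lborel) =
    (\<integral>\<^sup>+z. ennreal (riesz q (fst z) (snd z)) * (ennreal (\<bar>jump v z\<bar> powr p) * indicator (D \<times> D) z) \<partial>(lborel \<Otimes>\<^sub>M lborel))"
    by (subst lborel.nn_integral_fst[symmetric]) auto
  also have "... = (\<integral>\<^sup>+z. ennreal (indicator (D \<times> D) z * (\<bar>jump v z\<bar> powr p / norm (fst z - snd z) powr (real DIM('a) + q))) \<partial>lborel)"
    unfolding lborel_prod powr_divide_riesz by (intro nn_integral_cong) (simp add: indicator_def ennreal_mult)
  finally show ?thesis .
qed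

text \<open>The energy with respect to \<open>K\<close> and the Gagliardo seminorm differ by at most
  a factor \<open>\<Lambda>\<close> in either direction, so they are finite together.\<close>

lemma set_integrable_Gagliardo_iff:
  assumes [measurable]: "v \<in> borel_measurable borel" "D \<in> sets borel" and eq: "AE x in lborel. u x = v x"
  shows "set_integrable lebesgue (D \<times> D) (\<lambda>(x, y). \<bar>u x - u y\<bar> powr p / norm (x - y) powr (real DIM('a) + q)) \<longleftrightarrow>
    energy_on D v < \<infinity>"
proof -
  let ?f = "\<lambda>z. indicator (D \<times> D) z * (\<bar>jump v z\<bar> powr p / norm (fst z - snd z) powr (real DIM('a) + q))"
  let ?\<phi> = "\<lambda>x y. ennreal (\<bar>v x - v y\<bar> powr p) * indicator (D \<times> D) (x, y)"
  have f: "?f \<in> borel_measurable borel" unfolding borel_prod[symmetric] by measurable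
  have ae: "AE z in lborel. indicator (D \<times> D) z *\<^sub>R (case z of (x, y) => \<bar>u x - u y\<bar> powr p / norm (x - y) powr (real DIM('a) + q)) = ?f z"
    using AE_lborel_fst[OF eq] AE_lborel_snd[OF eq] by eventually_elim (simp add: split_beta')
  have "set_integrable lebesgue (D \<times> D) (\<lambda>(x, y). \<bar>u x - u y\<bar> powr p / norm (x - y) powr (real DIM('a) + q)) \<longleftrightarrow> integrable lborel ?f"
    unfolding set_integrable_def integral_lebesgue_AE(1)[OF f ae] ..
  also have "... \<longleftrightarrow> (\<integral>\<^sup>+z. ennreal (?f z) \<partial>lborel) < \<infinity>" using f by (auto simp: integrable_iff_bounded)
  also have "... \<longleftrightarrow> energy_on D v < \<infinity>"
  proof
    have en: "energy_on D v = (\<integral>\<^sup>+z. ?\<phi> (fst z) (snd z) \<partial>\<mu>)" by (simp add: energy_on_def)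
    have m: "(\<lambda>z. ?\<phi> (fst z) (snd z)) \<in> borel_measurable (borel \<Otimes>\<^sub>M borel)" by measurable
    note le = nn_integral_riesz_le[OF m, unfolded en[symmetric] nn_integral_Gagliardo[OF assms(1,2)]]
    show "energy_on D v < \<infinity>" if "(\<integral>\<^sup>+z. ennreal (?f z) \<partial>lborel) < \<infinity>"
      by (rule order_le_less_trans[OF le(2)]) (use that in \<open>simp add: ennreal_mult_less_top\<close>)
    show "(\<integral>\<^sup>+z. ennreal (?f z) \<partial>lborel) < \<infinity>" if "energy_on D v < \<infinity>"
      by (rule order_le_less_trans[OF le(1)]) (use that in \<open>simp add: ennreal_mult_less_top\<close>)
  qed
  finally show ?thesis .
qed

end


section \<open>Weak solutions and local solutions\<close>

context dirichlet_domain
begin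

lemma local_solution_uminus:
  assumes u: "local_solution u"
  shows "local_solution (\<lambda>x. - u x)"
proof -
  have t: "finite_tail u" using u by (simp add: local_solution_def)
  have "finite_tail (\<lambda>x. - u x)" by (rule finite_tail_dominate[OF t, of _ 0]) (use t in \<open>auto simp: finite_tail_def\<close>)
  moreover have "form (\<lambda>x. - u x) \<phi> = (\<lambda>z. - form u \<phi> z)" for \<phi> by (simp add: fun_eq_iff form_uminus)
  ultimately show ?thesis using u unfolding local_solution_def by (auto intro: finite_energy_uminus)
qed

lemma test_function_finite_energy:
  assumes \<eta>: "\<eta> \<in> test_functions \<Omega>" and W: "bounded W" "W \<in> sets borel"
  shows "finite_energy W \<eta>"
proof -
  have Ck: "Ck k \<eta>" for k using \<eta> by (simp add: test_functions_def)
  have "\<eta> \<in> borel_measurable borel" using Ck[of 0] by (intro borel_measurable_continuous_onI) simp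
  moreover obtain R where "!!x. x \<in> W ==> norm x <= R" using W by (auto simp: bounded_iff)
  moreover obtain L where "0 <= L" "!!x y. norm x <= R ==> norm y <= R ==> \<bar>\<eta> x - \<eta> y\<bar> <= L * norm (x - y)"
    using Ck_Lipschitz_on_cball[OF Ck] by blast
  ultimately show ?thesis using W by (intro finite_energy_Lipschitz[of _ _ L]) auto
qed

lemma weak_supersolution_if_local_solution:
  assumes K0: "AE z in lborel. K0 (fst z) (snd z) = K (fst z) (snd z)" and v: "local_solution v"
    and eq: "AE x in lborel. u x = v x"
  shows "weak_supersolution K0 s p \<Omega> u" unfolding weak_supersolution_def
proof (intro conjI ballI impI)
  have vt: "finite_tail v" using v by (simp add: local_solution_def)
  have [measurable]: "v \<in> borel_measurable borel" using vt by (simp add: finite_tail_def)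
  show um: "u \<in> borel_measurable lebesgue" by (rule borel_measurable_completion_AE[OF _ eq]) simp
  have "finite_tail (\<lambda>x. max (- v x) 0)" by (rule finite_tail_dominate[OF vt, of _ 0]) auto
  moreover have "AE x in lborel. max (- u x) 0 = max (- v x) 0" using eq by eventually_elim simp
  ultimately show "(\<lambda>x. max (- u x) 0) \<in> tail_space s p" by (rule tail_space_from_finite_tail)
  show "u \<in> frac_sobolev_loc s p \<Omega>" unfolding frac_sobolev_loc_def frac_sobolev_def
  proof (intro CollectI allI impI conjI)
    fix D :: "'a set" assume D: "open D \<and> compactly_contained D \<Omega>"
    have Dm [measurable]: "D \<in> sets borel" using D by simp
    have cD: "compact (closure D)" "closure D \<subseteq> \<Omega>" using D by (auto simp: compactly_contained_def)
    obtain e where e: "0 < e" "(\<Union>x\<in>closure D. ball x e) \<subseteq> \<Omega>" using compact_subset_open_imp_ball_epsilon_subset[OF cD(1) open_\<Omega> cD(2)] by blast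
    have "\<forall>x\<in>D. ball x e \<subseteq> \<Omega>" using e(2) closure_subset by blast
    then have fe: "finite_energy D v" using v Dm e(1) unfolding local_solution_def by blast
    then obtain M where M: "!!x. x \<in> D ==> \<bar>v x\<bar> <= M" by (auto simp: finite_energy_def)
    show "u \<in> borel_measurable (lebesgue_on D)" using um by (rule measurable_restrict_space1)
    have "bounded D" using cD(1) closure_subset compact_imp_bounded bounded_subset by metis
    then have iD: "integrable lborel (indicator D :: 'a => real)" using emeasure_bounded_finite by (intro integrable_real_indicator) auto
    have "integrable lborel (\<lambda>x. indicator D x * \<bar>v x\<bar> powr p)"
    proof (rule Bochner_Integration.integrable_bound[OF integrable_mult_left[OF iD, of "M powr p"]])
      show "AE x in lborel. norm (indicator D x * \<bar>v x\<bar> powr p) <= norm (indicator D x * M powr p)"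
        using M p_pos by (intro AE_I2) (auto simp: indicator_def intro!: powr_mono2)
    qed measurable
    moreover have "AE x in lborel. indicator D x *\<^sub>R \<bar>u x\<bar> powr p = indicator D x * \<bar>v x\<bar> powr p" using eq by eventually_elim simp
    ultimately show "set_integrable lebesgue D (\<lambda>x. \<bar>u x\<bar> powr p)" unfolding set_integrable_def by (subst integral_lebesgue_AE(1)) auto
    show "set_integrable lebesgue (D \<times> D) (\<lambda>(x, y). \<bar>u x - u y\<bar> powr p / norm (x - y) powr (real DIM('a) + s * p))"
      using fe by (subst set_integrable_Gagliardo_iff[OF _ Dm eq]) (auto simp: finite_energy_def)
  qed
  fix \<eta> assume \<eta>: "\<eta> \<in> test_functions \<Omega>" and \<eta>0: "\<forall>x. 0 <= \<eta> x"
  have c: "continuous_on UNIV \<eta>" and supp: "compactly_contained {x. \<eta> x \<noteq> 0} \<Omega>" using \<eta> by (auto simp: test_functions_def dest: spec[of _ 0])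
  have [measurable]: "\<eta> \<in> borel_measurable borel" by (rule borel_measurable_continuous_onI[OF c])
  have fe: "finite_energy W \<eta>" if "W \<in> sets borel" "0 < d" "\<forall>x\<in>W. ball x d \<subseteq> \<Omega>" for W and d :: real
  proof (rule test_function_finite_energy[OF \<eta> _ that(1)])
    have "W \<subseteq> \<Omega>" using that by force
    then show "bounded W" using bounded_\<Omega> by (rule bounded_subset[rotated])
  qed
  note form = local_solution_form[OF v c \<eta>0[rule_format] supp fe]
  have vm: "v \<in> borel_measurable borel" and \<eta>m: "\<eta> \<in> borel_measurable borel" by measurable
  note tr = energy_integrand_form[OF K0 eq vm \<eta>m]
  show "integrable lebesgue (energy_integrand K0 p u \<eta>)" using form(1) tr(1) by simp
  show "0 <= (LINT z|lebesgue. energy_integrand K0 p u \<eta> z)" using form(2) tr(2) by simp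
qed

lemma weak_solution_if_local_solution:
  assumes "AE z in lborel. K0 (fst z) (snd z) = K (fst z) (snd z)" "local_solution v" "AE x in lborel. u x = v x"
  shows "weak_solution K0 s p \<Omega> u" unfolding weak_solution_def weak_subsolution_def
proof
  show "weak_supersolution K0 s p \<Omega> u" by (rule weak_supersolution_if_local_solution[OF assms])
  have "AE x in lborel. - u x = - v x" using assms(3) by eventually_elim simp
  then show "weak_supersolution K0 s p \<Omega> (\<lambda>x. - u x)"
    by (rule weak_supersolution_if_local_solution[OF assms(1) local_solution_uminus[OF assms(2)]])
qed

text \<open>Membership in the local fractional Sobolev space gives local energy but no sup bound;
  the latter is the hypothesis on \<open>M\<close>, which continuity on the closure of \<Omega>
  supplies.\<close>

lemma local_solution_if_weak_solution:
  assumes K0: "AE z in lborel. K0 (fst z) (snd z) = K (fst z) (snd z)" and u: "weak_solution K0 s p \<Omega> u"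
    and eq: "AE x in lborel. u x = v x" and vt: "finite_tail v" and M: "!!x. x \<in> \<Omega> ==> \<bar>v x\<bar> <= M"
  shows "local_solution v" unfolding local_solution_def
proof (intro conjI allI impI ballI vt)
  have vm [measurable]: "v \<in> borel_measurable borel" using vt by (simp add: finite_tail_def)
  have sup: "weak_supersolution K0 s p \<Omega> u" and sub: "weak_supersolution K0 s p \<Omega> (\<lambda>x. - u x)"
    using u by (auto simp: weak_solution_def weak_subsolution_def)
  fix W and d :: real assume [measurable]: "W \<in> sets borel" and d: "0 < d" and W: "\<forall>x\<in>W. ball x d \<subseteq> \<Omega>"
  \<comment> \<open>The set \<open>W\<close> need not be open, while the Sobolev condition speaks of
    open sets; the neighbourhood at half the distance is open with closure still inside
    \<Omega>.\<close>
  define D where "D = (\<Union>x\<in>W. ball x (d / 2))"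
  have D: "open D" by (auto simp: D_def)
  have WD: "W \<subseteq> D" using d by (auto simp: D_def)
  have cD: "closure D \<subseteq> \<Omega>"
  proof
    fix y assume "y \<in> closure D"
    then have "\<exists>z\<in>D. dist z y < d / 2" unfolding closure_approachable using d half_gt_zero by blast
    then obtain z where z: "z \<in> D" "dist z y < d / 2" by blast
    then obtain x where x: "x \<in> W" "dist x z < d / 2" by (auto simp: D_def)
    have "dist x y < d" using z(2) x(2) dist_triangle[of x y z] by linarith
    then have "y \<in> ball x d" by simp
    then show "y \<in> \<Omega>" using W x(1) by blast
  qed
  then have "bounded (closure D)" using bounded_\<Omega> by (rule bounded_subset[rotated])
  then have "compactly_contained D \<Omega>" using cD by (simp add: compactly_contained_def compact_eq_bounded_closed)
  then have "u \<in> frac_sobolev s p D" using sup D by (auto simp: weak_supersolution_def frac_sobolev_loc_def)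
  then have "energy_on D v < \<infinity>" using set_integrable_Gagliardo_iff[OF vm _ eq, of D] D by (simp add: frac_sobolev_def)
  then have "finite_energy D v" using M cD closure_subset[of D] by (auto simp: finite_energy_def intro!: exI[of _ M])
  then show "finite_energy W v" using WD by (rule finite_energy_mono)
next
  have vm [measurable]: "v \<in> borel_measurable borel" using vt by (simp add: finite_tail_def)
  have sup: "weak_supersolution K0 s p \<Omega> u" and sub: "weak_supersolution K0 s p \<Omega> (\<lambda>x. - u x)"
    using u by (auto simp: weak_solution_def weak_subsolution_def)
  fix \<phi> assume \<phi>: "\<phi> \<in> test_functions \<Omega>" "\<forall>x. 0 <= \<phi> x"
  have c: "continuous_on UNIV \<phi>" using \<phi>(1) by (auto simp: test_functions_def dest: spec[of _ 0])
  have \<phi>m: "\<phi> \<in> borel_measurable borel" by (rule borel_measurable_continuous_onI[OF c])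
  have eq': "AE x in lborel. - u x = - v x" using eq by eventually_elim simp
  have "0 <= (LINT z|\<mu>. form v \<phi> z)" using sup \<phi> energy_integrand_form(2)[OF K0 eq vm \<phi>m] by (auto simp: weak_supersolution_def)
  moreover have "0 <= (LINT z|\<mu>. form (\<lambda>x. - v x) \<phi> z)"
    using sub \<phi> energy_integrand_form(2)[OF K0 eq' _ \<phi>m] by (auto simp: weak_supersolution_def)
  ultimately show "(LINT z|\<mu>. form v \<phi> z) = 0" by (simp add: form_uminus)
qed

text \<open>The given solution is only Lebesgue measurable. Replacing its values off
  \<open>\<Omega>'\<close> by those of the Borel representative of the datum changes it on a null
  set and leaves it untouched where continuity is required.\<close>

lemma local_solution_if_bounded:
  assumes K0: "AE z in lborel. K0 (fst z) (snd z) = K (fst z) (snd z)" and g: "finite_tail g'" "AE x in lborel. g x = g' x"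
    and \<Omega>': "open \<Omega>'" "closure \<Omega> \<subseteq> \<Omega>'" "!!x. x \<in> \<Omega>' ==> g' x = g x"
    and u: "weak_solution K0 s p \<Omega> u" "continuous_on \<Omega>' u" "!!x. x \<notin> \<Omega> ==> u x = g x"
  shows "local_solution (\<lambda>x. if x \<in> \<Omega>' then u x else g' x)"
proof -
  let ?v = "\<lambda>x. if x \<in> \<Omega>' then u x else g' x"
  have [measurable]: "g' \<in> borel_measurable borel" "\<Omega>' \<in> sets borel" using g \<Omega>' by (auto simp: finite_tail_def)
  have "(\<lambda>x. indicator \<Omega>' x *\<^sub>R u x) \<in> borel_measurable borel" using \<Omega>' u(2) by (intro borel_measurable_continuous_on_indicator) auto
  then have "(\<lambda>x. indicator \<Omega>' x *\<^sub>R u x + indicator (- \<Omega>') x * g' x) \<in> borel_measurable borel" by (rule borel_measurable_add) measurable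
  also have "(\<lambda>x. indicator \<Omega>' x *\<^sub>R u x + indicator (- \<Omega>') x * g' x) = ?v" by (auto simp: fun_eq_iff indicator_def)
  finally have vm: "?v \<in> borel_measurable borel" .
  have "compact (closure \<Omega>)" using bounded_\<Omega> by simp
  then have "compact (u ` closure \<Omega>)" by (intro compact_continuous_image continuous_on_subset[OF u(2) \<Omega>'(2)])
  then have "\<exists>M. \<forall>x\<in>closure \<Omega>. \<bar>u x\<bar> <= M" by (auto dest!: compact_imp_bounded simp: bounded_iff)
  then obtain M where M: "!!x. x \<in> closure \<Omega> ==> \<bar>u x\<bar> <= M" by blast
  have M': "\<bar>?v x\<bar> <= M" if "x \<in> \<Omega>" for x using M[of x] that \<Omega>'(2) closure_subset[of \<Omega>] by auto
  have out: "?v x = g' x" if "x \<notin> \<Omega>" for x using u(3)[OF that] \<Omega>'(3) by auto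
  have "finite_tail ?v"
  proof (rule finite_tail_dominate[OF g(1) vm, of "\<bar>M\<bar>"], intro AE_I2)
    fix x show "\<bar>?v x\<bar> <= \<bar>M\<bar> + \<bar>g' x\<bar>"
    proof (cases "x \<in> \<Omega>")
      case True from M'[OF this] show ?thesis by linarith
    next
      case False from out[OF this] show ?thesis by simp
    qed
  qed
  moreover have "AE x in lborel. u x = ?v x" using g(2)
  proof eventually_elim
    case (elim x) then show ?case using u(3)[of x] \<Omega>'(2) closure_subset[of \<Omega>] by auto
  qed
  ultimately show ?thesis using M' by (intro local_solution_if_weak_solution[OF K0 u(1)])
qed

end

text \<open>\<open>N\<close> is a closed neighbourhood of the closure of \<Omega>. If
  \<open>N - \<Omega>\<close> were null, the open set of points of \<open>G\<close> outside that
  closure would be empty, so the closure would equal the open set \<open>G\<close>; a nonempty,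
  bounded, open and closed set does not exist.\<close>

lemma compact_neighbourhood:
  fixes \<Omega> \<Omega>' :: "'a::euclidean_space set"
  assumes \<Omega>: "\<Omega> \<noteq> {}" "open \<Omega>" and \<Omega>': "open \<Omega>'" "compactly_contained \<Omega> \<Omega>'"
  obtains N d0 where "compact N" "0 < d0" "!!x. x \<in> \<Omega> ==> ball x d0 \<subseteq> N" "emeasure lborel (N - \<Omega>) \<noteq> 0"
    "N \<subseteq> \<Omega>'" "closure \<Omega> \<subseteq> interior N"
proof -
  let ?C = "closure \<Omega>"
  have C: "compact ?C" "?C \<subseteq> \<Omega>'" "?C \<noteq> {}" using \<Omega> \<Omega>' by (auto simp: compactly_contained_def)
  obtain e where e: "0 < e" "(\<Union>x\<in>?C. ball x e) \<subseteq> \<Omega>'" using compact_subset_open_imp_ball_epsilon_subset[OF C(1) \<Omega>'(1) C(2)] by blast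
  define N G where "N = {x. infdist x ?C <= e / 2}" and "G = {x. infdist x ?C < e / 2}"
  have G: "open G" unfolding G_def by (intro open_Collect_less continuous_intros)
  have GN: "G \<subseteq> interior N" by (rule interior_maximal[OF _ G]) (auto simp: G_def N_def)
  have CG: "?C \<subseteq> G" using e(1) by (auto simp: G_def)
  show ?thesis
  proof (rule that[of N "e / 2"])
    show "compact N" unfolding N_def by (intro compact_infdist_le C) (use e in auto)
    show "0 < e / 2" using e by simp
    show "ball x (e / 2) \<subseteq> N" if "x \<in> \<Omega>" for x
    proof
      fix y assume "y \<in> ball x (e / 2)"
      then have "dist y x <= e / 2" by (simp add: dist_commute)
      moreover have "x \<in> ?C" using that closure_subset by blast
      ultimately have "infdist y ?C <= e / 2" by (rule infdist_le2[rotated])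
      then show "y \<in> N" by (simp add: N_def)
    qed
    show "?C \<subseteq> interior N" using CG GN by blast
    show "N \<subseteq> \<Omega>'"
    proof
      fix x assume "x \<in> N"
      then have "infdist x ?C < e" using e(1) by (simp add: N_def)
      then obtain a where "a \<in> ?C" "dist x a < e" using infdist_less_ex[OF C(3)] by blast
      then have "x \<in> (\<Union>x\<in>?C. ball x e)" by (auto simp: dist_commute)
      then show "x \<in> \<Omega>'" using e(2) by blast
    qed
    show "emeasure lborel (N - \<Omega>) \<noteq> 0"
    proof
      assume 0: "emeasure lborel (N - \<Omega>) = 0"
      have "closed N" unfolding N_def by (intro closed_Collect_le continuous_intros)
      then have "N - \<Omega> \<in> null_sets lborel" using 0 \<Omega>(2) by (auto simp: null_sets_def)
      then have ae: "AE x in lborel. x \<notin> N - \<Omega>" by (rule AE_not_in)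
      have "G - ?C = {}"
      proof (rule ccontr)
        assume "G - ?C \<noteq> {}"
        then obtain a where a: "a \<in> G - ?C" by blast
        have "open (G - ?C)" using G by (intro open_Diff) auto
        then obtain r where r: "0 < r" "ball a r \<subseteq> G - ?C" using a by (auto simp: open_contains_ball)
        obtain y where "y \<in> ball a r" "y \<notin> N - \<Omega>" using AE_ball_ex[OF ae r(1)] by blast
        then show False using r(2) GN interior_subset[of N] closure_subset[of \<Omega>] by blast
      qed
      then have "?C = G" using CG by blast
      then have "open ?C" "closed ?C" using G by auto
      then have "?C = UNIV" using C(3) clopen by blast
      then show False using compact_imp_bounded[OF C(1)] not_bounded_UNIV by simp
    qed
  qed
qed

theorem theorem17:
  fixes \<Omega> \<Omega>' :: "(real ^ 'n) set"
    and K :: "real ^ 'n \<Rightarrow> real ^ 'n \<Rightarrow> real"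
    and g :: "real ^ 'n \<Rightarrow> real"
    and s p \<Lambda> :: real
  assumes "0 < s" and "s < 1" and "1 < p" and "1 \<le> \<Lambda>"
    and "elliptic_kernel s p \<Lambda> K"
    and "open \<Omega>" and "bounded \<Omega>"
    and "open \<Omega>'" and "bounded \<Omega>'"
    and "compactly_contained \<Omega> \<Omega>'"
    and "measure_density_condition (UNIV - \<Omega>)"
    and "continuous_on \<Omega>' g" and "g \<in> tail_space s p"
  shows "\<exists>!u. weak_solution K s p \<Omega> u \<and> continuous_on \<Omega>' u \<and> (\<forall>x\<in>UNIV - \<Omega>. u x = g x)"
proof -
  obtain K' where K': "nonlocal_kernel s p \<Lambda> K'" and KK': "AE z in lborel. K (fst z) (snd z) = K' (fst z) (snd z)"
    using elliptic_kernel_representative[OF assms(1-5)] by blast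
  interpret nonlocal_kernel s p \<Lambda> K' by (rule K')
  obtain g' where g'm: "g' \<in> borel_measurable borel" and gg': "AE x in lborel. g x = g' x"
    and g'\<Omega>': "!!x. x \<in> \<Omega>' ==> g' x = g x" using borel_representative[of g \<Omega>'] assms by (auto simp: tail_space_def)
  have g't: "finite_tail g'" by (rule finite_tail_from_tail_space[OF assms(13) g'm gg'])
  have cl: "closure \<Omega> \<subseteq> \<Omega>'" using assms(10) by (simp add: compactly_contained_def)
  then have \<Omega>\<Omega>': "\<Omega> \<subseteq> \<Omega>'" using closure_subset by blast
  show ?thesis
  proof (cases "\<Omega> = {}")
    case True
    \<comment> \<open>With \<Omega> empty, any compact set of positive measure can serve as the
      neighbourhood. The zero function is the only test function, and the datum itself is the
      solution.\<close>
    interpret dirichlet_domain s p \<Lambda> K' "\<Omega>" "cball 0 1" 1 by unfold_locales (use True in \<open>auto simp: emeasure_cball ennreal_eq_0_iff not_le\<close>)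
    have "form g' \<phi> = (\<lambda>z. 0)" if "\<phi> \<in> test_functions \<Omega>" for \<phi>
      using that True by (auto simp: test_functions_def compactly_contained_def fun_eq_iff form_def)
    moreover have "finite_energy W g'" if "\<forall>x\<in>W. ball x d \<subseteq> \<Omega>" "0 < d" for W and d :: real
    proof -
      have "W = {}" using that True by auto
      then show ?thesis using g'm by (simp add: finite_energy_def energy_on_def)
    qed
    ultimately have "local_solution g'" using g't unfolding local_solution_def by simp
    then have "weak_solution K s p \<Omega> g" using KK' gg' by (intro weak_solution_if_local_solution)
    then show ?thesis using assms True by (intro ex1I[of _ g]) auto
  next
    case False
    obtain N d0 where N: "compact N" "0 < d0" "!!x. x \<in> \<Omega> ==> ball x d0 \<subseteq> N" "emeasure lborel (N - \<Omega>) \<noteq> 0"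
      "N \<subseteq> \<Omega>'" "closure \<Omega> \<subseteq> interior N" using compact_neighbourhood[OF False assms(6,8,10)] by blast
    interpret dirichlet_domain s p \<Lambda> K' \<Omega> N d0 by unfold_locales (use assms(6) N in auto)
    obtain \<delta> r0 where \<delta>: "0 < \<delta>" "0 < r0" "!!x0 \<rho>. x0 \<in> frontier \<Omega> ==> 0 < \<rho> ==> \<rho> < r0 ==>
        ennreal (\<delta> * \<rho> powr real DIM(real ^ 'n)) <= emeasure lborel (ball x0 \<rho> - \<Omega>)"
      using exterior_density_lebesgue[OF assms(11) sets_\<Omega>] by blast
    have ext: "exterior_density \<delta>" using \<delta>(2,3) unfolding exterior_density_def by blast
    have gN: "continuous_on N g'" using continuous_on_subset[OF assms(12) N(5)] N(5) g'\<Omega>' by (subst continuous_on_cong[OF refl, of _ _ g]) auto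
    obtain V where V: "!!x. x \<notin> \<Omega> ==> V x = g' x" "continuous_on (interior N) V" "finite_tail V"
        "!!W d. W \<in> sets borel ==> 0 < d ==> (!!x. x \<in> W ==> ball x d \<subseteq> \<Omega>) ==> finite_energy W V"
      and EL: "!!W d \<eta>. W \<in> sets borel ==> 0 < d ==> (!!x. x \<in> W ==> ball x d \<subseteq> \<Omega>) ==> finite_energy N \<eta> ==>
        (!!x. x \<notin> W ==> \<eta> x = 0) ==> integrable \<mu> (form V \<eta>) \<and> (LINT z|\<mu>. form V \<eta> z) = 0"
      by (rule continuous_solution_exists[OF g'm g't gN \<delta>(1) ext]) blast
    have "(LINT z|\<mu>. form V \<phi> z) = 0" if \<phi>: "\<phi> \<in> test_functions \<Omega>" for \<phi>
    proof -
      let ?S = "closure {x. \<phi> x \<noteq> 0}"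
      have S: "compact ?S" "?S \<subseteq> \<Omega>" using \<phi> by (auto simp: test_functions_def compactly_contained_def)
      obtain e where e: "0 < e" "(\<Union>x\<in>?S. ball x e) \<subseteq> \<Omega>" using compact_subset_open_imp_ball_epsilon_subset[OF S(1) open_\<Omega> S(2)] by blast
      have "integrable \<mu> (form V \<phi>) \<and> (LINT z|\<mu>. form V \<phi> z) = 0"
      proof (rule EL)
        show "?S \<in> sets borel" "0 < e" using e(1) by auto
        show "ball x e \<subseteq> \<Omega>" if "x \<in> ?S" for x using that e(2) by blast
        show "finite_energy N \<phi>" by (rule test_function_finite_energy[OF \<phi> bounded_N]) simp
        show "\<phi> x = 0" if "x \<notin> ?S" for x using that closure_subset[of "{x. \<phi> x \<noteq> 0}"] by blast
      qed
      then show ?thesis ..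
    qed
    moreover have "finite_energy W V" if "W \<in> sets borel" "0 < d" "\<forall>x\<in>W. ball x d \<subseteq> \<Omega>" for W d
      by (rule V(4)[OF that(1,2)]) (use that(3) in blast)
    ultimately have "local_solution V" using V(3) unfolding local_solution_def by simp
    \<comment> \<open>Outside \<Omega> the solution \<open>V\<close> equals the Borel representative
      of the datum; the prescribed values of \<open>g\<close> are restored exactly, on a null
      set.\<close>
    define u where "u x = (if x \<in> \<Omega> then V x else g x)" for x
    have "AE x in lborel. u x = V x" using gg' by eventually_elim (simp add: u_def V(1))
    then have sol: "weak_solution K s p \<Omega> u" using KK' \<open>local_solution V\<close> by (intro weak_solution_if_local_solution)
    \<comment> \<open>The construction gives continuity in the interior of \<open>N\<close> only; in
      the rest of \<open>\<Omega>'\<close> the solution is the continuous datum, and the two open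
      sets cover \<open>\<Omega>'\<close>.\<close>
    have "continuous_on (\<Omega>' - closure \<Omega>) V"
    proof (subst continuous_on_cong[OF refl])
      show "V x = g x" if "x \<in> \<Omega>' - closure \<Omega>" for x
      proof -
        have "x \<notin> \<Omega>" using that closure_subset by blast
        then show ?thesis using V(1) g'\<Omega>' that by simp
      qed
      show "continuous_on (\<Omega>' - closure \<Omega>) g" by (rule continuous_on_subset[OF assms(12)]) auto
    qed
    then have "continuous_on ((\<Omega>' - closure \<Omega>) \<union> interior N) V" using assms(8) V(2) by (intro continuous_on_open_Un open_Diff) auto
    then have "continuous_on \<Omega>' V" by (rule continuous_on_subset) (use N(6) in auto)
    moreover have "u x = V x" if "x \<in> \<Omega>'" for x using that V(1) g'\<Omega>' by (simp add: u_def)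
    ultimately have cu: "continuous_on \<Omega>' u" by (subst continuous_on_cong[OF refl]) auto
    have unique: "w1 x <= w2 x"
      if w1: "weak_solution K s p \<Omega> w1" "continuous_on \<Omega>' w1" "\<forall>x\<in>UNIV - \<Omega>. w1 x = g x"
        and w2: "weak_solution K s p \<Omega> w2" "continuous_on \<Omega>' w2" "\<forall>x\<in>UNIV - \<Omega>. w2 x = g x" for w1 w2 x
    proof -
      define v where "v w x = (if x \<in> \<Omega>' then w x else g' x)" for w :: "real ^ 'n => real" and x
      have sol: "local_solution (v w)" and cont: "continuous_on \<Omega>' (v w)"
        if "weak_solution K s p \<Omega> w" "continuous_on \<Omega>' w" "\<forall>x\<in>UNIV - \<Omega>. w x = g x" for w
      proof -
        show "local_solution (v w)" unfolding v_def using that by (intro local_solution_if_bounded[OF KK' g't gg' assms(8) cl g'\<Omega>']) auto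
        show "continuous_on \<Omega>' (v w)" using that(2) by (subst continuous_on_cong[OF refl, of _ _ w]) (auto simp: v_def)
      qed
      have "v w1 y = v w2 y" if "y \<notin> \<Omega>" for y using that w1(3) w2(3) by (simp add: v_def)
      then have "v w1 x <= v w2 x" by (rule local_solution_le[OF sol[OF w1] sol[OF w2] cont[OF w1] cont[OF w2] assms(8) cl])
      then show ?thesis using w1(3) w2(3) \<Omega>\<Omega>' by (cases "x \<in> \<Omega>") (auto simp: v_def)
    qed
    show ?thesis
    proof (rule ex1I[of _ u])
      show P: "weak_solution K s p \<Omega> u \<and> continuous_on \<Omega>' u \<and> (\<forall>x\<in>UNIV - \<Omega>. u x = g x)" using sol cu by (simp add: u_def)
      show "w = u" if "weak_solution K s p \<Omega> w \<and> continuous_on \<Omega>' w \<and> (\<forall>x\<in>UNIV - \<Omega>. w x = g x)" for w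
      proof
        fix x show "w x = u x" using that P by (intro antisym unique) auto
      qed
    qed
  qed
qed

end
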